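(* Let $\varepsilon>0$, $\alpha_o>0$ and $\beta\ge 0$ be constants, and let $f_0\in H^3(\mathbb{R})$. Consider the initial value problem on $\mathbb{R}$ for the unknown $f=f(x_1,t)$ \begin{align*} 2f_t+\alpha_o\Lambda f_t={}&\frac{1}{\varepsilon}\Big\{f_{x_1}+\mathcal{H}f+(\alpha_o-\beta)\mathcal{H}f_{x_1x_1}\Big\}\\ &+\mathcal{H}\big((\Lambda f)^2\big)-[\![\mathcal{H},f]\!]\Lambda f+(\alpha_o-\beta)[\![\mathcal{H},f]\!]\Lambda^3 f, \end{align*} with initial data $f(x_1,0)=f_0(x_1)$. Then there exist $T^*>0$ and a unique solution $$f\in L^\infty(0,T^*;H^3(\mathbb{R}))$$ of this problem on $[0,T^*]$.
   Context: Subscripts $t$ and $x_1$ denote partial derivatives in time and in the space variable $x_1\in\mathbb{R}$. The unknown is real-valued. The Fourier transform is $\hat f(k)=\frac{1}{\sqrt{2\pi}}\int_{\mathbb{R}}f(x_1)e^{-ikx_1}\,dx_1$. The Hilbert transform $\mathcal{H}$ and the operator $\Lambda$ (and its powers $\Lambda^s$) are the Fourier multipliers $\widehat{\mathcal{H}f}(k)=-i\,\mathrm{sgn}(k)\hat f(k)$, $\widehat{\Lambda f}(k)=|k|\hat f(k)$, $\widehat{\Lambda^s f}(k)=|k|^s\hat f(k)$. For an operator $\mathcal{T}$ and functions $f,g$, the commutator is $[\![\mathcal{T},f]\!]g=\mathcal{T}(fg)-f\,\mathcal{T}(g)$. The Sobolev spaces are $$H^s(\mathbb{R})=\Big\{h\in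 L^2(\mathbb{R}):\ \|h\|_{H^s}^2=\int_{\mathbb{R}}(1+|n|^{2s})|\hat h(n)|^2\,dn<\infty\Big\}.$$ The constants are the steepness parameter $\varepsilon$, the odd Reynolds number $\alpha_o$ and the Bond number $\beta$. *)

theory Defs
  imports "HOL-Analysis.Analysis"
begin

text \<open>Elements of function spaces are represented by Borel functions; equality of elements is
  equality almost everywhere.\<close>

definition L2 :: "(real \<Rightarrow> real) set" where
  "L2 = {h. h \<in> borel_measurable lborel \<and> integrable lborel (\<lambda>x. (h x)\<^sup>2)}"

definition L2_norm :: "(real \<Rightarrow> real) \<Rightarrow> real" where
  "L2_norm h = sqrt (LINT x|lborel. (h x)\<^sup>2)"

definition truncated_fourier :: "real \<Rightarrow> (real \<Rightarrow> real) \<Rightarrow> real \<Rightarrow> complex" where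
  "truncated_fourier R h k =
     complex_of_real (1 / sqrt (2 * pi)) *
       (LINT x:{-R..R}|lborel. complex_of_real (h x) * exp (- \<i> * complex_of_real (k * x)))"

text \<open>A function in \<^term>\<open>L2\<close> need not be integrable, so its Fourier integral is the limit in
  the mean square of the integrals over \<open>[-R, R]\<close>.  The limit is determined only up to a null
  set; \<open>fourier h\<close> is one of its representatives, and likewise for the other choices
  \<open>SOME\<close> below.\<close>

definition is_fourier :: "(real \<Rightarrow> real) \<Rightarrow> (real \<Rightarrow> complex) \<Rightarrow> bool" where
  "is_fourier h F \<longleftrightarrow> F \<in> borel_measurable lborel \<and>
     ((\<lambda>R. \<integral>\<^sup>+ k. ennreal ((cmod (truncated_fourier R h k - F k))\<^sup>2) \<partial>lborel) \<longlongrightarrow> 0) at_top"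

definition fourier :: "(real \<Rightarrow> real) \<Rightarrow> real \<Rightarrow> complex" where
  "fourier h = (SOME F. is_fourier h F)"

definition sobolev :: "real \<Rightarrow> (real \<Rightarrow> real) set" where
  "sobolev s = {h \<in> L2.
     integrable lborel (\<lambda>n. (1 + \<bar>n\<bar> powr (2 * s)) * (cmod (fourier h n))\<^sup>2)}"

definition sobolev_norm :: "real \<Rightarrow> (real \<Rightarrow> real) \<Rightarrow> real" where
  "sobolev_norm s h =
     sqrt (LINT n|lborel. (1 + \<bar>n\<bar> powr (2 * s)) * (cmod (fourier h n))\<^sup>2)"

text \<open>The symbols used below satisfy \<open>m (- k) = cnj (m k)\<close>, so the operators map real functions
  to real functions.  The result is meaningful when \<open>m\<close> times the transform of \<open>h\<close> is square
  integrable.\<close>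

definition fourier_multiplier :: "(real \<Rightarrow> complex) \<Rightarrow> (real \<Rightarrow> real) \<Rightarrow> real \<Rightarrow> real" where
  "fourier_multiplier m h =
     (SOME g. g \<in> L2 \<and> (AE k in lborel. fourier g k = m k * fourier h k))"

definition hilbert :: "(real \<Rightarrow> real) \<Rightarrow> real \<Rightarrow> real" where
  "hilbert = fourier_multiplier (\<lambda>k. - \<i> * complex_of_real (sgn k))"

definition Lambda_pow :: "real \<Rightarrow> (real \<Rightarrow> real) \<Rightarrow> real \<Rightarrow> real" where
  "Lambda_pow s = fourier_multiplier (\<lambda>k. complex_of_real (\<bar>k\<bar> powr s))"

abbreviation Lambda :: "(real \<Rightarrow> real) \<Rightarrow> real \<Rightarrow> real" where
  "Lambda \<equiv> Lambda_pow 1"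

definition commutator ::
  "((real \<Rightarrow> real) \<Rightarrow> real \<Rightarrow> real) \<Rightarrow> (real \<Rightarrow> real) \<Rightarrow> (real \<Rightarrow> real) \<Rightarrow> real \<Rightarrow> real" where
  "commutator \<T> f g = (\<lambda>x. \<T> (\<lambda>y. f y * g y) x - f x * \<T> g x)"

definition test_function :: "real set \<Rightarrow> (real \<Rightarrow> real) \<Rightarrow> bool" where
  "test_function U \<phi> \<longleftrightarrow>
     (\<forall>n x. (deriv ^^ n) \<phi> differentiable (at x)) \<and>
     (\<exists>K. compact K \<and> K \<subseteq> U \<and> (\<forall>x. x \<notin> K \<longrightarrow> \<phi> x = 0))"

definition is_weak_deriv :: "(real \<Rightarrow> real) \<Rightarrow> (real \<Rightarrow> real) \<Rightarrow> bool" where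
  "is_weak_deriv u w \<longleftrightarrow>
     w \<in> borel_measurable lborel \<and> (\<forall>a b. set_integrable lborel {a..b} w) \<and>
     (\<forall>\<phi>. test_function UNIV \<phi> \<longrightarrow>
        (LINT x|lborel. u x * deriv \<phi> x) = - (LINT x|lborel. w x * \<phi> x))"

definition weak_deriv :: "(real \<Rightarrow> real) \<Rightarrow> real \<Rightarrow> real" where
  "weak_deriv u = (SOME w. is_weak_deriv u w)"

text \<open>A function of time and space is curried, time first.  Strongly measurable functions from
  \<open>(0, T)\<close> to \<open>L2\<close> are, up to null sets, the jointly measurable functions on the strip; since
  \<open>sobolev s\<close> is separable, this is also strong measurability into \<open>sobolev s\<close> for functions
  with values there.\<close>

definition strip_measurable :: "real \<Rightarrow> (real \<Rightarrow> real \<Rightarrow> real) \<Rightarrow> bool" where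
  "strip_measurable T f \<longleftrightarrow>
     set_borel_measurable (lborel \<Otimes>\<^sub>M lborel) ({0<..<T} \<times> UNIV) (\<lambda>(t, x). f t x)"

definition Linf_sobolev :: "real \<Rightarrow> real \<Rightarrow> (real \<Rightarrow> real \<Rightarrow> real) set" where
  "Linf_sobolev T s = {f. strip_measurable T f \<and>
     (\<exists>M. AE t in lborel. t \<in> {0<..<T} \<longrightarrow> f t \<in> sobolev s \<and> sobolev_norm s (f t) \<le> M)}"

definition continuous_L2 :: "real \<Rightarrow> (real \<Rightarrow> real \<Rightarrow> real) \<Rightarrow> bool" where
  "continuous_L2 T f \<longleftrightarrow>
     (\<forall>t\<in>{0..T}. f t \<in> L2 \<and>
        ((\<lambda>s. L2_norm (\<lambda>x. f s x - f t x)) \<longlongrightarrow> 0) (at t within {0..T}))"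

text \<open>The weak derivative of \<open>f\<close> as an \<open>L2\<close>-valued function on \<open>(0, T)\<close> is \<open>g\<close>, integrable in
  the sense of Bochner; the \<open>L2\<close>-valued integrals are evaluated at almost every \<open>x\<close>.\<close>

definition is_weak_time_deriv ::
  "real \<Rightarrow> (real \<Rightarrow> real \<Rightarrow> real) \<Rightarrow> (real \<Rightarrow> real \<Rightarrow> real) \<Rightarrow> bool" where
  "is_weak_time_deriv T f g \<longleftrightarrow>
     strip_measurable T g \<and>
     (AE t in lborel. t \<in> {0<..<T} \<longrightarrow> g t \<in> L2) \<and>
     set_integrable lborel {0<..<T} (\<lambda>t. L2_norm (g t)) \<and>
     (\<forall>\<eta>. test_function {0<..<T} \<eta> \<longrightarrow>
        (AE x in lborel. (LINT t:{0<..<T}|lborel. deriv \<eta> t * f t x)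
                       = - (LINT t:{0<..<T}|lborel. \<eta> t * g t x)))"

definition wave_rhs :: "real \<Rightarrow> real \<Rightarrow> real \<Rightarrow> (real \<Rightarrow> real) \<Rightarrow> real \<Rightarrow> real" where
  "wave_rhs \<epsilon> \<alpha>\<^sub>o \<beta> u x =
     1 / \<epsilon> * (weak_deriv u x + hilbert u x
               + (\<alpha>\<^sub>o - \<beta>) * hilbert (weak_deriv (weak_deriv u)) x)
     + hilbert (\<lambda>y. (Lambda u y)\<^sup>2) x
     - commutator hilbert u (Lambda u) x
     + (\<alpha>\<^sub>o - \<beta>) * commutator hilbert u (Lambda_pow 3 u) x"

text \<open>A solution has \<open>f\<^sub>t\<close> in \<open>L\<^sup>1(0, T; L2)\<close> and so exactly one representative that is
  continuous in time with values in \<open>L2\<close>.  This is the representative taken here; it gives a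
  meaning to the initial condition.  Membership of \<open>f\<^sub>t\<close> in \<open>sobolev 1\<close> gives a meaning to
  \<open>\<Lambda> f\<^sub>t\<close>.\<close>

definition is_solution ::
  "real \<Rightarrow> real \<Rightarrow> real \<Rightarrow> (real \<Rightarrow> real) \<Rightarrow> real \<Rightarrow> (real \<Rightarrow> real \<Rightarrow> real) \<Rightarrow> bool" where
  "is_solution \<epsilon> \<alpha>\<^sub>o \<beta> f\<^sub>0 T f \<longleftrightarrow>
     continuous_L2 T f \<and>
     (AE x in lborel. f 0 x = f\<^sub>0 x) \<and>
     (\<exists>f\<^sub>t. is_weak_time_deriv T f f\<^sub>t \<and>
        (AE t in lborel. t \<in> {0<..<T} \<longrightarrow>
           f\<^sub>t t \<in> sobolev 1 \<and>
           (AE x in lborel.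
              2 * f\<^sub>t t x + \<alpha>\<^sub>o * Lambda (f\<^sub>t t) x = wave_rhs \<epsilon> \<alpha>\<^sub>o \<beta> (f t) x)))"

end

theory Submission
  imports Defs "HOL-Probability.Probability"
begin

text \<open>After division by \<open>2 + \<alpha>|k|\<close> the equation reads \<open>u\<^sub>t = i p(k) u + Q(u, u)\<close> on the Fourier side, with
  \<open>p\<close> real and odd. The integral kernels of the two commutators vanish unless \<open>k\<close> and \<open>m\<close> have
  different signs, so all derivatives that they contain can be moved to the frequency \<open>k - m\<close> and \<open>Q\<close>
  is bounded on the weighted space \<open>L\<^sup>2((1 + |k|)\<^sup>6 dk)\<close>, the image of \<open>H\<^sup>3\<close>. The Picard
  iterates of Duhamel's formula and their differences are dominated by functions of \<open>k\<close> alone, so they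
  converge pointwise to a solution. For uniqueness, the difference of two solutions satisfies an
  \<open>L\<^sup>2\<close> energy estimate, to which Gronwall's inequality applies.

  Plancherel's theorem is obtained by Gaussian regularisation on continuous functions of compact support,
  and inversion from the fact that the transform and its conjugate are adjoint isometries.\<close>

section \<open>Square integrable functions\<close>

text \<open>Two losses of derivatives have to be met. The symbol \<open>p\<close> may grow like |k|;
  being real, it is absorbed into the factor \<open>exp (i p t)\<close> of modulus one, so only
  \<open>Q\<close> enters the iteration, and in the energy estimate its contribution has real part
  zero. In \<open>Q\<close> the division gains one power of |k|, while the term with
  \<open>Lambda_pow 3\<close> costs three. Where its kernel survives, |k| and |m| are both at most
  |k - m|; hence (1 + |k|)^3 times the kernel is bounded by terms with three powers on one factor
  and two on the other. The three are measured in L2, the two in L1, and the L1 norm costs one more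
  power by Cauchy-Schwarz: this is how the exponent 3 closes the estimate. Majorants are
  \<open>ennreal\<close>-valued, so that their integrals always make sense and the majorant
  iteration needs only monotonicity. A competing solution is only bounded in H^3 and continuous in
  L2. Differences are therefore measured without any weight, and all derivatives have to fall on the
  other factor, whichever side of the convolution it stands on. Since the time derivative is weak,
  the energy identity comes from testing with functions fixed in time.\<close>

definition sqn :: "(real \<Rightarrow> complex) \<Rightarrow> ennreal" where
  "sqn f = (\<integral>\<^sup>+x. ennreal ((cmod (f x))\<^sup>2) \<partial>lborel)"

definition L2C :: "(real \<Rightarrow> complex) set" where
  "L2C = {f. f \<in> borel_measurable borel \<and> sqn f < \<infinity>}"

lemma L2C_measurable [measurable_dest]: "f \<in> L2C \<Longrightarrow> f \<in> borel_measurable borel"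
  by (simp add: L2C_def)

lemma L2C_finite: "f \<in> L2C \<Longrightarrow> sqn f < \<infinity>"
  by (simp add: L2C_def)

lemma L2C_I: "f \<in> borel_measurable borel \<Longrightarrow> sqn f < \<infinity> \<Longrightarrow> f \<in> L2C"
  by (simp add: L2C_def)

lemma L2C_integrable_sq: "f \<in> L2C \<Longrightarrow> integrable lborel (\<lambda>x. (cmod (f x))\<^sup>2)"
  by (subst integrable_iff_bounded) (auto simp: L2C_def sqn_def)

lemma L2C_iff: "f \<in> L2C \<longleftrightarrow> f \<in> borel_measurable borel \<and> integrable lborel (\<lambda>x. (cmod (f x))\<^sup>2)"
proof -
  have "sqn f < \<infinity>" if "integrable lborel (\<lambda>x. (cmod (f x))\<^sup>2)"
    using integrableD(2)[OF that] by (simp add: sqn_def top.not_eq_extremum)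
  then show ?thesis using L2C_integrable_sq by (auto simp: L2C_def)
qed

lemma sqn_eq_integral: "f \<in> L2C \<Longrightarrow> sqn f = ennreal (LINT x|lborel. (cmod (f x))\<^sup>2)"
  unfolding sqn_def by (rule nn_integral_eq_integral) (auto dest: L2C_integrable_sq)

lemma sqn_cong_AE: "AE x in lborel. f x = g x \<Longrightarrow> sqn f = sqn g"
  unfolding sqn_def by (rule nn_integral_cong_AE) auto

lemma sqn_mono_AE: "AE x in lborel. cmod (f x) \<le> cmod (g x) \<Longrightarrow> sqn f \<le> sqn g"
  unfolding sqn_def by (rule nn_integral_mono_AE) (auto elim!: eventually_mono intro!: ennreal_leI power_mono)

text \<open>Squared norms are used throughout, so the triangle inequality appears with the factor 2
  on each term. Its repeated use produces most powers of 2 in the constants below.\<close>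

lemma sq_add_le: "(cmod (a + b))\<^sup>2 \<le> 2 * (cmod a)\<^sup>2 + 2 * (cmod b)\<^sup>2"
proof -
  have "(cmod (a + b))\<^sup>2 \<le> (cmod a + cmod b)\<^sup>2"
    by (intro power_mono norm_triangle_ineq) auto
  also have "\<dots> \<le> 2 * (cmod a)\<^sup>2 + 2 * (cmod b)\<^sup>2"
    using zero_le_power2[of "cmod a - cmod b"] by (simp add: power2_eq_square algebra_simps)
  finally show ?thesis .
qed

lemma sqn_cmult: "f \<in> borel_measurable borel \<Longrightarrow> sqn (\<lambda>x. c * f x) = ennreal ((cmod c)\<^sup>2) * sqn f"
  unfolding sqn_def by (subst nn_integral_cmult[symmetric]) (auto simp: norm_mult power_mult_distrib ennreal_mult)

lemma sqn_add_le:
  assumes [measurable]: "f \<in> borel_measurable borel" "g \<in> borel_measurable borel"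
  shows "sqn (\<lambda>x. f x + g x) \<le> 2 * sqn f + 2 * sqn g"
proof -
  have "sqn (\<lambda>x. f x + g x) \<le> (\<integral>\<^sup>+x. 2 * ennreal ((cmod (f x))\<^sup>2) + 2 * ennreal ((cmod (g x))\<^sup>2) \<partial>lborel)"
    unfolding sqn_def
  proof (rule nn_integral_mono)
    fix x
    have "ennreal ((cmod (f x + g x))\<^sup>2) \<le> ennreal (2 * (cmod (f x))\<^sup>2 + 2 * (cmod (g x))\<^sup>2)"
      by (rule ennreal_leI[OF sq_add_le])
    also have "\<dots> = 2 * ennreal ((cmod (f x))\<^sup>2) + 2 * ennreal ((cmod (g x))\<^sup>2)"
      by (simp add: ennreal_mult)
    finally show "ennreal ((cmod (f x + g x))\<^sup>2) \<le> 2 * ennreal ((cmod (f x))\<^sup>2) + 2 * ennreal ((cmod (g x))\<^sup>2)" .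
  qed
  also have "\<dots> = 2 * sqn f + 2 * sqn g"
    unfolding sqn_def by (subst nn_integral_add) (auto simp: nn_integral_cmult)
  finally show ?thesis .
qed

lemma sqn_diff_commute: "sqn (\<lambda>x. f x - g x) = sqn (\<lambda>x. g x - f x)"
  unfolding sqn_def by (simp add: norm_minus_commute)

lemma sqn_diff_triangle:
  assumes [measurable]: "f \<in> borel_measurable borel" "g \<in> borel_measurable borel" "h \<in> borel_measurable borel"
  shows "sqn (\<lambda>x. f x - h x) \<le> 2 * sqn (\<lambda>x. f x - g x) + 2 * sqn (\<lambda>x. g x - h x)"
  using sqn_add_le[of "\<lambda>x. f x - g x" "\<lambda>x. g x - h x"] by simp

lemma sqn_eq_0_iff: "f \<in> borel_measurable borel \<Longrightarrow> sqn f = 0 \<longleftrightarrow> (AE x in lborel. f x = 0)"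
  unfolding sqn_def by (subst nn_integral_0_iff_AE) auto

lemma L2C_add: "f \<in> L2C \<Longrightarrow> g \<in> L2C \<Longrightarrow> (\<lambda>x. f x + g x) \<in> L2C"
  unfolding L2C_def using sqn_add_le[of f g]
  by (auto elim!: le_less_trans simp: ennreal_mult_less_top)

lemma L2C_cmult: "f \<in> L2C \<Longrightarrow> (\<lambda>x. c * f x) \<in> L2C"
  by (auto simp: L2C_def sqn_cmult ennreal_mult_less_top)

lemma L2C_uminus: "f \<in> L2C \<Longrightarrow> (\<lambda>x. - f x) \<in> L2C"
  by (auto simp: L2C_def sqn_def)

lemma L2C_diff: "f \<in> L2C \<Longrightarrow> g \<in> L2C \<Longrightarrow> (\<lambda>x. f x - g x) \<in> L2C"
  using L2C_add[of f "\<lambda>x. - g x"] L2C_uminus[of g] by simp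

lemma borel_measurable_cnj [measurable (raw)]:
  "f \<in> borel_measurable M \<Longrightarrow> (\<lambda>x. cnj (f x)) \<in> borel_measurable M"
  by (rule borel_measurable_continuous_on[where f=cnj]) (auto intro!: continuous_intros)

lemma L2C_cnj: "f \<in> L2C \<Longrightarrow> (\<lambda>x. cnj (f x)) \<in> L2C"
  by (auto simp: L2C_def sqn_def)

lemma L2C_bound:
  assumes g: "g \<in> L2C" and f: "f \<in> borel_measurable borel" and "AE x in lborel. cmod (f x) \<le> cmod (g x)"
  shows "f \<in> L2C"
  using sqn_mono_AE[OF assms(3)] g f by (auto simp: L2C_def)

lemma L2C_cong_AE:
  assumes "g \<in> L2C" "f \<in> borel_measurable borel" "AE x in lborel. f x = g x"
  shows "f \<in> L2C"
  using assms by (intro L2C_bound[OF assms(1,2)]) auto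

lemma L2C_mult_bounded:
  assumes "f \<in> L2C" "m \<in> borel_measurable borel" "AE x in lborel. cmod (m x) \<le> B"
  shows "(\<lambda>x. m x * f x) \<in> L2C"
proof (rule L2C_bound[OF L2C_cmult[OF assms(1), of "of_real \<bar>B\<bar>"]])
  show "(\<lambda>x. m x * f x) \<in> borel_measurable borel"
    using assms(1,2) by (auto simp: L2C_def)
  show "AE x in lborel. cmod (m x * f x) \<le> cmod (complex_of_real \<bar>B\<bar> * f x)"
    using assms(3) by eventually_elim (auto simp: norm_mult intro!: mult_right_mono)
qed

lemma AE_lborel_uminus:
  assumes "AE x in lborel. P (x::real)" shows "AE x in lborel. P (- x)"
proof -
  have "AE x in distr lborel borel (\<lambda>x. - x). P x"
    using assms lborel_distr_uminus by metis
  then show ?thesis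
    by (rule AE_distrD[rotated]) simp
qed

lemma nn_integral_uminus:
  "f \<in> borel_measurable borel \<Longrightarrow> (\<integral>\<^sup>+x. f (- x :: real) \<partial>lborel) = (\<integral>\<^sup>+x. f x \<partial>lborel)"
  using nn_integral_real_affine[of f "-1" 0] by simp

lemma sqn_reflect: "f \<in> borel_measurable borel \<Longrightarrow> sqn (\<lambda>x. f (- x)) = sqn f"
  unfolding sqn_def using nn_integral_uminus[of "\<lambda>x. ennreal ((cmod (f x))\<^sup>2)"] by simp

lemma L2C_reflect: "f \<in> L2C \<Longrightarrow> (\<lambda>x. f (- x)) \<in> L2C"
  by (auto simp: L2C_def sqn_reflect)

lemma nn_Cauchy_Schwarz_L2C:
  assumes "f \<in> L2C" "g \<in> L2C"
  shows "(\<integral>\<^sup>+x. ennreal (cmod (f x) * cmod (g x)) \<partial>lborel)\<^sup>2 \<le> sqn f * sqn g"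
  using Cauchy_Schwarz_nn_integral[of "\<lambda>x. ennreal (cmod (f x))" lborel "\<lambda>x. ennreal (cmod (g x))"] assms
  by (auto simp: L2C_def sqn_def ennreal_mult ennreal_power)

lemma L2C_integrable_mult:
  assumes "f \<in> L2C" "g \<in> L2C"
  shows "integrable lborel (\<lambda>x. f x * g x)"
proof (subst integrable_iff_bounded, intro conjI)
  show "(\<lambda>x. f x * g x) \<in> borel_measurable lborel" using assms by (auto simp: L2C_def)
  have "(\<integral>\<^sup>+x. ennreal (cmod (f x) * cmod (g x)) \<partial>lborel)\<^sup>2 < \<infinity>"
    using nn_Cauchy_Schwarz_L2C[OF assms] L2C_finite[OF assms(1)] L2C_finite[OF assms(2)]
    by (auto simp: ennreal_mult_less_top elim!: le_less_trans)
  then show "(\<integral>\<^sup>+x. ennreal (norm (f x * g x)) \<partial>lborel) < \<infinity>"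
    by (auto simp: norm_mult power2_eq_square ennreal_mult_less_top top.not_eq_extremum[symmetric])
qed

lemma L2C_Cauchy_Schwarz:
  assumes "f \<in> L2C" "g \<in> L2C"
  shows "ennreal ((cmod (LINT x|lborel. f x * g x))\<^sup>2) \<le> sqn f * sqn g"
proof -
  have "ennreal (cmod (LINT x|lborel. f x * g x)) \<le> (\<integral>\<^sup>+x. ennreal (cmod (f x) * cmod (g x)) \<partial>lborel)"
    using integral_norm_bound_ennreal[OF L2C_integrable_mult[OF assms]] by (simp add: norm_mult)
  then have "(ennreal (cmod (LINT x|lborel. f x * g x)))\<^sup>2 \<le> (\<integral>\<^sup>+x. ennreal (cmod (f x) * cmod (g x)) \<partial>lborel)\<^sup>2"
    by (intro power_mono) auto
  also have "\<dots> \<le> sqn f * sqn g" by (rule nn_Cauchy_Schwarz_L2C[OF assms])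
  finally show ?thesis by (simp add: ennreal_power)
qed

lemma sqn_eq_integral_cnj: "f \<in> L2C \<Longrightarrow> complex_of_real (enn2real (sqn f)) = (LINT x|lborel. f x * cnj (f x))"
  by (simp only: sqn_eq_integral complex_norm_square[symmetric] integral_complex_of_real) simp

lemma tendsto_zero_of_sq_le:
  fixes z :: "nat \<Rightarrow> complex"
  assumes "\<And>n. ennreal ((cmod (z n))\<^sup>2) \<le> a n" "a \<longlonglongrightarrow> 0"
  shows "z \<longlonglongrightarrow> 0"
proof -
  have "(\<lambda>n. ennreal ((cmod (z n))\<^sup>2)) \<longlonglongrightarrow> ennreal 0"
    by (rule tendsto_sandwich[of "\<lambda>_. 0" _ _ a]) (use assms in auto)
  then have "(\<lambda>n. (cmod (z n))\<^sup>2) \<longlonglongrightarrow> 0"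
    by (subst (asm) tendsto_ennreal_iff) auto
  then have "(\<lambda>n. sqrt ((cmod (z n))\<^sup>2)) \<longlonglongrightarrow> sqrt 0" by (intro tendsto_intros)
  then show ?thesis by (simp add: tendsto_norm_zero_iff)
qed

lemma tendsto_mult_ennreal_0:
  fixes a :: "nat \<Rightarrow> ennreal"
  assumes "a \<longlonglongrightarrow> 0" "c < \<infinity>" shows "(\<lambda>n. a n * c) \<longlonglongrightarrow> 0" "(\<lambda>n. c * a n) \<longlonglongrightarrow> 0"
  using ennreal_tendsto_cmult[of c a 0 sequentially] assms by (auto simp: mult.commute)

text \<open>Joint continuity of the bilinear pairing, which carries identities from continuous
  functions of compact support to all of \<open>L2C\<close>. Splitting off the product of the two
  differences avoids any uniform bound on \<open>g n\<close>; each of the three pieces is small by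
  Cauchy-Schwarz.\<close>

lemma L2C_tendsto_integral:
  assumes "\<And>n. f n \<in> L2C" "f' \<in> L2C" "\<And>n. g n \<in> L2C" "g' \<in> L2C"
    and f: "(\<lambda>n. sqn (\<lambda>x. f n x - f' x)) \<longlonglongrightarrow> 0" and g: "(\<lambda>n. sqn (\<lambda>x. g n x - g' x)) \<longlonglongrightarrow> 0"
  shows "(\<lambda>n. LINT x|lborel. f n x * g n x) \<longlonglongrightarrow> (LINT x|lborel. f' x * g' x)"
proof -
  note [simp] = L2C_integrable_mult assms(1-4) L2C_diff
  have 1: "(\<lambda>n. LINT x|lborel. (f n x - f' x) * (g n x - g' x)) \<longlonglongrightarrow> 0"
  proof (rule tendsto_zero_of_sq_le)
    show "ennreal ((cmod (LINT x|lborel. (f n x - f' x) * (g n x - g' x)))\<^sup>2) \<le>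
      sqn (\<lambda>x. f n x - f' x) * sqn (\<lambda>x. g n x - g' x)" for n by (rule L2C_Cauchy_Schwarz) auto
    show "(\<lambda>n. sqn (\<lambda>x. f n x - f' x) * sqn (\<lambda>x. g n x - g' x)) \<longlonglongrightarrow> 0"
      using tendsto_mult_ennreal[OF f g] by simp
  qed
  have 2: "(\<lambda>n. LINT x|lborel. (f n x - f' x) * g' x) \<longlonglongrightarrow> 0"
  proof (rule tendsto_zero_of_sq_le)
    show "ennreal ((cmod (LINT x|lborel. (f n x - f' x) * g' x))\<^sup>2) \<le>
      sqn (\<lambda>x. f n x - f' x) * sqn g'" for n by (rule L2C_Cauchy_Schwarz) auto
    show "(\<lambda>n. sqn (\<lambda>x. f n x - f' x) * sqn g') \<longlonglongrightarrow> 0"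
      by (intro tendsto_mult_ennreal_0 f L2C_finite assms)
  qed
  have 3: "(\<lambda>n. LINT x|lborel. f' x * (g n x - g' x)) \<longlonglongrightarrow> 0"
  proof (rule tendsto_zero_of_sq_le)
    show "ennreal ((cmod (LINT x|lborel. f' x * (g n x - g' x)))\<^sup>2) \<le>
      sqn f' * sqn (\<lambda>x. g n x - g' x)" for n by (rule L2C_Cauchy_Schwarz) auto
    show "(\<lambda>n. sqn f' * sqn (\<lambda>x. g n x - g' x)) \<longlonglongrightarrow> 0"
      by (intro tendsto_mult_ennreal_0 g L2C_finite assms)
  qed
  have "(LINT x|lborel. f n x * g n x) - (LINT x|lborel. f' x * g' x) =
     (LINT x|lborel. (f n x - f' x) * (g n x - g' x)) + (LINT x|lborel. (f n x - f' x) * g' x)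
      + (LINT x|lborel. f' x * (g n x - g' x))" for n
  proof -
    have "(LINT x|lborel. f n x * g n x) - (LINT x|lborel. f' x * g' x) = (LINT x|lborel. f n x * g n x - f' x * g' x)"
      by (simp add: Bochner_Integration.integral_diff)
    also have "\<dots> = (LINT x|lborel. ((f n x - f' x) * (g n x - g' x) + (f n x - f' x) * g' x) + f' x * (g n x - g' x))"
      by (intro Bochner_Integration.integral_cong) (auto simp: algebra_simps)
    also have "\<dots> = (LINT x|lborel. (f n x - f' x) * (g n x - g' x)) + (LINT x|lborel. (f n x - f' x) * g' x)
      + (LINT x|lborel. f' x * (g n x - g' x))"
      by (subst Bochner_Integration.integral_add Bochner_Integration.integrable_add, simp, simp)+ simp
    finally show ?thesis .
  qed
  with tendsto_add[OF tendsto_add[OF 1 2] 3]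
  show ?thesis by (simp add: LIM_zero_cancel)
qed

lemma sqn_Fatou:
  assumes "\<And>n. f n \<in> borel_measurable borel" "AE x in lborel. (\<lambda>n. f n x) \<longlonglongrightarrow> g x"
  shows "sqn g \<le> liminf (\<lambda>n. sqn (f n))"
proof -
  have "sqn g = (\<integral>\<^sup>+x. liminf (\<lambda>n. ennreal ((cmod (f n x))\<^sup>2)) \<partial>lborel)"
    unfolding sqn_def
  proof (rule nn_integral_cong_AE)
    show "AE x in lborel. ennreal ((cmod (g x))\<^sup>2) = liminf (\<lambda>n. ennreal ((cmod (f n x))\<^sup>2))"
      using assms(2)
    proof eventually_elim
      case (elim x)
      then have "(\<lambda>n. ennreal ((cmod (f n x))\<^sup>2)) \<longlonglongrightarrow> ennreal ((cmod (g x))\<^sup>2)"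
        by (intro tendsto_intros) auto
      from lim_imp_Liminf[OF sequentially_bot this] show ?case by simp
    qed
  qed
  also have "\<dots> \<le> liminf (\<lambda>n. sqn (f n))"
    unfolding sqn_def using assms(1) by (intro nn_integral_liminf) auto
  finally show ?thesis .
qed

lemma sqn_Fatou_bound:
  assumes "\<And>n. f n \<in> borel_measurable borel" "AE x in lborel. (\<lambda>n. f n x) \<longlonglongrightarrow> g x"
    and "eventually (\<lambda>n. sqn (f n) \<le> c) sequentially"
  shows "sqn g \<le> c"
proof -
  have "sqn g \<le> liminf (\<lambda>n. sqn (f n))" by (rule sqn_Fatou[OF assms(1,2)])
  also have "\<dots> \<le> liminf (\<lambda>n. c)" by (rule Liminf_mono[OF assms(3)])
  also have "\<dots> = c" by (simp add: Liminf_const)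
  finally show ?thesis .
qed

lemma sqn_dominated:
  assumes "\<And>n. f n \<in> borel_measurable borel" "g \<in> L2C" 
    and "AE x in lborel. (\<lambda>n. f n x) \<longlonglongrightarrow> 0"
    and "\<And>n. AE x in lborel. cmod (f n x) \<le> cmod (g x)"
  shows "(\<lambda>n. sqn (f n)) \<longlonglongrightarrow> 0"
proof -
  have "(\<lambda>n. sqn (f n)) \<longlonglongrightarrow> (\<integral>\<^sup>+(x::real). 0 \<partial>lborel)"
    unfolding sqn_def
  proof (rule nn_integral_dominated_convergence[where w="\<lambda>x. ennreal ((cmod (g x))\<^sup>2)" and u'="\<lambda>_. 0"])
    show "AE x in lborel. ennreal ((cmod (f n x))\<^sup>2) \<le> ennreal ((cmod (g x))\<^sup>2)" for n
      using assms(4)[of n] by eventually_elim (auto intro!: ennreal_leI power_mono)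
    show "(\<integral>\<^sup>+x. ennreal ((cmod (g x))\<^sup>2) \<partial>lborel) < \<infinity>" using assms(2) by (simp add: L2C_def sqn_def)
    show "AE x in lborel. (\<lambda>n. ennreal ((cmod (f n x))\<^sup>2)) \<longlonglongrightarrow> 0"
      using assms(3)
    proof eventually_elim
      case (elim x)
      then have "(\<lambda>n. ennreal ((cmod (f n x))\<^sup>2)) \<longlonglongrightarrow> ennreal ((cmod 0)\<^sup>2)"
        by (intro tendsto_intros) auto
      then show ?case by simp
    qed
  qed (use assms in \<open>auto simp: L2C_def\<close>)
  then show ?thesis by simp
qed

text \<open>The weight \<open>2 ^ n\<close> against the decay \<open>4 ^ n\<close> leaves a
  convergent series of integrals, so for almost every \<open>x\<close> the numbers
  \<open>2 ^ n * (cmod (d n x))^2\<close> are bounded in \<open>n\<close>, and \<open>d n x\<close>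
  decays geometrically with ratio \<open>sqrt (1/2)\<close>. It serves for the completeness of L2
  and again for the Picard iterates.\<close>

lemma summable_of_weighted_sq:
  assumes m: "\<And>n. d n \<in> borel_measurable borel" and b: "\<And>n. sqn (d n) \<le> ennreal (c / 4 ^ n)" and c: "c \<ge> 0"
  shows "AE x in lborel. summable (\<lambda>n. cmod (d n x))"
proof -
  have "(\<integral>\<^sup>+x. (\<Sum>n. ennreal (2 ^ n) * ennreal ((cmod (d n x))\<^sup>2)) \<partial>lborel) = (\<Sum>n. ennreal (2^n) * sqn (d n))"
    unfolding sqn_def using m
    by (subst nn_integral_suminf) (auto simp: nn_integral_cmult)
  also have "\<dots> \<le> (\<Sum>n. ennreal (c * (1/2) ^ n))"
  proof (intro suminf_le)
    fix n
    have "ennreal (2^n) * sqn (d n) \<le> ennreal (2^n) * ennreal (c / 4 ^ n)"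
      by (intro mult_left_mono b) auto
    also have "\<dots> = ennreal (2^n * (c / 4 ^ n))" using c by (intro ennreal_mult[symmetric]) auto
    also have "2^n * (c / 4 ^ n) = c * (1/2) ^ n"
    proof -
      have "(4::real)^n = 2^n * 2^n" by (simp flip: power_mult_distrib)
      then show ?thesis by (simp add: power_one_over field_simps)
    qed
    finally show "ennreal (2^n) * sqn (d n) \<le> ennreal (c * (1/2) ^ n)" .
  qed auto
  also have "\<dots> = ennreal (\<Sum>n. c * (1/2) ^ n)"
    using c by (intro suminf_ennreal2) (auto intro!: summable_mult summable_geometric)
  also have "\<dots> < \<infinity>" by simp
  finally have "AE x in lborel. (\<Sum>n. ennreal (2 ^ n) * ennreal ((cmod (d n x))\<^sup>2)) \<noteq> \<infinity>"
    using m by (intro nn_integral_PInf_AE) auto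
  then show ?thesis
  proof eventually_elim
    case (elim x)
    define S where "S = (\<Sum>n. ennreal (2 ^ n) * ennreal ((cmod (d n x))\<^sup>2))"
    have le: "(cmod (d n x)) \<le> sqrt (enn2real S) * (sqrt (1/2)) ^ n" for n
    proof -
      have "sum (\<lambda>n. ennreal (2 ^ n) * ennreal ((cmod (d n x))\<^sup>2)) {n} \<le> S"
        unfolding S_def by (rule sum_le_suminf) auto
      then have "ennreal (2 ^ n * (cmod (d n x))\<^sup>2) \<le> S" by (simp add: ennreal_mult)
      then have "2 ^ n * (cmod (d n x))\<^sup>2 \<le> enn2real S"
        using elim by (simp add: S_def ennreal_le_iff2 enn2real_leI le_ennreal_iff top.not_eq_extremum)
          (metis ennreal_enn2real ennreal_le_iff enn2real_nonneg top.not_eq_extremum)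
      then have "(cmod (d n x))\<^sup>2 \<le> enn2real S * (1/2) ^ n"
        by (simp add: power_one_over field_simps)
      then have "sqrt ((cmod (d n x))\<^sup>2) \<le> sqrt (enn2real S * (1/2)^n)"
        by (rule real_sqrt_le_mono)
      then show ?thesis by (simp add: real_sqrt_mult real_sqrt_power del: real_sqrt_divide)
    qed
    have "sqrt (1/2) < (1::real)" by (simp add: real_sqrt_lt_1_iff)
    then have "summable (\<lambda>n. sqrt (enn2real S) * (sqrt (1/2)) ^ n)"
      by (intro summable_mult summable_geometric) (auto)
    then show ?case
      by (rule summable_comparison_test[rotated]) (use le in auto)
  qed
qed

text \<open>Riesz-Fischer for sequences with a geometric Cauchy rate, the only ones that occur since
  approximants can be chosen at that rate. The limit is taken pointwise almost everywhere.\<close>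

lemma L2C_complete:
  assumes m: "\<And>n. f n \<in> L2C" and b: "\<And>n k. n \<le> k \<Longrightarrow> sqn (\<lambda>x. f k x - f n x) \<le> ennreal (c / 4 ^ n)" and c: "c \<ge> 0"
  obtains g where "g \<in> L2C" "(\<lambda>n. sqn (\<lambda>x. f n x - g x)) \<longlonglongrightarrow> 0"
proof -
  have fm [measurable]: "f n \<in> borel_measurable borel" for n using m by (auto simp: L2C_def)
  define g where "g x = lim (\<lambda>n. f n x)" for x
  have gm [measurable]: "g \<in> borel_measurable borel" unfolding g_def by measurable
  have "AE x in lborel. summable (\<lambda>n. cmod (f (Suc n) x - f n x))"
    by (rule summable_of_weighted_sq[where c=c]) (use b c in auto)
  then have conv: "AE x in lborel. (\<lambda>n. f n x) \<longlonglongrightarrow> g x"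
  proof eventually_elim
    case (elim x)
    then have "summable (\<lambda>n. f (Suc n) x - f n x)" by (rule summable_norm_cancel)
    then have "convergent (\<lambda>n. \<Sum>i<n. f (Suc i) x - f i x)" by (simp add: summable_iff_convergent)
    then have "convergent (\<lambda>n. f n x - f 0 x)" by (simp add: sum_lessThan_telescope [of "\<lambda>i. f i x"])
    from convergent_add[OF this convergent_const[of "f 0 x"]] have "convergent (\<lambda>n. f n x)" by simp
    then show ?case by (simp add: g_def convergent_LIMSEQ_iff)
  qed
  \<comment> \<open>Fatou's lemma in the second index turns the Cauchy bound into a bound for the
    distance to the limit.\<close>
  have bd: "sqn (\<lambda>x. f n x - g x) \<le> ennreal (c / 4 ^ n)" for n
  proof (rule sqn_Fatou_bound[where f="\<lambda>k x. f n x - f k x"])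
    show "AE x in lborel. (\<lambda>k. f n x - f k x) \<longlonglongrightarrow> f n x - g x"
      using conv by eventually_elim (intro tendsto_intros)
    show "eventually (\<lambda>k. sqn (\<lambda>x. f n x - f k x) \<le> ennreal (c / 4 ^ n)) sequentially"
      using b[of n] by (auto simp: eventually_sequentially sqn_diff_commute[of "f n"])
  qed auto
  have lim: "(\<lambda>n. sqn (\<lambda>x. f n x - g x)) \<longlonglongrightarrow> 0"
  proof (rule tendsto_sandwich[of "\<lambda>_. 0" _ _ "\<lambda>n. ennreal (c / 4 ^ n)"])
    have "(\<lambda>n. c * (1/4) ^ n) \<longlonglongrightarrow> c * 0" by (intro tendsto_intros LIMSEQ_realpow_zero) auto
    then have "(\<lambda>n. ennreal (c / 4^n)) \<longlonglongrightarrow> ennreal 0"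
      by (intro tendsto_ennrealI) (simp add: power_one_over field_simps)
    then show "(\<lambda>n. ennreal (c / 4^n)) \<longlonglongrightarrow> 0" by simp
  qed (use bd in auto)
  have "(\<lambda>x. f 0 x - g x) \<in> L2C"
    using bd[of 0] by (auto simp: L2C_def intro: le_less_trans)
  from L2C_diff[OF m[of 0] this] have "g \<in> L2C" by simp
  with lim show ?thesis using that by blast
qed

section \<open>Plancherel's identity for continuous functions of compact support\<close>

lemma lborel_prod_integrableI:
  fixes f :: "real \<Rightarrow> real \<Rightarrow> 'b::{banach, second_countable_topology}"
  assumes "(\<lambda>(x, y). f x y) \<in> borel_measurable (lborel \<Otimes>\<^sub>M lborel)"
    and "(\<integral>\<^sup>+x. \<integral>\<^sup>+y. ennreal (norm (f x y)) \<partial>lborel \<partial>lborel) < \<infinity>"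
  shows "integrable (lborel \<Otimes>\<^sub>M lborel) (\<lambda>(x, y). f x y)"
proof (subst integrable_iff_bounded, intro conjI)
  have "(\<integral>\<^sup>+ z. ennreal (norm (case z of (x, y) \<Rightarrow> f x y)) \<partial>(lborel \<Otimes>\<^sub>M lborel)) =
    (\<integral>\<^sup>+x. \<integral>\<^sup>+y. ennreal (norm (f x y)) \<partial>lborel \<partial>lborel)"
    using assms(1) by (subst lborel.nn_integral_fst[symmetric]) auto
  then show "(\<integral>\<^sup>+ z. ennreal (norm (case z of (x, y) \<Rightarrow> f x y)) \<partial>(lborel \<Otimes>\<^sub>M lborel)) < \<infinity>"
    using assms(2) by simp
qed (use assms in auto)

lemma lborel_Fubini:
  fixes f :: "real \<Rightarrow> real \<Rightarrow> 'b::{banach, second_countable_topology}"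
  assumes "(\<lambda>(x, y). f x y) \<in> borel_measurable (lborel \<Otimes>\<^sub>M lborel)"
    and "(\<integral>\<^sup>+x. \<integral>\<^sup>+y. ennreal (norm (f x y)) \<partial>lborel \<partial>lborel) < \<infinity>"
  shows "(LINT x|lborel. LINT y|lborel. f x y) = (LINT y|lborel. LINT x|lborel. f x y)"
  using lborel_pair.Fubini_integral[OF lborel_prod_integrableI[OF assms]] by simp

lemma norm_exp_ii [simp]: "cmod (exp (\<i> * complex_of_real r)) = 1" "cmod (exp (- (\<i> * complex_of_real r))) = 1"
  by (simp_all add: norm_exp_eq_Re)

text \<open>The transform as a convergent integral, meaningful for integrable functions; the
  relation \<open>FT\<close> below extends it to \<open>L2C\<close>.\<close>

definition cft :: "(real \<Rightarrow> complex) \<Rightarrow> real \<Rightarrow> complex" where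
  "cft h k = complex_of_real (1 / sqrt (2 * pi)) * (LINT x|lborel. h x * exp (- \<i> * complex_of_real (k * x)))"

lemma cft_measurable [measurable]: 
  assumes [measurable]: "h \<in> borel_measurable borel" shows "cft h \<in> borel_measurable borel"
  unfolding cft_def by measurable

lemma integrable_mult_exp:
  assumes "integrable lborel h" shows "integrable lborel (\<lambda>x. h x * exp (- \<i> * complex_of_real (k * x)))"
  by (rule Bochner_Integration.integrable_bound[OF assms]) (use assms in \<open>auto simp: norm_mult\<close>)

lemma cft_bound:
  assumes "integrable lborel h" shows "cmod (cft h k) \<le> (LINT x|lborel. cmod (h x))"
proof -
  have "cmod (LINT x|lborel. h x * exp (- \<i> * complex_of_real (k * x))) \<le> (LINT x|lborel. cmod (h x * exp (- \<i> * complex_of_real (k * x))))"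
    by (rule integral_norm_bound)
  also have "\<dots> = (LINT x|lborel. cmod (h x))" by (simp add: norm_mult)
  finally have *: "cmod (LINT x|lborel. h x * exp (- \<i> * complex_of_real (k * x))) \<le> (LINT x|lborel. cmod (h x))" .
  have "1 / sqrt (2 * pi) \<le> 1" using pi_gt3 by (simp add: real_le_lsqrt)
  then have "(1 / sqrt (2*pi)) * cmod (LINT x|lborel. h x * exp (- \<i> * complex_of_real (k * x))) \<le> 1 * (LINT x|lborel. cmod (h x))"
    using * by (intro mult_mono) auto
  then show ?thesis by (simp add: cft_def norm_mult norm_divide)
qed

text \<open>Fubini's theorem: the transform is symmetric for the bilinear pairing without
  conjugation. This moves a transform from one factor to the other before any inversion formula is
  available, and its extension to \<open>L2C\<close> later yields that inversion.\<close>

lemma cft_multiplication: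
  assumes h: "integrable lborel h" and c: "integrable lborel c"
  shows "(LINT k|lborel. cft h k * c k) = (LINT x|lborel. h x * cft c x)"
proof -
  have [measurable]: "h \<in> borel_measurable borel" "c \<in> borel_measurable borel" using h c by auto
  have fin: "(\<integral>\<^sup>+x. \<integral>\<^sup>+k. ennreal (cmod (h x * exp (- \<i> * complex_of_real (k * x)) * c k)) \<partial>lborel \<partial>lborel) < \<infinity>"
  proof -
    have "(\<integral>\<^sup>+x. \<integral>\<^sup>+k. ennreal (cmod (h x * exp (- \<i> * complex_of_real (k * x)) * c k)) \<partial>lborel \<partial>lborel)
      = (\<integral>\<^sup>+x. ennreal (cmod (h x)) * (\<integral>\<^sup>+k. ennreal (cmod (c k)) \<partial>lborel) \<partial>lborel)"
      by (simp add: norm_mult ennreal_mult nn_integral_cmult)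
    also have "\<dots> = (\<integral>\<^sup>+x. ennreal (cmod (h x)) \<partial>lborel) * (\<integral>\<^sup>+k. ennreal (cmod (c k)) \<partial>lborel)"
      by (subst nn_integral_multc) auto
    also have "\<dots> < \<infinity>" using h c by (simp add: ennreal_mult_less_top integrable_iff_bounded)
    finally show ?thesis .
  qed
  let ?s = "complex_of_real (1 / sqrt (2 * pi))"
  have "(LINT k|lborel. cft h k * c k) = (LINT k|lborel. ?s * (LINT x|lborel. h x * exp (- \<i> * complex_of_real (k * x)) * c k))"
    unfolding cft_def by (intro Bochner_Integration.integral_cong refl) (subst integral_mult_left_zero, rule mult.assoc)
  also have "\<dots> = ?s * (LINT k|lborel. LINT x|lborel. h x * exp (- \<i> * complex_of_real (k * x)) * c k)"
    by simp
  also have "(LINT k|lborel. LINT x|lborel. h x * exp (- \<i> * complex_of_real (k * x)) * c k) = 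
      (LINT x|lborel. LINT k|lborel. h x * exp (- \<i> * complex_of_real (k * x)) * c k)"
    by (rule lborel_Fubini[symmetric, OF _ fin]) measurable
  also have "?s * \<dots> = (LINT x|lborel. ?s * (LINT k|lborel. h x * exp (- \<i> * complex_of_real (k * x)) * c k))" by simp
  also have "\<dots> = (LINT x|lborel. h x * cft c x)"
  proof (intro Bochner_Integration.integral_cong refl)
    fix x
    have "(LINT k|lborel. h x * exp (- \<i> * complex_of_real (k * x)) * c k) = (LINT k|lborel. h x * (c k * exp (- \<i> * complex_of_real (x * k))))"
      by (intro Bochner_Integration.integral_cong refl) (simp add: mult_ac)
    then show "?s * (LINT k|lborel. h x * exp (- \<i> * complex_of_real (k * x)) * c k) = h x * cft c x"
      by (simp add: cft_def)
  qed
  finally show ?thesis .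
qed

lemma cft_modulate: "cft (\<lambda>x. exp (\<i> * complex_of_real (a * x)) * h x) k = cft h (k - a)"
proof -
  have "exp (\<i> * complex_of_real (a * x)) * h x * exp (- \<i> * complex_of_real (k * x)) = h x * exp (- \<i> * complex_of_real ((k - a) * x))" for x
  proof -
    have "exp (\<i> * complex_of_real (a * x)) * exp (- \<i> * complex_of_real (k * x)) = exp (- \<i> * complex_of_real ((k - a) * x))"
      by (simp add: exp_add[symmetric] algebra_simps)
    then show ?thesis by (metis mult.commute mult.left_commute)
  qed
  then show ?thesis unfolding cft_def by (simp only:)
qed

lemma cft_cnj: "cft (\<lambda>x. cnj (h x)) k = cnj (cft h (- k))"
proof -
  have "cnj (LINT x|lborel. h x * exp (- \<i> * complex_of_real (- k * x))) = (LINT x|lborel. cnj (h x) * exp (- \<i> * complex_of_real (k * x)))"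
    by (subst Bochner_Integration.integral_cnj[symmetric]) (simp add: exp_cnj)
  then show ?thesis unfolding cft_def complex_cnj_mult complex_cnj_complex_of_real by (simp only:)
qed

lemma integral_uminus:
  fixes f :: "real \<Rightarrow> complex" shows "(LINT x|lborel. f (- x)) = (LINT x|lborel. f x)"
  using lborel_integral_real_affine[of "-1" f 0] by simp

lemma cft_reflect: "cft (\<lambda>x. h (- x)) k = cft h (- k)"
  unfolding cft_def using integral_uminus[of "\<lambda>x. h x * exp (- \<i> * complex_of_real (- k * x))"] by simp

section \<open>Gaussian regularisation and Parseval's identity\<close>

lemma std_normal_fourier:
  "(LINT u|lborel. complex_of_real (std_normal_density u) * exp (\<i> * complex_of_real (t * u))) = complex_of_real (exp (- t\<^sup>2 / 2))"
proof -
  have "char std_normal_distribution t = (LINT u|lborel. std_normal_density u *\<^sub>R exp (\<i> * complex_of_real (t * u)))"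
    unfolding char_def by (subst integral_density) auto
  then show ?thesis
    by (simp add: char_std_normal_distribution scaleR_conv_of_real)
qed

text \<open>A convergence factor and not a density: it equals 1 at the origin and tends to 1
  pointwise as \<open>d\<close> tends to 0, while its transform is a bump of width \<open>d\<close>,
  an approximate identity.\<close>

definition gauss :: "real \<Rightarrow> real \<Rightarrow> real" where
  "gauss d k = exp (- (d * k)\<^sup>2 / 2)"

lemma gauss_le_1: "gauss d k \<le> 1" and gauss_pos: "gauss d k > 0"
  by (auto simp: gauss_def)

lemma gauss_measurable [measurable]: "gauss d \<in> borel_measurable borel"
  unfolding gauss_def by measurable

lemma gauss_density: "d > 0 \<Longrightarrow> gauss d k = sqrt (2 * pi) * std_normal_density (d * k)"
  by (simp add: gauss_def std_normal_density_def)

lemma integrable_gauss: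
  assumes "d > 0" shows "integrable lborel (\<lambda>k. complex_of_real (gauss d k))"
proof -
  have "integrable lborel (\<lambda>k. std_normal_density (0 + d * k))"
    using assms by (intro lborel_integrable_real_affine) auto
  then have "integrable lborel (\<lambda>k. sqrt (2 * pi) * std_normal_density (d * k))" by simp
  then show ?thesis using assms by (simp add: gauss_density)
qed

lemma cft_gauss:
  assumes d: "d > 0" shows "cft (\<lambda>k. complex_of_real (gauss d k)) z = complex_of_real (gauss (1/d) z / d)"
proof -
  have "(LINT k|lborel. complex_of_real (gauss d k) * exp (- \<i> * complex_of_real (z * k)))
     = complex_of_real (sqrt (2 * pi)) * (LINT k|lborel. complex_of_real (std_normal_density (d * k)) * exp (\<i> * complex_of_real ((- z / d) * (d * k))))"
    using d by (subst integral_mult_right_zero[symmetric], intro Bochner_Integration.integral_cong) (auto simp: gauss_density mult.assoc)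
  also have "(LINT k|lborel. complex_of_real (std_normal_density (d * k)) * exp (\<i> * complex_of_real ((- z / d) * (d * k))))
     = complex_of_real (1/d) * (LINT u|lborel. complex_of_real (std_normal_density u) * exp (\<i> * complex_of_real ((- z / d) * u)))"
    using lborel_integral_real_affine[of d "\<lambda>u. complex_of_real (std_normal_density u) * exp (\<i> * complex_of_real ((- z / d) * u))" 0] d
    by (simp add: scaleR_conv_of_real)
  also have "\<dots> = complex_of_real (gauss (1/d) z / d)"
    unfolding std_normal_fourier using d by (simp add: gauss_def power_divide)
  finally have "(LINT k|lborel. complex_of_real (gauss d k) * exp (- \<i> * complex_of_real (z * k))) = complex_of_real (sqrt (2 * pi)) * complex_of_real (gauss (1/d) z / d)" .
  then show ?thesis by (simp add: cft_def)
qed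

definition Cc :: "(real \<Rightarrow> complex) set" where
  "Cc = {f. continuous_on UNIV f \<and> (\<exists>R. \<forall>x. \<bar>x\<bar> > R \<longrightarrow> f x = 0)}"

lemma Cc_measurable: "f \<in> Cc \<Longrightarrow> f \<in> borel_measurable borel"
  by (auto simp: Cc_def intro: borel_measurable_continuous_onI)

lemma Cc_bounded:
  assumes "f \<in> Cc" obtains B where "B > 0" "\<And>x. cmod (f x) \<le> B"
proof -
  obtain R where R: "\<forall>x. \<bar>x\<bar> > R \<longrightarrow> f x = 0" using assms by (auto simp: Cc_def)
  have "compact (f ` {-\<bar>R\<bar>..\<bar>R\<bar>})"
    using assms by (intro compact_continuous_image) (auto simp: Cc_def intro: continuous_on_subset)
  then obtain B where B: "B > 0" "\<forall>z\<in>f ` {-\<bar>R\<bar>..\<bar>R\<bar>}. norm z \<le> B"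
    using compact_imp_bounded bounded_pos by metis
  have "cmod (f x) \<le> B" for x
  proof (cases "\<bar>x\<bar> > R")
    case False
    then have "x \<in> {-\<bar>R\<bar>..\<bar>R\<bar>}" by auto
    then show ?thesis using B(2) by blast
  qed (use R B(1) in auto)
  with B that show ?thesis by blast
qed

lemma Cc_diff: "f \<in> Cc \<Longrightarrow> g \<in> Cc \<Longrightarrow> (\<lambda>x. f x - g x) \<in> Cc"
  unfolding Cc_def
proof safe
  fix R S assume "\<forall>x. \<bar>x\<bar> > R \<longrightarrow> f x = 0" "\<forall>x. \<bar>x\<bar> > S \<longrightarrow> g x = 0"
  then show "\<exists>R. \<forall>x. \<bar>x\<bar> > R \<longrightarrow> f x - g x = 0" by (intro exI[of _ "max R S"]) auto
qed (auto intro!: continuous_intros)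

lemma Cc_add: "f \<in> Cc \<Longrightarrow> g \<in> Cc \<Longrightarrow> (\<lambda>x. f x + g x) \<in> Cc"
  unfolding Cc_def
proof safe
  fix R S assume "\<forall>x. \<bar>x\<bar> > R \<longrightarrow> f x = 0" "\<forall>x. \<bar>x\<bar> > S \<longrightarrow> g x = 0"
  then show "\<exists>R. \<forall>x. \<bar>x\<bar> > R \<longrightarrow> f x + g x = 0" by (intro exI[of _ "max R S"]) auto
qed (auto intro!: continuous_intros)

lemma Cc_cmult: "f \<in> Cc \<Longrightarrow> (\<lambda>x. c * f x) \<in> Cc"
  unfolding Cc_def by (auto intro!: continuous_intros)

lemma Cc_cnj: "f \<in> Cc \<Longrightarrow> (\<lambda>x. cnj (f x)) \<in> Cc"
  unfolding Cc_def by (auto intro!: continuous_intros)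

lemma Cc_reflect: "f \<in> Cc \<Longrightarrow> (\<lambda>x. f (- x)) \<in> Cc"
  unfolding Cc_def
proof safe
  fix R assume "continuous_on UNIV f" "\<forall>x. \<bar>x\<bar> > R \<longrightarrow> f x = 0"
  then show "continuous_on UNIV (\<lambda>x. f (- x))" "\<exists>R. \<forall>x. \<bar>x\<bar> > R \<longrightarrow> f (- x) = 0"
    by (auto intro!: continuous_intros exI[of _ R] intro: continuous_on_compose2[of UNIV f])
qed

lemma bounded_support_integrable:
  fixes f :: "real \<Rightarrow> 'b::{banach, second_countable_topology}"
  assumes "f \<in> borel_measurable borel" "\<And>x. norm (f x) \<le> B" "\<And>x. \<bar>x\<bar> > R \<Longrightarrow> f x = 0"
  shows "integrable lborel f"
proof (rule Bochner_Integration.integrable_bound[of _ "\<lambda>x. indicator {-R..R} x * B"])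
  show "integrable lborel (\<lambda>x. indicator {-R..R} x * B)"
    by (intro integrable_mult_left integrable_real_indicator) (auto simp: emeasure_lborel_Icc_eq)
  show "AE x in lborel. norm (f x) \<le> norm (indicator {- R..R} x * B)"
    using assms(2,3) by (intro AE_I2) (auto simp: indicator_def intro: order_trans[OF assms(2) abs_ge_self])
qed (use assms in auto)

lemma Cc_integrable: "f \<in> Cc \<Longrightarrow> integrable lborel f"
  by (rule Cc_bounded) (auto simp: Cc_def intro!: bounded_support_integrable borel_measurable_continuous_onI)

lemma bounded_support_L2C:
  assumes "f \<in> borel_measurable borel" "\<And>x. cmod (f x) \<le> B" "\<And>x. \<bar>x\<bar> > R \<Longrightarrow> f x = 0"
  shows "f \<in> L2C"
  unfolding L2C_iff using assms
  by (auto intro!: bounded_support_integrable[where B="B\<^sup>2" and R=R] power_mono)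

lemma Cc_L2C: 
  assumes "f \<in> Cc" shows "f \<in> L2C"
proof -
  obtain B where B: "\<And>x. cmod (f x) \<le> B" using Cc_bounded[OF assms] by metis
  obtain R where "\<And>x. \<bar>x\<bar> > R \<Longrightarrow> f x = 0" using assms by (auto simp: Cc_def)
  with B Cc_measurable[OF assms] show ?thesis by (intro bounded_support_L2C) auto
qed

text \<open>The Gaussian factor makes the transform side integrable, so that
  \<open>cft_multiplication\<close> applies to it. The transform of
  \<open>cnj (cft g) * gauss d\<close> is the conjugate of a Gaussian average of \<open>g\<close> at
  scale \<open>d\<close>, and Parseval's identity is the limit of small \<open>d\<close>.\<close>

lemma gauss_Parseval:
  assumes h: "h \<in> Cc" and g: "g \<in> Cc" and d: "d > 0"
  shows "(LINT k|lborel. cft h k * (cnj (cft g k) * gauss d k)) =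
     (LINT x|lborel. h x * cnj (LINT z|lborel. g (x + d * z) * std_normal_density z))"
proof -
  note [measurable] = Cc_measurable[OF h] Cc_measurable[OF g]
  have hi: "integrable lborel h" and gi: "integrable lborel g" using h g by (auto intro: Cc_integrable)
  have ci: "integrable lborel (\<lambda>k. cnj (cft g k) * complex_of_real (gauss d k))"
  proof (rule Bochner_Integration.integrable_bound[OF integrable_mult_right[OF integrable_gauss[OF d], of "of_real (LINT x|lborel. cmod (g x))"]])
    show "AE k in lborel. norm (cnj (cft g k) * complex_of_real (gauss d k)) \<le> norm (complex_of_real (LINT x|lborel. cmod (g x)) * complex_of_real (gauss d k))"
      using cft_bound[OF gi] by (intro AE_I2) (auto simp: norm_mult intro!: mult_right_mono order_trans[OF cft_bound[OF gi]])
  qed measurable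
  have "cft (\<lambda>k. cnj (cft g k) * complex_of_real (gauss d k)) x = cnj (LINT z|lborel. g (x + d * z) * std_normal_density z)" for x
  proof -
    let ?W = "\<lambda>k. exp (\<i> * complex_of_real (x * k)) * complex_of_real (gauss d k)"
    have Wi: "integrable lborel ?W"
      by (rule Bochner_Integration.integrable_bound[OF integrable_gauss[OF d]]) (auto simp: norm_mult)
    have "cft (\<lambda>k. cnj (cft g k) * complex_of_real (gauss d k)) x =
      cnj (complex_of_real (1 / sqrt (2*pi)) * (LINT k|lborel. cft g k * ?W k))"
      unfolding cft_def[of "\<lambda>k. cnj (cft g k) * complex_of_real (gauss d k)"]
      by (simp add: Bochner_Integration.integral_cnj[symmetric] exp_cnj mult_ac del: Bochner_Integration.integral_cnj)
    also have "(LINT k|lborel. cft g k * ?W k) = (LINT y|lborel. g y * cft ?W y)"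
      by (rule cft_multiplication[OF gi Wi])
    also have "\<dots> = (LINT y|lborel. g y * complex_of_real (gauss (1/d) (y - x) / d))"
      by (simp only: cft_modulate cft_gauss[OF d])
    \<comment> \<open>The substitution y = x + d z: the Jacobian cancels the factor 1/d, and the
      width \<open>d\<close> disappears from the kernel.\<close>
    also have "\<dots> = d *\<^sub>R (LINT z|lborel. g (x + d * z) * complex_of_real (gauss (1/d) (x + d * z - x) / d))"
      using d by (subst lborel_integral_real_affine[of d _ x]) auto
    also have "\<dots> = (LINT z|lborel. g (x + d * z) * complex_of_real (sqrt (2*pi) * std_normal_density z))"
      using d by (subst integral_scaleR_right[symmetric], intro Bochner_Integration.integral_cong refl)
        (simp add: gauss_def std_normal_density_def scaleR_conv_of_real)
    also have "\<dots> = complex_of_real (sqrt (2*pi)) * (LINT z|lborel. g (x + d * z) * complex_of_real (std_normal_density z))"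
      by (subst integral_mult_right_zero[symmetric], intro Bochner_Integration.integral_cong) (auto simp: mult_ac)
    finally show ?thesis by simp
  qed
  then show ?thesis by (subst cft_multiplication[OF hi ci]) simp
qed

lemma gauss_Parseval_limit:
  assumes h: "h \<in> Cc" and g: "g \<in> Cc"
  shows "(\<lambda>n. LINT k|lborel. cft h k * (cnj (cft g k) * gauss (1 / real (Suc n)) k)) \<longlonglongrightarrow> (LINT x|lborel. h x * cnj (g x))"
proof -
  note [measurable] = Cc_measurable[OF h] Cc_measurable[OF g]
  obtain B where B: "B > 0" "\<And>x. cmod (g x) \<le> B" using Cc_bounded[OF g] by metis
  define J where "J n x = (LINT z|lborel. g (x + (1 / real (Suc n)) * z) * std_normal_density z)" for n x
  have Jm [measurable]: "J n \<in> borel_measurable borel" for n unfolding J_def by measurable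
  have dens: "integrable lborel (\<lambda>z. B * std_normal_density z)" by simp
  have gi: "integrable lborel (\<lambda>z. g (x + c * z) * std_normal_density z)" for x c
    by (rule Bochner_Integration.integrable_bound[OF dens]) (use B in \<open>auto simp: norm_mult abs_mult intro!: AE_I2 mult_right_mono\<close>)
  have Jb: "cmod (J n x) \<le> B" for n x
  proof -
    have "cmod (J n x) \<le> (LINT z|lborel. B * std_normal_density z)"
      unfolding J_def
      by (rule Bochner_Integration.integral_norm_bound_integral[OF gi dens]) (use B in \<open>auto simp: norm_mult intro!: mult_right_mono\<close>)
    then show ?thesis by simp
  qed
  have Jlim: "(\<lambda>n. J n x) \<longlonglongrightarrow> g x" for x
  proof -
    have "(\<lambda>n. J n x) \<longlonglongrightarrow> (LINT z|lborel. g x * std_normal_density z)"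
      unfolding J_def
    proof (rule integral_dominated_convergence[where w="\<lambda>z. B * std_normal_density z"])
      show "AE z in lborel. (\<lambda>n. g (x + 1 / real (Suc n) * z) * complex_of_real (std_normal_density z)) \<longlonglongrightarrow> g x * complex_of_real (std_normal_density z)"
      proof (intro AE_I2 tendsto_mult tendsto_const)
        fix z
        have "(\<lambda>n. x + 1 / real (Suc n) * z) \<longlonglongrightarrow> x + 0 * z"
          by (intro tendsto_intros LIMSEQ_inverse_real_of_nat[unfolded inverse_eq_divide])
        moreover have "isCont g x" using g by (auto simp: Cc_def continuous_on_eq_continuous_at)
        ultimately show "(\<lambda>n. g (x + 1 / real (Suc n) * z)) \<longlonglongrightarrow> g x"
          by (auto intro: isCont_tendsto_compose)
      qed
      show "AE z in lborel. norm (g (x + 1 / real (Suc n) * z) * complex_of_real (std_normal_density z)) \<le> B * std_normal_density z" for n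
        by (intro AE_I2) (auto simp: norm_mult B intro!: mult_right_mono)
    qed (use dens in auto)
    also have "(LINT z|lborel. g x * std_normal_density z) = g x" by (simp only: integral_mult_right_zero integral_complex_of_real integral_normal_density) simp
    finally show ?thesis .
  qed
  have "(\<lambda>n. LINT x|lborel. h x * cnj (J n x)) \<longlonglongrightarrow> (LINT x|lborel. h x * cnj (g x))"
  proof (rule integral_dominated_convergence[where w="\<lambda>x. B * cmod (h x)"])
    show "integrable lborel (\<lambda>x. B * cmod (h x))" using Cc_integrable[OF h] by auto
    show "AE x in lborel. (\<lambda>n. h x * cnj (J n x)) \<longlonglongrightarrow> h x * cnj (g x)"
      by (intro AE_I2 tendsto_intros Jlim)
    show "AE x in lborel. norm (h x * cnj (J n x)) \<le> B * cmod (h x)" for n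
      using Jb by (intro AE_I2) (auto simp: norm_mult mult.commute[of B] intro!: mult_left_mono)
  qed auto
  moreover have "(LINT k|lborel. cft h k * (cnj (cft g k) * gauss (1 / real (Suc n)) k)) = (LINT x|lborel. h x * cnj (J n x))" for n
    unfolding J_def by (rule gauss_Parseval[OF h g]) simp
  ultimately show ?thesis by simp
qed

lemma gauss_tendsto_1: "(\<lambda>n. gauss (1 / real (Suc n)) k) \<longlonglongrightarrow> 1"
proof -
  have "(\<lambda>n. exp (- (1 / real (Suc n) * k)\<^sup>2 / 2)) \<longlonglongrightarrow> exp (- (0 * k)\<^sup>2 / 2)"
    by (intro tendsto_intros LIMSEQ_inverse_real_of_nat[unfolded inverse_eq_divide])
      (auto)
  then show ?thesis by (simp add: gauss_def)
qed

text \<open>Square integrability of the transform is not known beforehand. With \<open>g = h\<close>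
  the regularised Parseval identity shows that the squares weighted by the Gaussian have bounded
  integrals, and Fatou's lemma removes the weight.\<close>

lemma Cc_cft_L2C:
  assumes h: "h \<in> Cc" shows "cft h \<in> L2C"
proof -
  note [measurable] = Cc_measurable[OF h]
  have lim: "(\<lambda>n. LINT k|lborel. cft h k * (cnj (cft h k) * gauss (1 / real (Suc n)) k)) \<longlonglongrightarrow> (LINT x|lborel. h x * cnj (h x))"
    by (rule gauss_Parseval_limit[OF h h])
  \<comment> \<open>The square root makes the square of \<open>f n\<close> equal to the integrand of
    the regularised identity.\<close>
  define f where "f n k = cft h k * complex_of_real (sqrt (gauss (1 / real (Suc n)) k))" for n k
  have fm [measurable]: "f n \<in> borel_measurable borel" for n unfolding f_def by measurable
  have fL: "f n \<in> L2C" for n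
  proof -
    have "integrable lborel (\<lambda>k. (cmod (f n k))\<^sup>2)"
    proof (rule Bochner_Integration.integrable_bound[OF integrable_mult_right[OF integrable_gauss[of "1 / real (Suc n)"], of "of_real ((LINT x|lborel. cmod (h x))\<^sup>2)"]])
      show "AE k in lborel. norm ((cmod (f n k))\<^sup>2) \<le> norm (complex_of_real ((LINT x|lborel. cmod (h x))\<^sup>2) * complex_of_real (gauss (1 / real (Suc n)) k))"
      proof (intro AE_I2)
        fix k
        have "(cmod (cft h k))\<^sup>2 \<le> (LINT x|lborel. cmod (h x))\<^sup>2"
          by (intro power_mono cft_bound Cc_integrable[OF h]) auto
        from mult_right_mono[OF this less_imp_le[OF gauss_pos[of "1 / real (Suc n)" k]]]
        show "norm ((cmod (f n k))\<^sup>2) \<le> norm (complex_of_real ((LINT x|lborel. cmod (h x))\<^sup>2) * complex_of_real (gauss (1 / real (Suc n)) k))"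
          using gauss_pos[THEN less_imp_le] by (simp add: f_def norm_mult power_mult_distrib norm_power)
      qed
    qed auto
    then show ?thesis by (simp add: L2C_iff)
  qed
  have "complex_of_real (enn2real (sqn (f n))) = (LINT k|lborel. cft h k * (cnj (cft h k) * gauss (1 / real (Suc n)) k))" for n
    unfolding sqn_eq_integral_cnj[OF fL]
    using gauss_pos[THEN less_imp_le] by (intro Bochner_Integration.integral_cong refl) (simp add: f_def mult_ac flip: of_real_mult)
  with lim have "(\<lambda>n. complex_of_real (enn2real (sqn (f n)))) \<longlonglongrightarrow> complex_of_real (enn2real (sqn h))"
    by (simp add: sqn_eq_integral_cnj Cc_L2C h)
  then have "(\<lambda>n. enn2real (sqn (f n))) \<longlonglongrightarrow> enn2real (sqn h)" by (simp only: tendsto_of_real_iff)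
  \<comment> \<open>Only finiteness is at stake, so the limit is bounded crudely by adding
    1.\<close>
  then have "eventually (\<lambda>n. enn2real (sqn (f n)) < enn2real (sqn h) + 1) sequentially"
    by (rule order_tendstoD) simp
  then have ev: "eventually (\<lambda>n. sqn (f n) \<le> ennreal (enn2real (sqn h) + 1)) sequentially"
  proof eventually_elim
    case (elim n)
    have "sqn (f n) = ennreal (enn2real (sqn (f n)))" using L2C_finite[OF fL[of n]] by simp
    also have "\<dots> \<le> ennreal (enn2real (sqn h) + 1)" using elim by (intro ennreal_leI) simp
    finally show ?case .
  qed
  have "sqn (cft h) \<le> ennreal (enn2real (sqn h) + 1)"
  proof (rule sqn_Fatou_bound[OF fm _ ev])
    have "(\<lambda>n. f n k) \<longlonglongrightarrow> cft h k * complex_of_real (sqrt 1)" for k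
      unfolding f_def by (intro tendsto_intros gauss_tendsto_1)
    then show "AE k in lborel. (\<lambda>n. f n k) \<longlonglongrightarrow> cft h k" by simp
  qed
  then show ?thesis by (auto simp: L2C_def intro: le_less_trans)
qed

text \<open>Now that the product of the transforms is known to be integrable, it dominates its
  Gaussian-weighted versions, and the regularisation can be removed on both sides.\<close>

lemma Cc_Parseval:
  assumes h: "h \<in> Cc" and g: "g \<in> Cc"
  shows "(LINT k|lborel. cft h k * cnj (cft g k)) = (LINT x|lborel. h x * cnj (g x))"
proof (rule LIMSEQ_unique[OF _ gauss_Parseval_limit[OF h g]])
  note [measurable] = Cc_measurable[OF h] Cc_measurable[OF g]
  have i: "integrable lborel (\<lambda>k. cft h k * cnj (cft g k))"
    by (intro L2C_integrable_mult L2C_cnj Cc_cft_L2C h g)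
  show "(\<lambda>n. LINT k|lborel. cft h k * (cnj (cft g k) * gauss (1 / real (Suc n)) k)) \<longlonglongrightarrow> (LINT k|lborel. cft h k * cnj (cft g k))"
  proof (rule integral_dominated_convergence[where w="\<lambda>k. cmod (cft h k * cnj (cft g k))"])
    have "(\<lambda>n. cft h k * (cnj (cft g k) * gauss (1 / real (Suc n)) k)) \<longlonglongrightarrow> cft h k * (cnj (cft g k) * of_real 1)" for k
      by (intro tendsto_intros gauss_tendsto_1)
    then show "AE k in lborel. (\<lambda>n. cft h k * (cnj (cft g k) * gauss (1 / real (Suc n)) k)) \<longlonglongrightarrow> cft h k * cnj (cft g k)" by simp
    show "AE k in lborel. norm (cft h k * (cnj (cft g k) * complex_of_real (gauss (1 / real (Suc n)) k))) \<le> cmod (cft h k * cnj (cft g k))" for n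
      using gauss_pos[THEN less_imp_le] gauss_le_1
      by (intro AE_I2) (auto simp: norm_mult mult.assoc[symmetric] intro!: mult_left_le)
  qed (use i in auto)
qed

text \<open>Lebesgue measurability supplies continuous functions converging off a negligible set;
  cutting them off in space and in size makes them dominated, so one sequence converges both in L2
  and in L1.\<close>

lemma Cc_approx_bounded:
  assumes hm: "h \<in> borel_measurable borel" and hb: "\<And>x. cmod (h x) \<le> B" and hs: "\<And>x. \<bar>x\<bar> > R \<Longrightarrow> h x = 0" and e: "e > 0"
  shows "\<exists>c\<in>Cc. sqn (\<lambda>x. c x - h x) < e \<and> (\<integral>\<^sup>+x. ennreal (cmod (c x - h x)) \<partial>lborel) < e"
proof -
  define B' where "B' = \<bar>B\<bar> + 1"
  have B': "B' > 0" "\<And>x. cmod (h x) \<le> B'" using hb by (auto simp: B'_def intro: order_trans[OF hb])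
  have "h \<in> borel_measurable lebesgue"
    using hm by (simp add: measurable_completion)
  then have "h measurable_on UNIV" by (rule lebesgue_measurable_imp_measurable_on) auto
  then obtain N g where N: "negligible N" and gc: "\<And>n. continuous_on UNIV (g n)" and gl: "\<And>x. x \<notin> N \<Longrightarrow> (\<lambda>n. g n x) \<longlonglongrightarrow> h x"
    unfolding measurable_on_def by auto
  define chi where "chi x = max 0 (min 1 (\<bar>R\<bar> + 1 - \<bar>x\<bar>))" for x :: real
  \<comment> \<open>The quotient is the radial retraction onto the disc of radius \<open>B'\<close>.
    It is continuous and fixes the values of \<open>h\<close>, as does \<open>chi\<close> on the
    support of \<open>h\<close>, so the limit is unchanged.\<close>
  define c where "c n x = (chi x * (B' / max B' (cmod (g n x)))) *\<^sub>R g n x" for n x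
  have chi: "0 \<le> chi x" "chi x \<le> 1" "\<bar>x\<bar> > \<bar>R\<bar> + 1 \<Longrightarrow> chi x = 0" "\<bar>x\<bar> \<le> R \<Longrightarrow> chi x = 1" for x
    by (auto simp: chi_def)
  have cb: "cmod (c n x) \<le> B'" for n x
  proof -
    have "B' * cmod (g n x) / max B' (cmod (g n x)) \<le> B'"
      using B'(1) by (simp add: field_simps max_def)
    then have "chi x * (B' * cmod (g n x) / max B' (cmod (g n x))) \<le> 1 * B'"
      using chi[of x] B'(1) by (intro mult_mono) auto
    then show ?thesis using chi[of x] B'(1) by (simp add: c_def abs_mult)
  qed
  have cC: "c n \<in> Cc" for n
    unfolding Cc_def
  proof (safe intro!: exI[of _ "\<bar>R\<bar> + 1"])
    show "continuous_on UNIV (c n)"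
      unfolding c_def chi_def using B'(1) gc[of n] by (intro continuous_intros) auto
    show "c n x = 0" if "\<bar>x\<bar> > \<bar>R\<bar> + 1" for x using chi(3)[OF that] by (simp add: c_def)
  qed
  have cl: "(\<lambda>n. c n x) \<longlonglongrightarrow> h x" if "x \<notin> N" for x
  proof -
    have "(\<lambda>n. c n x) \<longlonglongrightarrow> (chi x * (B' / max B' (cmod (h x)))) *\<^sub>R h x"
      unfolding c_def using B'(1) gl[OF that] by (intro tendsto_intros) auto
    moreover have "(chi x * (B' / max B' (cmod (h x)))) *\<^sub>R h x = h x"
      using B'(1) B'(2)[of x] hs[of x] chi(4)[of x] by (cases "\<bar>x\<bar> \<le> R") (auto simp: max_absorb1)
    ultimately show ?thesis by simp
  qed
  have AE: "AE x in lborel. (\<lambda>n. c n x) \<longlonglongrightarrow> h x"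
  proof -
    have "AE x in lebesgue. x \<notin> N" using N by (simp add: negligible_iff_null_sets AE_not_in)
    then have "AE x in lborel. x \<notin> N" by (simp add: AE_completion_iff)
    then show ?thesis by eventually_elim (rule cl)
  qed
  define w where "w x = complex_of_real (2 * B' * indicator {-(\<bar>R\<bar>+1)..\<bar>R\<bar>+1} x)" for x :: real
  have "w \<in> borel_measurable borel" unfolding w_def by measurable
  then have w: "w \<in> borel_measurable borel" "\<And>x. cmod (w x) \<le> 2 * B'" "\<And>x. \<bar>x\<bar> > \<bar>R\<bar>+1 \<Longrightarrow> w x = 0"
    using B' by (auto simp: w_def indicator_def)
  have dw: "cmod (c n x - h x) \<le> cmod (w x)" for n x
  proof (cases "\<bar>x\<bar> > \<bar>R\<bar> + 1")
    case True then show ?thesis using chi(3)[OF True] hs[of x] by (simp add: c_def)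
  next
    case False
    have "cmod (c n x - h x) \<le> B' + B'" by (rule norm_triangle_le_diff) (use cb B' add_mono in blast)
    moreover have "x \<in> {-(\<bar>R\<bar>+1)..\<bar>R\<bar>+1}" using False by auto
    ultimately show ?thesis using B'(1) by (simp add: w_def)
  qed
  note [measurable] = hm Cc_measurable[OF cC] w(1)
  have "(\<lambda>n. sqn (\<lambda>x. c n x - h x)) \<longlonglongrightarrow> 0"
  proof (rule sqn_dominated[of _ w])
    show "AE x in lborel. (\<lambda>n. c n x - h x) \<longlonglongrightarrow> 0" using AE by eventually_elim (simp add: LIM_zero)
  qed (use dw w in \<open>auto intro!: bounded_support_L2C\<close>)
  then have 1: "eventually (\<lambda>n. sqn (\<lambda>x. c n x - h x) < e) sequentially" using e by (rule order_tendstoD)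
  have "(\<lambda>n. \<integral>\<^sup>+x. ennreal (cmod (h x - c n x)) \<partial>lborel) \<longlonglongrightarrow> 0"
  proof (rule nn_integral_dominated_convergence_norm[where w="\<lambda>x. B' * indicator {-(\<bar>R\<bar>+1)..\<bar>R\<bar>+1} x"])
    show "AE x in lborel. cmod (c n x) \<le> B' * indicator {-(\<bar>R\<bar>+1)..\<bar>R\<bar>+1} x" for n
      using cb[of n] chi(3) by (intro AE_I2) (force simp: indicator_def c_def)
    have "integrable lborel (\<lambda>x. B' * indicator {-(\<bar>R\<bar>+1)..\<bar>R\<bar>+1} x)"
      by (intro integrable_mult_right integrable_real_indicator) (auto simp: emeasure_lborel_Icc_eq)
    from integrableD(2)[OF this] show "(\<integral>\<^sup>+x. ennreal (B' * indicator {-(\<bar>R\<bar>+1)..\<bar>R\<bar>+1} x) \<partial>lborel) < \<infinity>"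
      using B' by (simp add: abs_mult top.not_eq_extremum)
  qed (use AE in auto)
  then have 2: "eventually (\<lambda>n. (\<integral>\<^sup>+x. ennreal (cmod (h x - c n x)) \<partial>lborel) < e) sequentially" using e by (rule order_tendstoD)
  from eventually_conj[OF 1 2] obtain n where "sqn (\<lambda>x. c n x - h x) < e" "(\<integral>\<^sup>+x. ennreal (cmod (h x - c n x)) \<partial>lborel) < e"
    by (auto simp: eventually_sequentially)
  then show ?thesis using cC[of n] by (auto simp: norm_minus_commute)
qed

text \<open>Truncation in space and size reduces to the bounded case. The approximant is the same
  for both norms because \<open>FT_L1\<close> compares the L2 extension with the integral along one
  sequence.\<close>

lemma Cc_dense:
  assumes h: "h \<in> L2C" and e: "e > 0"
  shows "\<exists>c\<in>Cc. sqn (\<lambda>x. c x - h x) < e \<and> (integrable lborel h \<longrightarrow> (\<integral>\<^sup>+x. ennreal (cmod (c x - h x)) \<partial>lborel) < e)"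
proof -
  \<comment> \<open>The squared triangle inequality turns two errors below \<open>e'\<close> into
    one below \<open>4 * e'\<close>; the case of infinite \<open>e\<close> is separate because
    \<open>e\<close> ranges over \<open>ennreal\<close>.\<close>
  obtain e' :: ennreal where e': "e' > 0" "4 * e' \<le> e" 
  proof (cases "e = \<infinity>")
    case True then show ?thesis using that[of 1] by auto
  next
    case False
    then obtain r where "e = ennreal r" "r > 0" using e by (cases e) (auto simp: ennreal_less_zero_iff)
    then show ?thesis by (intro that[of "ennreal (r / 4)"]) (auto simp: ennreal_mult[symmetric] simp flip: ennreal_numeral)
  qed
  have hm [measurable]: "h \<in> borel_measurable borel" using h by (simp add: L2C_def)
  define t where "t n x = (if \<bar>x\<bar> \<le> real n \<and> cmod (h x) \<le> real n then h x else 0)" for n x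
  have tm [measurable]: "t n \<in> borel_measurable borel" for n unfolding t_def by measurable
  have tl: "(\<lambda>n. t n x) \<longlonglongrightarrow> h x" for x
  proof (rule tendsto_eventually)
    obtain m where "max \<bar>x\<bar> (cmod (h x)) \<le> real m" using real_arch_simple by blast
    then show "eventually (\<lambda>n. t n x = h x) sequentially"
      by (auto simp: eventually_sequentially t_def intro!: exI[of _ m])
  qed
  have tb: "cmod (t n x) \<le> cmod (h x)" "cmod (t n x - h x) \<le> cmod (h x)" for n x by (auto simp: t_def)
  have "(\<lambda>n. sqn (\<lambda>x. t n x - h x)) \<longlonglongrightarrow> 0"
    using tb tl by (intro sqn_dominated[OF _ h]) (auto simp: LIM_zero)
  then have 1: "eventually (\<lambda>n. sqn (\<lambda>x. t n x - h x) < e') sequentially" using e'(1) by (rule order_tendstoD)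
  have 2: "eventually (\<lambda>n. integrable lborel h \<longrightarrow> (\<integral>\<^sup>+x. ennreal (cmod (h x - t n x)) \<partial>lborel) < e') sequentially"
  proof (cases "integrable lborel h")
    case True
    have "(\<lambda>n. \<integral>\<^sup>+x. ennreal (cmod (h x - t n x)) \<partial>lborel) \<longlonglongrightarrow> 0"
      by (rule nn_integral_dominated_convergence_norm[where w="\<lambda>x. cmod (h x)"])
        (use tb tl True in \<open>auto simp: integrable_iff_bounded\<close>)
    then have "eventually (\<lambda>n. (\<integral>\<^sup>+x. ennreal (cmod (h x - t n x)) \<partial>lborel) < e') sequentially" using e'(1) by (rule order_tendstoD)
    then show ?thesis by eventually_elim simp
  qed simp
  from eventually_conj[OF 1 2] obtain n where n: "sqn (\<lambda>x. t n x - h x) < e'" "integrable lborel h \<Longrightarrow> (\<integral>\<^sup>+x. ennreal (cmod (h x - t n x)) \<partial>lborel) < e'"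
    by (auto simp: eventually_sequentially)
  obtain c where c: "c \<in> Cc" "sqn (\<lambda>x. c x - t n x) < e'" "(\<integral>\<^sup>+x. ennreal (cmod (c x - t n x)) \<partial>lborel) < e'"
  proof -
    have "cmod (t n x) \<le> real n" "\<bar>x\<bar> > real n \<Longrightarrow> t n x = 0" for x by (auto simp: t_def)
    from Cc_approx_bounded[OF tm this e'(1)] show ?thesis using that by blast
  qed
  note [measurable] = Cc_measurable[OF c(1)]
  have four: "2 * e' + 2 * e' = 4 * e'" by (simp flip: distrib_right)
  have "sqn (\<lambda>x. c x - h x) \<le> 2 * sqn (\<lambda>x. c x - t n x) + 2 * sqn (\<lambda>x. t n x - h x)" by (rule sqn_diff_triangle) auto
  also have "\<dots> < 2 * e' + 2 * e'" using c(2) n(1)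
    by (intro add_strict_mono ennreal_mult_strict_left_mono) auto
  also have "\<dots> \<le> e" using e'(2) four by simp
  finally have s: "sqn (\<lambda>x. c x - h x) < e" .
  have "(\<integral>\<^sup>+x. ennreal (cmod (c x - h x)) \<partial>lborel) < e" if "integrable lborel h"
  proof -
    have "(\<integral>\<^sup>+x. ennreal (cmod (c x - h x)) \<partial>lborel) \<le> (\<integral>\<^sup>+x. ennreal (cmod (c x - t n x)) + ennreal (cmod (h x - t n x)) \<partial>lborel)"
      by (intro nn_integral_mono) (metis ennreal_leI ennreal_plus norm_ge_zero norm_minus_commute norm_diff_triangle_ineq norm_diff_triangle_le order_refl)
    also have "\<dots> = (\<integral>\<^sup>+x. ennreal (cmod (c x - t n x)) \<partial>lborel) + (\<integral>\<^sup>+x. ennreal (cmod (h x - t n x)) \<partial>lborel)"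
      by (rule nn_integral_add) auto
    also have "\<dots> < e' + e'" using c(3) n(2)[OF that] by (rule add_strict_mono)
    also have "\<dots> \<le> 2 * e' + 2 * e'" by (simp add: mult_2 add_mono add_increasing)
    also have "\<dots> \<le> e" using e'(2) four by simp
    finally show ?thesis .
  qed
  with s c(1) show ?thesis by auto
qed

section \<open>The Fourier transform on square integrable functions\<close>

lemma cft_add: "integrable lborel f \<Longrightarrow> integrable lborel g \<Longrightarrow> cft (\<lambda>x. f x + g x) k = cft f k + cft g k"
  unfolding cft_def distrib_right distrib_left[symmetric]
  by (rule arg_cong2[where f="(*)", OF refl], rule Bochner_Integration.integral_add) (rule integrable_mult_exp, assumption)+

lemma cft_diff: "integrable lborel f \<Longrightarrow> integrable lborel g \<Longrightarrow> cft (\<lambda>x. f x - g x) k = cft f k - cft g k"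
  unfolding cft_def left_diff_distrib right_diff_distrib[symmetric]
  by (rule arg_cong2[where f="(*)", OF refl], rule Bochner_Integration.integral_diff) (rule integrable_mult_exp, assumption)+

lemma cft_cmult: "cft (\<lambda>x. c * f x) k = c * cft f k"
  unfolding cft_def mult.assoc by (subst integral_mult_right_zero) (simp add: mult_ac)

lemma sqn_cft_Cc:
  assumes "c \<in> Cc" shows "sqn (cft c) = sqn c"
proof -
  have "complex_of_real (enn2real (sqn (cft c))) = complex_of_real (enn2real (sqn c))"
    unfolding sqn_eq_integral_cnj[OF Cc_L2C[OF assms]] sqn_eq_integral_cnj[OF Cc_cft_L2C[OF assms]]
    by (rule Cc_Parseval[OF assms assms])
  then have "enn2real (sqn (cft c)) = enn2real (sqn c)" by (simp only: of_real_eq_iff)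
  then show ?thesis using L2C_finite[OF Cc_L2C[OF assms]] L2C_finite[OF Cc_cft_L2C[OF assms]]
    by (cases "sqn c"; cases "sqn (cft c)") auto
qed

lemma sqn_cft_diff_Cc: "c \<in> Cc \<Longrightarrow> d \<in> Cc \<Longrightarrow> sqn (\<lambda>k. cft c k - cft d k) = sqn (\<lambda>x. c x - d x)"
  using sqn_cft_Cc[OF Cc_diff, of c d] ext[of "cft (\<lambda>x. c x - d x)" "\<lambda>k. cft c k - cft d k", OF cft_diff]
  by (simp add: Cc_integrable)

text \<open>A relation and not a function: the transform on L2 is determined only up to null sets,
  and the relation allows a convenient representative to be named on either side.
  \<open>FT_cong\<close> changes representatives.\<close>

definition FT :: "(real \<Rightarrow> complex) \<Rightarrow> (real \<Rightarrow> complex) \<Rightarrow> bool" where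
  "FT h F \<longleftrightarrow> h \<in> L2C \<and> F \<in> L2C \<and>
     (\<exists>c. (\<forall>n. c n \<in> Cc) \<and> (\<lambda>n. sqn (\<lambda>x. c n x - h x)) \<longlonglongrightarrow> 0 \<and> (\<lambda>n. sqn (\<lambda>k. cft (c n) k - F k)) \<longlonglongrightarrow> 0)"

lemma FT_L2C: "FT h F \<Longrightarrow> h \<in> L2C" "FT h F \<Longrightarrow> F \<in> L2C"
  by (auto simp: FT_def)

lemma FT_measurable: "FT h F \<Longrightarrow> h \<in> borel_measurable borel" "FT h F \<Longrightarrow> F \<in> borel_measurable borel"
  by (auto simp: FT_def L2C_def)

lemma FT_E:
  assumes "FT h F"
  obtains c where "\<And>n. c n \<in> Cc" "(\<lambda>n. sqn (\<lambda>x. c n x - h x)) \<longlonglongrightarrow> 0" "(\<lambda>n. sqn (\<lambda>k. cft (c n) k - F k)) \<longlonglongrightarrow> 0"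
  using assms unfolding FT_def by blast

lemma FT_I:
  assumes "h \<in> L2C" "F \<in> L2C" "\<And>n. c n \<in> Cc" "(\<lambda>n. sqn (\<lambda>x. c n x - h x)) \<longlonglongrightarrow> 0" "(\<lambda>n. sqn (\<lambda>k. cft (c n) k - F k)) \<longlonglongrightarrow> 0"
  shows "FT h F"
  using assms unfolding FT_def by blast

lemma FT_Cc: "c \<in> Cc \<Longrightarrow> FT c (cft c)"
  by (rule FT_I[where c="\<lambda>_. c"]) (auto simp: Cc_L2C Cc_cft_L2C sqn_def)

text \<open>Approximants are chosen at the rate \<open>4 ^ n\<close> demanded by
  \<open>L2C_complete\<close>; the isometry on \<open>Cc\<close> carries the Cauchy bound to their
  transforms.\<close>

lemma FT_exists:
  assumes h: "h \<in> L2C" obtains F where "FT h F"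
proof -
  have "\<exists>c. c \<in> Cc \<and> sqn (\<lambda>x. c x - h x) < ennreal (1 / 4 ^ n)" for n
    using Cc_dense[OF h, of "ennreal (1 / 4 ^ n)"] by auto
  then obtain c where c: "\<And>n. c n \<in> Cc" "\<And>n. sqn (\<lambda>x. c n x - h x) < ennreal (1 / 4 ^ n)" by metis
  note [measurable] = Cc_measurable[OF c(1)] L2C_measurable[OF h]
  have b: "sqn (\<lambda>x. cft (c k) x - cft (c n) x) \<le> ennreal (4 / 4 ^ n)" if "n \<le> k" for n k
  proof -
    have "sqn (\<lambda>x. cft (c k) x - cft (c n) x) = sqn (\<lambda>x. c k x - c n x)" using c by (simp add: sqn_cft_diff_Cc)
    also have "\<dots> \<le> 2 * sqn (\<lambda>x. c k x - h x) + 2 * sqn (\<lambda>x. h x - c n x)"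
      by (rule sqn_diff_triangle) auto
    also have "\<dots> \<le> 2 * ennreal (1 / 4 ^ k) + 2 * ennreal (1 / 4 ^ n)"
      using c(2)[of k] c(2)[of n] by (intro add_mono mult_left_mono) (auto simp: sqn_diff_commute[of h])
    also have "\<dots> \<le> 2 * ennreal (1 / 4 ^ n) + 2 * ennreal (1 / 4 ^ n)"
      using that by (intro add_mono mult_left_mono ennreal_leI) (auto simp: field_simps power_increasing)
    also have "\<dots> = ennreal (4 / 4 ^ n)"
      by (simp add: ennreal_mult[symmetric] ennreal_plus[symmetric] del: ennreal_plus flip: ennreal_numeral)
    finally show ?thesis .
  qed
  obtain F where F: "F \<in> L2C" "(\<lambda>n. sqn (\<lambda>x. cft (c n) x - F x)) \<longlonglongrightarrow> 0"
    using L2C_complete[of "\<lambda>n. cft (c n)" 4] b c Cc_cft_L2C by auto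
  have "(\<lambda>n. sqn (\<lambda>x. c n x - h x)) \<longlonglongrightarrow> 0"
  proof (rule tendsto_sandwich[of "\<lambda>_. 0" _ _ "\<lambda>n. ennreal (1 / 4 ^ n)"])
    have "(\<lambda>n. (1/4) ^ n :: real) \<longlonglongrightarrow> 0" by (intro LIMSEQ_realpow_zero) auto
    then have "(\<lambda>n. ennreal (1 / 4^n)) \<longlonglongrightarrow> ennreal 0"
      by (intro tendsto_ennrealI) (simp add: power_one_over)
    then show "(\<lambda>n. ennreal (1 / 4^n)) \<longlonglongrightarrow> 0" by simp
  qed (use c(2) in \<open>auto intro!: always_eventually less_imp_le\<close>)
  with F c(1) h show ?thesis by (intro that FT_I) auto
qed

lemma sqn_cnj: "sqn (\<lambda>x. cnj (f x) - cnj (g x)) = sqn (\<lambda>x. f x - g x)"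
  unfolding sqn_def complex_cnj_diff[symmetric] complex_mod_cnj ..

lemma FT_Parseval:
  assumes "FT h F" "FT g G"
  shows "(LINT k|lborel. F k * cnj (G k)) = (LINT x|lborel. h x * cnj (g x))"
proof -
  obtain c where c: "\<And>n. c n \<in> Cc" "(\<lambda>n. sqn (\<lambda>x. c n x - h x)) \<longlonglongrightarrow> 0" "(\<lambda>n. sqn (\<lambda>k. cft (c n) k - F k)) \<longlonglongrightarrow> 0"
    using FT_E[OF assms(1)] by blast
  obtain d where d: "\<And>n. d n \<in> Cc" "(\<lambda>n. sqn (\<lambda>x. d n x - g x)) \<longlonglongrightarrow> 0" "(\<lambda>n. sqn (\<lambda>k. cft (d n) k - G k)) \<longlonglongrightarrow> 0"
    using FT_E[OF assms(2)] by blast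
  have "(\<lambda>n. LINT k|lborel. cft (c n) k * cnj (cft (d n) k)) \<longlonglongrightarrow> (LINT k|lborel. F k * cnj (G k))"
    by (rule L2C_tendsto_integral) (use c d FT_L2C[OF assms(1)] FT_L2C[OF assms(2)] in \<open>auto simp: sqn_cnj intro!: L2C_cnj intro: Cc_cft_L2C\<close>)
  moreover have "(\<lambda>n. LINT x|lborel. c n x * cnj (d n x)) \<longlonglongrightarrow> (LINT x|lborel. h x * cnj (g x))"
    by (rule L2C_tendsto_integral) (use c d FT_L2C[OF assms(1)] FT_L2C[OF assms(2)] in \<open>auto simp: sqn_cnj intro!: L2C_cnj intro: Cc_L2C\<close>)
  ultimately show ?thesis using c d by (simp add: Cc_Parseval LIMSEQ_unique)
qed

lemma FT_multiplication:
  assumes "FT h F" "FT g G"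
  shows "(LINT k|lborel. F k * g k) = (LINT x|lborel. h x * G x)"
proof -
  obtain c where c: "\<And>n. c n \<in> Cc" "(\<lambda>n. sqn (\<lambda>x. c n x - h x)) \<longlonglongrightarrow> 0" "(\<lambda>n. sqn (\<lambda>k. cft (c n) k - F k)) \<longlonglongrightarrow> 0"
    using FT_E[OF assms(1)] by blast
  obtain d where d: "\<And>n. d n \<in> Cc" "(\<lambda>n. sqn (\<lambda>x. d n x - g x)) \<longlonglongrightarrow> 0" "(\<lambda>n. sqn (\<lambda>k. cft (d n) k - G k)) \<longlonglongrightarrow> 0"
    using FT_E[OF assms(2)] by blast
  have "(\<lambda>n. LINT k|lborel. cft (c n) k * d n k) \<longlonglongrightarrow> (LINT k|lborel. F k * g k)"
    by (rule L2C_tendsto_integral) (use c d FT_L2C[OF assms(1)] FT_L2C[OF assms(2)] in \<open>auto intro: Cc_cft_L2C Cc_L2C\<close>)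
  moreover have "(\<lambda>n. LINT x|lborel. c n x * cft (d n) x) \<longlonglongrightarrow> (LINT x|lborel. h x * G x)"
    by (rule L2C_tendsto_integral) (use c d FT_L2C[OF assms(1)] FT_L2C[OF assms(2)] in \<open>auto intro: Cc_cft_L2C Cc_L2C\<close>)
  ultimately show ?thesis using c d by (simp add: cft_multiplication Cc_integrable LIMSEQ_unique)
qed

lemma FT_isometry: assumes "FT h F" shows "sqn F = sqn h"
proof -
  have "enn2real (sqn F) = enn2real (sqn h)"
    using FT_Parseval[OF assms assms] FT_L2C[OF assms] by (simp add: sqn_eq_integral_cnj[symmetric])
  then show ?thesis using L2C_finite[OF FT_L2C(1)[OF assms]] L2C_finite[OF FT_L2C(2)[OF assms]]
    by (cases "sqn F"; cases "sqn h") auto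
qed

lemma tendsto_ennreal_0_le:
  fixes a b :: "nat \<Rightarrow> ennreal"
  assumes "\<And>n. a n \<le> b n" "b \<longlonglongrightarrow> 0" shows "a \<longlonglongrightarrow> 0"
  by (rule tendsto_sandwich[of "\<lambda>_. 0" _ _ b]) (use assms in \<open>auto intro!: always_eventually\<close>)

lemma FT_add:
  assumes "FT h F" "FT g G" shows "FT (\<lambda>x. h x + g x) (\<lambda>k. F k + G k)"
proof -
  obtain c where c: "\<And>n. c n \<in> Cc" "(\<lambda>n. sqn (\<lambda>x. c n x - h x)) \<longlonglongrightarrow> 0" "(\<lambda>n. sqn (\<lambda>k. cft (c n) k - F k)) \<longlonglongrightarrow> 0"
    using FT_E[OF assms(1)] by blast
  obtain d where d: "\<And>n. d n \<in> Cc" "(\<lambda>n. sqn (\<lambda>x. d n x - g x)) \<longlonglongrightarrow> 0" "(\<lambda>n. sqn (\<lambda>k. cft (d n) k - G k)) \<longlonglongrightarrow> 0"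
    using FT_E[OF assms(2)] by blast
  note [measurable] = FT_measurable[OF assms(1)] FT_measurable[OF assms(2)] Cc_measurable[OF c(1)] Cc_measurable[OF d(1)]
  have lim: "(\<lambda>n. 2 * a n + 2 * b n) \<longlonglongrightarrow> 0" if "a \<longlonglongrightarrow> 0" "b \<longlonglongrightarrow> 0" for a b :: "nat \<Rightarrow> ennreal"
    using tendsto_add[OF tendsto_mult_ennreal_0(2)[OF that(1), of 2] tendsto_mult_ennreal_0(2)[OF that(2), of 2]] by simp
  show ?thesis
  proof (rule FT_I[where c="\<lambda>n x. c n x + d n x"])
    show "(\<lambda>n. sqn (\<lambda>x. c n x + d n x - (h x + g x))) \<longlonglongrightarrow> 0"
    proof (rule tendsto_ennreal_0_le[OF _ lim[OF c(2) d(2)]])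
      show "sqn (\<lambda>x. c n x + d n x - (h x + g x)) \<le> 2 * sqn (\<lambda>x. c n x - h x) + 2 * sqn (\<lambda>x. d n x - g x)" for n
        using sqn_add_le[of "\<lambda>x. c n x - h x" "\<lambda>x. d n x - g x"] by (simp add: algebra_simps)
    qed
    show "(\<lambda>n. sqn (\<lambda>x. cft (\<lambda>x. c n x + d n x) x - (F x + G x))) \<longlonglongrightarrow> 0"
    proof (rule tendsto_ennreal_0_le[OF _ lim[OF c(3) d(3)]])
      show "sqn (\<lambda>x. cft (\<lambda>x. c n x + d n x) x - (F x + G x)) \<le> 2 * sqn (\<lambda>x. cft (c n) x - F x) + 2 * sqn (\<lambda>x. cft (d n) x - G x)" for n
        using sqn_add_le[of "\<lambda>x. cft (c n) x - F x" "\<lambda>x. cft (d n) x - G x"] c(1) d(1) by (simp add: cft_add Cc_integrable algebra_simps)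
    qed
  qed (use c d FT_L2C[OF assms(1)] FT_L2C[OF assms(2)] in \<open>auto intro!: L2C_add Cc_add\<close>)
qed

lemma FT_cmult:
  assumes "FT h F" shows "FT (\<lambda>x. a * h x) (\<lambda>k. a * F k)"
proof -
  obtain c where c: "\<And>n. c n \<in> Cc" "(\<lambda>n. sqn (\<lambda>x. c n x - h x)) \<longlonglongrightarrow> 0" "(\<lambda>n. sqn (\<lambda>k. cft (c n) k - F k)) \<longlonglongrightarrow> 0"
    using FT_E[OF assms(1)] by blast
  note [measurable] = FT_measurable[OF assms(1)] Cc_measurable[OF c(1)]
  show ?thesis
  proof (rule FT_I[where c="\<lambda>n x. a * c n x"])
    show "(\<lambda>n. sqn (\<lambda>x. a * c n x - a * h x)) \<longlonglongrightarrow> 0"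
      using tendsto_mult_ennreal_0(2)[OF c(2), of "ennreal ((cmod a)\<^sup>2)"] by (simp add: right_diff_distrib[symmetric] sqn_cmult)
    show "(\<lambda>n. sqn (\<lambda>x. cft (\<lambda>x. a * c n x) x - a * F x)) \<longlonglongrightarrow> 0"
      using tendsto_mult_ennreal_0(2)[OF c(3), of "ennreal ((cmod a)\<^sup>2)"] by (simp add: cft_cmult right_diff_distrib[symmetric] sqn_cmult)
  qed (use c FT_L2C[OF assms] in \<open>auto intro!: L2C_cmult Cc_cmult\<close>)
qed

lemma FT_diff: "FT h F \<Longrightarrow> FT g G \<Longrightarrow> FT (\<lambda>x. h x - g x) (\<lambda>k. F k - G k)"
  using FT_add[of h F "\<lambda>x. -1 * g x" "\<lambda>k. -1 * G k"] FT_cmult[of g G "-1"] by simp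

lemma FT_cnj:
  assumes "FT h F" shows "FT (\<lambda>x. cnj (h x)) (\<lambda>k. cnj (F (- k)))"
proof -
  obtain c where c: "\<And>n. c n \<in> Cc" "(\<lambda>n. sqn (\<lambda>x. c n x - h x)) \<longlonglongrightarrow> 0" "(\<lambda>n. sqn (\<lambda>k. cft (c n) k - F k)) \<longlonglongrightarrow> 0"
    using FT_E[OF assms(1)] by blast
  note [measurable] = FT_measurable[OF assms(1)] Cc_measurable[OF c(1)]
  show ?thesis
  proof (rule FT_I[where c="\<lambda>n x. cnj (c n x)"])
    show "(\<lambda>n. sqn (\<lambda>x. cnj (c n x) - cnj (h x))) \<longlonglongrightarrow> 0" using c by (simp add: sqn_cnj)
    show "(\<lambda>n. sqn (\<lambda>x. cft (\<lambda>x. cnj (c n x)) x - cnj (F (- x)))) \<longlonglongrightarrow> 0"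
      using c(3) sqn_reflect[of "\<lambda>k. cft (c n) k - F k" for n] by (simp add: cft_cnj sqn_cnj)
  qed (use c FT_L2C[OF assms] in \<open>auto intro!: L2C_cnj L2C_reflect Cc_cnj\<close>)
qed

lemma FT_reflect:
  assumes "FT h F" shows "FT (\<lambda>x. h (- x)) (\<lambda>k. F (- k))"
proof -
  obtain c where c: "\<And>n. c n \<in> Cc" "(\<lambda>n. sqn (\<lambda>x. c n x - h x)) \<longlonglongrightarrow> 0" "(\<lambda>n. sqn (\<lambda>k. cft (c n) k - F k)) \<longlonglongrightarrow> 0"
    using FT_E[OF assms(1)] by blast
  note [measurable] = FT_measurable[OF assms(1)] Cc_measurable[OF c(1)]
  show ?thesis
  proof (rule FT_I[where c="\<lambda>n x. c n (- x)"])
    show "(\<lambda>n. sqn (\<lambda>x. c n (- x) - h (- x))) \<longlonglongrightarrow> 0" using c sqn_reflect[of "\<lambda>k. c n k - h k" for n] by simp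
    show "(\<lambda>n. sqn (\<lambda>x. cft (\<lambda>x. c n (- x)) x - F (- x))) \<longlonglongrightarrow> 0"
      using c(3) sqn_reflect[of "\<lambda>k. cft (c n) k - F k" for n] by (simp add: cft_reflect)
  qed (use c FT_L2C[OF assms] in \<open>auto intro!: L2C_reflect Cc_reflect\<close>)
qed

lemma sqn_translate: "f \<in> borel_measurable borel \<Longrightarrow> sqn (\<lambda>x. f (x - a)) = sqn f"
  unfolding sqn_def using nn_integral_real_affine[of "\<lambda>x. ennreal ((cmod (f x))\<^sup>2)" 1 "- a"] by simp

lemma L2C_translate: "f \<in> L2C \<Longrightarrow> (\<lambda>x. f (x - a)) \<in> L2C"
  by (auto simp: L2C_def sqn_translate)

lemma FT_modulate:
  assumes "FT h F" shows "FT (\<lambda>x. exp (\<i> * complex_of_real (a * x)) * h x) (\<lambda>k. F (k - a))"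
proof -
  obtain c where c: "\<And>n. c n \<in> Cc" "(\<lambda>n. sqn (\<lambda>x. c n x - h x)) \<longlonglongrightarrow> 0" "(\<lambda>n. sqn (\<lambda>k. cft (c n) k - F k)) \<longlonglongrightarrow> 0"
    using FT_E[OF assms(1)] by blast
  note [measurable] = FT_measurable[OF assms(1)] Cc_measurable[OF c(1)]
  let ?e = "\<lambda>x. exp (\<i> * complex_of_real (a * x))"
  show ?thesis
  proof (rule FT_I[where c="\<lambda>n x. ?e x * c n x"])
    have "sqn (\<lambda>x. ?e x * c n x - ?e x * h x) = sqn (\<lambda>x. c n x - h x)" for n
      unfolding sqn_def right_diff_distrib[symmetric] norm_mult norm_exp_ii by simp
    then show "(\<lambda>n. sqn (\<lambda>x. ?e x * c n x - ?e x * h x)) \<longlonglongrightarrow> 0" using c by simp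
    show "(\<lambda>n. sqn (\<lambda>x. cft (\<lambda>x. ?e x * c n x) x - F (x - a))) \<longlonglongrightarrow> 0"
      using c(3) sqn_translate[of "\<lambda>k. cft (c n) k - F k" a for n] by (simp only: cft_modulate) simp
    show "(\<lambda>x. ?e x * c n x) \<in> Cc" for n using c(1)[of n] unfolding Cc_def by (auto intro!: continuous_intros)
    show "(\<lambda>x. ?e x * h x) \<in> L2C" using FT_L2C(1)[OF assms] by (rule L2C_mult_bounded[where B=1]) (auto simp flip: of_real_mult)
  qed (use FT_L2C[OF assms] in \<open>auto intro!: L2C_translate\<close>)
qed

lemma AE_eq_iff_sqn:
  assumes [measurable]: "f \<in> borel_measurable borel" "g \<in> borel_measurable borel"
  shows "(AE x in lborel. f x = g x) \<longleftrightarrow> sqn (\<lambda>x. f x - g x) = 0"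
  by (subst sqn_eq_0_iff) auto

lemma FT_unique_iff:
  assumes "FT h F" "FT g G"
  shows "(AE x in lborel. h x = g x) \<longleftrightarrow> (AE k in lborel. F k = G k)"
  using FT_isometry[OF FT_diff[OF assms]] FT_measurable[OF assms(1)] FT_measurable[OF assms(2)]
  by (simp add: AE_eq_iff_sqn)

lemma FT_unique: "FT h F \<Longrightarrow> FT h F' \<Longrightarrow> AE k in lborel. F k = F' k"
  using FT_unique_iff[of h F h F'] by simp

lemma FT_inj: "FT h F \<Longrightarrow> FT h' F \<Longrightarrow> AE k in lborel. h k = h' k"
  using FT_unique_iff[of h F h' F] by simp

lemma FT_cong:
  assumes F: "FT h F" and g: "g \<in> borel_measurable borel" "AE x in lborel. g x = h x" and G: "G \<in> borel_measurable borel" "AE x in lborel. G x = F x"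
  shows "FT g G"
proof -
  obtain c where c: "\<And>n. c n \<in> Cc" "(\<lambda>n. sqn (\<lambda>x. c n x - h x)) \<longlonglongrightarrow> 0" "(\<lambda>n. sqn (\<lambda>k. cft (c n) k - F k)) \<longlonglongrightarrow> 0"
    using FT_E[OF F] by blast
  have 1: "sqn (\<lambda>x. c n x - g x) = sqn (\<lambda>x. c n x - h x)" for n
    by (rule sqn_cong_AE) (use g(2) in \<open>eventually_elim, simp\<close>)
  have 2: "sqn (\<lambda>x. cft (c n) x - G x) = sqn (\<lambda>x. cft (c n) x - F x)" for n
    by (rule sqn_cong_AE) (use G(2) in \<open>eventually_elim, simp\<close>)
  show ?thesis
    by (rule FT_I[where c=c, OF L2C_cong_AE[OF FT_L2C(1)[OF F] g] L2C_cong_AE[OF FT_L2C(2)[OF F] G] c(1)])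
      (simp_all only: 1 2 c)
qed

text \<open>The transforms need to converge only pointwise: Fatou's lemma bounds the distance of
  \<open>H'\<close> from a true transform of \<open>h'\<close> by the lower limit of the distances
  before the transform, which is zero.\<close>

lemma FT_limit:
  assumes n: "\<And>n. FT (h n) (H n)" and h: "h' \<in> L2C" "(\<lambda>n. sqn (\<lambda>x. h n x - h' x)) \<longlonglongrightarrow> 0"
    and H: "H' \<in> borel_measurable borel" "AE k in lborel. (\<lambda>n. H n k) \<longlonglongrightarrow> H' k"
  shows "FT h' H'"
proof -
  obtain F where F: "FT h' F" using FT_exists[OF h(1)] by blast
  note [measurable] = FT_measurable[OF F] FT_measurable[OF n] H(1)
  have "sqn (\<lambda>k. H' k - F k) \<le> liminf (\<lambda>n. sqn (\<lambda>k. H n k - F k))"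
    by (rule sqn_Fatou) (use H(2) in \<open>auto elim!: eventually_mono intro!: tendsto_intros\<close>)
  also have "\<dots> = liminf (\<lambda>n. sqn (\<lambda>x. h n x - h' x))"
    using FT_isometry[OF FT_diff[OF n F]] by simp
  also have "\<dots> = 0" using lim_imp_Liminf[OF sequentially_bot h(2)] .
  finally have "AE k in lborel. H' k = F k" by (simp add: AE_eq_iff_sqn)
  then show ?thesis by (intro FT_cong[OF F]) auto
qed

text \<open>Along a sequence approximating \<open>h\<close> in both norms, L1 convergence gives the
  pointwise limit of the transforms and L2 convergence identifies that limit as the
  transform.\<close>

lemma FT_L1:
  assumes h: "h \<in> L2C" and i: "integrable lborel h" shows "FT h (cft h)"
proof -
  have "\<exists>c. c \<in> Cc \<and> sqn (\<lambda>x. c x - h x) < ennreal (1 / Suc n) \<and> (\<integral>\<^sup>+x. ennreal (cmod (c x - h x)) \<partial>lborel) < ennreal (1 / Suc n)" for n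
    using Cc_dense[OF h, of "ennreal (1 / Suc n)"] i by auto
  then obtain c where c: "\<And>n. c n \<in> Cc" "\<And>n. sqn (\<lambda>x. c n x - h x) < ennreal (1 / Suc n)"
      "\<And>n. (\<integral>\<^sup>+x. ennreal (cmod (c n x - h x)) \<partial>lborel) < ennreal (1 / Suc n)" by metis
  note [measurable] = L2C_measurable[OF h]
  have l0: "(\<lambda>n. 1 / real (Suc n)) \<longlonglongrightarrow> 0" by (rule LIMSEQ_inverse_real_of_nat[unfolded inverse_eq_divide])
  have l: "(\<lambda>n. ennreal (1 / Suc n)) \<longlonglongrightarrow> 0"
    using tendsto_ennrealI[OF l0] by simp
  have s: "(\<lambda>n. sqn (\<lambda>x. c n x - h x)) \<longlonglongrightarrow> 0"
    by (rule tendsto_ennreal_0_le[OF _ l]) (use c(2) less_imp_le in blast)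
  have k: "(\<lambda>n. cft (c n) k) \<longlonglongrightarrow> cft h k" for k
  proof (rule Lim_transform_bound[OF _ l0, THEN LIM_zero_cancel])
    have "cmod (cft (c n) k - cft h k) \<le> 1 / real (Suc n)" for n
    proof -
      have ii: "integrable lborel (\<lambda>x. c n x - h x)" using c(1) i by (auto intro: Cc_integrable)
      have "cmod (cft (c n) k - cft h k) \<le> (LINT x|lborel. cmod (c n x - h x))"
        using cft_bound[OF ii] c(1) i by (simp add: cft_diff Cc_integrable)
      also have "\<dots> \<le> 1 / real (Suc n)"
        using c(3)[of n] nn_integral_eq_integral[of lborel "\<lambda>x. cmod (c n x - h x)"] ii by (simp add: ennreal_less_iff)
      finally show ?thesis .
    qed
    then show "eventually (\<lambda>n. norm (cft (c n) k - cft h k) \<le> norm (1 / real (Suc n))) sequentially" by simp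
  qed
  show ?thesis by (rule FT_limit[OF FT_Cc[OF c(1)] h s]) (use k in auto)
qed

text \<open>The square of the transform is the reflection: since both the transform and its conjugate
  are isometries and they are adjoint, each inverts the other.\<close>

lemma FT_involution:
  assumes F: "FT h F" shows "FT F (\<lambda>x. h (- x))"
proof -
  obtain K where K: "FT F K" using FT_exists[OF FT_L2C(2)[OF F]] by blast
  have cf: "FT (\<lambda>x. cnj (h (- x))) (\<lambda>k. cnj (F k))"
    using FT_reflect[OF FT_cnj[OF F]] by simp
  have 1: "(LINT x|lborel. K x * cnj (h (- x))) = (LINT x|lborel. h (- x) * cnj (h (- x)))"
  proof -
    have "(LINT x|lborel. K x * cnj (h (- x))) = (LINT x|lborel. F x * cnj (F x))"
      by (rule FT_multiplication[OF K cf])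
    also have "\<dots> = (LINT x|lborel. h x * cnj (h x))" by (rule FT_Parseval[OF F F])
    also have "\<dots> = (LINT x|lborel. h (- x) * cnj (h (- x)))" using integral_uminus[of "\<lambda>x. h x * cnj (h x)"] by simp
    finally show ?thesis .
  qed
  have KK: "(LINT x|lborel. K x * cnj (K x)) = (LINT x|lborel. h (- x) * cnj (h (- x)))"
    using FT_Parseval[OF K K] FT_Parseval[OF F F] integral_uminus[of "\<lambda>x. h x * cnj (h x)"] by simp
  let ?r = "\<lambda>x. h (- x)"
  have L: "K \<in> L2C" "?r \<in> L2C" using FT_L2C[OF K] L2C_reflect[OF FT_L2C(1)[OF F]] by auto
  have 2: "(LINT x|lborel. ?r x * cnj (K x)) = (LINT x|lborel. h (- x) * cnj (h (- x)))"
  proof -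
    have "(LINT x|lborel. ?r x * cnj (K x)) = cnj (LINT x|lborel. K x * cnj (?r x))"
      by (subst Bochner_Integration.integral_cnj[symmetric]) (simp add: mult.commute)
    also have "\<dots> = (LINT x|lborel. h (- x) * cnj (h (- x)))"
      unfolding 1 by (subst Bochner_Integration.integral_cnj[symmetric]) (simp add: mult.commute)
    finally show ?thesis .
  qed
  note i = L2C_integrable_mult L2C_cnj L
  \<comment> \<open>The square of \<open>K - ?r\<close> expands into four pairings, all equal to the
    squared norm of \<open>h\<close>, so they cancel.\<close>
  have "complex_of_real (enn2real (sqn (\<lambda>x. K x - ?r x))) = (LINT x|lborel. (K x - ?r x) * cnj (K x - ?r x))"
    by (rule sqn_eq_integral_cnj[OF L2C_diff[OF L]])
  also have "\<dots> = (LINT x|lborel. (K x * cnj (K x) - K x * cnj (?r x)) - (?r x * cnj (K x) - ?r x * cnj (?r x)))"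
    by (simp add: algebra_simps)
  also have "\<dots> = ((LINT x|lborel. K x * cnj (K x)) - (LINT x|lborel. K x * cnj (?r x))) -
      ((LINT x|lborel. ?r x * cnj (K x)) - (LINT x|lborel. ?r x * cnj (?r x)))"
    by (simp only: Bochner_Integration.integral_diff Bochner_Integration.integrable_diff i)
  also have "\<dots> = 0" unfolding 1 2 KK by simp
  finally have "sqn (\<lambda>x. K x - ?r x) = 0"
    using L2C_finite[OF L2C_diff[OF L]] by (auto simp: enn2real_eq_0_iff)
  then have "AE x in lborel. K x = ?r x" using L by (subst AE_eq_iff_sqn) (auto simp: L2C_def)
  then show ?thesis using L by (intro FT_cong[OF K]) (auto simp: L2C_def FT_measurable[OF F])
qed

lemma FT_surj: assumes "F \<in> L2C" obtains h where "FT h F"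
proof -
  obtain K where "FT F K" using FT_exists[OF assms] by blast
  from FT_reflect[OF FT_involution[OF this]] show ?thesis using that by simp
qed

lemma FT_inverse_L1:
  assumes "F \<in> L2C" "integrable lborel F" shows "FT (\<lambda>x. cft F (- x)) F"
  using FT_reflect[OF FT_involution[OF FT_L1[OF assms]]] by simp

lemma FT_L1_bounded:
  assumes F: "FT f F" and i: "integrable lborel F"
  shows "AE x in lborel. cmod (f x) \<le> (LINT k|lborel. cmod (F k))"
proof -
  have "AE x in lborel. f x = cft F (- x)" by (rule FT_inj[OF F FT_inverse_L1[OF FT_L2C(2)[OF F] i]])
  then show ?thesis by eventually_elim (simp add: cft_bound[OF i])
qed

text \<open>Convolution with the constant that the symmetric normalisation of the transform attaches
  to products.\<close>

definition cv :: "(real \<Rightarrow> complex) \<Rightarrow> (real \<Rightarrow> complex) \<Rightarrow> real \<Rightarrow> complex" where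
  "cv F G k = complex_of_real (1 / sqrt (2 * pi)) * (LINT m|lborel. F (k - m) * G m)"

text \<open>Integrability of \<open>F\<close> makes \<open>f\<close> bounded, so the product lies in
  L2 as well as in L1 and its transform is an integral. For each fixed \<open>k\<close> that
  integral pairs \<open>g\<close> with a modulation of the conjugate of \<open>f\<close>, and
  Parseval's identity turns it into the convolution.\<close>

lemma FT_mult:
  assumes F: "FT f F" and G: "FT g G" and i: "integrable lborel F"
  shows "FT (\<lambda>x. f x * g x) (cv F G)"
proof -
  have L: "(\<lambda>x. f x * g x) \<in> L2C"
    by (rule L2C_mult_bounded[OF FT_L2C(1)[OF G] FT_measurable(1)[OF F] FT_L1_bounded[OF F i]])
  have "cft (\<lambda>x. f x * g x) k = cv F G k" for k
  proof -
    have m: "FT (\<lambda>x. exp (\<i> * complex_of_real (k * x)) * cnj (f x)) (\<lambda>m. cnj (F (k - m)))"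
      using FT_modulate[OF FT_cnj[OF F], of k] by simp
    have "(LINT x|lborel. f x * g x * exp (- \<i> * complex_of_real (k * x))) = (LINT x|lborel. g x * cnj (exp (\<i> * complex_of_real (k * x)) * cnj (f x)))"
      by (simp add: exp_cnj mult_ac)
    also have "\<dots> = (LINT m|lborel. G m * cnj (cnj (F (k - m))))" by (rule FT_Parseval[OF G m, symmetric])
    finally show ?thesis by (simp add: cft_def cv_def mult.commute)
  qed
  moreover have "cft (\<lambda>x. f x * g x) = cv F G" using calculation by auto
  ultimately show ?thesis using FT_L1[OF L L2C_integrable_mult[OF FT_L2C(1)[OF F] FT_L2C(1)[OF G]]] by simp
qed

section \<open>Agreement with the transform of the definitions, and real-valued functions\<close>

lemma L2_iff_L2C: "h \<in> L2 \<longleftrightarrow> (\<lambda>x. complex_of_real (h x)) \<in> L2C"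
proof -
  have "h \<in> borel_measurable borel" if [measurable]: "(\<lambda>x. complex_of_real (h x)) \<in> borel_measurable borel"
  proof -
    have "(\<lambda>x. Re (complex_of_real (h x))) \<in> borel_measurable borel" by measurable
    then show ?thesis by simp
  qed
  then have "(\<lambda>x. complex_of_real (h x)) \<in> borel_measurable borel \<longleftrightarrow> h \<in> borel_measurable borel"
    using measurable_compose[OF _ borel_measurable_of_real, of h borel] by blast
  then show ?thesis by (simp add: L2_def L2C_iff)
qed

lemma truncated_fourier_eq: 
  "truncated_fourier R h = cft (\<lambda>x. complex_of_real (indicator {-R..R} x * h x))"
  unfolding truncated_fourier_def cft_def set_lebesgue_integral_def
  by (intro ext arg_cong2[where f="(*)"] refl Bochner_Integration.integral_cong) (auto simp: indicator_def)

text \<open>Truncations to [-R, R] are integrable and converge in mean square, so by the isometry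
  their integrals converge to any \<open>FT\<close> transform; conversely the mean-square limit is
  unique up to null sets. From here on the choice inside \<open>fourier\<close> is accessible
  through \<open>FT\<close>.\<close>

lemma is_fourier_iff:
  assumes h: "h \<in> L2"
  shows "is_fourier h F \<longleftrightarrow> FT (\<lambda>x. complex_of_real (h x)) F"
proof -
  let ?h = "\<lambda>x. complex_of_real (h x)"
  let ?t = "\<lambda>R x. complex_of_real (indicator {-R..R} x * h x)"
  have hL: "?h \<in> L2C" using h by (simp add: L2_iff_L2C)
  then have [measurable]: "h \<in> borel_measurable borel" using h by (simp add: L2_def)
  have tb: "cmod (?t R x) \<le> cmod (?h x)" "cmod (?t R x - ?h x) \<le> cmod (?h x)" for R x by (auto simp: indicator_def)
  have tL: "?t R \<in> L2C" for R by (rule L2C_bound[OF hL]) (use tb in auto)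
  have ti: "integrable lborel (?t R)" for R
  proof -
    have "(\<lambda>x. complex_of_real (indicator {-R..R} x)) \<in> L2C"
      by (rule bounded_support_L2C[where B=1 and R="\<bar>R\<bar>"]) (auto simp: indicator_def)
    from L2C_integrable_mult[OF this hL] show ?thesis by simp
  qed
  have tF: "FT (?t R) (truncated_fourier R h)" for R
    unfolding truncated_fourier_eq by (rule FT_L1[OF tL ti])
  have lim: "((\<lambda>R. sqn (\<lambda>k. truncated_fourier R h k - F k)) \<longlongrightarrow> 0) at_top" if F: "FT ?h F" for F
  proof (rule tendsto_at_topI_sequentially)
    fix X :: "nat \<Rightarrow> real" assume X: "filterlim X at_top sequentially"
    have "(\<lambda>n. sqn (\<lambda>x. ?t (X n) x - ?h x)) \<longlonglongrightarrow> 0"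
    proof (rule sqn_dominated[OF _ hL])
      show "AE x in lborel. (\<lambda>n. ?t (X n) x - ?h x) \<longlonglongrightarrow> 0"
      proof (intro AE_I2 tendsto_eventually)
        fix x
        have "eventually (\<lambda>n. \<bar>x\<bar> \<le> X n) sequentially" using X by (simp add: filterlim_at_top)
        then show "eventually (\<lambda>n. ?t (X n) x - ?h x = 0) sequentially"
          by eventually_elim (auto simp: indicator_def)
      qed
    qed (use tb in auto)
    then show "(\<lambda>n. sqn (\<lambda>k. truncated_fourier (X n) h k - F k)) \<longlonglongrightarrow> 0"
      using FT_isometry[OF FT_diff[OF tF F]] by simp
  qed
  show ?thesis
  proof
    assume F: "FT ?h F"
    then show "is_fourier h F" using lim[OF F] FT_measurable[OF F] by (simp add: is_fourier_def sqn_def)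
  next
    assume "is_fourier h F"
    then have Fm [measurable]: "F \<in> borel_measurable borel" and Fl: "((\<lambda>R. sqn (\<lambda>k. truncated_fourier R h k - F k)) \<longlongrightarrow> 0) at_top"
      by (auto simp: is_fourier_def sqn_def)
    obtain G where G: "FT ?h G" using FT_exists[OF hL] by blast
    note [measurable] = FT_measurable(2)[OF G] FT_measurable(2)[OF tF]
    have "((\<lambda>R. 2 * sqn (\<lambda>k. truncated_fourier R h k - F k) + 2 * sqn (\<lambda>k. truncated_fourier R h k - G k)) \<longlongrightarrow> 2 * 0 + 2 * 0) at_top"
      by (intro tendsto_add ennreal_tendsto_cmult Fl lim[OF G]) auto
    then have "sqn (\<lambda>k. F k - G k) \<le> 2 * 0 + 2 * 0"
    proof (rule tendsto_lowerbound)
      have "sqn (\<lambda>k. F k - G k) \<le> 2 * sqn (\<lambda>k. truncated_fourier R h k - F k) + 2 * sqn (\<lambda>k. truncated_fourier R h k - G k)" for R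
        using sqn_diff_triangle[of F "truncated_fourier R h" G] by (simp add: sqn_diff_commute[of F])
      then show "eventually (\<lambda>R. sqn (\<lambda>k. F k - G k) \<le> 2 * sqn (\<lambda>k. truncated_fourier R h k - F k) + 2 * sqn (\<lambda>k. truncated_fourier R h k - G k)) at_top"
        by (intro always_eventually allI)
    qed simp
    then have "AE k in lborel. F k = G k" by (simp add: AE_eq_iff_sqn)
    then show "FT ?h F" by (intro FT_cong[OF G]) (auto simp: FT_measurable[OF G])
  qed
qed

lemma fourier_FT: assumes "h \<in> L2" shows "FT (\<lambda>x. complex_of_real (h x)) (fourier h)"
proof -
  obtain F where "FT (\<lambda>x. complex_of_real (h x)) F" using FT_exists assms by (auto simp: L2_iff_L2C)
  then have "is_fourier h F" using is_fourier_iff[OF assms] by simp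
  then have "is_fourier h (fourier h)" unfolding fourier_def by (rule someI[where P="is_fourier h"])
  then show ?thesis using is_fourier_iff[OF assms] by simp
qed

lemma FT_fourier:
  assumes "FT (\<lambda>x. complex_of_real (h x)) F"
  shows "h \<in> L2" "AE k in lborel. fourier h k = F k"
proof -
  show h: "h \<in> L2" using FT_L2C[OF assms] by (simp add: L2_iff_L2C)
  show "AE k in lborel. fourier h k = F k" by (rule FT_unique[OF fourier_FT[OF h] assms])
qed

lemma FT_hermitian:
  assumes "FT (\<lambda>x. complex_of_real (h x)) F" shows "AE k in lborel. F (- k) = cnj (F k)"
proof -
  have "AE k in lborel. cnj (F (- k)) = F k" using FT_unique[OF FT_cnj[OF assms]] assms by simp
  then show ?thesis by eventually_elim (metis complex_cnj_cnj)
qed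

text \<open>How real functions are made on the Fourier side: hermitian symmetry says that
  \<open>h\<close> and its conjugate have the same transform, hence \<open>h\<close> is real almost
  everywhere, and the real part is a representative of the right type.\<close>

lemma FT_real:
  assumes F: "FT h F" and herm: "AE k in lborel. F (- k) = cnj (F k)"
  shows "FT (\<lambda>x. complex_of_real (Re (h x))) F"
proof -
  note [measurable] = FT_measurable[OF F]
  have "FT (\<lambda>x. cnj (h x)) F"
    by (rule FT_cong[OF FT_cnj[OF F]]) (use herm in \<open>auto elim!: eventually_mono\<close>)
  from FT_inj[OF this F] have "AE x in lborel. complex_of_real (Re (h x)) = h x"
    by eventually_elim (simp add: complex_eq_iff)
  then show ?thesis by (intro FT_cong[OF F]) auto
qed

section \<open>Test functions\<close>

text \<open>The positive and the negative part of \<open>h\<close> are densities of two finite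
  measures with the same distribution function. The measures coincide, so the parts agree almost
  everywhere, which forces both to vanish.\<close>

lemma AE_zero_of_integral_atMost:
  fixes h :: "real \<Rightarrow> real"
  assumes h: "integrable lborel h" and z: "\<And>x. (LINT y|lborel. h y * indicator {..x} y) = 0"
  shows "AE x in lborel. h x = 0"
proof -
  have [measurable]: "h \<in> borel_measurable borel" using h by auto
  let ?P = "density lborel (\<lambda>x. ennreal (h x))" and ?Q = "density lborel (\<lambda>x. ennreal (- h x))"
  have fin: "(\<integral>\<^sup>+x. ennreal (h x) \<partial>lborel) \<noteq> \<infinity>" "(\<integral>\<^sup>+x. ennreal (- h x) \<partial>lborel) \<noteq> \<infinity>"
    using h by (auto simp: real_integrable_def)
  have "?P = ?Q"
  proof (rule cdf_unique')
    show "finite_borel_measure ?P" "finite_borel_measure ?Q"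
      using fin by (auto simp: finite_borel_measure_def finite_borel_measure_axioms_def emeasure_density intro!: finite_measureI)
    show "cdf ?P = cdf ?Q"
    proof
      fix x
      have i: "integrable lborel (\<lambda>y. h y * indicator {..x} y)"
        using h by (rule Bochner_Integration.integrable_bound) (auto simp: indicator_def)
      have e: "ennreal (h y * indicator {..x} y) = ennreal (h y) * indicator {..x} y"
        "ennreal (- (h y * indicator {..x} y)) = ennreal (- h y) * indicator {..x} y" for y
        by (auto simp: indicator_def)
      have "(LINT y|lborel. h y * indicator {..x} y) = enn2real (\<integral>\<^sup>+y. ennreal (h y) * indicator {..x} y \<partial>lborel)
          - enn2real (\<integral>\<^sup>+y. ennreal (- h y) * indicator {..x} y \<partial>lborel)"
        using real_lebesgue_integral_def[OF i] unfolding e by simp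
      then show "cdf ?P x = cdf ?Q x"
        using z[of x] by (simp add: cdf_def measure_def emeasure_density)
    qed
  qed
  then have "AE x in lborel. ennreal (h x) = ennreal (- h x)"
    using fin by (subst (asm) finite_density_unique) auto
  then show ?thesis
  proof eventually_elim
    case (elim x)
    then show ?case
      by (cases "h x" "0::real" rule: linorder_cases) (auto simp: ennreal_neg ennreal_eq_0_iff dest: sym)
  qed
qed

section \<open>Smooth functions of compact support and the fundamental lemmas\<close>

definition smooth :: "(real \<Rightarrow> real) \<Rightarrow> bool" where
  "smooth f \<longleftrightarrow> (\<forall>n x. (deriv ^^ n) f differentiable (at x))"

lemma smooth_coinduct:
  assumes "f \<in> S" and "\<And>g. g \<in> S \<Longrightarrow> deriv g \<in> S" and "\<And>g x. g \<in> S \<Longrightarrow> g differentiable (at x)"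
  shows "smooth f"
proof -
  have "(deriv ^^ n) f \<in> S" for n by (induction n) (use assms in auto)
  then show ?thesis using assms(3) by (auto simp: smooth_def)
qed

lemma smooth_DERIV: "smooth f \<Longrightarrow> (f has_real_derivative deriv f x) (at x)"
  unfolding smooth_def using DERIV_deriv_iff_real_differentiable funpow_0 by metis

lemma smooth_deriv: "smooth f \<Longrightarrow> smooth (deriv f)"
  unfolding smooth_def by (metis comp_apply funpow_Suc_right)

lemma smooth_primitive:
  assumes "\<And>x. (F has_real_derivative f x) (at x)" "smooth f" shows "smooth F"
  unfolding smooth_def
proof (intro allI)
  fix n x
  have d: "deriv F = f" using assms(1) by (auto intro: DERIV_imp_deriv)
  show "(deriv ^^ n) F differentiable (at x)"
  proof (cases n)
    case 0 then show ?thesis using assms(1)[of x] by (auto simp: real_differentiable_def)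
  next
    case (Suc m) then show ?thesis using assms(2) by (simp add: funpow_Suc_right d smooth_def del: funpow.simps)
  qed
qed

lemma smooth_lincomb:
  assumes "smooth f" "smooth g" shows "smooth (\<lambda>x. a * f x + b * g x)"
proof (rule smooth_coinduct[where S="{\<lambda>x. a * f x + b * g x | a b f g. smooth f \<and> smooth g}"])
  show "(\<lambda>x. a * f x + b * g x) \<in> {\<lambda>x. a * f x + b * g x |a b f g. smooth f \<and> smooth g}" using assms by blast
next
  fix h assume "h \<in> {\<lambda>x. a * f x + b * g x |a b f g. smooth f \<and> smooth g}"
  then obtain a b f g where h: "h = (\<lambda>x. a * f x + b * g x)" "smooth f" "smooth g" by blast
  have D: "(h has_real_derivative a * deriv f x + b * deriv g x) (at x)" for x
    unfolding h(1) by (intro DERIV_add DERIV_cmult smooth_DERIV h)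
  then have "deriv h = (\<lambda>x. a * deriv f x + b * deriv g x)" by (auto intro: DERIV_imp_deriv)
  with h show "deriv h \<in> {\<lambda>x. a * f x + b * g x |a b f g. smooth f \<and> smooth g}" using smooth_deriv by blast
  show "h differentiable (at x)" for x using D by (auto simp: real_differentiable_def)
qed

text \<open>The polynomial in 1/x is carried along because differentiating exp(-1/x) produces such
  factors: the family is closed under differentiation.\<close>

definition flat :: "real poly \<Rightarrow> real \<Rightarrow> real" where
  "flat P x = (if x > 0 then poly P (1 / x) * exp (- (1 / x)) else 0)"

text \<open>The extra power makes the induction work: splitting off the constant coefficient of the
  polynomial raises \<open>k\<close> by one.\<close>

lemma poly_mult_power_exp_tendsto: "((\<lambda>y. poly P y * y ^ k * exp (- y)) \<longlongrightarrow> (0::real)) at_top"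
proof (induction P arbitrary: k)
  case 0 then show ?case by simp
next
  case (pCons a P)
  have "((\<lambda>y. a * (y ^ k / exp y) + poly P y * y ^ (Suc k) * exp (- y)) \<longlongrightarrow> a * 0 + 0) at_top"
    by (intro tendsto_intros tendsto_power_div_exp_0 pCons.IH)
  moreover have "(\<lambda>y. a * (y ^ k / exp y) + poly P y * y ^ (Suc k) * exp (- y)) = (\<lambda>y. poly (pCons a P) y * y ^ k * exp (- y))"
    by (auto simp: exp_minus field_simps)
  ultimately show ?case by simp
qed

text \<open>For positive x the derivative of P(1/x) exp(-1/x) is x^(-2) (P - P')(1/x) exp(-1/x), and
  the polynomial \<open>[:0, 0, 1:]\<close> supplies the square. At 0 the right difference quotient
  tends to 0 because the exponential beats every power of 1/x.\<close>

lemma flat_deriv: "(flat P has_real_derivative flat ([:0, 0, 1:] * (P - pderiv P)) x) (at x)"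
proof -
  consider "x > 0" | "x < 0" | "x = 0" by linarith
  then show ?thesis
  proof cases
    case 1
    have "((\<lambda>x. poly P (1 / x) * exp (- (1 / x))) has_real_derivative flat ([:0, 0, 1:] * (P - pderiv P)) x) (at x)"
      using 1 by (auto intro!: derivative_eq_intros DERIV_chain2[OF poly_DERIV] simp: flat_def field_simps power2_eq_square)
    then show ?thesis
      by (rule has_field_derivative_transform_within_open[where S="{0<..}"]) (use 1 in \<open>auto simp: flat_def\<close>)
  next
    case 2
    have "((\<lambda>x. 0) has_real_derivative flat ([:0, 0, 1:] * (P - pderiv P)) x) (at x)"
      using 2 by (simp add: flat_def)
    then show ?thesis
      by (rule has_field_derivative_transform_within_open[where S="{..<0}"]) (use 2 in \<open>auto simp: flat_def\<close>)
  next
    case 3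
    have "((\<lambda>h. flat P h / h) \<longlongrightarrow> 0) (at_right 0)"
    proof -
      have "((\<lambda>h. poly P (inverse h) * (inverse h) ^ 1 * exp (- (inverse h))) \<longlongrightarrow> 0) (at_right 0)"
        by (rule filterlim_compose[OF poly_mult_power_exp_tendsto filterlim_inverse_at_top_right])
      then show ?thesis
        by (rule Lim_transform_eventually)
          (auto simp: eventually_at_right_field flat_def field_simps intro!: exI[of _ 1])
    qed
    moreover have "((\<lambda>h. flat P h / h) \<longlongrightarrow> 0) (at_left 0)"
      by (rule tendsto_eventually) (auto simp: eventually_at_left_field flat_def intro!: exI[of _ "-1"])
    ultimately have "((\<lambda>h. flat P h / h) \<longlongrightarrow> 0) (at 0)" by (simp add: filterlim_split_at)
    then show ?thesis using 3 by (simp add: DERIV_def flat_def)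
  qed
qed

text \<open>Products vanish outside the interval (c, d). Sums have to be included because the
  product rule yields two such products; the result is a class closed under differentiation.\<close>

inductive_set flats :: "real \<Rightarrow> real \<Rightarrow> (real \<Rightarrow> real) set" for c d where
  base: "(\<lambda>x. flat P (x - c) * flat Q (d - x)) \<in> flats c d"
| add: "f \<in> flats c d \<Longrightarrow> g \<in> flats c d \<Longrightarrow> (\<lambda>x. f x + g x) \<in> flats c d"

lemma flats_deriv:
  assumes "f \<in> flats c d" shows "\<exists>g\<in>flats c d. \<forall>x. (f has_real_derivative g x) (at x)"
  using assms
proof induction
  case (base P Q)
  let ?D = "\<lambda>P. [:0, 0, 1:] * (P - pderiv P)"
  have m: "flat (- P) x = - flat P x" for P x by (simp add: flat_def)
  have "((\<lambda>x. flat P (x - c) * flat Q (d - x)) has_real_derivative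
      (flat (?D P) (x - c) * flat Q (d - x) + flat P (x - c) * flat (- ?D Q) (d - x))) (at x)" for x
    unfolding m by (rule derivative_eq_intros DERIV_chain2[OF flat_deriv] refl)+ (simp add: algebra_simps)
  then show ?case by (intro bexI[OF _ flats.add[OF flats.base flats.base]]) auto
next
  case (add f g)
  then obtain f' g' where "f' \<in> flats c d" "g' \<in> flats c d" "\<And>x. (f has_real_derivative f' x) (at x)" "\<And>x. (g has_real_derivative g' x) (at x)"
    by blast
  then show ?case by (intro bexI[of _ "\<lambda>x. f' x + g' x"]) (auto intro: DERIV_add flats.add)
qed

lemma flats_smooth: assumes "f \<in> flats c d" shows "smooth f"
proof (rule smooth_coinduct[OF assms])
  fix g assume "g \<in> flats c d"
  from flats_deriv[OF this] obtain g' where g': "g' \<in> flats c d" "\<And>x. (g has_real_derivative g' x) (at x)" by blast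
  then have "deriv g = g'" by (auto intro: DERIV_imp_deriv)
  then show "deriv g \<in> flats c d" using g' by simp
  show "g differentiable (at x)" for x using g'(2) by (auto simp: real_differentiable_def)
qed

lemma smooth_continuous: "smooth f \<Longrightarrow> continuous_on A f"
  by (meson DERIV_isCont continuous_at_imp_continuous_on smooth_DERIV)

text \<open>A bump supported in [c, d] is integrated and divided by its total mass, which is
  positive by the mean value theorem.\<close>

lemma smooth_step:
  fixes c d :: real
  assumes cd: "c < d"
  obtains F where "smooth F" "\<And>x. x \<le> c \<Longrightarrow> F x = 0" "\<And>x. x \<ge> d \<Longrightarrow> F x = 1"
    "\<And>x. 0 \<le> F x" "\<And>x. F x \<le> 1" "\<And>x. deriv F x \<ge> 0" "\<And>x. x \<notin> {c..d} \<Longrightarrow> deriv F x = 0"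
proof -
  define f where "f x = flat 1 (x - c) * flat 1 (d - x)" for x
  have fs: "smooth f" unfolding f_def[abs_def] by (rule flats_smooth[OF flats.base])
  have f0: "f x \<ge> 0" "x \<le> c \<Longrightarrow> f x = 0" "x \<ge> d \<Longrightarrow> f x = 0" "c < x \<Longrightarrow> x < d \<Longrightarrow> f x > 0" for x
    by (auto simp: f_def flat_def)
  \<comment> \<open>Starting the integral at c - 1, to the left of the support, makes c an interior
    point, so the derivative there is two-sided.\<close>
  define G where "G x = integral {c - 1..x} f" for x
  have GD: "(G has_real_derivative f x) (at x)" for x
  proof (cases "x > c - 1")
    case True
    have "(G has_real_derivative f x) (at x within {c - 1..x + 1})"
      unfolding G_def[abs_def] using True by (intro integral_has_real_derivative smooth_continuous fs) auto
    then show ?thesis using True by (subst (asm) at_within_Icc_at) auto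
  next
    case False
    have z: "G y = 0" if "y < c" for y
    proof -
      have "integral {c - 1..y} f = integral {c - 1..y} (\<lambda>_. 0)"
        by (rule integral_cong) (use f0 that in auto)
      then show ?thesis by (simp add: G_def)
    qed
    have "((\<lambda>x. 0) has_real_derivative f x) (at x)" using f0(2)[of x] False by simp
    then show ?thesis
      by (rule has_field_derivative_transform_within_open[where S="{..<c}"]) (use False z in auto)
  qed
  have mono: "x \<le> y \<Longrightarrow> G x \<le> G y" for x y
    by (rule DERIV_nonneg_imp_nondecreasing) (use GD f0(1) in auto)
  have G0: "G x = 0" if "x \<le> c" for x
  proof -
    have "integral {c - 1..x} f = integral {c - 1..x} (\<lambda>_. 0)"
      by (rule integral_cong) (use f0 that in auto)
    then show ?thesis by (simp add: G_def)
  qed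
  have Gd: "G x = G d" if "x \<ge> d" for x
  proof (cases "x = d")
    case False
    then have "d < x" using that by simp
    then obtain z where "d < z" "z < x" "G x - G d = (x - d) * f z" using MVT2[of d x G f] GD by blast
    then show ?thesis using f0(3)[of z] by simp
  qed simp
  obtain z where z: "c < z" "z < d" "G d - G c = (d - c) * f z" using MVT2[of c d G f] GD cd by blast
  then have pos: "G d > 0" using f0(4)[of z] G0[of c] cd by simp
  define F where "F x = G x / G d" for x
  have FD: "(F has_real_derivative f x / G d) (at x)" for x
    unfolding F_def[abs_def] by (intro DERIV_cdivide GD)
  then have dF: "deriv F x = f x / G d" for x by (rule DERIV_imp_deriv)
  have "smooth (\<lambda>x. f x / G d)" using smooth_lincomb[OF fs fs, of "1 / G d" 0] by simp
  then have "smooth F" by (rule smooth_primitive[OF FD])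
  moreover have "F x = 0" if "x \<le> c" for x using G0[OF that] by (simp add: F_def)
  moreover have "F x = 1" if "x \<ge> d" for x using Gd[OF that] pos by (simp add: F_def)
  moreover have "0 \<le> F x" for x using mono[of "min x c" x] G0[of "min x c"] pos by (simp add: F_def)
  moreover have "F x \<le> 1" for x using mono[of x "max x d"] Gd[of "max x d"] pos by (simp add: F_def)
  moreover have "deriv F x \<ge> 0" for x using f0(1)[of x] pos by (simp add: dF)
  moreover have "deriv F x = 0" if "x \<notin> {c..d}" for x using f0(2,3)[of x] that by (auto simp: dF)
  ultimately show ?thesis using that by blast
qed

text \<open>Since \<open>F\<close> rises from 0 to 1, its derivative is a probability density on
  [c, d]; the average of \<open>a\<close> is as close to \<open>A\<close> as the values of
  \<open>a\<close> are.\<close>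

lemma weighted_average:
  fixes F a :: "real \<Rightarrow> real"
  assumes cd: "c < d" and F: "smooth F" "F c = 0" "F d = 1" "\<And>x. deriv F x \<ge> 0" 
    and a: "continuous_on {c..d} a" and e: "\<And>x. x \<in> {c..d} \<Longrightarrow> \<bar>a x - A\<bar> \<le> e"
  shows "\<bar>(LINT x:{c..d}|lborel. deriv F x * a x) - A\<bar> \<le> e"
proof -
  have cF: "continuous_on {c..d} (deriv F)" by (intro smooth_continuous smooth_deriv F)
  have "(LINT x:{c..d}|lborel. deriv F x) = F d - F c"
    unfolding set_lebesgue_integral_def
    by (rule integral_FTC_Icc) (use cd cF smooth_DERIV[OF F(1)] in \<open>auto intro: DERIV_subset simp: has_real_derivative_iff_has_vector_derivative[symmetric]\<close>)
  then have one: "(LINT x:{c..d}|lborel. deriv F x) = 1" using F by simp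
  have i1: "set_integrable lborel {c..d} (\<lambda>x. deriv F x * a x)" "set_integrable lborel {c..d} (\<lambda>x. deriv F x * A)" "set_integrable lborel {c..d} (\<lambda>x. deriv F x * e)"
    by (intro borel_integrable_atLeastAtMost' continuous_intros cF a)+
  have "(LINT x:{c..d}|lborel. deriv F x * a x) - A = (LINT x:{c..d}|lborel. deriv F x * a x - deriv F x * A)"
    using i1 one by simp
  also have "\<bar>\<dots>\<bar> \<le> (LINT x:{c..d}|lborel. deriv F x * e)"
    unfolding set_lebesgue_integral_def real_norm_def[symmetric]
  proof (rule Bochner_Integration.integral_norm_bound_integral)
    show "integrable lborel (\<lambda>x. indicat_real {c..d} x *\<^sub>R (deriv F x * a x - deriv F x * A))"
      using set_integral_diff(1)[OF i1(1,2)] by (simp add: set_integrable_def)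
    show "integrable lborel (\<lambda>x. indicat_real {c..d} x *\<^sub>R (deriv F x * e))"
      using i1(3) by (simp add: set_integrable_def)
    fix x
    show "norm (indicat_real {c..d} x *\<^sub>R (deriv F x * a x - deriv F x * A)) \<le> indicat_real {c..d} x *\<^sub>R (deriv F x * e)"
      using F(4)[of x] e[of x] by (auto simp: indicator_def right_diff_distrib[symmetric] abs_mult intro!: mult_left_mono)
  qed
  also have "\<dots> = e" using one by simp
  finally show ?thesis .
qed

lemma test_functionI:
  assumes "smooth \<phi>" "compact K" "K \<subseteq> U" "\<And>x. x \<notin> K \<Longrightarrow> \<phi> x = 0" shows "test_function U \<phi>"
  using assms unfolding test_function_def smooth_def by blast

lemma test_function_mono: "test_function U \<phi> \<Longrightarrow> U \<subseteq> V \<Longrightarrow> test_function V \<phi>"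
  unfolding test_function_def by blast

lemma test_function_smooth: "test_function U \<phi> \<Longrightarrow> smooth \<phi>"
  by (auto simp: test_function_def smooth_def)

lemma test_function_support:
  assumes "test_function U \<phi>"
  obtains K where "compact K" "K \<subseteq> U" "\<And>x. x \<notin> K \<Longrightarrow> \<phi> x = 0" "\<And>x. x \<notin> K \<Longrightarrow> deriv \<phi> x = 0"
proof -
  obtain K where K: "compact K" "K \<subseteq> U" "\<And>x. x \<notin> K \<Longrightarrow> \<phi> x = 0" using assms by (auto simp: test_function_def)
  have "deriv \<phi> x = 0" if "x \<notin> K" for x
  proof (rule DERIV_imp_deriv)
    show "(\<phi> has_real_derivative 0) (at x)"
      by (rule has_field_derivative_transform_within_open[of "\<lambda>_. 0" 0 x "- K"]) (use K that compact_imp_closed in auto)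
  qed
  with K that show ?thesis by blast
qed

text \<open>Each plateau is a difference of two smooth steps, so its derivative is a difference of
  two probability densities which concentrate at \<open>s\<close> and at \<open>t\<close>. The steps
  are returned separately because \<open>weak_FTC\<close> treats the two endpoints one at a
  time.\<close>

lemma test_plateau:
  fixes s t :: real
  assumes st: "s < t"
  obtains \<eta> :: "nat \<Rightarrow> real \<Rightarrow> real" and F1 F2 and \<delta> :: "nat \<Rightarrow> real"
  where "\<And>n. test_function {s<..<t} (\<eta> n)" "\<And>n x. 0 \<le> \<eta> n x" "\<And>n x. \<eta> n x \<le> 1" "\<And>x. (\<lambda>n. \<eta> n x) \<longlonglongrightarrow> indicator {s<..<t} x"
    "\<And>n x. deriv (\<eta> n) x = deriv (F1 n) x - deriv (F2 n) x"
    "\<And>n. \<delta> n > 0" "\<delta> \<longlonglongrightarrow> 0" "\<And>n. s + 2 * \<delta> n < t - 2 * \<delta> n"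
    "\<And>n. smooth (F1 n)" "\<And>n. smooth (F2 n)"
    "\<And>n. F1 n (s + \<delta> n) = 0" "\<And>n. F1 n (s + 2 * \<delta> n) = 1" "\<And>n. F2 n (t - 2 * \<delta> n) = 0" "\<And>n. F2 n (t - \<delta> n) = 1"
    "\<And>n x. deriv (F1 n) x \<ge> 0" "\<And>n x. deriv (F2 n) x \<ge> 0"
    "\<And>n x. x \<notin> {s + \<delta> n..s + 2 * \<delta> n} \<Longrightarrow> deriv (F1 n) x = 0" "\<And>n x. x \<notin> {t - 2 * \<delta> n..t - \<delta> n} \<Longrightarrow> deriv (F2 n) x = 0"
proof -
  \<comment> \<open>Dividing by 5 keeps 4 \<open>\<delta> n\<close> below t - s, so the rising ramp
    ends before the falling one begins.\<close>
  define \<delta> where "\<delta> n = (t - s) / 5 * (1 / real (Suc n))" for n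
  have dpos: "\<delta> n > 0" for n using st by (simp add: \<delta>_def)
  have dl: "\<delta> \<longlonglongrightarrow> 0"
    using tendsto_mult[OF tendsto_const[of "(t - s) / 5"] LIMSEQ_inverse_real_of_nat] by (simp add: \<delta>_def[abs_def] inverse_eq_divide)
  have d5: "\<delta> n \<le> (t - s) / 5" for n using st mult_left_le[of "1 / real (Suc n)" "(t - s) / 5"] by (simp add: \<delta>_def)
  have d4: "s + 2 * \<delta> n < t - 2 * \<delta> n" for n using d5[of n] st by (simp add: field_simps)
  have "\<exists>F. smooth F \<and> (\<forall>x. x \<le> s + \<delta> n \<longrightarrow> F x = 0) \<and> (\<forall>x. x \<ge> s + 2 * \<delta> n \<longrightarrow> F x = 1) \<and> (\<forall>x. 0 \<le> F x) \<and> (\<forall>x. F x \<le> 1)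
     \<and> (\<forall>x. deriv F x \<ge> 0) \<and> (\<forall>x. x \<notin> {s + \<delta> n..s + 2 * \<delta> n} \<longrightarrow> deriv F x = 0)" for n
    by (rule smooth_step[of "s + \<delta> n" "s + 2 * \<delta> n"]) (use dpos[of n] in auto)
  then obtain F1 where F1: "\<And>n. smooth (F1 n)" "\<And>n x. x \<le> s + \<delta> n \<Longrightarrow> F1 n x = 0" "\<And>n x. x \<ge> s + 2 * \<delta> n \<Longrightarrow> F1 n x = 1"
     "\<And>n x. 0 \<le> F1 n x" "\<And>n x. F1 n x \<le> 1" "\<And>n x. deriv (F1 n) x \<ge> 0" "\<And>n x. x \<notin> {s + \<delta> n..s + 2 * \<delta> n} \<Longrightarrow> deriv (F1 n) x = 0"
    by metis
  have "\<exists>F. smooth F \<and> (\<forall>x. x \<le> t - 2 * \<delta> n \<longrightarrow> F x = 0) \<and> (\<forall>x. x \<ge> t - \<delta> n \<longrightarrow> F x = 1) \<and> (\<forall>x. 0 \<le> F x) \<and> (\<forall>x. F x \<le> 1)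
     \<and> (\<forall>x. deriv F x \<ge> 0) \<and> (\<forall>x. x \<notin> {t - 2 * \<delta> n..t - \<delta> n} \<longrightarrow> deriv F x = 0)" for n
    by (rule smooth_step[of "t - 2 * \<delta> n" "t - \<delta> n"]) (use dpos[of n] in auto)
  then obtain F2 where F2: "\<And>n. smooth (F2 n)" "\<And>n x. x \<le> t - 2 * \<delta> n \<Longrightarrow> F2 n x = 0" "\<And>n x. x \<ge> t - \<delta> n \<Longrightarrow> F2 n x = 1"
     "\<And>n x. 0 \<le> F2 n x" "\<And>n x. F2 n x \<le> 1" "\<And>n x. deriv (F2 n) x \<ge> 0" "\<And>n x. x \<notin> {t - 2 * \<delta> n..t - \<delta> n} \<Longrightarrow> deriv (F2 n) x = 0"
    by metis
  define \<eta> where "\<eta> n x = F1 n x - F2 n x" for n x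
  have es: "smooth (\<eta> n)" for n
    using smooth_lincomb[OF F1(1)[of n] F2(1)[of n], of 1 "-1"] by (simp add: \<eta>_def[abs_def])
  have out: "\<eta> n x = 0" if "x \<notin> {s + \<delta> n..t - \<delta> n}" for n x
    using that F1(2,3)[where n=n and x=x] F2(2,3)[where n=n and x=x] d4[of n] dpos[of n] by (auto simp: \<eta>_def)
  have inn: "\<eta> n x = 1" if "x \<in> {s + 2 * \<delta> n..t - 2 * \<delta> n}" for n x
    using that F1(3)[where n=n and x=x] F2(2)[where n=n and x=x] by (auto simp: \<eta>_def)
  show ?thesis
  proof (rule that[of \<eta> F1 F2 \<delta>])
    show "test_function {s<..<t} (\<eta> n)" for n
      by (rule test_functionI[OF es, of "{s + \<delta> n..t - \<delta> n}"]) (use out dpos[of n] in auto)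
    show "0 \<le> \<eta> n x" for n x
      using F1(3,4)[where n=n and x=x] F2(2,5)[where n=n and x=x] d4[of n] by (cases "x \<le> t - 2 * \<delta> n") (auto simp: \<eta>_def)
    show "\<eta> n x \<le> 1" for n x
      using F1(5)[of n x] F2(4)[of n x] by (simp add: \<eta>_def)
    show "deriv (\<eta> n) x = deriv (F1 n) x - deriv (F2 n) x" for n x
      unfolding \<eta>_def[abs_def] by (intro DERIV_imp_deriv DERIV_diff smooth_DERIV F1 F2)
    show "(\<lambda>n. \<eta> n x) \<longlonglongrightarrow> indicator {s<..<t} x" for x
    proof (rule tendsto_eventually, cases "x \<in> {s<..<t}")
      case True
      then have "min (x - s) (t - x) / 2 > 0" by auto
      with dl have "eventually (\<lambda>n. \<delta> n < min (x - s) (t - x) / 2) sequentially" by (rule order_tendstoD)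
      then show "eventually (\<lambda>n. \<eta> n x = indicator {s<..<t} x) sequentially"
        by eventually_elim (use True in \<open>auto intro!: inn\<close>)
    next
      case False
      then have "\<eta> n x = 0" for n by (intro out) (use dpos[of n] in auto)
      then show "eventually (\<lambda>n. \<eta> n x = indicator {s<..<t} x) sequentially" using False by simp
    qed
  qed (use F1 F2 dpos dl d4 in auto)
qed

lemma test_plateau_integral:
  fixes w :: "real \<Rightarrow> real"
  assumes w: "set_integrable lborel {s<..<t} w"
    and \<eta>: "\<And>n. \<eta> n \<in> borel_measurable borel" "\<And>n x. 0 \<le> \<eta> n x" "\<And>n x. \<eta> n x \<le> 1" "\<And>x. (\<lambda>n. \<eta> n x) \<longlonglongrightarrow> indicator {s<..<t} x"
  shows "(\<lambda>n. LINT x:{s<..<t}|lborel. \<eta> n x * w x) \<longlonglongrightarrow> (LINT x:{s<..<t}|lborel. w x)"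
  unfolding set_lebesgue_integral_def
proof (rule integral_dominated_convergence[where w="\<lambda>x. norm (indicator {s<..<t} x *\<^sub>R w x)"])
  have wm [measurable]: "(\<lambda>x. indicator {s<..<t} x *\<^sub>R w x) \<in> borel_measurable borel" using w by (auto simp: set_integrable_def)
  show "(\<lambda>x. indicat_real {s<..<t} x *\<^sub>R w x) \<in> borel_measurable lborel" by measurable
  show "(\<lambda>x. indicat_real {s<..<t} x *\<^sub>R (\<eta> n x * w x)) \<in> borel_measurable lborel" for n
  proof -
    note [measurable] = \<eta>(1)
    have "(\<lambda>x. \<eta> n x * (indicat_real {s<..<t} x *\<^sub>R w x)) \<in> borel_measurable lborel" by measurable
    then show ?thesis by (simp add: mult_ac)
  qed
  show "integrable lborel (\<lambda>x. norm (indicator {s<..<t} x *\<^sub>R w x))" using w by (auto simp: set_integrable_def simp del: real_scaleR_def)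
  show "AE x in lborel. (\<lambda>n. indicat_real {s<..<t} x *\<^sub>R (\<eta> n x * w x)) \<longlonglongrightarrow> indicat_real {s<..<t} x *\<^sub>R w x"
  proof (intro AE_I2)
    fix x
    have "(\<lambda>n. indicat_real {s<..<t} x *\<^sub>R (\<eta> n x * w x)) \<longlonglongrightarrow> indicat_real {s<..<t} x *\<^sub>R (indicator {s<..<t} x * w x)"
      by (intro tendsto_intros \<eta>)
    then show "(\<lambda>n. indicat_real {s<..<t} x *\<^sub>R (\<eta> n x * w x)) \<longlonglongrightarrow> indicat_real {s<..<t} x *\<^sub>R w x"
      by (auto simp: indicator_def split: if_splits)
  qed
  show "AE x in lborel. norm (indicat_real {s<..<t} x *\<^sub>R (\<eta> n x * w x)) \<le> norm (indicator {s<..<t} x *\<^sub>R w x)" for n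
    using \<eta>(2,3)[of n] by (intro AE_I2) (auto simp: indicator_def abs_mult intro!: mult_left_le_one_le)
qed

text \<open>Plateau functions converge boundedly to the indicator of an interval, so all interval
  integrals of \<open>w\<close> vanish. Restriction to (-N, N) makes \<open>w\<close> integrable,
  and comparison of distribution functions finishes the argument.\<close>

lemma fundamental_lemma:
  fixes w :: "real \<Rightarrow> real"
  assumes w: "\<And>a b. set_integrable lborel {a..b} w" and z: "\<And>\<phi>. test_function UNIV \<phi> \<Longrightarrow> (LINT x|lborel. w x * \<phi> x) = 0"
  shows "AE x in lborel. w x = 0"
proof -
  have zero: "(LINT x:{s<..<t}|lborel. w x) = 0" if st: "s < t" for s t :: real
  proof -
    obtain \<eta> :: "nat \<Rightarrow> real \<Rightarrow> real" where \<eta>: "\<And>n. test_function {s<..<t} (\<eta> n)" "\<And>n x. 0 \<le> \<eta> n x" "\<And>n x. \<eta> n x \<le> 1" "\<And>x. (\<lambda>n. \<eta> n x) \<longlonglongrightarrow> indicator {s<..<t} x"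
      by (rule test_plateau[OF st]) blast
    have m: "\<eta> n \<in> borel_measurable borel" for n
      by (intro borel_measurable_continuous_onI smooth_continuous test_function_smooth[OF \<eta>(1)])
    have "(LINT x:{s<..<t}|lborel. \<eta> n x * w x) = (LINT x|lborel. w x * \<eta> n x)" for n
    proof -
      obtain K where "K \<subseteq> {s<..<t}" "\<And>x. x \<notin> K \<Longrightarrow> \<eta> n x = 0" using \<eta>(1)[of n] by (auto simp: test_function_def)
      then have "\<And>x. x \<notin> {s<..<t} \<Longrightarrow> \<eta> n x = 0" by blast
      then show ?thesis unfolding set_lebesgue_integral_def
        by (intro Bochner_Integration.integral_cong refl) (fastforce simp: indicator_def mult_ac)
    qed
    also have "\<dots> n = 0" for n using z[OF test_function_mono[OF \<eta>(1)[of n]]] by simp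
    finally have "(\<lambda>n. 0) \<longlonglongrightarrow> (LINT x:{s<..<t}|lborel. w x)"
      using test_plateau_integral[OF set_integrable_subset[OF w[of s t]] m \<eta>(2-4)] greaterThanLessThan_subseteq_atLeastAtMost_iff[of s t s t] by auto
    then show ?thesis by (simp add: LIMSEQ_const_iff)
  qed
  have "AE x in lborel. x \<in> {- real N<..<real N} \<longrightarrow> w x = 0" for N :: nat
  proof -
    let ?h = "\<lambda>x. indicator {- real N<..<real N} x * w x"
    have "AE x in lborel. ?h x = 0"
    proof (rule AE_zero_of_integral_atMost)
      have "set_integrable lborel {- real N<..<real N} w"
        by (rule set_integrable_subset[OF w[of "- real N" "real N"]]) auto
      then show "integrable lborel ?h" by (simp add: set_integrable_def)
      fix x
      show "(LINT y|lborel. ?h y * indicator {..x} y) = 0"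
      proof (cases "- real N < min x (real N)")
        case True
        have "(LINT y|lborel. ?h y * indicator {..x} y) = (LINT y:{- real N<..<min x (real N)}|lborel. w y)"
          unfolding set_lebesgue_integral_def
        proof (rule integral_cong_AE)
          show "AE y in lborel. ?h y * indicator {..x} y = indicat_real {- real N<..<min x (real N)} y *\<^sub>R w y"
            using AE_lborel_singleton[of x] by eventually_elim (auto simp: indicator_def)
          have "(\<lambda>y. indicator {- real N..real N} y *\<^sub>R w y) \<in> borel_measurable borel"
            using w[of "- real N" "real N"] by (auto simp: set_integrable_def)
          then have m: "(\<lambda>y. indicator A y * (indicator {- real N..real N} y *\<^sub>R w y)) \<in> borel_measurable lborel" if "A \<in> sets borel" for A :: "real set"
            using that by measurable
          show "(\<lambda>y. ?h y * indicator {..x} y) \<in> borel_measurable lborel"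
            by (rule measurable_cong[THEN iffD1, OF _ m[of "{- real N<..<real N} \<inter> {..x}"]]) (auto simp: indicator_def)
          show "(\<lambda>y. indicat_real {- real N<..<min x (real N)} y *\<^sub>R w y) \<in> borel_measurable lborel"
            by (rule measurable_cong[THEN iffD1, OF _ m[of "{- real N<..<min x (real N)}"]]) (auto simp: indicator_def)
        qed
        then show ?thesis using zero[OF True] by simp
      next
        case False
        have "(LINT y|lborel. ?h y * indicator {..x} y) = (LINT (y::real)|lborel. 0)"
          by (rule Bochner_Integration.integral_cong) (use False in \<open>auto simp: indicator_def\<close>)
        then show ?thesis by simp
      qed
    qed
    then show ?thesis by eventually_elim (auto simp: indicator_def)
  qed
  then have "AE x in lborel. \<forall>N. x \<in> {- real N<..<real N} \<longrightarrow> w x = 0" by (subst AE_all_countable) blast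
  then show ?thesis
  proof eventually_elim
    case (elim x)
    obtain N where "\<bar>x\<bar> < real N" using reals_Archimedean2 by blast
    then show ?case using elim by (auto simp: abs_less_iff)
  qed
qed

text \<open>The weak equation is tested with plateaus on (0, t), whose derivatives tend to a unit
  mass at 0 minus a unit mass at t. Continuity of \<open>a\<close> up to the endpoints gives the
  limit on the left, dominated convergence the one on the right.\<close>

lemma weak_FTC:
  fixes a b :: "real \<Rightarrow> real"
  assumes T: "0 < t" "t \<le> T" and a: "continuous_on {0..T} a" and b: "set_integrable lborel {0<..<T} b"
    and weak: "\<And>\<eta>. test_function {0<..<T} \<eta> \<Longrightarrow> (LINT t:{0<..<T}|lborel. deriv \<eta> t * a t) = - (LINT t:{0<..<T}|lborel. \<eta> t * b t)"
  shows "a t = a 0 + (LINT s:{0<..<t}|lborel. b s)"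
proof -
  obtain \<eta> :: "nat \<Rightarrow> real \<Rightarrow> real" and F1 F2 and \<delta> :: "nat \<Rightarrow> real"
  where \<eta>: "\<And>n. test_function {0<..<t} (\<eta> n)" "\<And>n x. 0 \<le> \<eta> n x" "\<And>n x. \<eta> n x \<le> 1" "\<And>x. (\<lambda>n. \<eta> n x) \<longlonglongrightarrow> indicator {0<..<t} x"
    and d\<eta>: "\<And>n x. deriv (\<eta> n) x = deriv (F1 n) x - deriv (F2 n) x"
    and \<delta>: "\<And>n. \<delta> n > 0" "\<delta> \<longlonglongrightarrow> 0" "\<And>n. 0 + 2 * \<delta> n < t - 2 * \<delta> n"
    and sm: "\<And>n. smooth (F1 n)" "\<And>n. smooth (F2 n)"
    and F: "\<And>n. F1 n (0 + \<delta> n) = 0" "\<And>n. F1 n (0 + 2 * \<delta> n) = 1" "\<And>n. F2 n (t - 2 * \<delta> n) = 0" "\<And>n. F2 n (t - \<delta> n) = 1"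
    and dF: "\<And>n x. deriv (F1 n) x \<ge> 0" "\<And>n x. deriv (F2 n) x \<ge> 0"
    and dF0: "\<And>n x. x \<notin> {0 + \<delta> n..0 + 2 * \<delta> n} \<Longrightarrow> deriv (F1 n) x = 0" "\<And>n x. x \<notin> {t - 2 * \<delta> n..t - \<delta> n} \<Longrightarrow> deriv (F2 n) x = 0"
    by (rule test_plateau[OF T(1)]) blast
  \<comment> \<open>One statement for both endpoints: \<open>p\<close> is 0 with the rising steps,
    and \<open>t\<close> with the falling ones.\<close>
  have lim: "(\<lambda>n. LINT x:{c n..d n}|lborel. deriv (F n) x * a x) \<longlonglongrightarrow> a p"
    if p: "p \<in> {0..T}" and cd: "\<And>n. c n < d n" "\<And>n. {c n..d n} \<subseteq> {0..T}" "\<And>n x. x \<in> {c n..d n} \<Longrightarrow> \<bar>x - p\<bar> \<le> 2 * \<delta> n"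
      and F: "\<And>n. smooth (F n)" "\<And>n. F n (c n) = 0" "\<And>n. F n (d n) = 1" "\<And>n x. deriv (F n) x \<ge> 0"
    for p c d and F :: "nat \<Rightarrow> real \<Rightarrow> real"
  proof (rule LIMSEQ_I)
    fix e :: real assume "e > 0"
    then have "e / 2 > 0" by simp
    then obtain r where r: "r > 0" "\<And>x. x \<in> {0..T} \<Longrightarrow> dist x p < r \<Longrightarrow> dist (a x) (a p) < e / 2"
      using a p unfolding continuous_on_iff by metis
    have "eventually (\<lambda>n. \<delta> n < r / 2) sequentially" using \<delta>(2) r(1) by (intro order_tendstoD) auto
    then obtain n0 where n0: "\<And>n. n \<ge> n0 \<Longrightarrow> \<delta> n < r / 2" by (auto simp: eventually_sequentially)
    have "\<bar>(LINT x:{c n..d n}|lborel. deriv (F n) x * a x) - a p\<bar> \<le> e / 2" if "n \<ge> n0" for n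
    proof (rule weighted_average[OF cd(1) F])
      show "continuous_on {c n..d n} a" using continuous_on_subset[OF a cd(2)] .
      fix x assume x: "x \<in> {c n..d n}"
      then have "dist x p < r" using cd(3)[OF x] n0[OF that] by (simp add: dist_real_def)
      with r(2)[of x] x cd(2)[of n] show "\<bar>a x - a p\<bar> \<le> e / 2" by (force simp: dist_real_def)
    qed
    then show "\<exists>no. \<forall>n\<ge>no. norm ((LINT x:{c n..d n}|lborel. deriv (F n) x * a x) - a p) < e"
      using \<open>e > 0\<close> by (intro exI[of _ n0]) force
  qed
  have l1: "(\<lambda>n. LINT x:{0 + \<delta> n..0 + 2 * \<delta> n}|lborel. deriv (F1 n) x * a x) \<longlonglongrightarrow> a 0"
  proof (rule lim)
    fix n show "{0 + \<delta> n..0 + 2 * \<delta> n} \<subseteq> {0..T}" "0 + \<delta> n < 0 + 2 * \<delta> n" using \<delta>(1,3)[of n] T by auto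
    show "\<bar>x - 0\<bar> \<le> 2 * \<delta> n" if "x \<in> {0 + \<delta> n..0 + 2 * \<delta> n}" for x using that \<delta>(1)[of n] by auto
  qed (use T sm F dF in auto)
  have l2: "(\<lambda>n. LINT x:{t - 2 * \<delta> n..t - \<delta> n}|lborel. deriv (F2 n) x * a x) \<longlonglongrightarrow> a t"
  proof (rule lim)
    fix n show "{t - 2 * \<delta> n..t - \<delta> n} \<subseteq> {0..T}" "t - 2 * \<delta> n < t - \<delta> n" using \<delta>(1,3)[of n] T by auto
    show "\<bar>x - t\<bar> \<le> 2 * \<delta> n" if "x \<in> {t - 2 * \<delta> n..t - \<delta> n}" for x using that \<delta>(1)[of n] by auto
  qed (use T sm F dF in auto)
  have split: "(LINT x:{0<..<T}|lborel. deriv (\<eta> n) x * a x) = (LINT x:{0 + \<delta> n..0 + 2 * \<delta> n}|lborel. deriv (F1 n) x * a x) - (LINT x:{t - 2 * \<delta> n..t - \<delta> n}|lborel. deriv (F2 n) x * a x)" for n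
  proof -
    have i: "set_integrable lborel {0 + \<delta> n..0 + 2 * \<delta> n} (\<lambda>x. deriv (F1 n) x * a x)" "set_integrable lborel {t - 2 * \<delta> n..t - \<delta> n} (\<lambda>x. deriv (F2 n) x * a x)"
      using \<delta>(1,3)[of n] T
      by - (rule borel_integrable_atLeastAtMost', rule continuous_on_mult, rule smooth_continuous, rule smooth_deriv, rule sm, rule continuous_on_subset[OF a], force)+
    have "(LINT x:{0<..<T}|lborel. deriv (\<eta> n) x * a x) = (LINT x|lborel. indicator {0 + \<delta> n..0 + 2 * \<delta> n} x *\<^sub>R (deriv (F1 n) x * a x) - indicator {t - 2 * \<delta> n..t - \<delta> n} x *\<^sub>R (deriv (F2 n) x * a x))"
      unfolding set_lebesgue_integral_def
    proof (rule Bochner_Integration.integral_cong[OF refl])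
      fix x
      have "indicator {0<..<T} x *\<^sub>R deriv (F1 n) x = indicator {0 + \<delta> n..0 + 2 * \<delta> n} x *\<^sub>R deriv (F1 n) x"
        using dF0(1)[of x n] \<delta>(1,3)[of n] T by (auto simp: indicator_def)
      moreover have "indicator {0<..<T} x *\<^sub>R deriv (F2 n) x = indicator {t - 2 * \<delta> n..t - \<delta> n} x *\<^sub>R deriv (F2 n) x"
        using dF0(2)[of x n] \<delta>(1,3)[of n] T by (auto simp: indicator_def)
      ultimately show "indicat_real {0<..<T} x *\<^sub>R (deriv (\<eta> n) x * a x) = indicator {0 + \<delta> n..0 + 2 * \<delta> n} x *\<^sub>R (deriv (F1 n) x * a x) - indicator {t - 2 * \<delta> n..t - \<delta> n} x *\<^sub>R (deriv (F2 n) x * a x)"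
        unfolding d\<eta> by (simp only: real_scaleR_def mult.assoc[symmetric] left_diff_distrib right_diff_distrib)
    qed
    also have "\<dots> = (LINT x:{0 + \<delta> n..0 + 2 * \<delta> n}|lborel. deriv (F1 n) x * a x) - (LINT x:{t - 2 * \<delta> n..t - \<delta> n}|lborel. deriv (F2 n) x * a x)"
      using i unfolding set_integrable_def set_lebesgue_integral_def by (rule Bochner_Integration.integral_diff)
    finally show ?thesis .
  qed
  have m: "\<eta> n \<in> borel_measurable borel" for n
    by (intro borel_measurable_continuous_onI smooth_continuous test_function_smooth[OF \<eta>(1)])
  have r: "(LINT x:{0<..<T}|lborel. \<eta> n x * b x) = (LINT x:{0<..<t}|lborel. \<eta> n x * b x)" for n
  proof -
    obtain K where "K \<subseteq> {0<..<t}" "\<And>x. x \<notin> K \<Longrightarrow> \<eta> n x = 0" using \<eta>(1)[of n] by (auto simp: test_function_def)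
    then have "\<And>x. x \<notin> {0<..<t} \<Longrightarrow> \<eta> n x = 0" by blast
    then show ?thesis unfolding set_lebesgue_integral_def using T
      by (intro Bochner_Integration.integral_cong refl) (fastforce simp: indicator_def)
  qed
  have "set_integrable lborel {0<..<t} b" by (rule set_integrable_subset[OF b]) (use T in auto)
  from test_plateau_integral[OF this m \<eta>(2-4)]
  have "(\<lambda>n. - (LINT x:{0<..<T}|lborel. \<eta> n x * b x)) \<longlonglongrightarrow> - (LINT s:{0<..<t}|lborel. b s)" unfolding r by (rule tendsto_minus)
  moreover have "test_function {0<..<T} (\<eta> n)" for n by (rule test_function_mono[OF \<eta>(1)]) (use T in auto)
  ultimately have "(\<lambda>n. LINT x:{0<..<T}|lborel. deriv (\<eta> n) x * a x) \<longlonglongrightarrow> - (LINT s:{0<..<t}|lborel. b s)"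
    by (simp add: weak)
  moreover have "(\<lambda>n. LINT x:{0<..<T}|lborel. deriv (\<eta> n) x * a x) \<longlonglongrightarrow> a 0 - a t"
    unfolding split by (rule tendsto_diff[OF l1 l2])
  ultimately show ?thesis using LIMSEQ_unique by fastforce
qed

section \<open>Weak derivatives and Fourier multipliers\<close>

lemma test_function_Cc:
  assumes "test_function UNIV \<phi>"
  shows "(\<lambda>x. complex_of_real (\<phi> x)) \<in> Cc" "(\<lambda>x. complex_of_real (deriv \<phi> x)) \<in> Cc"
    and "\<exists>R>0. \<forall>x. R \<le> \<bar>x\<bar> \<longrightarrow> \<phi> x = 0 \<and> deriv \<phi> x = 0"
proof -
  obtain K where K: "compact K" "\<And>x. x \<notin> K \<Longrightarrow> \<phi> x = 0" "\<And>x. x \<notin> K \<Longrightarrow> deriv \<phi> x = 0"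
    using test_function_support[OF assms] by metis
  obtain B where B: "\<forall>x\<in>K. norm x \<le> B" using compact_imp_bounded[OF K(1)] bounded_iff by blast
  then have z: "\<phi> x = 0 \<and> deriv \<phi> x = 0" if "\<bar>x\<bar> > B" for x
    using K(2,3)[of x] that by (force simp: not_le[symmetric])
  then show "\<exists>R>0. \<forall>x. R \<le> \<bar>x\<bar> \<longrightarrow> \<phi> x = 0 \<and> deriv \<phi> x = 0"
    by (intro exI[of _ "\<bar>B\<bar> + 1"]) auto
  note s = test_function_smooth[OF assms]
  show "(\<lambda>x. complex_of_real (\<phi> x)) \<in> Cc" "(\<lambda>x. complex_of_real (deriv \<phi> x)) \<in> Cc"
    unfolding Cc_def using z by (auto intro!: continuous_intros smooth_continuous smooth_deriv s)
qed

lemma cft_deriv: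
  assumes t: "test_function UNIV \<phi>"
  shows "cft (\<lambda>x. complex_of_real (deriv \<phi> x)) k = \<i> * k * cft (\<lambda>x. complex_of_real (\<phi> x)) k"
proof -
  obtain R where R: "R > 0" "\<And>x. R \<le> \<bar>x\<bar> \<Longrightarrow> \<phi> x = 0" "\<And>x. R \<le> \<bar>x\<bar> \<Longrightarrow> deriv \<phi> x = 0"
    using test_function_Cc(3)[OF t] by auto
  note s = test_function_smooth[OF t]
  let ?e = "\<lambda>x. exp (- \<i> * complex_of_real (k * x))"
  let ?D = "\<lambda>x. complex_of_real (deriv \<phi> x) * ?e x - \<i> * k * (complex_of_real (\<phi> x) * ?e x)"
  have D: "((\<lambda>x. complex_of_real (\<phi> x) * ?e x) has_vector_derivative ?D x) (at x within A)" for x A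
  proof -
    have 1: "((\<lambda>x. complex_of_real (\<phi> x)) has_vector_derivative complex_of_real (deriv \<phi> x)) (at x within A)"
      using smooth_DERIV[OF s, of x]
      by (intro has_vector_derivative_of_real) (auto simp: has_real_derivative_iff_has_vector_derivative intro: has_vector_derivative_at_within)
    have "(?e has_vector_derivative ?e x * (- \<i> * k)) (at x within A)"
    proof -
      have "((\<lambda>z. exp (- \<i> * (of_real k * z))) has_field_derivative ?e x * (- \<i> * k)) (at (complex_of_real x))"
        by (auto intro!: derivative_eq_intros)
      from has_vector_derivative_real_field[OF this] show ?thesis by (simp add: has_vector_derivative_at_within)
    qed
    from has_vector_derivative_mult[OF 1 this] show ?thesis by (simp add: algebra_simps)
  qed
  have "(LINT x|lborel. indicator {-R..R} x *\<^sub>R ?D x) = complex_of_real (\<phi> R) * ?e R - complex_of_real (\<phi> (-R)) * ?e (- R)"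
    by (rule integral_FTC_Icc) (use R(1) D in \<open>auto intro!: continuous_intros smooth_continuous smooth_deriv s\<close>)
  also have "\<dots> = 0" using R by simp
  also have "(LINT x|lborel. indicator {-R..R} x *\<^sub>R ?D x) = (LINT x|lborel. ?D x)"
    using R by (intro Bochner_Integration.integral_cong) (auto simp: indicator_def abs_le_iff not_le)
  also have "\<dots> = (LINT x|lborel. complex_of_real (deriv \<phi> x) * ?e x) - (LINT x|lborel. \<i> * k * (complex_of_real (\<phi> x) * ?e x))"
    by (intro Bochner_Integration.integral_diff integrable_mult_right integrable_mult_exp Cc_integrable test_function_Cc t)
  finally show ?thesis unfolding cft_def integral_mult_right_zero by (simp add: mult_ac)
qed

lemma L2C_set_integrable:
  assumes "(\<lambda>x. complex_of_real (w x)) \<in> L2C" shows "set_integrable lborel {a..b} w"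
proof -
  have "(\<lambda>x. complex_of_real (indicator {a..b} x)) \<in> L2C"
    by (rule bounded_support_L2C[where B=1 and R="max \<bar>a\<bar> \<bar>b\<bar>"]) (auto simp: indicator_def)
  from L2C_integrable_mult[OF this assms] have "integrable lborel (\<lambda>x. complex_of_real (indicator {a..b} x * w x))"
    by simp
  then show ?thesis unfolding complex_of_real_integrable_eq by (simp add: set_integrable_def)
qed

text \<open>A function with transform \<open>i k U\<close> exists and is real by symmetry;
  Parseval's identity against test functions shows that it is a weak derivative.\<close>

lemma FT_weak_deriv:
  assumes U: "FT (\<lambda>x. complex_of_real (u x)) U" and L: "(\<lambda>k. \<i> * k * U k) \<in> L2C"
  shows "FT (\<lambda>x. complex_of_real (weak_deriv u x)) (\<lambda>k. \<i> * k * U k)"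
proof -
  obtain w' where w': "FT w' (\<lambda>k. \<i> * complex_of_real k * U k)" using FT_surj[OF L] by blast
  define w where "w x = Re (w' x)" for x
  have w: "FT (\<lambda>x. complex_of_real (w x)) (\<lambda>k. \<i> * complex_of_real k * U k)"
    unfolding w_def by (rule FT_real[OF w']) (use FT_hermitian[OF U] in \<open>eventually_elim, simp\<close>)
  have weak: "is_weak_deriv u w"
    unfolding is_weak_deriv_def
  proof (intro conjI allI impI)
    show "w \<in> borel_measurable lborel" using FT_fourier(1)[OF w] by (simp add: L2_def)
    show "set_integrable lborel {a..b} w" for a b by (rule L2C_set_integrable[OF FT_L2C(1)[OF w]])
    fix \<phi> assume t: "test_function UNIV \<phi>"
    note c = test_function_Cc[OF t]
    have "(LINT x|lborel. complex_of_real (u x) * cnj (complex_of_real (deriv \<phi> x))) = (LINT k|lborel. U k * cnj (cft (\<lambda>x. complex_of_real (deriv \<phi> x)) k))"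
      by (rule FT_Parseval[OF U FT_Cc[OF c(2)], symmetric])
    also have "\<dots> = (LINT k|lborel. - ((\<i> * k * U k) * cnj (cft (\<lambda>x. complex_of_real (\<phi> x)) k)))"
      by (simp only: cft_deriv[OF t]) (simp add: mult_ac)
    also have "\<dots> = - (LINT x|lborel. complex_of_real (w x) * cnj (complex_of_real (\<phi> x)))"
      by (simp only: Bochner_Integration.integral_minus FT_Parseval[OF w FT_Cc[OF c(1)]])
    finally have "complex_of_real (LINT x|lborel. u x * deriv \<phi> x) = complex_of_real (- (LINT x|lborel. w x * \<phi> x))"
      by (simp only: complex_cnj_complex_of_real of_real_mult[symmetric] integral_complex_of_real of_real_minus)
    then show "(LINT x|lborel. u x * deriv \<phi> x) = - (LINT x|lborel. w x * \<phi> x)" by (simp only: of_real_eq_iff)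
  qed
  then have wd: "is_weak_deriv u (weak_deriv u)" unfolding weak_deriv_def by (rule someI[where P="is_weak_deriv u"])
  \<comment> \<open>\<open>weak_deriv\<close> is only some weak derivative, possibly another one, so
    uniqueness up to null sets has to identify it with \<open>w\<close>.\<close>
  have "AE x in lborel. weak_deriv u x - w x = 0"
  proof (rule fundamental_lemma)
    show "set_integrable lborel {a..b} (\<lambda>x. weak_deriv u x - w x)" for a b
      using weak wd by (intro set_integral_diff) (auto simp: is_weak_deriv_def)
    fix \<phi> assume t: "test_function UNIV \<phi>"
    obtain R where R: "R > 0" "\<And>x. R \<le> \<bar>x\<bar> \<Longrightarrow> \<phi> x = 0" using test_function_Cc(3)[OF t] by auto
    obtain B where B: "\<And>x. cmod (complex_of_real (\<phi> x)) \<le> B" using Cc_bounded[OF test_function_Cc(1)[OF t]] by metis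
    have [measurable]: "\<phi> \<in> borel_measurable borel"
      by (intro borel_measurable_continuous_onI smooth_continuous test_function_smooth[OF t])
    have i: "integrable lborel (\<lambda>x. v x * \<phi> x)" if v: "is_weak_deriv u v" for v
    proof (rule Bochner_Integration.integrable_bound)
      show "integrable lborel (\<lambda>x. B * (indicator {-R..R} x *\<^sub>R v x))"
        using v unfolding is_weak_deriv_def set_integrable_def by (intro integrable_mult_right) blast
      show "(\<lambda>x. v x * \<phi> x) \<in> borel_measurable lborel" using v unfolding is_weak_deriv_def by auto
      show "AE x in lborel. norm (v x * \<phi> x) \<le> norm (B * (indicat_real {- R..R} x *\<^sub>R v x))"
      proof (intro AE_I2)
        fix x
        show "norm (v x * \<phi> x) \<le> norm (B * (indicat_real {- R..R} x *\<^sub>R v x))"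
        proof (cases "R \<le> \<bar>x\<bar>")
          case False
          then have "x \<in> {-R..R}" by auto
          then show ?thesis using B[of x] using mult_right_mono[OF order_trans[OF B[of x] abs_ge_self] abs_ge_zero[of "v x"]] by (simp add: abs_mult mult.commute)
        qed (use R in simp)
      qed
    qed
    have "(LINT x|lborel. (weak_deriv u x - w x) * \<phi> x) = (LINT x|lborel. weak_deriv u x * \<phi> x) - (LINT x|lborel. w x * \<phi> x)"
      by (subst left_diff_distrib) (rule Bochner_Integration.integral_diff[OF i[OF wd] i[OF weak]])
    also have "\<dots> = 0"
    proof -
      have "(LINT x|lborel. u x * deriv \<phi> x) = - (LINT x|lborel. v x * \<phi> x)" if "is_weak_deriv u v" for v
        using that t unfolding is_weak_deriv_def by blast
      from this[OF wd] this[OF weak] show ?thesis by linarith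
    qed
    finally show "(LINT x|lborel. (weak_deriv u x - w x) * \<phi> x) = 0" .
  qed
  then have eq: "AE x in lborel. complex_of_real (weak_deriv u x) = complex_of_real (w x)"
    by eventually_elim simp
  have [measurable]: "weak_deriv u \<in> borel_measurable borel" using wd by (simp add: is_weak_deriv_def)
  have "(\<lambda>x. complex_of_real (weak_deriv u x)) \<in> borel_measurable borel" by measurable
  from FT_cong[OF w this eq FT_measurable(2)[OF w]] show ?thesis by simp
qed

text \<open>The symmetry of \<open>m\<close> is what lets a real function have the transform
  \<open>m H\<close>. Such a function witnesses the choice in \<open>fourier_multiplier\<close>, and
  the chosen function has the same transform almost everywhere.\<close>

lemma FT_multiplier:
  assumes H: "FT (\<lambda>x. complex_of_real (h x)) H" and L: "(\<lambda>k. m k * H k) \<in> L2C"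
    and m: "m \<in> borel_measurable borel" "\<And>k. m (- k) = cnj (m k)"
  shows "FT (\<lambda>x. complex_of_real (fourier_multiplier m h x)) (\<lambda>k. m k * H k)"
proof -
  let ?P = "\<lambda>g. g \<in> L2 \<and> (AE k in lborel. fourier g k = m k * fourier h k)"
  obtain w where w: "FT w (\<lambda>k. m k * H k)" using FT_surj[OF L] by blast
  have w: "FT (\<lambda>x. complex_of_real (Re (w x))) (\<lambda>k. m k * H k)"
    by (rule FT_real[OF w]) (use FT_hermitian[OF H] in \<open>eventually_elim, simp add: m\<close>)
  have hH: "AE k in lborel. fourier h k = H k" by (rule FT_fourier[OF H])
  have "?P (\<lambda>x. Re (w x))"
    using FT_fourier[OF w] hH by auto
  then have P: "?P (fourier_multiplier m h)" unfolding fourier_multiplier_def by (rule someI[where P="?P"])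
  then have eq: "AE k in lborel. m k * H k = fourier (fourier_multiplier m h) k"
    using hH by auto
  have F: "FT (\<lambda>x. complex_of_real (fourier_multiplier m h x)) (fourier (fourier_multiplier m h))"
    using P by (intro fourier_FT) blast
  from FT_cong[OF F FT_measurable(1)[OF F] _ L2C_measurable[OF L] eq] show ?thesis by simp
qed

section \<open>Sobolev spaces as weighted L2 spaces\<close>

definition wt :: "nat \<Rightarrow> (real \<Rightarrow> complex) \<Rightarrow> real \<Rightarrow> complex" where
  "wt s F k = complex_of_real ((1 + \<bar>k\<bar>) ^ s) * F k"

lemma cmod_one_plus_abs [simp]: "cmod (1 + complex_of_real \<bar>k\<bar>) = 1 + \<bar>k\<bar>"
  by (metis abs_ge_zero add_nonneg_nonneg norm_of_real of_real_1 of_real_add zero_le_one abs_of_nonneg)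

lemma wt_measurable [measurable]: "F \<in> borel_measurable borel \<Longrightarrow> wt s F \<in> borel_measurable borel"
  unfolding wt_def by measurable

lemma cmod_wt: "cmod (wt s F k) = (1 + \<bar>k\<bar>) ^ s * cmod (F k)"
  by (simp add: wt_def norm_mult norm_power)

lemma one_plus_power_le:
  fixes x :: real assumes "x \<ge> 0" shows "(1 + x) ^ n \<le> 2 ^ n * (1 + x ^ n)"
proof (cases "x \<le> 1")
  case True
  then have "(1 + x) ^ n \<le> 2 ^ n" using assms by (intro power_mono) auto
  also have "\<dots> \<le> 2 ^ n * (1 + x ^ n)" using assms by simp
  finally show ?thesis .
next
  case False
  then have "(1 + x) ^ n \<le> (2 * x) ^ n" by (intro power_mono) auto
  also have "\<dots> \<le> 2 ^ n * (1 + x ^ n)" using assms by (simp add: power_mult_distrib)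
  finally show ?thesis .
qed

text \<open>The powers of 1 + |k| are preferred to the weight of the definition because 1 + |k| is
  at most (1 + |k - m|) + (1 + |m|), which splits weights inside a convolution. The price is the
  pair of constants 2 and \<open>4 ^ s\<close>; the second is 64 for \<open>s = 3\<close>.\<close>

lemma sobolev_weight:
  assumes "s \<ge> 1"
  shows "(1 + \<bar>n\<bar> powr (2 * real s)) \<le> 2 * ((1 + \<bar>n\<bar>) ^ s)\<^sup>2" "((1 + \<bar>n\<bar>) ^ s)\<^sup>2 \<le> 4 ^ s * (1 + \<bar>n\<bar> powr (2 * real s))"
proof -
  have p: "\<bar>n\<bar> powr (2 * real s) = \<bar>n\<bar> ^ (2 * s)"
    using powr_realpow[of "\<bar>n\<bar>" "2 * s"] assms by (cases "n = 0") auto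
  have q: "((1 + \<bar>n\<bar>) ^ s)\<^sup>2 = (1 + \<bar>n\<bar>) ^ (2 * s)" by (simp add: power_mult mult.commute)
  have "1 \<le> (1 + \<bar>n\<bar>) ^ (2 * s)" "\<bar>n\<bar> ^ (2 * s) \<le> (1 + \<bar>n\<bar>) ^ (2 * s)" by (auto intro: one_le_power power_mono)
  then show "(1 + \<bar>n\<bar> powr (2 * real s)) \<le> 2 * ((1 + \<bar>n\<bar>) ^ s)\<^sup>2" unfolding p q by linarith
  show "((1 + \<bar>n\<bar>) ^ s)\<^sup>2 \<le> 4 ^ s * (1 + \<bar>n\<bar> powr (2 * real s))"
    unfolding p q using one_plus_power_le[of "\<bar>n\<bar>" "2 * s"] by (simp add: power_mult)
qed

lemma sobolev_iff:
  assumes H: "FT (\<lambda>x. complex_of_real (h x)) H" and s: "s \<ge> 1"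
  shows "h \<in> sobolev (real s) \<longleftrightarrow> wt s H \<in> L2C"
proof -
  note [measurable] = FT_measurable(2)[OF H] FT_measurable(2)[OF fourier_FT[OF FT_fourier(1)[OF H]]]
  have "integrable lborel (\<lambda>n. (1 + \<bar>n\<bar> powr (2 * real s)) * (cmod (fourier h n))\<^sup>2) \<longleftrightarrow> integrable lborel (\<lambda>n. (1 + \<bar>n\<bar> powr (2 * real s)) * (cmod (H n))\<^sup>2)"
    by (rule integrable_cong_AE) (use FT_fourier(2)[OF H] in \<open>auto elim!: eventually_mono\<close>)
  also have "\<dots> \<longleftrightarrow> integrable lborel (\<lambda>n. (cmod (wt s H n))\<^sup>2)"
  proof
    assume "integrable lborel (\<lambda>n. (1 + \<bar>n\<bar> powr (2 * real s)) * (cmod (H n))\<^sup>2)"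
    from integrable_mult_right[OF this, of "4 ^ s"]
    show "integrable lborel (\<lambda>n. (cmod (wt s H n))\<^sup>2)"
    proof (rule Bochner_Integration.integrable_bound)
      show "AE n in lborel. norm ((cmod (wt s H n))\<^sup>2) \<le> norm (4 ^ s * ((1 + \<bar>n\<bar> powr (2 * real s)) * (cmod (H n))\<^sup>2))"
        using sobolev_weight(2)[OF s]
        by (intro AE_I2) (auto simp: cmod_wt norm_mult power_mult_distrib mult.assoc[symmetric] intro!: mult_right_mono)
    qed (unfold wt_def, measurable)
  next
    assume "integrable lborel (\<lambda>n. (cmod (wt s H n))\<^sup>2)"
    from integrable_mult_right[OF this, of "2"]
    show "integrable lborel (\<lambda>n. (1 + \<bar>n\<bar> powr (2 * real s)) * (cmod (H n))\<^sup>2)"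
    proof (rule Bochner_Integration.integrable_bound)
      show "AE n in lborel. norm ((1 + \<bar>n\<bar> powr (2 * real s)) * (cmod (H n))\<^sup>2) \<le> norm (2 * (cmod (wt s H n))\<^sup>2)"
        using sobolev_weight(1)[OF s]
        by (intro AE_I2) (auto simp: cmod_wt norm_mult power_mult_distrib mult.assoc[symmetric] intro!: mult_right_mono)
    qed measurable
  qed
  finally show ?thesis using FT_fourier(1)[OF H] FT_measurable(2)[OF H]
    by (simp add: sobolev_def L2C_iff wt_measurable)
qed

lemma sobolev_norm_bounds:
  assumes H: "FT (\<lambda>x. complex_of_real (h x)) H" and s: "s \<ge> 1" and L: "wt s H \<in> L2C"
  shows "ennreal ((sobolev_norm (real s) h)\<^sup>2) \<le> 2 * sqn (wt s H)" "sqn (wt s H) \<le> ennreal (4 ^ s * (sobolev_norm (real s) h)\<^sup>2)"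
proof -
  note [measurable] = FT_measurable(2)[OF H] FT_measurable(2)[OF fourier_FT[OF FT_fourier(1)[OF H]]]
  let ?f = "\<lambda>n. (1 + \<bar>n\<bar> powr (2 * real s)) * (cmod (fourier h n))\<^sup>2"
  have i: "integrable lborel ?f"
    using sobolev_iff[OF H s] L by (simp add: sobolev_def)
  have "(LINT n|lborel. ?f n) \<ge> 0" by (intro integral_nonneg_AE) auto
  then have "(sobolev_norm (real s) h)\<^sup>2 = (LINT n|lborel. ?f n)" by (simp add: sobolev_norm_def)
  then have eq: "ennreal ((sobolev_norm (real s) h)\<^sup>2) = (\<integral>\<^sup>+n. ennreal (?f n) \<partial>lborel)"
    using nn_integral_eq_integral[OF i] by simp
  have "(\<integral>\<^sup>+n. ennreal (?f n) \<partial>lborel) \<le> (\<integral>\<^sup>+n. 2 * ennreal ((cmod (wt s H n))\<^sup>2) \<partial>lborel)"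
  proof (rule nn_integral_mono_AE)
    show "AE n in lborel. ennreal (?f n) \<le> 2 * ennreal ((cmod (wt s H n))\<^sup>2)"
      using FT_fourier(2)[OF H]
    proof eventually_elim
      case (elim n)
      have "?f n \<le> 2 * (cmod (wt s H n))\<^sup>2"
        using sobolev_weight(1)[OF s, of n] elim by (auto simp: cmod_wt norm_mult power_mult_distrib mult.assoc[symmetric] intro!: mult_right_mono)
      from ennreal_leI[OF this] show ?case by (simp add: ennreal_mult)
    qed
  qed
  also have "\<dots> = 2 * sqn (wt s H)" unfolding sqn_def by (rule nn_integral_cmult) (unfold wt_def, measurable)
  finally show "ennreal ((sobolev_norm (real s) h)\<^sup>2) \<le> 2 * sqn (wt s H)" unfolding eq .
  have "sqn (wt s H) \<le> (\<integral>\<^sup>+n. ennreal (4 ^ s) * ennreal (?f n) \<partial>lborel)"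
    unfolding sqn_def
  proof (rule nn_integral_mono_AE)
    show "AE n in lborel. ennreal ((cmod (wt s H n))\<^sup>2) \<le> ennreal (4 ^ s) * ennreal (?f n)"
      using FT_fourier(2)[OF H]
    proof eventually_elim
      case (elim n)
      have "(cmod (wt s H n))\<^sup>2 \<le> 4 ^ s * ?f n"
        using sobolev_weight(2)[OF s, of n] elim by (auto simp: cmod_wt norm_mult power_mult_distrib mult.assoc[symmetric] intro!: mult_right_mono)
      from ennreal_leI[OF this] show ?case by (simp add: ennreal_mult)
    qed
  qed
  also have "\<dots> = ennreal (4 ^ s) * ennreal ((sobolev_norm (real s) h)\<^sup>2)" unfolding eq by (rule nn_integral_cmult) measurable
  finally show "sqn (wt s H) \<le> ennreal (4 ^ s * (sobolev_norm (real s) h)\<^sup>2)" by (simp add: ennreal_mult)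
qed

lemma wt_L2C_mult:
  assumes F: "wt s F \<in> L2C" "F \<in> borel_measurable borel" and m: "m \<in> borel_measurable borel" "\<And>k. cmod (m k) \<le> C * (1 + \<bar>k\<bar>) ^ s"
  shows "(\<lambda>k. m k * F k) \<in> L2C"
proof (rule L2C_bound[OF L2C_cmult[OF F(1), of "of_real \<bar>C\<bar>"]])
  have "cmod (m k) \<le> \<bar>C\<bar> * (1 + \<bar>k\<bar>) ^ s" for k
    using m(2)[of k] by (rule order_trans) (auto intro!: mult_right_mono)
  from mult_right_mono[OF this norm_ge_zero]
  show "AE k in lborel. cmod (m k * F k) \<le> cmod (complex_of_real \<bar>C\<bar> * wt s F k)"
    by (intro AE_I2) (simp add: norm_mult cmod_wt mult.assoc)
qed (use F m in auto)

text \<open>The source of every passage from L2 to L1 below: by Cauchy-Schwarz against this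
  function, one power of the weight buys integrability.\<close>

lemma decay_L2C: "(\<lambda>k. complex_of_real (1 / (1 + \<bar>k\<bar>))) \<in> L2C"
proof -
  have "set_integrable lborel (einterval (-\<infinity>) \<infinity>) (\<lambda>x. inverse (1 + x\<^sup>2) :: real)" by (rule integrable_inverse_1_plus_square)
  then have "integrable lborel (\<lambda>x::real. inverse (1 + x\<^sup>2))" by (simp add: set_integrable_def)
  then have "integrable lborel (\<lambda>k. (cmod (complex_of_real (1 / (1 + \<bar>k\<bar>))))\<^sup>2)"
  proof (rule Bochner_Integration.integrable_bound)
    show "AE x in lborel. norm ((cmod (complex_of_real (1 / (1 + \<bar>x\<bar>))))\<^sup>2) \<le> norm (inverse (1 + x\<^sup>2))"
    proof (intro AE_I2)
      fix x :: real
      have "1 + x\<^sup>2 \<le> (1 + \<bar>x\<bar>)\<^sup>2" by (simp add: power2_sum)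
      moreover have "0 < 1 + x\<^sup>2" by (smt (verit) zero_le_power2)
      ultimately have "inverse ((1 + \<bar>x\<bar>)\<^sup>2) \<le> inverse (1 + x\<^sup>2)" by (rule le_imp_inverse_le)
      then show "norm ((cmod (complex_of_real (1 / (1 + \<bar>x\<bar>))))\<^sup>2) \<le> norm (inverse (1 + x\<^sup>2))"
        by (simp add: norm_divide power_divide inverse_eq_divide norm_power)
    qed
  qed measurable
  then show ?thesis by (simp add: L2C_iff)
qed

lemma wt_integrable_mult:
  assumes F: "wt (Suc s) F \<in> L2C" "F \<in> borel_measurable borel" and m: "m \<in> borel_measurable borel" "\<And>k. cmod (m k) \<le> C * (1 + \<bar>k\<bar>) ^ s"
  shows "integrable lborel (\<lambda>k. m k * F k)"
proof -
  have "(\<lambda>k. (complex_of_real (1 + \<bar>k\<bar>) * m k) * F k) \<in> L2C"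
  proof (rule wt_L2C_mult[OF F])
    show "cmod (complex_of_real (1 + \<bar>k\<bar>) * m k) \<le> C * (1 + \<bar>k\<bar>) ^ Suc s" for k
      using mult_left_mono[OF m(2)[of k], of "1 + \<bar>k\<bar>"] by (simp add: norm_mult mult_ac del: of_real_add)
  qed (use m in measurable)
  from L2C_integrable_mult[OF decay_L2C this] show ?thesis
  proof (rule Bochner_Integration.integrable_cong[OF refl, THEN iffD1, rotated])
    fix k
    have "complex_of_real (1 / (1 + \<bar>k\<bar>)) * complex_of_real (1 + \<bar>k\<bar>) = 1"
      by (simp only: of_real_mult[symmetric]) simp
    then show "complex_of_real (1 / (1 + \<bar>k\<bar>)) * (complex_of_real (1 + \<bar>k\<bar>) * m k * F k) = m k * F k"
      by (simp only: mult.assoc[symmetric]) simp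
  qed
qed

section \<open>The equation on the Fourier side\<close>

definition hs :: "real \<Rightarrow> complex" where "hs k = - \<i> * complex_of_real (sgn k)"

lemma hs_measurable [measurable]: "hs \<in> borel_measurable borel"
  unfolding hs_def sgn_real_def by measurable

lemma hs_bound: "cmod (hs k) \<le> 1"
  by (auto simp: hs_def norm_mult sgn_real_def)

lemma FT_hilbert:
  assumes "FT (\<lambda>x. complex_of_real (h x)) H"
  shows "FT (\<lambda>x. complex_of_real (hilbert h x)) (\<lambda>k. hs k * H k)"
proof -
  have L: "(\<lambda>k. hs k * H k) \<in> L2C"
    by (rule L2C_mult_bounded[OF FT_L2C(2)[OF assms] hs_measurable, of 1]) (simp add: hs_bound)
  have "hilbert = fourier_multiplier hs" by (simp add: hilbert_def hs_def[abs_def])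
  then show ?thesis using FT_multiplier[OF assms L hs_measurable] by (simp add: hs_def sgn_minus)
qed

lemma FT_mult_real:
  assumes "FT (\<lambda>x. complex_of_real (f x)) F" "FT (\<lambda>x. complex_of_real (g x)) G" "integrable lborel F"
  shows "FT (\<lambda>x. complex_of_real (f x * g x)) (cv F G)"
  using FT_mult[OF assms] by simp

lemma FT_commutator:
  assumes u: "FT (\<lambda>x. complex_of_real (u x)) U" and i: "integrable lborel U" and g: "FT (\<lambda>x. complex_of_real (g x)) G"
  shows "FT (\<lambda>x. complex_of_real (commutator hilbert u g x)) (\<lambda>k. hs k * cv U G k - cv U (\<lambda>m. hs m * G m) k)"
  using FT_diff[OF FT_hilbert[OF FT_mult_real[OF u g i]] FT_mult_real[OF u FT_hilbert[OF g] i]]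
  by (simp add: commutator_def)

text \<open>The dispersion relation: \<open>i * symb\<close> is the linear part of the right-hand
  side divided by 2 + a|k|. With \<open>g\<close> standing for \<open>\<alpha> - \<beta>\<close>,
  its three terms come from the first derivative, from \<open>hilbert u\<close>, and from
  \<open>hilbert\<close> of the second derivative.\<close>

definition symb :: "real \<Rightarrow> real \<Rightarrow> real \<Rightarrow> real \<Rightarrow> real" where
  "symb e a g k = (k - sgn k + g * (k * \<bar>k\<bar>)) / (e * (2 + a * \<bar>k\<bar>))"

text \<open>The first summand is the kernel of \<open>hilbert\<close> of the squared
  \<open>Lambda u\<close>. The difference of signs is the common kernel of both commutators, applied
  to \<open>Lambda u\<close> with a minus sign and to \<open>Lambda_pow 3 u\<close> with the factor
  \<open>g\<close>. The square root comes from the convolution theorem.\<close>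

definition kq :: "real \<Rightarrow> real \<Rightarrow> real \<Rightarrow> real \<Rightarrow> complex" where
  "kq a g k m = \<i> * complex_of_real (1 / sqrt (2 * pi) / (2 + a * \<bar>k\<bar>) *
     (- sgn k * \<bar>k - m\<bar> * \<bar>m\<bar> + (sgn k - sgn m) * (\<bar>m\<bar> - g * \<bar>m\<bar> ^ 3)))"

definition Qf :: "(real \<Rightarrow> real \<Rightarrow> complex) \<Rightarrow> (real \<Rightarrow> complex) \<Rightarrow> (real \<Rightarrow> complex) \<Rightarrow> real \<Rightarrow> complex" where
  "Qf q F G k = (LINT m|lborel. q k m * F (k - m) * G m)"

lemma L2C_flip: "F \<in> L2C \<Longrightarrow> (\<lambda>m. F (k - m)) \<in> L2C"
  using L2C_translate[OF L2C_reflect, of F "k"] by (simp add: minus_diff_commute)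

lemma abs_pow_le: "j \<le> s \<Longrightarrow> cmod (complex_of_real (\<bar>k\<bar> ^ j)) \<le> 1 * (1 + \<bar>k\<bar>) ^ s"
proof -
  assume "j \<le> s"
  have "\<bar>k\<bar> ^ j \<le> (1 + \<bar>k\<bar>) ^ j" by (rule power_mono) auto
  also have "\<dots> \<le> (1 + \<bar>k\<bar>) ^ s" using \<open>j \<le> s\<close> by (intro power_increasing) auto
  finally show ?thesis by (simp add: norm_power)
qed

lemma FT_Lambda_pow:
  assumes U: "FT (\<lambda>x. complex_of_real (u x)) U" and w: "wt s U \<in> L2C" and j: "j \<le> s" "j \<ge> 1" and p: "p = real j"
  shows "FT (\<lambda>x. complex_of_real (Lambda_pow p u x)) (\<lambda>k. complex_of_real (\<bar>k\<bar> ^ j) * U k)"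
proof -
  have eq: "(\<lambda>k. complex_of_real (\<bar>k\<bar> powr p)) = (\<lambda>k. complex_of_real (\<bar>k\<bar> ^ j))"
  proof
    fix k :: real
    show "complex_of_real (\<bar>k\<bar> powr p) = complex_of_real (\<bar>k\<bar> ^ j)"
      using j(2) by (cases "k = 0") (auto simp: p powr_realpow)
  qed
  have L: "(\<lambda>k. complex_of_real (\<bar>k\<bar> ^ j) * U k) \<in> L2C"
    by (rule wt_L2C_mult[OF w FT_measurable(2)[OF U] _ abs_pow_le[OF j(1)]]) measurable
  show ?thesis unfolding Lambda_pow_def eq by (rule FT_multiplier[OF U L]) auto
qed

text \<open>Three weights are what every term asks for: \<open>Lambda_pow 3 u\<close> then lies in
  L2, and \<open>u\<close> and \<open>Lambda u\<close> have integrable transforms, so that each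
  product has a bounded factor and the convolution theorem applies.\<close>

lemma FT_wave_rhs:
  assumes U: "FT (\<lambda>x. complex_of_real (u x)) U" and w: "wt 3 U \<in> L2C" and e: "\<epsilon> > 0" and a: "\<alpha> > 0"
  shows "FT (\<lambda>x. complex_of_real (wave_rhs \<epsilon> \<alpha> \<beta> u x))
     (\<lambda>k. complex_of_real (2 + \<alpha> * \<bar>k\<bar>) * (\<i> * symb \<epsilon> \<alpha> (\<alpha> - \<beta>) k * U k + Qf (kq \<alpha> (\<alpha> - \<beta>)) U U k))"
proof -
  define g where "g = \<alpha> - \<beta>"
  note [measurable] = FT_measurable(2)[OF U]
  note Um = FT_measurable(2)[OF U]
  have w3: "wt (Suc 2) U \<in> L2C" using w by (simp add: numeral_3_eq_3 numeral_2_eq_2)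
  define U1 where "U1 = (\<lambda>k. complex_of_real (\<bar>k\<bar> ^ 1) * U k)"
  define U3 where "U3 = (\<lambda>k. complex_of_real (\<bar>k\<bar> ^ 3) * U k)"
  have m1: "(\<lambda>k. complex_of_real (\<bar>k\<bar> ^ j)) \<in> borel_measurable borel" for j by measurable
  have L1: "FT (\<lambda>x. complex_of_real (Lambda u x)) U1" unfolding U1_def by (rule FT_Lambda_pow[OF U w]) auto
  have L3: "FT (\<lambda>x. complex_of_real (Lambda_pow 3 u x)) U3" unfolding U3_def by (rule FT_Lambda_pow[OF U w]) auto
  have U0i: "integrable lborel U"
    using wt_integrable_mult[OF w3 Um m1[of 0] abs_pow_le[of 0 2]] by simp
  have U1i: "integrable lborel U1" unfolding U1_def by (rule wt_integrable_mult[OF w3 Um m1 abs_pow_le]) simp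
  have U2L: "(\<lambda>k. (\<i> * k) * (\<i> * k) * U k) \<in> L2C"
  proof (rule wt_L2C_mult[OF w Um])
    show "cmod ((\<i> * k) * (\<i> * k)) \<le> 1 * (1 + \<bar>k\<bar>) ^ 3" for k :: real
      using abs_pow_le[of 2 3 k] by (simp add: norm_mult power2_eq_square)
  qed measurable
  have UdL: "(\<lambda>k. (\<i> * k) * U k) \<in> L2C"
  proof (rule wt_L2C_mult[OF w Um])
    show "cmod (\<i> * k) \<le> 1 * (1 + \<bar>k\<bar>) ^ 3" for k :: real
      using abs_pow_le[of 1 3 k] by (simp add: norm_mult)
  qed measurable
  have D1: "FT (\<lambda>x. complex_of_real (weak_deriv u x)) (\<lambda>k. \<i> * k * U k)" by (rule FT_weak_deriv[OF U UdL])
  have D2: "FT (\<lambda>x. complex_of_real (weak_deriv (weak_deriv u) x)) (\<lambda>k. \<i> * k * (\<i> * k * U k))"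
    using U2L by (intro FT_weak_deriv[OF D1]) (simp add: mult.assoc)
  have P: "FT (\<lambda>x. complex_of_real ((Lambda u x)\<^sup>2)) (cv U1 U1)"
    using FT_mult_real[OF L1 L1 U1i] by (simp add: power2_eq_square)
  have C1: "FT (\<lambda>x. complex_of_real (commutator hilbert u (Lambda u) x)) (\<lambda>k. hs k * cv U U1 k - cv U (\<lambda>m. hs m * U1 m) k)"
    by (rule FT_commutator[OF U U0i L1])
  have C3: "FT (\<lambda>x. complex_of_real (commutator hilbert u (Lambda_pow 3 u) x)) (\<lambda>k. hs k * cv U U3 k - cv U (\<lambda>m. hs m * U3 m) k)"
    by (rule FT_commutator[OF U U0i L3])
  let ?R = "\<lambda>k. complex_of_real (1 / \<epsilon>) * (\<i> * k * U k + hs k * U k + complex_of_real g * (hs k * (\<i> * k * (\<i> * k * U k)))) + hs k * cv U1 U1 k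
     - (hs k * cv U U1 k - cv U (\<lambda>m. hs m * U1 m) k) + complex_of_real g * (hs k * cv U U3 k - cv U (\<lambda>m. hs m * U3 m) k)"
  have F: "FT (\<lambda>x. complex_of_real (wave_rhs \<epsilon> \<alpha> \<beta> u x)) ?R"
    using FT_add[OF FT_diff[OF FT_add[OF FT_cmult[OF FT_add[OF FT_add[OF D1 FT_hilbert[OF U]] FT_cmult[OF FT_hilbert[OF D2], of "of_real g"]], of "of_real (1 / \<epsilon>)"]
      FT_hilbert[OF P]] C1] FT_cmult[OF C3, of "of_real g"]]
    by (simp add: wave_rhs_def g_def)
  have "?R k = complex_of_real (2 + \<alpha> * \<bar>k\<bar>) * (\<i> * symb \<epsilon> \<alpha> g k * U k + Qf (kq \<alpha> g) U U k)" for k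
  proof -
    \<comment> \<open>For fixed \<open>k\<close> all factors are square integrable in
      \<open>m\<close>, so the five convolutions converge absolutely and may be combined into the
      single integral \<open>Qf\<close>.\<close>
    have UL: "(\<lambda>m. U (k - m)) \<in> L2C" "(\<lambda>m. U1 (k - m)) \<in> L2C" using L2C_flip FT_L2C(2)[OF U] FT_L2C(2)[OF L1] by auto
    have hL: "(\<lambda>m. hs m * U1 m) \<in> L2C" "(\<lambda>m. hs m * U3 m) \<in> L2C"
      using FT_L2C(2)[OF FT_hilbert[OF L1]] FT_L2C(2)[OF FT_hilbert[OF L3]] by auto
    note i = L2C_integrable_mult[OF UL(2) FT_L2C(2)[OF L1]] L2C_integrable_mult[OF UL(1) FT_L2C(2)[OF L1]] L2C_integrable_mult[OF UL(1) hL(1)]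
      L2C_integrable_mult[OF UL(1) FT_L2C(2)[OF L3]] L2C_integrable_mult[OF UL(1) hL(2)]
    define s where "s = complex_of_real (1 / sqrt (2 * pi))"
    define d where "d = complex_of_real (2 + \<alpha> * \<bar>k\<bar>)"
    have "2 + \<alpha> * \<bar>k\<bar> > 0" using a by (intro add_pos_nonneg) auto
    then have d0: "d \<noteq> 0" unfolding d_def of_real_eq_0_iff by linarith
    have "d * Qf (kq \<alpha> g) U U k = (LINT m|lborel. s * (hs k * (U1 (k - m) * U1 m) - hs k * (U (k - m) * U1 m) + U (k - m) * (hs m * U1 m)
         + g * (hs k * (U (k - m) * U3 m)) - g * (U (k - m) * (hs m * U3 m))))"
      unfolding Qf_def
    proof (subst integral_mult_right_zero[symmetric], intro Bochner_Integration.integral_cong refl)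
      fix m
      have kq: "d * kq \<alpha> g k m = s * (hs k * of_real \<bar>k - m\<bar> * of_real \<bar>m\<bar> - (hs k - hs m) * (of_real \<bar>m\<bar> - g * of_real (\<bar>m\<bar> ^ 3)))"
      proof -
        have "kq \<alpha> g k m = \<i> * (s / d * (- of_real (sgn k) * of_real \<bar>k - m\<bar> * of_real \<bar>m\<bar> + (of_real (sgn k) - of_real (sgn m)) * (of_real \<bar>m\<bar> - g * of_real (\<bar>m\<bar> ^ 3))))"
          unfolding kq_def s_def d_def by simp
        then show ?thesis using d0 by (simp add: hs_def field_simps)
      qed
      have "d * (kq \<alpha> g k m * U (k - m) * U m) = (d * kq \<alpha> g k m) * U (k - m) * U m" by (simp add: mult.assoc)
      also have "\<dots> = s * (hs k * (U1 (k - m) * U1 m) - hs k * (U (k - m) * U1 m) + U (k - m) * (hs m * U1 m)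
         + g * (hs k * (U (k - m) * U3 m)) - g * (U (k - m) * (hs m * U3 m)))"
        unfolding kq U1_def U3_def by (simp add: algebra_simps)
      finally show "d * (kq \<alpha> g k m * U (k - m) * U m) = \<dots>" .
    qed
    also have "\<dots> = s * (hs k * (LINT m|lborel. U1 (k - m) * U1 m) - hs k * (LINT m|lborel. U (k - m) * U1 m) + (LINT m|lborel. U (k - m) * (hs m * U1 m))
         + g * (hs k * (LINT m|lborel. U (k - m) * U3 m)) - g * (LINT m|lborel. U (k - m) * (hs m * U3 m)))"
      using i by (simp only: integral_mult_right_zero Bochner_Integration.integral_add Bochner_Integration.integral_diff
          Bochner_Integration.integrable_add Bochner_Integration.integrable_diff integrable_mult_right)
    finally have Q: "d * Qf (kq \<alpha> g) U U k = \<dots>" .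
    have S: "d * (\<i> * symb \<epsilon> \<alpha> g k * U k) = complex_of_real (1 / \<epsilon>) * (\<i> * k * U k + hs k * U k + complex_of_real g * (hs k * (\<i> * k * (\<i> * k * U k))))"
    proof -
      have kk: "complex_of_real (k * \<bar>k\<bar>) = of_real (sgn k) * of_real k * of_real k"
        by (simp add: sgn_real_def flip: of_real_mult)
      have "complex_of_real (symb \<epsilon> \<alpha> g k) = (of_real k - of_real (sgn k) + of_real g * (of_real (sgn k) * of_real k * of_real k)) / (of_real \<epsilon> * d)"
        unfolding symb_def d_def of_real_divide of_real_add of_real_diff of_real_mult kk[unfolded of_real_mult] ..
      then have "d * (\<i> * symb \<epsilon> \<alpha> g k * U k) = \<i> * (of_real k - of_real (sgn k) + of_real g * (of_real (sgn k) * of_real k * of_real k)) / of_real \<epsilon> * U k"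
        using d0 e by simp
      also have "\<dots> = complex_of_real (1 / \<epsilon>) * (\<i> * k * U k + hs k * U k + complex_of_real g * (hs k * (\<i> * k * (\<i> * k * U k))))"
        by (simp add: hs_def algebra_simps add_divide_distrib diff_divide_distrib)
      finally show ?thesis .
    qed
    show ?thesis unfolding d_def[symmetric] distrib_left[of d] Q S unfolding cv_def s_def by (simp add: algebra_simps)
  qed
  then have "?R = (\<lambda>k. complex_of_real (2 + \<alpha> * \<bar>k\<bar>) * (\<i> * symb \<epsilon> \<alpha> g k * U k + Qf (kq \<alpha> g) U U k))" by (rule ext)
  with F show ?thesis unfolding g_def by metis
qed

text \<open>The quadratic operator with absolute values on the kernel and nonnegative arguments. It
  is monotone in both arguments and always defined, with infinity allowed.\<close>

definition maj :: "(real \<Rightarrow> real \<Rightarrow> complex) \<Rightarrow> (real \<Rightarrow> ennreal) \<Rightarrow> (real \<Rightarrow> ennreal) \<Rightarrow> real \<Rightarrow> ennreal" where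
  "maj q A D k = (\<integral>\<^sup>+m. ennreal (cmod (q k m)) * A (k - m) * D m \<partial>lborel)"

definition nsq :: "nat \<Rightarrow> (real \<Rightarrow> ennreal) \<Rightarrow> ennreal" where
  "nsq s A = (\<integral>\<^sup>+k. (ennreal (1 + \<bar>k\<bar>) ^ s * A k)\<^sup>2 \<partial>lborel)"

section \<open>Convolution inequalities for nonnegative functions\<close>

definition cvn :: "(real \<Rightarrow> ennreal) \<Rightarrow> (real \<Rightarrow> ennreal) \<Rightarrow> real \<Rightarrow> ennreal" where
  "cvn A D k = (\<integral>\<^sup>+m. A (k - m) * D m \<partial>lborel)"

lemma cvn_measurable [measurable]:
  assumes [measurable]: "A \<in> borel_measurable borel" "D \<in> borel_measurable borel"
  shows "cvn A D \<in> borel_measurable borel"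
  unfolding cvn_def by measurable

lemma nn_integral_translate: "f \<in> borel_measurable borel \<Longrightarrow> (\<integral>\<^sup>+x. f (x - a :: real) \<partial>lborel) = (\<integral>\<^sup>+x. f x \<partial>lborel)"
  using nn_integral_real_affine[of f 1 "- a"] by simp

lemma nn_integral_flip: "f \<in> borel_measurable borel \<Longrightarrow> (\<integral>\<^sup>+x. f (a - x :: real) \<partial>lborel) = (\<integral>\<^sup>+x. f x \<partial>lborel)"
  using nn_integral_real_affine[of f "-1" a] by simp

lemma cvn_commute:
  assumes [measurable]: "A \<in> borel_measurable borel" "D \<in> borel_measurable borel"
  shows "cvn A D k = cvn D A k"
  unfolding cvn_def using nn_integral_flip[of "\<lambda>m. A (k - m) * D m" k] by (simp add: mult.commute)

lemma cvn_sq_le: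
  assumes [measurable]: "A \<in> borel_measurable borel" "D \<in> borel_measurable borel"
  shows "(cvn A D k)\<^sup>2 \<le> (\<integral>\<^sup>+m. (A m)\<^sup>2 \<partial>lborel) * (\<integral>\<^sup>+m. (D m)\<^sup>2 \<partial>lborel)"
  using Cauchy_Schwarz_nn_integral[of "\<lambda>m. A (k - m)" lborel D] nn_integral_flip[of "\<lambda>m. (A m)\<^sup>2" k]
  by (simp add: cvn_def)

text \<open>Cauchy-Schwarz with respect to the measure with density \<open>D\<close> bounds the
  square of the convolution by the convolution of \<open>A^2\<close> with \<open>D\<close>, times
  the mass of \<open>D\<close>; Tonelli's theorem then produces the second factor of that
  mass.\<close>

lemma Young_L2_L1:
  assumes [measurable]: "A \<in> borel_measurable borel" "D \<in> borel_measurable borel"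
  shows "(\<integral>\<^sup>+k. (cvn A D k)\<^sup>2 \<partial>lborel) \<le> (\<integral>\<^sup>+m. (A m)\<^sup>2 \<partial>lborel) * (\<integral>\<^sup>+m. D m \<partial>lborel)\<^sup>2"
proof -
  have "(cvn A D k)\<^sup>2 \<le> (\<integral>\<^sup>+m. D m * (A (k - m))\<^sup>2 \<partial>lborel) * (\<integral>\<^sup>+m. D m \<partial>lborel)" for k
    using Cauchy_Schwarz_nn_integral[of "\<lambda>m. A (k - m)" "density lborel D" "\<lambda>_. 1"]
    by (simp add: nn_integral_density cvn_def mult.commute emeasure_density)
  then have "(\<integral>\<^sup>+k. (cvn A D k)\<^sup>2 \<partial>lborel) \<le> (\<integral>\<^sup>+k. (\<integral>\<^sup>+m. D m * (A (k - m))\<^sup>2 \<partial>lborel) * (\<integral>\<^sup>+m. D m \<partial>lborel) \<partial>lborel)"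
    by (intro nn_integral_mono)
  also have "\<dots> = (\<integral>\<^sup>+k. \<integral>\<^sup>+m. D m * (A (k - m))\<^sup>2 \<partial>lborel \<partial>lborel) * (\<integral>\<^sup>+m. D m \<partial>lborel)"
    by (rule nn_integral_multc) measurable
  also have "(\<integral>\<^sup>+k. \<integral>\<^sup>+m. D m * (A (k - m))\<^sup>2 \<partial>lborel \<partial>lborel) = (\<integral>\<^sup>+m. \<integral>\<^sup>+k. D m * (A (k - m))\<^sup>2 \<partial>lborel \<partial>lborel)"
    by (rule lborel_pair.Fubini') measurable
  also have "\<dots> = (\<integral>\<^sup>+m. D m * (\<integral>\<^sup>+k. (A k)\<^sup>2 \<partial>lborel) \<partial>lborel)"
    using nn_integral_translate[of "\<lambda>m. (A m)\<^sup>2"] by (simp add: nn_integral_cmult)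
  also have "\<dots> = (\<integral>\<^sup>+m. D m \<partial>lborel) * (\<integral>\<^sup>+k. (A k)\<^sup>2 \<partial>lborel)" by (rule nn_integral_multc) measurable
  finally show ?thesis by (simp add: power2_eq_square mult_ac)
qed

lemma ennreal_add_sq_le: "(x + y :: ennreal)\<^sup>2 \<le> 2 * x\<^sup>2 + 2 * y\<^sup>2"
proof (cases "x = \<top> \<or> y = \<top>")
  case True
  then show ?thesis by (auto simp: power2_eq_square ennreal_mult_top ennreal_top_mult)
next
  case False
  then obtain a b where ab: "x = ennreal a" "y = ennreal b" "a \<ge> 0" "b \<ge> 0" by (cases x; cases y) auto
  have "(a + b)\<^sup>2 \<le> 2 * a\<^sup>2 + 2 * b\<^sup>2"
    using zero_le_power2[of "a - b"] by (simp add: power2_eq_square algebra_simps)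
  from ennreal_leI[OF this] have "ennreal ((a + b)\<^sup>2) \<le> 2 * ennreal (a\<^sup>2) + 2 * ennreal (b\<^sup>2)"
    using ab by (simp add: ennreal_mult)
  then show ?thesis using ab by (simp add: ennreal_power flip: ennreal_plus)
qed

lemma nn_integral_sq_add_le:
  assumes [measurable]: "A \<in> borel_measurable M" "D \<in> borel_measurable M"
  shows "(\<integral>\<^sup>+k. (A k + D k)\<^sup>2 \<partial>M) \<le> 2 * (\<integral>\<^sup>+k. (A k)\<^sup>2 \<partial>M) + 2 * (\<integral>\<^sup>+k. (D k)\<^sup>2 \<partial>M)"
proof -
  have "(\<integral>\<^sup>+k. (A k + D k)\<^sup>2 \<partial>M) \<le> (\<integral>\<^sup>+k. 2 * (A k)\<^sup>2 + 2 * (D k)\<^sup>2 \<partial>M)" by (intro nn_integral_mono ennreal_add_sq_le)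
  also have "\<dots> = 2 * (\<integral>\<^sup>+k. (A k)\<^sup>2 \<partial>M) + 2 * (\<integral>\<^sup>+k. (D k)\<^sup>2 \<partial>M)" by (subst nn_integral_add) (auto simp: nn_integral_cmult)
  finally show ?thesis .
qed

lemma nsq_mono: "(\<And>k. A k \<le> D k) \<Longrightarrow> nsq s A \<le> nsq s D"
  unfolding nsq_def by (intro nn_integral_mono power_mono mult_left_mono) auto

lemma nsq_add_le:
  assumes [measurable]: "A \<in> borel_measurable borel" "D \<in> borel_measurable borel"
  shows "nsq s (\<lambda>k. A k + D k) \<le> 2 * nsq s A + 2 * nsq s D"
  unfolding nsq_def distrib_left by (rule nn_integral_sq_add_le) measurable

lemma nsq_cmult:
  assumes [measurable]: "A \<in> borel_measurable borel"
  shows "nsq s (\<lambda>k. c * A k) = c\<^sup>2 * nsq s A"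
  unfolding nsq_def by (subst nn_integral_cmult[symmetric]) (auto simp: power_mult_distrib mult_ac)

lemma nsq_le: "s \<le> r \<Longrightarrow> nsq s A \<le> nsq r A"
  unfolding nsq_def by (intro nn_integral_mono power_mono mult_right_mono power_increasing) (auto simp flip: ennreal_1 intro!: ennreal_leI)

lemma sqn_wt_eq: "sqn (wt s F) = nsq s (\<lambda>k. ennreal (cmod (F k)))"
  unfolding sqn_def nsq_def
  by (rule nn_integral_cong) (simp add: cmod_wt ennreal_mult ennreal_power[symmetric] power_mult_distrib)

definition Jc :: ennreal where "Jc = (\<integral>\<^sup>+k. (ennreal (1 / (1 + \<bar>k\<bar>)))\<^sup>2 \<partial>(lborel :: real measure))"

lemma Jc_finite: "Jc < \<infinity>"
proof -
  have "Jc = sqn (\<lambda>k. complex_of_real (1 / (1 + \<bar>k\<bar>)))"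
    unfolding Jc_def sqn_def by (intro nn_integral_cong) (simp add: ennreal_power norm_divide)
  then show ?thesis using L2C_finite[OF decay_L2C] by simp
qed

text \<open>Writing the weight of order 2 as the weight of order 3 over 1 + |k| and applying
  Cauchy-Schwarz: H^3 controls the L1 norm of two derivatives on the Fourier side, with the constant
  \<open>Jc\<close>.\<close>

lemma weighted_L1_le:
  assumes [measurable]: "A \<in> borel_measurable borel"
  shows "(\<integral>\<^sup>+k. ennreal (1 + \<bar>k\<bar>) ^ 2 * A k \<partial>lborel)\<^sup>2 \<le> Jc * nsq 3 A"
proof -
  have "ennreal (1 / (1 + \<bar>k\<bar>)) * (ennreal (1 + \<bar>k\<bar>) ^ 3 * A k) = ennreal (1 + \<bar>k\<bar>) ^ 2 * A k" for k :: real
  proof -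
    have "ennreal (1 / (1 + \<bar>k\<bar>)) * ennreal (1 + \<bar>k\<bar>) = 1" by (simp add: ennreal_mult[symmetric] del: ennreal_plus)
    then show ?thesis by (metis (no_types, lifting) mult.assoc mult_1 numeral_3_eq_3 numeral_2_eq_2 power_Suc)
  qed
  then show ?thesis
    using Cauchy_Schwarz_nn_integral[of "\<lambda>k. ennreal (1 / (1 + \<bar>k\<bar>))" lborel "\<lambda>k. ennreal (1 + \<bar>k\<bar>) ^ 3 * A k"]
    by (simp add: Jc_def nsq_def)
qed

section \<open>Pointwise bounds for the kernel\<close>

definition tk :: "real \<Rightarrow> real \<Rightarrow> real \<Rightarrow> real" where
  "tk g k m = \<bar>k - m\<bar> * \<bar>m\<bar> + (if sgn k \<noteq> sgn m \<and> m \<noteq> 0 then 2 * (1 + \<bar>g\<bar>) * (\<bar>m\<bar> + \<bar>m\<bar> ^ 3) else 0)"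

text \<open>The gain of one derivative from inverting 2 + a|k|: the factor 1 + 1/a is chosen so that
  its product with 2 + a|k|, namely 2 + 2/a + a|k| + |k|, is at least 1 + |k| whatever the size of
  \<open>a\<close>.\<close>

lemma kq_tk:
  assumes a: "a > 0"
  shows "cmod (kq a g k m) \<le> (1 + 1 / a) / (1 + \<bar>k\<bar>) * tk g k m"
proof -
  have d: "2 + a * \<bar>k\<bar> > 0" using a by (intro add_pos_nonneg) auto
  have "\<bar>- sgn k * \<bar>k - m\<bar> * \<bar>m\<bar> + (sgn k - sgn m) * (\<bar>m\<bar> - g * \<bar>m\<bar> ^ 3)\<bar> \<le> tk g k m"
  proof -
    have "\<bar>sgn k\<bar> * (\<bar>k - m\<bar> * \<bar>m\<bar>) \<le> 1 * (\<bar>k - m\<bar> * \<bar>m\<bar>)"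
      by (intro mult_right_mono) (auto simp: sgn_real_def)
    then have 1: "\<bar>- sgn k * \<bar>k - m\<bar> * \<bar>m\<bar>\<bar> \<le> \<bar>k - m\<bar> * \<bar>m\<bar>" by (simp add: abs_mult mult.assoc)
    have 2: "\<bar>(sgn k - sgn m) * (\<bar>m\<bar> - g * \<bar>m\<bar> ^ 3)\<bar> \<le> (if sgn k \<noteq> sgn m \<and> m \<noteq> 0 then 2 * (1 + \<bar>g\<bar>) * (\<bar>m\<bar> + \<bar>m\<bar> ^ 3) else 0)"
    proof (cases "sgn k \<noteq> sgn m \<and> m \<noteq> 0")
      case True
      have "\<bar>\<bar>m\<bar> - g * \<bar>m\<bar> ^ 3\<bar> \<le> \<bar>m\<bar> + \<bar>g\<bar> * \<bar>m\<bar> ^ 3"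
        using abs_triangle_ineq4[of "\<bar>m\<bar>" "g * \<bar>m\<bar> ^ 3"] by (simp add: abs_mult power_abs)
      also have "\<dots> \<le> (1 + \<bar>g\<bar>) * (\<bar>m\<bar> + \<bar>m\<bar> ^ 3)" by (simp add: algebra_simps)
      finally have "\<bar>\<bar>m\<bar> - g * \<bar>m\<bar> ^ 3\<bar> \<le> (1 + \<bar>g\<bar>) * (\<bar>m\<bar> + \<bar>m\<bar> ^ 3)" .
      moreover have "\<bar>sgn k - sgn m\<bar> \<le> 2" by (auto simp: sgn_real_def)
      ultimately have "\<bar>sgn k - sgn m\<bar> * \<bar>\<bar>m\<bar> - g * \<bar>m\<bar> ^ 3\<bar> \<le> 2 * ((1 + \<bar>g\<bar>) * (\<bar>m\<bar> + \<bar>m\<bar> ^ 3))" by (intro mult_mono) auto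
      then show ?thesis unfolding if_P[OF True] abs_mult mult.assoc .
    qed auto
    show ?thesis unfolding tk_def by (rule order_trans[OF abs_triangle_ineq add_mono[OF 1 2]])
  qed
  moreover have "\<bar>1 / sqrt (2 * pi) / (2 + a * \<bar>k\<bar>)\<bar> \<le> (1 + 1 / a) / (1 + \<bar>k\<bar>)"
  proof -
    have "1 / sqrt (2 * pi) \<le> 1" using pi_gt3 by (simp add: real_le_lsqrt)
    then have "1 / sqrt (2 * pi) / (2 + a * \<bar>k\<bar>) \<le> 1 / (2 + a * \<bar>k\<bar>)" using d by (intro divide_right_mono) auto
    also have "\<dots> \<le> (1 + 1 / a) / (1 + \<bar>k\<bar>)"
    proof -
      have "1 + \<bar>k\<bar> \<le> (1 + 1 / a) * (2 + a * \<bar>k\<bar>)" using a by (simp add: field_simps)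
      then have "(1 + \<bar>k\<bar>) / ((1 + \<bar>k\<bar>) * (2 + a * \<bar>k\<bar>)) \<le> ((1 + 1 / a) * (2 + a * \<bar>k\<bar>)) / ((1 + \<bar>k\<bar>) * (2 + a * \<bar>k\<bar>))"
        by (rule divide_right_mono) (use d in auto)
      moreover have "1 + \<bar>k\<bar> \<noteq> 0" by linarith
      ultimately show ?thesis using d by simp
    qed
    finally show ?thesis using d by simp
  qed
  ultimately have "\<bar>1 / sqrt (2 * pi) / (2 + a * \<bar>k\<bar>)\<bar> * \<bar>- sgn k * \<bar>k - m\<bar> * \<bar>m\<bar> + (sgn k - sgn m) * (\<bar>m\<bar> - g * \<bar>m\<bar> ^ 3)\<bar> \<le> (1 + 1 / a) / (1 + \<bar>k\<bar>) * tk g k m"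
    using a by (intro mult_mono) auto
  then show ?thesis unfolding kq_def norm_mult norm_of_real by simp
qed

text \<open>When the signs of \<open>k\<close> and \<open>m\<close> differ, both \<open>|k|\<close> and \<open>|m|\<close> are at most \<open>|k - m|\<close>: this is
  the smoothing effect of the commutators.\<close>

lemma sgn_neq_abs: "sgn k \<noteq> sgn m \<Longrightarrow> m \<noteq> 0 \<Longrightarrow> \<bar>k::real\<bar> \<le> \<bar>k - m\<bar> \<and> \<bar>m\<bar> \<le> \<bar>k - m\<bar>"
  by (auto simp: sgn_real_def split: if_splits)

lemma one_abs_powers: "\<bar>m::real\<bar> + \<bar>m\<bar> ^ 3 \<le> 2 * (1 + \<bar>m\<bar>) ^ 3"
proof -
  have "\<bar>m\<bar> ^ 1 \<le> (1 + \<bar>m\<bar>) ^ 1" "(1 + \<bar>m\<bar>) ^ 1 \<le> (1 + \<bar>m\<bar>) ^ 3" "\<bar>m\<bar> ^ 3 \<le> (1 + \<bar>m\<bar>) ^ 3"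
    by (intro power_mono power_increasing; simp)+
  then show ?thesis unfolding power_one_right by linarith
qed

text \<open>For the H^3 estimate: of the three powers of 1 + |k| one is paid by the division, so two
  remain. The product term is bounded by (x + y)^2 x y. In the commutator term both powers go to
  \<open>x\<close>, because |k| is at most |k - m| there, and \<open>y\<close> keeps its three. No
  term carries more than three powers on one factor together with two on the other.\<close>

lemma tk_bound1:
  fixes k m g :: real
  defines "x \<equiv> 1 + \<bar>k - m\<bar>" and "y \<equiv> 1 + \<bar>m\<bar>" and "C \<equiv> 8 * (1 + \<bar>g\<bar>)"
  shows "(1 + \<bar>k\<bar>)\<^sup>2 * tk g k m \<le> C * (x ^ 3 * y\<^sup>2 + x\<^sup>2 * y ^ 3)"
proof -
  have x1: "x \<ge> 1" "y \<ge> 1" by (auto simp: x_def y_def)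
  have ge: "0 \<le> x\<^sup>2 * y ^ 3" "0 \<le> x ^ 3 * y\<^sup>2" using x1 by auto
  have 1: "(1 + \<bar>k\<bar>)\<^sup>2 * (\<bar>k - m\<bar> * \<bar>m\<bar>) \<le> 2 * (x ^ 3 * y\<^sup>2 + x\<^sup>2 * y ^ 3)"
  proof -
    have "(1 + \<bar>k\<bar>)\<^sup>2 \<le> (x + y)\<^sup>2" by (intro power_mono) (auto simp: x_def y_def)
    also have "\<dots> \<le> 2 * x\<^sup>2 + 2 * y\<^sup>2" using zero_le_power2[of "x - y"] by (simp add: power2_eq_square algebra_simps)
    finally have "(1 + \<bar>k\<bar>)\<^sup>2 * (\<bar>k - m\<bar> * \<bar>m\<bar>) \<le> (2 * x\<^sup>2 + 2 * y\<^sup>2) * (x * y)"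
      using x1 by (intro mult_mono) (auto simp: x_def y_def)
    also have "\<dots> = 2 * (x ^ 3 * y) + 2 * (x * y ^ 3)" by (simp add: power2_eq_square power3_eq_cube algebra_simps)
    also have "\<dots> \<le> 2 * (x ^ 3 * y\<^sup>2) + 2 * (x\<^sup>2 * y ^ 3)"
      using x1 by (intro add_mono mult_left_mono mult_right_mono) (auto simp: power2_eq_square)
    finally show ?thesis by simp
  qed
  have 2: "(1 + \<bar>k\<bar>)\<^sup>2 * (2 * (1 + \<bar>g\<bar>) * (\<bar>m\<bar> + \<bar>m\<bar> ^ 3)) \<le> 4 * (1 + \<bar>g\<bar>) * (x\<^sup>2 * y ^ 3)" if "sgn k \<noteq> sgn m" "m \<noteq> 0"
  proof -
    have "(1 + \<bar>k\<bar>)\<^sup>2 \<le> x\<^sup>2" using sgn_neq_abs[OF that] by (intro power_mono) (auto simp: x_def)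
    then have "(1 + \<bar>k\<bar>)\<^sup>2 * (2 * (1 + \<bar>g\<bar>) * (\<bar>m\<bar> + \<bar>m\<bar> ^ 3)) \<le> x\<^sup>2 * (2 * (1 + \<bar>g\<bar>) * (2 * y ^ 3))"
      using one_abs_powers[of m] unfolding y_def by (intro mult_mono mult_left_mono) auto
    also have "\<dots> = 4 * (1 + \<bar>g\<bar>) * (x\<^sup>2 * y ^ 3)" by (simp add: algebra_simps)
    finally show ?thesis .
  qed
  have z: "z \<le> (1 + \<bar>g\<bar>) * z" if "z \<ge> 0" for z :: real using that by (simp add: distrib_right)
  show ?thesis
  proof (cases "sgn k \<noteq> sgn m \<and> m \<noteq> 0")
    case True
    have "(1 + \<bar>k\<bar>)\<^sup>2 * tk g k m \<le> 2 * (x ^ 3 * y\<^sup>2 + x\<^sup>2 * y ^ 3) + 4 * (1 + \<bar>g\<bar>) * (x\<^sup>2 * y ^ 3)"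
      using 1 2 True unfolding tk_def distrib_left by (simp add: distrib_left)
    also have "\<dots> \<le> 2 * ((1 + \<bar>g\<bar>) * (x ^ 3 * y\<^sup>2 + x\<^sup>2 * y ^ 3)) + 4 * ((1 + \<bar>g\<bar>) * (x ^ 3 * y\<^sup>2 + x\<^sup>2 * y ^ 3))"
      using ge z[of "x ^ 3 * y\<^sup>2 + x\<^sup>2 * y ^ 3"] unfolding mult.assoc
      by (intro add_mono mult_left_mono) linarith+
    also have "\<dots> \<le> 8 * ((1 + \<bar>g\<bar>) * (x ^ 3 * y\<^sup>2 + x\<^sup>2 * y ^ 3))"
      using ge z[of "x ^ 3 * y\<^sup>2 + x\<^sup>2 * y ^ 3"] by linarith
    also have "\<dots> = C * (x ^ 3 * y\<^sup>2 + x\<^sup>2 * y ^ 3)" unfolding C_def by (rule mult.assoc[symmetric])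
    finally show ?thesis .
  next
    case False
    then have "(1 + \<bar>k\<bar>)\<^sup>2 * tk g k m \<le> 2 * (x ^ 3 * y\<^sup>2 + x\<^sup>2 * y ^ 3)" using 1 unfolding tk_def if_not_P[OF False] by simp
    also have "\<dots> \<le> C * (x ^ 3 * y\<^sup>2 + x\<^sup>2 * y ^ 3)"
      using ge unfolding C_def by (intro mult_right_mono) auto
    finally show ?thesis .
  qed
qed

text \<open>For differences of solutions the factor at k - m carries no weight, so everything is put
  on \<open>m\<close>. Dividing by 1 + |k| afterwards leaves two powers, summable in L1, and three
  powers with a decaying factor in front.\<close>

lemma tk_bound2:
  fixes k m g :: real
  defines "y \<equiv> 1 + \<bar>m\<bar>" and "C \<equiv> 8 * (1 + \<bar>g\<bar>)"
  shows "tk g k m \<le> C * ((1 + \<bar>k\<bar>) * y\<^sup>2 + y ^ 3)"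
proof -
  have y1: "y \<ge> 1" by (auto simp: y_def)
  have "\<bar>k - m\<bar> * \<bar>m\<bar> \<le> (\<bar>k\<bar> + \<bar>m\<bar>) * \<bar>m\<bar>" by (intro mult_right_mono) auto
  also have "\<dots> = \<bar>k\<bar> * \<bar>m\<bar> + \<bar>m\<bar> ^ 2" by (simp add: distrib_right power2_eq_square)
  also have "\<dots> \<le> (1 + \<bar>k\<bar>) * y\<^sup>2 + y ^ 3"
  proof (intro add_mono mult_mono)
    show "\<bar>m\<bar> \<le> y\<^sup>2" using power_increasing[of 1 2 y] y1 by (simp add: y_def)
    have "\<bar>m\<bar> ^ 2 \<le> y ^ 2" by (intro power_mono) (auto simp: y_def)
    also have "\<dots> \<le> y ^ 3" using y1 by (intro power_increasing) auto
    finally show "\<bar>m\<bar> ^ 2 \<le> y ^ 3" .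
  qed auto
  finally have 1: "\<bar>k - m\<bar> * \<bar>m\<bar> \<le> 1 * ((1 + \<bar>k\<bar>) * y\<^sup>2 + y ^ 3)" by simp
  have "2 * (1 + \<bar>g\<bar>) * (\<bar>m\<bar> + \<bar>m\<bar> ^ 3) \<le> 2 * (1 + \<bar>g\<bar>) * (2 * y ^ 3)"
    using one_abs_powers[of m] unfolding y_def by (intro mult_left_mono) auto
  also have "\<dots> = 4 * (1 + \<bar>g\<bar>) * y ^ 3" by simp
  also have "\<dots> \<le> 4 * (1 + \<bar>g\<bar>) * ((1 + \<bar>k\<bar>) * y\<^sup>2 + y ^ 3)" using y1 by (intro mult_left_mono) auto
  finally have 2: "(if sgn k \<noteq> sgn m \<and> m \<noteq> 0 then 2 * (1 + \<bar>g\<bar>) * (\<bar>m\<bar> + \<bar>m\<bar> ^ 3) else 0) \<le> 4 * (1 + \<bar>g\<bar>) * ((1 + \<bar>k\<bar>) * y\<^sup>2 + y ^ 3)"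
    using y1 by auto
  from add_mono[OF 1 2] have "tk g k m \<le> 1 * ((1 + \<bar>k\<bar>) * y\<^sup>2 + y ^ 3) + 4 * (1 + \<bar>g\<bar>) * ((1 + \<bar>k\<bar>) * y\<^sup>2 + y ^ 3)"
    by (simp only: tk_def)
  also have "\<dots> = (1 + 4 * (1 + \<bar>g\<bar>)) * ((1 + \<bar>k\<bar>) * y\<^sup>2 + y ^ 3)" by (rule distrib_right[symmetric])
  also have "\<dots> \<le> C * ((1 + \<bar>k\<bar>) * y\<^sup>2 + y ^ 3)" using y1 unfolding C_def by (intro mult_right_mono) auto
  finally show ?thesis .
qed

text \<open>The mirror image, with the unweighted factor at \<open>m\<close>. Here the sign
  condition is indispensable: three derivatives stand on the unweighted factor and are moved to k -
  m because |m| is at most |k - m|.\<close>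

lemma tk_bound3:
  fixes k m g :: real
  defines "x \<equiv> 1 + \<bar>k - m\<bar>" and "C \<equiv> 8 * (1 + \<bar>g\<bar>)"
  shows "tk g k m \<le> C * ((1 + \<bar>k\<bar>) * x\<^sup>2 + x ^ 3)"
proof -
  have x1: "x \<ge> 1" by (auto simp: x_def)
  have "\<bar>k - m\<bar> * \<bar>m\<bar> \<le> \<bar>k - m\<bar> * (\<bar>k\<bar> + \<bar>k - m\<bar>)" by (intro mult_left_mono) auto
  also have "\<dots> = \<bar>k\<bar> * \<bar>k - m\<bar> + \<bar>k - m\<bar> ^ 2" by (simp add: distrib_left power2_eq_square)
  also have "\<dots> \<le> (1 + \<bar>k\<bar>) * x\<^sup>2 + x ^ 3"
  proof (intro add_mono mult_mono)
    show "\<bar>k - m\<bar> \<le> x\<^sup>2" using power_increasing[of 1 2 x] x1 by (simp add: x_def)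
    have "\<bar>k - m\<bar> ^ 2 \<le> x ^ 2" by (intro power_mono) (auto simp: x_def)
    also have "\<dots> \<le> x ^ 3" using x1 by (intro power_increasing) auto
    finally show "\<bar>k - m\<bar> ^ 2 \<le> x ^ 3" .
  qed auto
  finally have 1: "\<bar>k - m\<bar> * \<bar>m\<bar> \<le> 1 * ((1 + \<bar>k\<bar>) * x\<^sup>2 + x ^ 3)" by simp
  have 2: "(if sgn k \<noteq> sgn m \<and> m \<noteq> 0 then 2 * (1 + \<bar>g\<bar>) * (\<bar>m\<bar> + \<bar>m\<bar> ^ 3) else 0) \<le> 4 * (1 + \<bar>g\<bar>) * ((1 + \<bar>k\<bar>) * x\<^sup>2 + x ^ 3)"
  proof (cases "sgn k \<noteq> sgn m \<and> m \<noteq> 0")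
    case True
    have "(1 + \<bar>m\<bar>) ^ 3 \<le> x ^ 3" using sgn_neq_abs True by (intro power_mono) (auto simp: x_def)
    then have "2 * (1 + \<bar>g\<bar>) * (\<bar>m\<bar> + \<bar>m\<bar> ^ 3) \<le> 2 * (1 + \<bar>g\<bar>) * (2 * x ^ 3)"
      using one_abs_powers[of m] by (intro mult_left_mono) auto
    also have "\<dots> = 4 * (1 + \<bar>g\<bar>) * x ^ 3" by simp
    also have "\<dots> \<le> 4 * (1 + \<bar>g\<bar>) * ((1 + \<bar>k\<bar>) * x\<^sup>2 + x ^ 3)" using x1 by (intro mult_left_mono) auto
    finally show ?thesis using True by simp
  qed (use x1 in auto)
  from add_mono[OF 1 2] have "tk g k m \<le> 1 * ((1 + \<bar>k\<bar>) * x\<^sup>2 + x ^ 3) + 4 * (1 + \<bar>g\<bar>) * ((1 + \<bar>k\<bar>) * x\<^sup>2 + x ^ 3)"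
    by (simp only: tk_def)
  also have "\<dots> = (1 + 4 * (1 + \<bar>g\<bar>)) * ((1 + \<bar>k\<bar>) * x\<^sup>2 + x ^ 3)" by (rule distrib_right[symmetric])
  also have "\<dots> \<le> C * ((1 + \<bar>k\<bar>) * x\<^sup>2 + x ^ 3)" using x1 unfolding C_def by (intro mult_right_mono) auto
  finally show ?thesis .
qed

section \<open>Estimates of the quadratic term\<close>

lemma kq_measurable [measurable]: "(\<lambda>(k, m). kq a g k m) \<in> borel_measurable (borel \<Otimes>\<^sub>M borel)"
  unfolding kq_def sgn_real_def by measurable

lemma symb_measurable [measurable]: "symb e a g \<in> borel_measurable borel"
  unfolding symb_def sgn_real_def by measurable

abbreviation ew :: "real \<Rightarrow> ennreal" where "ew k \<equiv> ennreal (1 + \<bar>k\<bar>)"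

text \<open>The first factor stems from the division in \<open>kq_tk\<close>, the second from the
  three bounds on \<open>tk\<close>.\<close>

definition Cq :: "real \<Rightarrow> real \<Rightarrow> real" where "Cq a g = (1 + 1 / a) * (8 * (1 + \<bar>g\<bar>))"

lemma Cq_pos: "a > 0 \<Longrightarrow> Cq a g > 0"
  unfolding Cq_def by (intro mult_pos_pos add_pos_nonneg) auto

lemma kq_weight1:
  assumes a: "a > 0"
  shows "ew k ^ 3 * ennreal (cmod (kq a g k m)) \<le> ennreal (Cq a g) * (ew (k - m) ^ 3 * ew m ^ 2 + ew (k - m) ^ 2 * ew m ^ 3)"
proof -
  let ?x = "1 + \<bar>k - m\<bar>" and ?y = "1 + \<bar>m\<bar>" and ?z = "1 + \<bar>k\<bar>"
  have z: "?z > 0" by linarith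
  have "?z ^ 3 * cmod (kq a g k m) \<le> ?z ^ 3 * ((1 + 1 / a) / ?z * tk g k m)"
    using kq_tk[OF a] by (intro mult_left_mono) auto
  also have "\<dots> = (1 + 1 / a) * (?z\<^sup>2 * tk g k m)" using z by (simp add: power3_eq_cube power2_eq_square)
  also have "\<dots> \<le> (1 + 1 / a) * (8 * (1 + \<bar>g\<bar>) * (?x ^ 3 * ?y\<^sup>2 + ?x\<^sup>2 * ?y ^ 3))"
    using a by (intro mult_left_mono tk_bound1) auto
  also have "\<dots> = Cq a g * (?x ^ 3 * ?y\<^sup>2 + ?x\<^sup>2 * ?y ^ 3)" by (simp add: Cq_def mult.assoc)
  finally have "ennreal (?z ^ 3 * cmod (kq a g k m)) \<le> ennreal (Cq a g * (?x ^ 3 * ?y\<^sup>2 + ?x\<^sup>2 * ?y ^ 3))" by (rule ennreal_leI)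
  then show ?thesis using Cq_pos[OF a, of g]
    by (simp add: ennreal_mult ennreal_power[symmetric] ennreal_plus[of "?x ^ 3 * ?y\<^sup>2"] del: ennreal_plus)
qed

lemma add_div_cancel: "z > 0 \<Longrightarrow> (z * p + r) / z = p + 1 / z * (r::real)"
  by (simp add: add_divide_distrib)

lemma kq_weight2:
  assumes a: "a > 0"
  shows "ennreal (cmod (kq a g k m)) \<le> ennreal (Cq a g) * (ew m ^ 2 + ennreal (1 / (1 + \<bar>k\<bar>)) * ew m ^ 3)"
proof -
  let ?y = "1 + \<bar>m\<bar>" and ?z = "1 + \<bar>k\<bar>"
  have z: "?z > 0" by linarith
  have "cmod (kq a g k m) \<le> (1 + 1 / a) / ?z * tk g k m" by (rule kq_tk[OF a])
  also have "\<dots> \<le> (1 + 1 / a) / ?z * (8 * (1 + \<bar>g\<bar>) * (?z * ?y\<^sup>2 + ?y ^ 3))"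
    using a by (intro mult_left_mono tk_bound2) auto
  also have "\<dots> = Cq a g * ((?z * ?y\<^sup>2 + ?y ^ 3) / ?z)" by (simp only: Cq_def times_divide_eq_left times_divide_eq_right mult.assoc)
  also have "(?z * ?y\<^sup>2 + ?y ^ 3) / ?z = ?y\<^sup>2 + 1 / ?z * ?y ^ 3" using z by (rule add_div_cancel)
  finally have "ennreal (cmod (kq a g k m)) \<le> ennreal (Cq a g * (?y\<^sup>2 + 1 / ?z * ?y ^ 3))" by (rule ennreal_leI)
  also have "\<dots> = ennreal (Cq a g) * (ennreal (?y\<^sup>2) + ennreal (1 / ?z * ?y ^ 3))"
    using Cq_pos[OF a, of g] by (subst ennreal_mult) auto
  also have "ennreal (?y\<^sup>2) = ennreal ?y ^ 2" by (simp add: ennreal_power del: ennreal_plus)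
  also have "ennreal (1 / ?z * ?y ^ 3) = ennreal (1 / ?z) * ennreal ?y ^ 3"
    by (subst ennreal_mult) (auto simp: ennreal_power simp del: ennreal_plus)
  finally show ?thesis .
qed

lemma kq_weight3:
  assumes a: "a > 0"
  shows "ennreal (cmod (kq a g k m)) \<le> ennreal (Cq a g) * (ew (k - m) ^ 2 + ennreal (1 / (1 + \<bar>k\<bar>)) * ew (k - m) ^ 3)"
proof -
  let ?y = "1 + \<bar>k - m\<bar>" and ?z = "1 + \<bar>k\<bar>"
  have z: "?z > 0" by linarith
  have "cmod (kq a g k m) \<le> (1 + 1 / a) / ?z * tk g k m" by (rule kq_tk[OF a])
  also have "\<dots> \<le> (1 + 1 / a) / ?z * (8 * (1 + \<bar>g\<bar>) * (?z * ?y\<^sup>2 + ?y ^ 3))"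
    using a by (intro mult_left_mono tk_bound3) auto
  also have "\<dots> = Cq a g * ((?z * ?y\<^sup>2 + ?y ^ 3) / ?z)" by (simp only: Cq_def times_divide_eq_left times_divide_eq_right mult.assoc)
  also have "(?z * ?y\<^sup>2 + ?y ^ 3) / ?z = ?y\<^sup>2 + 1 / ?z * ?y ^ 3" using z by (rule add_div_cancel)
  finally have "ennreal (cmod (kq a g k m)) \<le> ennreal (Cq a g * (?y\<^sup>2 + 1 / ?z * ?y ^ 3))" by (rule ennreal_leI)
  also have "\<dots> = ennreal (Cq a g) * (ennreal (?y\<^sup>2) + ennreal (1 / ?z * ?y ^ 3))"
    using Cq_pos[OF a, of g] by (subst ennreal_mult) auto
  also have "ennreal (?y\<^sup>2) = ennreal ?y ^ 2" by (simp add: ennreal_power del: ennreal_plus)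
  also have "ennreal (1 / ?z * ?y ^ 3) = ennreal (1 / ?z) * ennreal ?y ^ 3"
    by (subst ennreal_mult) (auto simp: ennreal_power simp del: ennreal_plus)
  finally show ?thesis .
qed

lemma maj_measurable [measurable]:
  assumes [measurable]: "(\<lambda>(k, m). q k m) \<in> borel_measurable (borel \<Otimes>\<^sub>M borel)" "A \<in> borel_measurable borel" "D \<in> borel_measurable borel"
  shows "maj q A D \<in> borel_measurable borel"
proof -
  note [measurable] = measurable_Pair_compose_split[OF assms(1)]
  show ?thesis unfolding maj_def by measurable
qed

lemma maj_mono: "(\<And>k. A k \<le> A' k) \<Longrightarrow> (\<And>k. D k \<le> D' k) \<Longrightarrow> maj q A D k \<le> maj q A' D' k"
  unfolding maj_def by (intro nn_integral_mono mult_mono) auto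

text \<open>The factor 4 is 2 + 2, from squaring a sum of two convolutions; \<open>Jc\<close> is the
  price of one L1 norm or of one decaying factor.\<close>

definition Kq :: "real \<Rightarrow> real \<Rightarrow> ennreal" where "Kq a g = 4 * (ennreal (Cq a g))\<^sup>2 * Jc"

lemma Kq_finite: "Kq a g < \<infinity>"
  unfolding Kq_def using Jc_finite by (simp add: ennreal_mult_less_top power_less_top_ennreal)

lemma nn_integral_sq_cmult_add_le:
  assumes [measurable]: "A \<in> borel_measurable lborel" "D \<in> borel_measurable lborel"
  shows "(\<integral>\<^sup>+k. (c * (A k + D k))\<^sup>2 \<partial>lborel) \<le> c\<^sup>2 * (2 * (\<integral>\<^sup>+k. (A k)\<^sup>2 \<partial>lborel) + 2 * (\<integral>\<^sup>+k. (D k)\<^sup>2 \<partial>lborel))"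
proof -
  have "(\<integral>\<^sup>+k. (c * (A k + D k))\<^sup>2 \<partial>lborel) = c\<^sup>2 * (\<integral>\<^sup>+k. (A k + D k)\<^sup>2 \<partial>lborel)"
    unfolding power_mult_distrib by (rule nn_integral_cmult) measurable
  also have "\<dots> \<le> c\<^sup>2 * (2 * (\<integral>\<^sup>+k. (A k)\<^sup>2 \<partial>lborel) + 2 * (\<integral>\<^sup>+k. (D k)\<^sup>2 \<partial>lborel))"
    by (intro mult_left_mono nn_integral_sq_add_le) auto
  finally show ?thesis .
qed

text \<open>Boundedness of the quadratic term on H^3: in each of the two convolutions the factor
  with weight 3 is measured in L2 and the factor with weight 2 in L1, by Young's inequality.\<close>

lemma maj_bound1:
  assumes a: "a > 0" and [measurable]: "A \<in> borel_measurable borel" "D \<in> borel_measurable borel"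
  shows "nsq 3 (maj (kq a g) A D) \<le> Kq a g * nsq 3 A * nsq 3 D"
proof -
  let ?c = "ennreal (Cq a g)"
  let ?A = "\<lambda>s k. ew k ^ s * A k" and ?D = "\<lambda>s k. ew k ^ s * D k"
  note [measurable] = measurable_Pair_compose_split[OF kq_measurable]
  have "ew k ^ 3 * maj (kq a g) A D k \<le> ?c * (cvn (?A 3) (?D 2) k + cvn (?A 2) (?D 3) k)" for k
  proof -
    have "ew k ^ 3 * maj (kq a g) A D k = (\<integral>\<^sup>+m. (ew k ^ 3 * ennreal (cmod (kq a g k m))) * (A (k - m) * D m) \<partial>lborel)"
      unfolding maj_def by (subst nn_integral_cmult[symmetric]) (auto simp: mult.assoc)
    also have "\<dots> \<le> (\<integral>\<^sup>+m. (?c * (ew (k - m) ^ 3 * ew m ^ 2 + ew (k - m) ^ 2 * ew m ^ 3)) * (A (k - m) * D m) \<partial>lborel)"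
      by (intro nn_integral_mono mult_right_mono kq_weight1 a) auto
    also have "\<dots> = (\<integral>\<^sup>+m. ?c * (?A 3 (k - m) * ?D 2 m + ?A 2 (k - m) * ?D 3 m) \<partial>lborel)"
      by (intro nn_integral_cong) (simp add: distrib_left distrib_right mult_ac)
    also have "\<dots> = ?c * (cvn (?A 3) (?D 2) k + cvn (?A 2) (?D 3) k)"
      unfolding cvn_def by (subst nn_integral_cmult, measurable, subst nn_integral_add) measurable
    finally show ?thesis .
  qed
  then have "nsq 3 (maj (kq a g) A D) \<le> (\<integral>\<^sup>+k. (?c * (cvn (?A 3) (?D 2) k + cvn (?A 2) (?D 3) k))\<^sup>2 \<partial>lborel)"
    unfolding nsq_def by (intro nn_integral_mono power_mono) auto
  also have "\<dots> \<le> ?c\<^sup>2 * (2 * (\<integral>\<^sup>+k. (cvn (?A 3) (?D 2) k)\<^sup>2 \<partial>lborel) + 2 * (\<integral>\<^sup>+k. (cvn (?A 2) (?D 3) k)\<^sup>2 \<partial>lborel))"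
    by (rule nn_integral_sq_cmult_add_le) measurable
  also have "\<dots> \<le> ?c\<^sup>2 * (2 * (nsq 3 A * (Jc * nsq 3 D)) + 2 * (nsq 3 D * (Jc * nsq 3 A)))"
  proof (intro mult_left_mono add_mono)
    have "(\<integral>\<^sup>+k. (cvn (?A 3) (?D 2) k)\<^sup>2 \<partial>lborel) \<le> (\<integral>\<^sup>+m. (?A 3 m)\<^sup>2 \<partial>lborel) * (\<integral>\<^sup>+m. ?D 2 m \<partial>lborel)\<^sup>2"
      by (rule Young_L2_L1) measurable
    also have "\<dots> \<le> nsq 3 A * (Jc * nsq 3 D)" unfolding nsq_def[of 3 A] by (intro mult_left_mono weighted_L1_le) auto
    finally show "(\<integral>\<^sup>+k. (cvn (?A 3) (?D 2) k)\<^sup>2 \<partial>lborel) \<le> nsq 3 A * (Jc * nsq 3 D)" .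
    have "(\<integral>\<^sup>+k. (cvn (?A 2) (?D 3) k)\<^sup>2 \<partial>lborel) = (\<integral>\<^sup>+k. (cvn (?D 3) (?A 2) k)\<^sup>2 \<partial>lborel)"
      by (subst cvn_commute) auto
    also have "\<dots> \<le> (\<integral>\<^sup>+m. (?D 3 m)\<^sup>2 \<partial>lborel) * (\<integral>\<^sup>+m. ?A 2 m \<partial>lborel)\<^sup>2"
      by (rule Young_L2_L1) measurable
    also have "\<dots> \<le> nsq 3 D * (Jc * nsq 3 A)" unfolding nsq_def[of 3 D] by (intro mult_left_mono weighted_L1_le) auto
    finally show "(\<integral>\<^sup>+k. (cvn (?A 2) (?D 3) k)\<^sup>2 \<partial>lborel) \<le> nsq 3 D * (Jc * nsq 3 A)" .
  qed auto
  also have "\<dots> = Kq a g * nsq 3 A * nsq 3 D"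
  proof -
    have "2 * x + 2 * x = 4 * x" for x :: ennreal by (simp flip: distrib_right)
    from this[of "Jc * nsq 3 A * nsq 3 D"] show ?thesis by (simp add: Kq_def mult_ac)
  qed
  finally show ?thesis .
qed

lemma maj_le_cvn:
  assumes a: "a > 0" and [measurable]: "A \<in> borel_measurable borel" "D \<in> borel_measurable borel"
  shows "maj (kq a g) A D k \<le> ennreal (Cq a g) * (cvn A (\<lambda>k. ew k ^ 2 * D k) k + ennreal (1 / (1 + \<bar>k\<bar>)) * cvn A (\<lambda>k. ew k ^ 3 * D k) k)"
    and "maj (kq a g) A D k \<le> ennreal (Cq a g) * (cvn (\<lambda>k. ew k ^ 2 * A k) D k + ennreal (1 / (1 + \<bar>k\<bar>)) * cvn (\<lambda>k. ew k ^ 3 * A k) D k)"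
proof -
  let ?c = "ennreal (Cq a g)" and ?v = "ennreal (1 / (1 + \<bar>k\<bar>))"
  note [measurable] = measurable_Pair_compose_split[OF kq_measurable]
  have "maj (kq a g) A D k \<le> (\<integral>\<^sup>+m. (?c * (ew m ^ 2 + ?v * ew m ^ 3)) * (A (k - m) * D m) \<partial>lborel)"
    unfolding maj_def mult.assoc[of _ "A _"] by (intro nn_integral_mono mult_right_mono kq_weight2 a) auto
  also have "\<dots> = (\<integral>\<^sup>+m. ?c * (A (k - m) * (ew m ^ 2 * D m) + ?v * (A (k - m) * (ew m ^ 3 * D m))) \<partial>lborel)"
    by (intro nn_integral_cong) (simp add: distrib_left distrib_right mult_ac)
  also have "\<dots> = ?c * (cvn A (\<lambda>k. ew k ^ 2 * D k) k + ?v * cvn A (\<lambda>k. ew k ^ 3 * D k) k)"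
    unfolding cvn_def by (subst nn_integral_cmult, measurable, subst nn_integral_add, measurable, subst nn_integral_cmult) measurable
  finally show "maj (kq a g) A D k \<le> ?c * (cvn A (\<lambda>k. ew k ^ 2 * D k) k + ?v * cvn A (\<lambda>k. ew k ^ 3 * D k) k)" .
  have "maj (kq a g) A D k \<le> (\<integral>\<^sup>+m. (?c * (ew (k - m) ^ 2 + ?v * ew (k - m) ^ 3)) * (A (k - m) * D m) \<partial>lborel)"
    unfolding maj_def mult.assoc[of _ "A _"] by (intro nn_integral_mono mult_right_mono kq_weight3 a) auto
  also have "\<dots> = (\<integral>\<^sup>+m. ?c * (ew (k - m) ^ 2 * A (k - m) * D m + ?v * (ew (k - m) ^ 3 * A (k - m) * D m)) \<partial>lborel)"
    by (intro nn_integral_cong) (simp add: distrib_left distrib_right mult_ac)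
  also have "\<dots> = ?c * (cvn (\<lambda>k. ew k ^ 2 * A k) D k + ?v * cvn (\<lambda>k. ew k ^ 3 * A k) D k)"
    unfolding cvn_def by (subst nn_integral_cmult, measurable, subst nn_integral_add, measurable, subst nn_integral_cmult) measurable
  finally show "maj (kq a g) A D k \<le> ?c * (cvn (\<lambda>k. ew k ^ 2 * A k) D k + ?v * cvn (\<lambda>k. ew k ^ 3 * A k) D k)" .
qed

text \<open>With all three powers on one factor the L1 norm is no longer available. The convolution
  of two L2 functions is merely bounded, and the decay 1/(1 + |k|) left over from the division makes
  it square integrable.\<close>

lemma decay_cvn_sq_le:
  assumes [measurable]: "A \<in> borel_measurable borel" "D \<in> borel_measurable borel"
  shows "(\<integral>\<^sup>+k. (ennreal (1 / (1 + \<bar>k\<bar>)) * cvn A D k)\<^sup>2 \<partial>lborel) \<le> Jc * ((\<integral>\<^sup>+m. (A m)\<^sup>2 \<partial>lborel) * (\<integral>\<^sup>+m. (D m)\<^sup>2 \<partial>lborel))"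
proof -
  have "(\<integral>\<^sup>+k. (ennreal (1 / (1 + \<bar>k\<bar>)) * cvn A D k)\<^sup>2 \<partial>lborel) \<le>
    (\<integral>\<^sup>+k. (ennreal (1 / (1 + \<bar>k\<bar>)))\<^sup>2 * ((\<integral>\<^sup>+m. (A m)\<^sup>2 \<partial>lborel) * (\<integral>\<^sup>+m. (D m)\<^sup>2 \<partial>lborel)) \<partial>lborel)"
    unfolding power_mult_distrib by (intro nn_integral_mono mult_left_mono cvn_sq_le) auto
  also have "\<dots> = Jc * ((\<integral>\<^sup>+m. (A m)\<^sup>2 \<partial>lborel) * (\<integral>\<^sup>+m. (D m)\<^sup>2 \<partial>lborel))"
    unfolding Jc_def by (rule nn_integral_multc) measurable
  finally show ?thesis .
qed

lemma Kq_combine: "(ennreal (Cq a g))\<^sup>2 * (2 * (x * (Jc * y)) + 2 * (Jc * (x * y))) = Kq a g * x * y"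
proof -
  have "2 * x + 2 * x = 4 * x" for x :: ennreal by (simp flip: distrib_right)
  from this[of "Jc * x * y"] show ?thesis by (simp add: Kq_def mult_ac)
qed

text \<open>An estimate with no weight on the first factor, meant for the difference of two
  solutions; it combines Young's inequality for the term with weight 2 and the decaying bound for
  the term with weight 3. \<open>maj_bound3\<close> exchanges the roles of the factors.\<close>

lemma maj_bound2:
  assumes a: "a > 0" and [measurable]: "A \<in> borel_measurable borel" "D \<in> borel_measurable borel"
  shows "nsq 0 (maj (kq a g) A D) \<le> Kq a g * nsq 0 A * nsq 3 D"
proof -
  let ?c = "ennreal (Cq a g)" and ?v = "\<lambda>k. ennreal (1 / (1 + \<bar>k\<bar>))"
  let ?D = "\<lambda>s k. ew k ^ s * D k"
  have "nsq 0 (maj (kq a g) A D) \<le> (\<integral>\<^sup>+k. (?c * (cvn A (?D 2) k + ?v k * cvn A (?D 3) k))\<^sup>2 \<partial>lborel)"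
    unfolding nsq_def using maj_le_cvn(1)[OF assms] by (intro nn_integral_mono power_mono) auto
  also have "\<dots> \<le> ?c\<^sup>2 * (2 * (\<integral>\<^sup>+k. (cvn A (?D 2) k)\<^sup>2 \<partial>lborel) + 2 * (\<integral>\<^sup>+k. (?v k * cvn A (?D 3) k)\<^sup>2 \<partial>lborel))"
    by (rule nn_integral_sq_cmult_add_le) measurable
  also have "\<dots> \<le> ?c\<^sup>2 * (2 * (nsq 0 A * (Jc * nsq 3 D)) + 2 * (Jc * (nsq 0 A * nsq 3 D)))"
  proof (intro mult_left_mono add_mono)
    have "(\<integral>\<^sup>+k. (cvn A (?D 2) k)\<^sup>2 \<partial>lborel) \<le> (\<integral>\<^sup>+m. (A m)\<^sup>2 \<partial>lborel) * (\<integral>\<^sup>+m. ?D 2 m \<partial>lborel)\<^sup>2"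
      by (rule Young_L2_L1) measurable
    also have "\<dots> \<le> nsq 0 A * (Jc * nsq 3 D)" by (intro mult_mono weighted_L1_le) (auto simp: nsq_def)
    finally show "(\<integral>\<^sup>+k. (cvn A (?D 2) k)\<^sup>2 \<partial>lborel) \<le> nsq 0 A * (Jc * nsq 3 D)" .
    show "(\<integral>\<^sup>+k. (?v k * cvn A (?D 3) k)\<^sup>2 \<partial>lborel) \<le> Jc * (nsq 0 A * nsq 3 D)"
      using decay_cvn_sq_le[of A "?D 3"] by (simp add: nsq_def)
  qed auto
  also have "\<dots> = Kq a g * nsq 0 A * nsq 3 D" by (rule Kq_combine)
  finally show ?thesis .
qed

lemma maj_bound3:
  assumes a: "a > 0" and [measurable]: "A \<in> borel_measurable borel" "D \<in> borel_measurable borel"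
  shows "nsq 0 (maj (kq a g) A D) \<le> Kq a g * nsq 3 A * nsq 0 D"
proof -
  let ?c = "ennreal (Cq a g)" and ?v = "\<lambda>k. ennreal (1 / (1 + \<bar>k\<bar>))"
  let ?A = "\<lambda>s k. ew k ^ s * A k"
  have "nsq 0 (maj (kq a g) A D) \<le> (\<integral>\<^sup>+k. (?c * (cvn (?A 2) D k + ?v k * cvn (?A 3) D k))\<^sup>2 \<partial>lborel)"
    unfolding nsq_def using maj_le_cvn(2)[OF assms] by (intro nn_integral_mono power_mono) auto
  also have "\<dots> \<le> ?c\<^sup>2 * (2 * (\<integral>\<^sup>+k. (cvn (?A 2) D k)\<^sup>2 \<partial>lborel) + 2 * (\<integral>\<^sup>+k. (?v k * cvn (?A 3) D k)\<^sup>2 \<partial>lborel))"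
    by (rule nn_integral_sq_cmult_add_le) measurable
  also have "\<dots> \<le> ?c\<^sup>2 * (2 * (nsq 0 D * (Jc * nsq 3 A)) + 2 * (Jc * (nsq 0 D * nsq 3 A)))"
  proof (intro mult_left_mono add_mono)
    have "(\<integral>\<^sup>+k. (cvn (?A 2) D k)\<^sup>2 \<partial>lborel) = (\<integral>\<^sup>+k. (cvn D (?A 2) k)\<^sup>2 \<partial>lborel)" by (subst cvn_commute) auto
    also have "\<dots> \<le> (\<integral>\<^sup>+m. (D m)\<^sup>2 \<partial>lborel) * (\<integral>\<^sup>+m. ?A 2 m \<partial>lborel)\<^sup>2"
      by (rule Young_L2_L1) measurable
    also have "\<dots> \<le> nsq 0 D * (Jc * nsq 3 A)" by (intro mult_mono weighted_L1_le) (auto simp: nsq_def)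
    finally show "(\<integral>\<^sup>+k. (cvn (?A 2) D k)\<^sup>2 \<partial>lborel) \<le> nsq 0 D * (Jc * nsq 3 A)" .
    show "(\<integral>\<^sup>+k. (?v k * cvn (?A 3) D k)\<^sup>2 \<partial>lborel) \<le> Jc * (nsq 0 D * nsq 3 A)"
      using decay_cvn_sq_le[of "?A 3" D] by (simp add: nsq_def mult.commute)
  qed auto
  also have "\<dots> = Kq a g * nsq 0 D * nsq 3 A" by (rule Kq_combine)
  finally show ?thesis by (simp add: mult_ac)
qed

text \<open>Finite at every \<open>k\<close>, not just almost everywhere, since convolutions of L2
  functions are bounded. This lets the mild equation be treated at each frequency
  separately.\<close>

lemma maj_finite:
  assumes a: "a > 0" and [measurable]: "A \<in> borel_measurable borel" "D \<in> borel_measurable borel"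
    and fin: "nsq 3 A < \<infinity>" "nsq 3 D < \<infinity>"
  shows "maj (kq a g) A D k < \<infinity>"
proof -
  have c: "cvn A (\<lambda>k. ew k ^ s * D k) k < \<infinity>" if "s \<le> 3" for s
  proof -
    have "(cvn A (\<lambda>k. ew k ^ s * D k) k)\<^sup>2 \<le> nsq 0 A * nsq s D" using cvn_sq_le[of A "\<lambda>k. ew k ^ s * D k" k] by (simp add: nsq_def)
    also have "\<dots> \<le> nsq 3 A * nsq 3 D" using that by (intro mult_mono nsq_le) auto
    also have "\<dots> < \<infinity>" using fin by (simp add: ennreal_mult_less_top)
    finally show ?thesis by (simp add: power_less_top_ennreal)
  qed
  show ?thesis
    by (rule le_less_trans[OF maj_le_cvn(1)[OF assms(1-3)]]) (use c[of 2] c[of 3] in \<open>auto simp: ennreal_mult_less_top\<close>)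
qed

lemma Qf_le_maj:
  assumes "\<And>k. ennreal (cmod (F k)) \<le> A k" "\<And>k. ennreal (cmod (G k)) \<le> D k"
  shows "ennreal (cmod (Qf q F G k)) \<le> maj q A D k"
proof -
  have "ennreal (cmod (Qf q F G k)) \<le> (\<integral>\<^sup>+m. ennreal (cmod (q k m * F (k - m) * G m)) \<partial>lborel)"
    unfolding Qf_def
  proof (cases "integrable lborel (\<lambda>m. q k m * F (k - m) * G m)")
    case True
    then show "ennreal (cmod (LINT m|lborel. q k m * F (k - m) * G m)) \<le> (\<integral>\<^sup>+m. ennreal (cmod (q k m * F (k - m) * G m)) \<partial>lborel)"
      by (rule integral_norm_bound_ennreal)
  qed (simp add: not_integrable_integral_eq)
  also have "\<dots> \<le> maj q A D k"
    unfolding maj_def using assms by (intro nn_integral_mono) (auto simp: norm_mult ennreal_mult intro!: mult_mono)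
  finally show ?thesis .
qed

lemma Qf_integrable:
  assumes q: "(\<lambda>(k, m). q k m) \<in> borel_measurable (borel \<Otimes>\<^sub>M borel)"
    and [measurable]: "F \<in> borel_measurable borel" "G \<in> borel_measurable borel"
    and "\<And>k. ennreal (cmod (F k)) \<le> A k" "\<And>k. ennreal (cmod (G k)) \<le> D k" and fin: "maj q A D k < \<infinity>"
  shows "integrable lborel (\<lambda>m. q k m * F (k - m) * G m)"
proof (subst integrable_iff_bounded, intro conjI)
  note [measurable] = measurable_Pair_compose_split[OF q]
  show "(\<lambda>m. q k m * F (k - m) * G m) \<in> borel_measurable lborel" by measurable
  have "(\<integral>\<^sup>+m. ennreal (cmod (q k m * F (k - m) * G m)) \<partial>lborel) \<le> maj q A D k"
    unfolding maj_def using assms(4,5) by (intro nn_integral_mono) (auto simp: norm_mult ennreal_mult intro!: mult_mono)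
  then show "(\<integral>\<^sup>+m. ennreal (norm (q k m * F (k - m) * G m)) \<partial>lborel) < \<infinity>" using fin by (rule le_less_trans)
qed

lemma Qf_diff_le:
  assumes q: "(\<lambda>(k, m). q k m) \<in> borel_measurable (borel \<Otimes>\<^sub>M borel)"
    and m: "F \<in> borel_measurable borel" "G \<in> borel_measurable borel"
    and F: "\<And>k. ennreal (cmod (F k)) \<le> A k" and G: "\<And>k. ennreal (cmod (G k)) \<le> A k" and fin: "maj q A A k < \<infinity>"
    and D: "\<And>k. ennreal (cmod (F k - G k)) \<le> D k" and [measurable]: "A \<in> borel_measurable borel" "D \<in> borel_measurable borel"
  shows "ennreal (cmod (Qf q F F k - Qf q G G k)) \<le> maj q D A k + maj q A D k"
proof -
  note [measurable] = measurable_Pair_compose_split[OF q]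
  note i = Qf_integrable[OF q m(1) m(1) F F fin] Qf_integrable[OF q m(2) m(2) G G fin]
  have "Qf q F F k - Qf q G G k = (LINT m|lborel. q k m * F (k - m) * F m - q k m * G (k - m) * G m)"
    unfolding Qf_def using i by simp
  also have "ennreal (cmod \<dots>) \<le> (\<integral>\<^sup>+m. ennreal (cmod (q k m * F (k - m) * F m - q k m * G (k - m) * G m)) \<partial>lborel)"
    using i by (intro integral_norm_bound_ennreal) auto
  also have "\<dots> \<le> (\<integral>\<^sup>+m. ennreal (cmod (q k m)) * D (k - m) * A m + ennreal (cmod (q k m)) * A (k - m) * D m \<partial>lborel)"
  proof (rule nn_integral_mono)
    fix m
    have "q k m * F (k - m) * F m - q k m * G (k - m) * G m = q k m * (F (k - m) - G (k - m)) * F m + q k m * G (k - m) * (F m - G m)"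
      by (simp add: algebra_simps)
    then have "cmod (q k m * F (k - m) * F m - q k m * G (k - m) * G m) \<le> cmod (q k m * (F (k - m) - G (k - m)) * F m) + cmod (q k m * G (k - m) * (F m - G m))"
      by (simp only: norm_triangle_ineq)
    then have "ennreal (cmod (q k m * F (k - m) * F m - q k m * G (k - m) * G m)) \<le> ennreal (cmod (q k m * (F (k - m) - G (k - m)) * F m)) + ennreal (cmod (q k m * G (k - m) * (F m - G m)))"
      by (simp add: ennreal_leI flip: ennreal_plus)
    also have "\<dots> \<le> ennreal (cmod (q k m)) * D (k - m) * A m + ennreal (cmod (q k m)) * A (k - m) * D m"
      using F G D by (intro add_mono) (auto simp: norm_mult ennreal_mult intro!: mult_mono)
    finally show "ennreal (cmod (q k m * F (k - m) * F m - q k m * G (k - m) * G m)) \<le> ennreal (cmod (q k m)) * D (k - m) * A m + ennreal (cmod (q k m)) * A (k - m) * D m" .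
  qed
  also have "\<dots> = maj q D A k + maj q A D k" unfolding maj_def by (rule nn_integral_add) measurable
  finally show ?thesis .
qed

text \<open>Equality almost everywhere of the arguments gives equality at every \<open>k\<close>:
  the quadratic term sees its arguments only under an integral. The Picard limit relies on this to
  remove exceptional sets.\<close>

lemma Qf_cong_AE:
  assumes q: "(\<lambda>(k, m). q k m) \<in> borel_measurable (borel \<Otimes>\<^sub>M borel)"
    and [measurable]: "F \<in> borel_measurable borel" "G \<in> borel_measurable borel" and eq: "AE k in lborel. F k = G k"
  shows "Qf q F F k = Qf q G G k"
  unfolding Qf_def
proof (rule integral_cong_AE)
  note [measurable] = measurable_Pair_compose_split[OF q]
  have "AE m in lborel. F (k - m) = G (k - m)"
  proof -
    have "AE m in lborel. F (k + m) = G (k + m)"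
      using AE_borel_affine[of 1 "\<lambda>m. F m = G m" k] eq by simp
    from AE_lborel_uminus[OF this] show ?thesis by simp
  qed
  with eq show "AE m in lborel. q k m * F (k - m) * F m = q k m * G (k - m) * G m" by eventually_elim simp
  show "(\<lambda>m. q k m * F (k - m) * F m) \<in> borel_measurable lborel" by measurable
  show "(\<lambda>m. q k m * G (k - m) * G m) \<in> borel_measurable lborel" by measurable
qed

section \<open>Iteration with a majorant independent of time\<close>

lemma norm_integral_le_nn_integral: "ennreal (norm (LINT x|M. f x)) \<le> (\<integral>\<^sup>+x. ennreal (norm (f x)) \<partial>M)"
  for f :: "'a \<Rightarrow> complex"
  by (cases "integrable M f") (auto simp: integral_norm_bound_ennreal not_integrable_integral_eq)

lemma integrable_enn2real:
  assumes [measurable]: "h \<in> borel_measurable M" and "(\<integral>\<^sup>+x. h x \<partial>M) < \<infinity>"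
  shows "integrable M (\<lambda>x. enn2real (h x))"
proof (subst integrable_iff_bounded, intro conjI)
  have "(\<integral>\<^sup>+x. ennreal (norm (enn2real (h x))) \<partial>M) \<le> (\<integral>\<^sup>+x. h x \<partial>M)"
    by (intro nn_integral_mono) (simp add: ennreal_enn2real_if)
  then show "(\<integral>\<^sup>+x. ennreal (norm (enn2real (h x))) \<partial>M) < \<infinity>" using assms(2) by (rule le_less_trans)
qed measurable

lemma le_enn2real: "ennreal r \<le> x \<Longrightarrow> x < \<infinity> \<Longrightarrow> r \<le> enn2real x"
  by (cases x) (auto simp: ennreal_le_iff2)

lemma AE_lborel_plus:
  assumes "AE x in lborel. P (x::real)" shows "AE x in lborel. P (c + x)"
proof -
  have "AE x in distr lborel borel ((+) c). P x"
    using assms lborel_distr_plus by metis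
  then show ?thesis by (rule AE_distrD[rotated]) simp
qed

abbreviation ex :: "real \<Rightarrow> complex" where "ex r \<equiv> exp (\<i> * complex_of_real r)"

text \<open>The properties of kernel, symbol and datum on which the iteration rests.
  \<open>K\<close> is the constant of the bilinear bound; the last three assumptions make every
  iterate hermitian, that is, the transform of a real function, and they are imposed at every
  frequency.\<close>

locale picard =
  fixes q :: "real \<Rightarrow> real \<Rightarrow> complex" and p :: "real \<Rightarrow> real" and phi :: "real \<Rightarrow> complex" and K :: ennreal
  assumes q_meas: "(\<lambda>(k, m). q k m) \<in> borel_measurable (borel \<Otimes>\<^sub>M borel)"
    and p_meas [measurable]: "p \<in> borel_measurable borel"
    and phi_meas [measurable]: "phi \<in> borel_measurable borel"
    and phi_fin: "nsq 3 (\<lambda>k. ennreal (cmod (phi k))) < \<infinity>"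
    and K_fin: "K < \<infinity>"
    and bound: "\<And>A D. A \<in> borel_measurable borel \<Longrightarrow> D \<in> borel_measurable borel \<Longrightarrow> nsq 3 (maj q A D) \<le> K * nsq 3 A * nsq 3 D"
    and maj_fin: "\<And>A D k. A \<in> borel_measurable borel \<Longrightarrow> D \<in> borel_measurable borel \<Longrightarrow> nsq 3 A < \<infinity> \<Longrightarrow> nsq 3 D < \<infinity> \<Longrightarrow> maj q A D k < \<infinity>"
    and q_herm: "\<And>k m. q (- k) (- m) = cnj (q k m)"
    and p_odd: "\<And>k. p (- k) = - p k"
    and phi_herm: "\<And>k. phi (- k) = cnj (phi k)"
begin

lemmas q_comp = measurable_Pair_compose_split[OF q_meas]

text \<open>The integrand of Duhamel's formula with the restriction to [0, t] built in, so that the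
  integral runs over the line. The phase has modulus one, hence the growth of \<open>p\<close> never
  enters an estimate of the iterates.\<close>

definition duh :: "(real \<Rightarrow> real \<Rightarrow> complex) \<Rightarrow> real \<Rightarrow> real \<Rightarrow> real \<Rightarrow> complex" where
  "duh F t k s = (if 0 \<le> s \<and> s \<le> t then ex (- (p k * s)) * Qf q (F s) (F s) k else 0)"

definition Du :: "(real \<Rightarrow> real \<Rightarrow> complex) \<Rightarrow> real \<Rightarrow> real \<Rightarrow> complex" where
  "Du F t k = ex (p k * t) * (phi k + (LINT s|lborel. duh F t k s))"

lemma Qf_meas:
  assumes F: "(\<lambda>(t, k). F t k) \<in> borel_measurable (borel \<Otimes>\<^sub>M borel)"
  shows "(\<lambda>(t, k). Qf q (F t) (F t) k) \<in> borel_measurable (borel \<Otimes>\<^sub>M borel)"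
proof -
  note [measurable] = q_comp measurable_Pair_compose_split[OF F]
  show ?thesis unfolding Qf_def split_beta by measurable
qed

lemma duh_meas:
  assumes F: "(\<lambda>(t, k). F t k) \<in> borel_measurable (borel \<Otimes>\<^sub>M borel)"
    and [measurable]: "f \<in> borel_measurable M" "g \<in> borel_measurable M" "h \<in> borel_measurable M"
  shows "(\<lambda>x. duh F (f x) (g x) (h x)) \<in> borel_measurable M"
proof -
  note [measurable] = measurable_Pair_compose_split[OF Qf_meas[OF F]]
  show ?thesis unfolding duh_def by measurable
qed

lemma duh_curry_meas:
  assumes F: "(\<lambda>(t, k). F t k) \<in> borel_measurable (borel \<Otimes>\<^sub>M borel)"
  shows "duh F t k \<in> borel_measurable borel"
  using duh_meas[OF F borel_measurable_const borel_measurable_const measurable_ident_sets[OF refl], of t k] .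

lemma Du_meas:
  assumes F: "(\<lambda>(t, k). F t k) \<in> borel_measurable (borel \<Otimes>\<^sub>M borel)"
  shows "(\<lambda>(t, k). Du F t k) \<in> borel_measurable (borel \<Otimes>\<^sub>M borel)"
proof -
  note [measurable] = duh_meas[OF F]
  show ?thesis unfolding Du_def split_beta by measurable
qed

lemma curry_meas:
  assumes F: "(\<lambda>(t, k). F t k) \<in> borel_measurable (borel \<Otimes>\<^sub>M borel)"
  shows "F t \<in> borel_measurable borel"
  using measurable_Pair_compose_split[OF F borel_measurable_const measurable_ident_sets[OF refl], of t] .

lemma nn_integral_interval: "0 \<le> T \<Longrightarrow> (\<integral>\<^sup>+s. (if 0 \<le> s \<and> s \<le> T then c else 0) \<partial>lborel) = ennreal T * c"
proof -
  assume T: "0 \<le> T"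
  have "(\<integral>\<^sup>+s. (if 0 \<le> s \<and> s \<le> T then c else 0) \<partial>lborel) = (\<integral>\<^sup>+s. c * indicator {0..T} s \<partial>lborel)"
    by (intro nn_integral_cong) (auto simp: indicator_def)
  also have "\<dots> = c * emeasure lborel {0..T}" by (rule nn_integral_cmult_indicator) simp
  finally show ?thesis using T by (simp add: mult.commute)
qed

lemma duh_le:
  assumes "\<And>s k. 0 \<le> s \<Longrightarrow> s \<le> T \<Longrightarrow> ennreal (cmod (F s k)) \<le> A k" and t: "t \<le> T"
  shows "ennreal (cmod (duh F t k s)) \<le> (if 0 \<le> s \<and> s \<le> T then maj q A A k else 0)"
proof (cases "0 \<le> s \<and> s \<le> t")
  case True
  then have s: "0 \<le> s" "s \<le> T" using t by auto
  have "duh F t k s = ex (- (p k * s)) * Qf q (F s) (F s) k" using True by (simp add: duh_def)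
  then have "ennreal (cmod (duh F t k s)) = ennreal (cmod (Qf q (F s) (F s) k))"
    by (simp only: norm_mult norm_exp_ii) simp
  also have "\<dots> \<le> maj q A A k" by (rule Qf_le_maj) (rule assms(1)[OF s])+
  finally show ?thesis using s by simp
qed (auto simp: duh_def)

lemma duh_integrable:
  assumes F: "(\<lambda>(t, k). F t k) \<in> borel_measurable (borel \<Otimes>\<^sub>M borel)"
    and A: "\<And>s k. 0 \<le> s \<Longrightarrow> s \<le> T \<Longrightarrow> ennreal (cmod (F s k)) \<le> A k" and t: "0 \<le> T" "t \<le> T" and fin: "maj q A A k < \<infinity>"
  shows "integrable lborel (duh F t k)"
proof (subst integrable_iff_bounded, intro conjI)
  show "duh F t k \<in> borel_measurable lborel" unfolding measurable_lborel2 by (rule duh_curry_meas[OF F])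
  have "(\<integral>\<^sup>+s. ennreal (norm (duh F t k s)) \<partial>lborel) \<le> (\<integral>\<^sup>+s. (if 0 \<le> s \<and> s \<le> T then maj q A A k else 0) \<partial>lborel)"
    by (intro nn_integral_mono duh_le A t)
  also have "\<dots> = ennreal T * maj q A A k" by (rule nn_integral_interval[OF t(1)])
  also have "\<dots> < \<infinity>" using fin by (simp add: ennreal_mult_less_top)
  finally show "(\<integral>\<^sup>+s. ennreal (norm (duh F t k s)) \<partial>lborel) < \<infinity>" .
qed

lemma Du_le:
  assumes A: "\<And>s k. 0 \<le> s \<Longrightarrow> s \<le> T \<Longrightarrow> ennreal (cmod (F s k)) \<le> A k" and t: "0 \<le> t" "t \<le> T"
  shows "ennreal (cmod (Du F t k)) \<le> ennreal (cmod (phi k)) + ennreal T * maj q A A k"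
proof -
  have "ennreal (cmod (LINT s|lborel. duh F t k s)) \<le> (\<integral>\<^sup>+s. ennreal (norm (duh F t k s)) \<partial>lborel)"
    by (rule norm_integral_le_nn_integral)
  also have "\<dots> \<le> (\<integral>\<^sup>+s. (if 0 \<le> s \<and> s \<le> T then maj q A A k else 0) \<partial>lborel)"
    by (intro nn_integral_mono duh_le A t)
  also have "\<dots> = ennreal T * maj q A A k" using t by (intro nn_integral_interval) auto
  finally have 1: "ennreal (cmod (LINT s|lborel. duh F t k s)) \<le> ennreal T * maj q A A k" .
  have "cmod (Du F t k) \<le> cmod (phi k) + cmod (LINT s|lborel. duh F t k s)"
    unfolding Du_def norm_mult norm_exp_ii by (simp add: norm_triangle_ineq)
  then have "ennreal (cmod (Du F t k)) \<le> ennreal (cmod (phi k)) + ennreal (cmod (LINT s|lborel. duh F t k s))"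
    by (simp add: ennreal_leI flip: ennreal_plus)
  also have "\<dots> \<le> ennreal (cmod (phi k)) + ennreal T * maj q A A k" using 1 by (intro add_left_mono)
  finally show ?thesis .
qed

lemma Du_diff_le:
  assumes Fm: "(\<lambda>(t, k). F t k) \<in> borel_measurable (borel \<Otimes>\<^sub>M borel)" and Gm: "(\<lambda>(t, k). G t k) \<in> borel_measurable (borel \<Otimes>\<^sub>M borel)"
    and F: "\<And>s k. 0 \<le> s \<Longrightarrow> s \<le> T \<Longrightarrow> ennreal (cmod (F s k)) \<le> A k" and G: "\<And>s k. 0 \<le> s \<Longrightarrow> s \<le> T \<Longrightarrow> ennreal (cmod (G s k)) \<le> A k"
    and D: "\<And>s k. 0 \<le> s \<Longrightarrow> s \<le> T \<Longrightarrow> ennreal (cmod (F s k - G s k)) \<le> D k" 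
    and m: "A \<in> borel_measurable borel" "D \<in> borel_measurable borel"
    and t: "0 \<le> t" "t \<le> T" and fin: "maj q A A k < \<infinity>"
  shows "ennreal (cmod (Du F t k - Du G t k)) \<le> ennreal T * (maj q D A k + maj q A D k)"
proof -
  have T: "0 \<le> T" using t by simp
  have "Du F t k - Du G t k = ex (p k * t) * (LINT s|lborel. duh F t k s - duh G t k s)"
    using duh_integrable[OF Fm F T t(2) fin] duh_integrable[OF Gm G T t(2) fin]
    by (simp add: Du_def right_diff_distrib[symmetric])
  then have "ennreal (cmod (Du F t k - Du G t k)) = ennreal (cmod (LINT s|lborel. duh F t k s - duh G t k s))"
    by (simp only: norm_mult norm_exp_ii) simp
  also have "\<dots> \<le> (\<integral>\<^sup>+s. ennreal (norm (duh F t k s - duh G t k s)) \<partial>lborel)"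
    by (rule norm_integral_le_nn_integral)
  also have "\<dots> \<le> (\<integral>\<^sup>+s. (if 0 \<le> s \<and> s \<le> T then maj q D A k + maj q A D k else 0) \<partial>lborel)"
  proof (rule nn_integral_mono)
    fix s
    show "ennreal (norm (duh F t k s - duh G t k s)) \<le> (if 0 \<le> s \<and> s \<le> T then maj q D A k + maj q A D k else 0)"
    proof (cases "0 \<le> s \<and> s \<le> t")
      case True
      then have s: "0 \<le> s" "s \<le> T" using t by auto
      have "duh F t k s - duh G t k s = ex (- (p k * s)) * (Qf q (F s) (F s) k - Qf q (G s) (G s) k)"
        using True by (simp add: duh_def right_diff_distrib)
      then have "ennreal (norm (duh F t k s - duh G t k s)) = ennreal (norm (Qf q (F s) (F s) k - Qf q (G s) (G s) k))"
        by (simp only: norm_mult norm_exp_ii) simp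
      also have "\<dots> \<le> maj q D A k + maj q A D k"
        by (rule Qf_diff_le[OF q_meas curry_meas[OF Fm] curry_meas[OF Gm] F G fin D m]) (use s in auto)
      finally show ?thesis using s by simp
    qed (auto simp: duh_def)
  qed
  also have "\<dots> = ennreal T * (maj q D A k + maj q A D k)" using T by (intro nn_integral_interval) auto
  finally show ?thesis .
qed

lemma Qf_lim:
  assumes F: "\<And>n. F n \<in> borel_measurable borel" "F' \<in> borel_measurable borel"
    and A: "\<And>n k. ennreal (cmod (F n k)) \<le> A k" "A \<in> borel_measurable borel"
    and lim: "AE k in lborel. (\<lambda>n. F n k) \<longlonglongrightarrow> F' k" and fin: "maj q A A k < \<infinity>"
  shows "(\<lambda>n. Qf q (F n) (F n) k) \<longlonglongrightarrow> Qf q F' F' k"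
  unfolding Qf_def
proof (rule integral_dominated_convergence)
  note [measurable] = q_comp F A(2)
  let ?h = "\<lambda>m. ennreal (cmod (q k m)) * A (k - m) * A m"
  have h: "(\<integral>\<^sup>+m. ?h m \<partial>lborel) < \<infinity>" using fin by (simp add: maj_def)
  show "integrable lborel (\<lambda>m. enn2real (?h m))" by (rule integrable_enn2real[OF _ h]) measurable
  have "AE m in lborel. ?h m \<noteq> \<infinity>" using h by (intro nn_integral_PInf_AE) auto
  then show "AE m in lborel. norm (q k m * F n (k - m) * F n m) \<le> enn2real (?h m)" for n
  proof eventually_elim
    case (elim m)
    have "ennreal (norm (q k m * F n (k - m) * F n m)) \<le> ?h m"
      using A(1) by (auto simp: norm_mult ennreal_mult intro!: mult_mono)
    then show ?case using elim by (intro le_enn2real) (auto simp: top.not_eq_extremum)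
  qed
  have "AE m in lborel. (\<lambda>n. F n (k - m)) \<longlonglongrightarrow> F' (k - m)"
  proof -
    have "AE m in lborel. (\<lambda>n. F n (k + m)) \<longlonglongrightarrow> F' (k + m)"
      using AE_lborel_plus[OF lim] .
    from AE_lborel_uminus[OF this] show ?thesis by simp
  qed
  with lim show "AE m in lborel. (\<lambda>n. q k m * F n (k - m) * F n m) \<longlonglongrightarrow> q k m * F' (k - m) * F' m"
    by eventually_elim (intro tendsto_intros)
  show "(\<lambda>m. q k m * F' (k - m) * F' m) \<in> borel_measurable lborel" by measurable
  show "(\<lambda>m. q k m * F n (k - m) * F n m) \<in> borel_measurable lborel" for n by measurable
qed

lemma Du_lim:
  assumes F: "\<And>n. (\<lambda>(t, k). F n t k) \<in> borel_measurable (borel \<Otimes>\<^sub>M borel)" "(\<lambda>(t, k). F' t k) \<in> borel_measurable (borel \<Otimes>\<^sub>M borel)"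
    and A: "\<And>n s k. 0 \<le> s \<Longrightarrow> s \<le> T \<Longrightarrow> ennreal (cmod (F n s k)) \<le> A k" "A \<in> borel_measurable borel"
    and lim: "\<And>s. 0 \<le> s \<Longrightarrow> s \<le> T \<Longrightarrow> AE k in lborel. (\<lambda>n. F n s k) \<longlonglongrightarrow> F' s k" and fin: "maj q A A k < \<infinity>"
    and t: "0 \<le> t" "t \<le> T"
  shows "(\<lambda>n. Du (F n) t k) \<longlonglongrightarrow> Du F' t k"
  unfolding Du_def
proof (intro tendsto_intros)
  let ?h = "\<lambda>s. if 0 \<le> s \<and> s \<le> T then maj q A A k else 0"
  show "(\<lambda>n. LINT s|lborel. duh (F n) t k s) \<longlonglongrightarrow> (LINT s|lborel. duh F' t k s)"
  proof (rule integral_dominated_convergence)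
    have "(\<integral>\<^sup>+s. ?h s \<partial>lborel) < \<infinity>" using t fin by (subst nn_integral_interval) (auto simp: ennreal_mult_less_top)
    then show "integrable lborel (\<lambda>s. enn2real (?h s))" by (intro integrable_enn2real) measurable
    show "AE s in lborel. norm (duh (F n) t k s) \<le> enn2real (?h s)" for n
      using duh_le[OF A(1) t(2)] fin by (intro AE_I2 le_enn2real) auto
    show "AE s in lborel. (\<lambda>n. duh (F n) t k s) \<longlonglongrightarrow> duh F' t k s"
    proof (intro AE_I2)
      fix s
      show "(\<lambda>n. duh (F n) t k s) \<longlonglongrightarrow> duh F' t k s"
      proof (cases "0 \<le> s \<and> s \<le> t")
        case True
        then have s: "0 \<le> s" "s \<le> T" using t by auto
        have "(\<lambda>n. Qf q (F n s) (F n s) k) \<longlonglongrightarrow> Qf q (F' s) (F' s) k"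
          by (rule Qf_lim[OF curry_meas[OF F(1)] curry_meas[OF F(2)] A(1)[OF s] A(2) lim[OF s] fin])
        then show ?thesis unfolding duh_def using True by (auto intro!: tendsto_intros)
      next
        case False
        show ?thesis unfolding duh_def if_not_P[OF False] by (rule tendsto_const)
      qed
    qed
    show "duh F' t k \<in> borel_measurable lborel" unfolding measurable_lborel2 by (rule duh_curry_meas[OF F(2)])
    show "duh (F n) t k \<in> borel_measurable lborel" for n unfolding measurable_lborel2 by (rule duh_curry_meas[OF F(1)])
  qed
qed

lemma Du_cong:
  assumes F: "(\<lambda>(t, k). F t k) \<in> borel_measurable (borel \<Otimes>\<^sub>M borel)" "(\<lambda>(t, k). G t k) \<in> borel_measurable (borel \<Otimes>\<^sub>M borel)"
    and eq: "\<And>s. 0 \<le> s \<Longrightarrow> s \<le> T \<Longrightarrow> AE k in lborel. F s k = G s k" and t: "t \<le> T"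
  shows "Du F t k = Du G t k"
proof -
  have "duh F t k s = duh G t k s" for s
  proof (cases "0 \<le> s \<and> s \<le> t")
    case True
    then have s: "0 \<le> s" "s \<le> T" using t by auto
    show ?thesis unfolding duh_def Qf_cong_AE[OF q_meas curry_meas[OF F(1)] curry_meas[OF F(2)] eq[OF s]] ..
  qed (auto simp: duh_def)
  then show ?thesis by (simp add: Du_def)
qed

lemma Qf_herm:
  assumes "\<And>k. F (- k) = cnj (F k)" shows "Qf q F F (- k) = cnj (Qf q F F k)"
proof -
  have "Qf q F F (- k) = (LINT m|lborel. q (- k) (- m) * F (- k - (- m)) * F (- m))"
    unfolding Qf_def using integral_uminus[of "\<lambda>m. q (- k) m * F (- k - m) * F m"] by simp
  also have "\<dots> = (LINT m|lborel. cnj (q k m * F (k - m) * F m))"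
  proof (intro Bochner_Integration.integral_cong refl)
    fix m
    have "F (- k - (- m)) = cnj (F (k - m))" using assms[of "k - m"] by simp
    then show "q (- k) (- m) * F (- k - - m) * F (- m) = cnj (q k m * F (k - m) * F m)" by (simp add: q_herm assms)
  qed
  finally show ?thesis unfolding Qf_def by (simp only: Bochner_Integration.integral_cnj)
qed

lemma Du_herm:
  assumes "\<And>t k. F t (- k) = cnj (F t k)" shows "Du F t (- k) = cnj (Du F t k)"
proof -
  have d: "duh F t (- k) s = cnj (duh F t k s)" for s
    unfolding duh_def using Qf_herm[of "F s" k] assms by (simp add: p_odd exp_cnj)
  show ?thesis unfolding Du_def d by (simp add: p_odd exp_cnj phi_herm)
qed

section \<open>The iterates, their common majorant and their limit\<close>

primrec Fi :: "nat \<Rightarrow> real \<Rightarrow> real \<Rightarrow> complex" where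
  "Fi 0 = (\<lambda>t k. ex (p k * t) * phi k)"
| "Fi (Suc n) = Du (Fi n)"

lemma Fi_meas: "(\<lambda>(t, k). Fi n t k) \<in> borel_measurable (borel \<Otimes>\<^sub>M borel)"
proof (induction n)
  case (Suc n) then show ?case using Du_meas by simp
qed simp

lemma Fi_herm: "Fi n t (- k) = cnj (Fi n t k)"
  by (induction n arbitrary: t k) (auto simp: p_odd exp_cnj phi_herm intro: Du_herm)

abbreviation a0 :: "real \<Rightarrow> ennreal" where "a0 \<equiv> \<lambda>k. ennreal (cmod (phi k))"
abbreviation nu :: ennreal where "nu \<equiv> nsq 3 a0"

text \<open>The recursion of \<open>Fi\<close> with phases dropped, absolute values inside and the
  time replaced by its maximum. Time disappears, so one function of \<open>k\<close> dominates an
  iterate on the whole interval.\<close>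

primrec Gi :: "real \<Rightarrow> nat \<Rightarrow> real \<Rightarrow> ennreal" where
  "Gi T 0 = a0"
| "Gi T (Suc n) = (\<lambda>k. a0 k + ennreal T * maj q (Gi T n) (Gi T n) k)"

lemma Gi_meas [measurable]: "Gi T n \<in> borel_measurable borel"
proof (induction n)
  case (Suc n)
  note [measurable] = Suc maj_measurable[OF q_meas Suc Suc]
  show ?case by simp
qed simp

lemma Gi_mono: "Gi T n k \<le> Gi T (Suc n) k"
proof (induction n arbitrary: k)
  case (Suc n)
  then show ?case unfolding Gi.simps(2)[of T "Suc n"] unfolding Gi.simps(2)[of T n] by (intro add_left_mono mult_left_mono maj_mono) auto
qed simp

lemma Fi_le_Gi: "0 \<le> t \<Longrightarrow> t \<le> T \<Longrightarrow> ennreal (cmod (Fi n t k)) \<le> Gi T n k"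
proof (induction n arbitrary: t k)
  case 0 then show ?case by (simp add: norm_mult)
next
  case (Suc n) then show ?case by (simp add: Du_le[of T "Fi n" "Gi T n"])
qed

text \<open>The ball of squared radius \<open>4 * nu\<close> is invariant: the new squared norm is
  at most 2 nu + 2 T^2 K (4 nu)^2, and the second term is 32 T^2 K nu times nu. The number 64 in the
  condition on \<open>T\<close> leaves room here; it is dictated by the contraction in
  \<open>nsq_Di\<close>.\<close>

lemma nsq_affine_le:
  assumes A: "A \<in> borel_measurable borel" and N: "nsq 3 A \<le> 4 * nu" and T: "(ennreal T)\<^sup>2 * K * nu * 64 \<le> 1"
  shows "nsq 3 (\<lambda>k. a0 k + ennreal T * maj q A A k) \<le> 4 * nu"
proof -
  note [measurable] = A maj_measurable[OF q_meas A A]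
  have "nsq 3 (\<lambda>k. ennreal T * maj q A A k) = (ennreal T)\<^sup>2 * nsq 3 (maj q A A)" by (rule nsq_cmult) measurable
  also have "\<dots> \<le> (ennreal T)\<^sup>2 * (K * (4 * nu) * (4 * nu))"
    using order_trans[OF bound[OF A A] mult_mono[OF mult_left_mono[OF N] N]] by (intro mult_left_mono) auto
  finally have "2 * nsq 3 (\<lambda>k. ennreal T * maj q A A k) \<le> 2 * ((ennreal T)\<^sup>2 * (K * (4 * nu) * (4 * nu)))"
    by (rule mult_left_mono) simp
  also have "\<dots> = ((ennreal T)\<^sup>2 * K * nu * 32) * nu"
    by (simp add: mult_ac)
  also have "\<dots> \<le> 2 * nu"
  proof (rule mult_right_mono)
    have "(ennreal T)\<^sup>2 * K * nu * 32 \<le> (ennreal T)\<^sup>2 * K * nu * 64" by (intro mult_left_mono) auto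
    also have "\<dots> \<le> 1" by (rule T)
    finally show "(ennreal T)\<^sup>2 * K * nu * 32 \<le> 2" by (rule order_trans) simp
  qed simp
  finally have "2 * nsq 3 (\<lambda>k. ennreal T * maj q A A k) \<le> 2 * nu" .
  moreover have "nsq 3 (\<lambda>k. a0 k + ennreal T * maj q A A k) \<le> 2 * nu + 2 * nsq 3 (\<lambda>k. ennreal T * maj q A A k)"
    by (rule nsq_add_le) measurable
  ultimately have "nsq 3 (\<lambda>k. a0 k + ennreal T * maj q A A k) \<le> 2 * nu + 2 * nu"
    by (meson add_left_mono order_trans)
  then show ?thesis by (simp flip: distrib_right)
qed

lemma nsq_Gi: "(ennreal T)\<^sup>2 * K * nu * 64 \<le> 1 \<Longrightarrow> nsq 3 (Gi T n) \<le> 4 * nu"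
proof (induction n)
  case 0
  have "1 * nu \<le> 4 * nu" by (intro mult_right_mono) auto
  then show ?case by simp
next
  case (Suc n) then show ?case unfolding Gi.simps by (intro nsq_affine_le Gi_meas)
qed

text \<open>The majorants increase with \<open>n\<close>, so their supremum dominates all iterates
  at all times of [0, T] at once, and Fatou's lemma keeps its norm below the common bound.\<close>

definition Gs :: "real \<Rightarrow> real \<Rightarrow> ennreal" where "Gs T k = (SUP n. Gi T n k)"

lemma Gs_meas [measurable]: "Gs T \<in> borel_measurable borel"
  unfolding Gs_def by measurable

lemma Gi_le_Gs: "Gi T n k \<le> Gs T k"
  unfolding Gs_def by (rule SUP_upper) simp

lemma nsq_Gs:
  assumes T: "(ennreal T)\<^sup>2 * K * nu * 64 \<le> 1" shows "nsq 3 (Gs T) \<le> 4 * nu"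
proof -
  have lim: "(\<lambda>n. (ew k ^ 3 * Gi T n k)\<^sup>2) \<longlonglongrightarrow> (ew k ^ 3 * Gs T k)\<^sup>2" for k
  proof -
    have "(\<lambda>n. Gi T n k) \<longlonglongrightarrow> Gs T k" unfolding Gs_def by (rule LIMSEQ_SUP) (auto intro: incseq_SucI Gi_mono)
    then have l: "(\<lambda>n. ew k ^ 3 * Gi T n k) \<longlonglongrightarrow> ew k ^ 3 * Gs T k"
      by (intro ennreal_tendsto_cmult) (auto simp: power_less_top_ennreal)
    show ?thesis unfolding power2_eq_square by (rule tendsto_mult_ennreal[OF l l]) auto
  qed
  have "nsq 3 (Gs T) = (\<integral>\<^sup>+k. liminf (\<lambda>n. (ew k ^ 3 * Gi T n k)\<^sup>2) \<partial>lborel)"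
    unfolding nsq_def using lim_imp_Liminf[OF sequentially_bot lim] by simp
  also have "\<dots> \<le> liminf (\<lambda>n. nsq 3 (Gi T n))" unfolding nsq_def by (rule nn_integral_liminf) measurable
  also have "\<dots> \<le> liminf (\<lambda>n::nat. 4 * nu)" by (intro Liminf_mono always_eventually allI nsq_Gi T)
  finally show ?thesis by (simp add: Liminf_const)
qed

text \<open>Majorants of the successive differences, again free of time. The start is the trivial
  bound by the sum of two iterates; the recursion splits the difference of two squares with one
  factor bounded by \<open>Gs\<close>.\<close>

primrec Di :: "real \<Rightarrow> nat \<Rightarrow> real \<Rightarrow> ennreal" where
  "Di T 0 = (\<lambda>k. 2 * Gs T k)"
| "Di T (Suc n) = (\<lambda>k. ennreal T * (maj q (Di T n) (Gs T) k + maj q (Gs T) (Di T n) k))"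

lemma Di_meas [measurable]: "Di T n \<in> borel_measurable borel"
proof (induction n)
  case (Suc n)
  note [measurable] = Suc maj_measurable[OF q_meas Suc Gs_meas] maj_measurable[OF q_meas Gs_meas Suc]
  show ?case by simp
qed simp

text \<open>Each step multiplies the squared norm by at most 16 T^2 K nu, which the condition on
  \<open>T\<close> makes at most 1/4. This is the rate that \<open>summable_of_weighted_sq\<close>
  expects.\<close>

lemma nsq_Di:
  assumes T: "(ennreal T)\<^sup>2 * K * nu * 64 \<le> 1" shows "nsq 3 (Di T n) * 4 ^ n \<le> 16 * nu"
proof (induction n)
  case 0
  have "nsq 3 (\<lambda>k. 2 * Gs T k) = 2\<^sup>2 * nsq 3 (Gs T)" by (rule nsq_cmult) measurable
  also have "\<dots> \<le> 2\<^sup>2 * (4 * nu)" by (intro mult_left_mono nsq_Gs T) auto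
  finally show ?case by (simp add: mult.assoc[symmetric])
next
  case (Suc n)
  note [measurable] = maj_measurable[OF q_meas Di_meas Gs_meas] maj_measurable[OF q_meas Gs_meas Di_meas]
  have "nsq 3 (Di T (Suc n)) = (ennreal T)\<^sup>2 * nsq 3 (\<lambda>k. maj q (Di T n) (Gs T) k + maj q (Gs T) (Di T n) k)"
    unfolding Di.simps by (rule nsq_cmult) measurable
  also have "\<dots> \<le> (ennreal T)\<^sup>2 * (2 * nsq 3 (maj q (Di T n) (Gs T)) + 2 * nsq 3 (maj q (Gs T) (Di T n)))"
    by (intro mult_left_mono nsq_add_le) measurable
  also have "\<dots> \<le> (ennreal T)\<^sup>2 * (2 * (K * nsq 3 (Di T n) * (4 * nu)) + 2 * (K * (4 * nu) * nsq 3 (Di T n)))"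
  proof (intro mult_left_mono add_mono)
    show "nsq 3 (maj q (Di T n) (Gs T)) \<le> K * nsq 3 (Di T n) * (4 * nu)"
      by (rule order_trans[OF bound mult_left_mono[OF nsq_Gs[OF T]]]) auto
    show "nsq 3 (maj q (Gs T) (Di T n)) \<le> K * (4 * nu) * nsq 3 (Di T n)"
      by (rule order_trans[OF bound mult_right_mono[OF mult_left_mono[OF nsq_Gs[OF T]]]]) auto
  qed auto
  also have "\<dots> = (ennreal T)\<^sup>2 * K * nu * 16 * nsq 3 (Di T n)"
  proof -
    have "2 * x + 2 * x = 4 * x" for x :: ennreal by (simp flip: distrib_right)
    from this[of "K * nsq 3 (Di T n) * (4 * nu)"] show ?thesis by (simp add: mult_ac)
  qed
  finally have "nsq 3 (Di T (Suc n)) * 4 ^ Suc n \<le> (ennreal T)\<^sup>2 * K * nu * 16 * nsq 3 (Di T n) * 4 ^ Suc n"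
    by (rule mult_right_mono) simp
  also have "\<dots> = ((ennreal T)\<^sup>2 * K * nu * 64) * (nsq 3 (Di T n) * 4 ^ n)" by (simp add: mult_ac)
  also have "\<dots> \<le> 1 * (16 * nu)" by (intro mult_mono T Suc) auto
  finally show ?case by simp
qed

lemma exists_time: "\<exists>T>0. (ennreal T)\<^sup>2 * K * nu * 64 \<le> 1"
proof -
  obtain c where c: "c \<ge> 0" "K * nu = ennreal c"
    using K_fin phi_fin by (cases "K * nu") (auto simp: ennreal_mult_eq_top_iff)
  \<comment> \<open>With this choice T^2 c 64 equals c / (c + 1); the added 1 also covers
    \<open>c = 0\<close>.\<close>
  define T where "T = 1 / (8 * sqrt (c + 1))"
  have T: "T > 0" using c by (simp add: T_def)
  have "T\<^sup>2 = 1 / (64 * (c + 1))" using c by (simp add: T_def power_divide power_mult_distrib)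
  then have "T\<^sup>2 * c * 64 = 64 * c / (64 * (c + 1))" by simp
  also have "\<dots> = c / (c + 1)" by (rule mult_divide_mult_cancel_left) simp
  also have "\<dots> \<le> 1" using c by simp
  finally have "T\<^sup>2 * c * 64 \<le> 1" .
  then have "ennreal (T\<^sup>2 * c * 64) \<le> 1" by (simp add: ennreal_le_1)
  then have "(ennreal T)\<^sup>2 * ennreal c * 64 \<le> 1" using T c by (simp add: ennreal_mult ennreal_power)
  then show ?thesis using T c by (auto simp: mult.assoc intro!: exI[of _ T])
qed

theorem picard_solution:
  obtains T F G where "T > 0" "(\<lambda>(t, k). F t k) \<in> borel_measurable (borel \<Otimes>\<^sub>M borel)" "G \<in> borel_measurable borel"
    "nsq 3 G < \<infinity>" "\<And>k. G k < \<infinity>" "\<And>t k. 0 \<le> t \<Longrightarrow> t \<le> T \<Longrightarrow> ennreal (cmod (F t k)) \<le> G k"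
    "\<And>t k. 0 \<le> t \<Longrightarrow> t \<le> T \<Longrightarrow> F t k = Du F t k" "\<And>t k. 0 \<le> t \<Longrightarrow> t \<le> T \<Longrightarrow> F t (- k) = cnj (F t k)"
proof -
  obtain T where T0: "T > 0" and T: "(ennreal T)\<^sup>2 * K * nu * 64 \<le> 1" using exists_time by blast
  have nu4: "4 * nu < \<infinity>" using phi_fin by (simp add: ennreal_mult_less_top)
  have GsN: "nsq 3 (Gs T) < \<infinity>" by (rule le_less_trans[OF nsq_Gs[OF T] nu4])
  have fin: "maj q (Gs T) (Gs T) k < \<infinity>" for k by (rule maj_fin[OF Gs_meas Gs_meas GsN GsN])
  have FG: "ennreal (cmod (Fi n t k)) \<le> Gs T k" if "0 \<le> t" "t \<le> T" for n t k
    by (rule order_trans[OF Fi_le_Gi[OF that] Gi_le_Gs])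
  have FD: "ennreal (cmod (Fi (Suc n) t k - Fi n t k)) \<le> Di T n k" if "0 \<le> t" "t \<le> T" for n t k
    using that
  proof (induction n arbitrary: t k)
    case 0
    have "cmod (Fi 1 t k - Fi 0 t k) \<le> cmod (Fi 1 t k) + cmod (Fi 0 t k)" by (rule norm_triangle_ineq4)
    then have "ennreal (cmod (Fi 1 t k - Fi 0 t k)) \<le> ennreal (cmod (Fi 1 t k)) + ennreal (cmod (Fi 0 t k))"
      by (simp add: ennreal_leI del: Fi.simps flip: ennreal_plus)
    also have "\<dots> \<le> Gs T k + Gs T k" using 0 by (intro add_mono FG)
    finally show ?case by (simp add: mult_2 del: Fi.simps)
  next
    case (Suc n)
    have "ennreal (cmod (Du (Fi (Suc n)) t k - Du (Fi n) t k)) \<le> ennreal T * (maj q (Di T n) (Gs T) k + maj q (Gs T) (Di T n) k)"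
      by (rule Du_diff_le[OF Fi_meas Fi_meas FG FG Suc.IH Gs_meas Di_meas Suc.prems fin]) auto
    then show ?case by simp
  qed
  define c where "c = enn2real (16 * nu)"
  have c: "c \<ge> 0" "16 * nu = ennreal c" using phi_fin by (auto simp: c_def ennreal_mult_less_top)
  let ?d = "\<lambda>n k. complex_of_real (enn2real (Di T n k))"
  have DN: "nsq 3 (Di T n) \<le> ennreal (c / 4 ^ n)" for n
  proof -
    have "nsq 3 (Di T n) * ennreal (4 ^ n) \<le> ennreal c" using nsq_Di[OF T, of n] c(2) by (simp flip: ennreal_power)
    then show ?thesis
      by (cases "nsq 3 (Di T n)") (auto simp: ennreal_mult[symmetric] c(1) field_simps ennreal_top_mult top_unique)
  qed
  have "AE k in lborel. summable (\<lambda>n. cmod (?d n k))"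
  proof (rule summable_of_weighted_sq[OF _ _ c(1)])
    fix n
    have "sqn (?d n) \<le> nsq 0 (Di T n)"
      unfolding sqn_def nsq_def by (intro nn_integral_mono) (simp add: ennreal_power[symmetric] ennreal_enn2real_if)
    also have "\<dots> \<le> nsq 3 (Di T n)" by (rule nsq_le) simp
    finally show "sqn (?d n) \<le> ennreal (c / 4 ^ n)" using DN[of n] by (rule order_trans)
  qed measurable
  moreover have "AE k in lborel. \<forall>n. Di T n k \<noteq> \<infinity>"
    unfolding AE_all_countable
  proof
    fix n
    have "nsq 0 (Di T n) < \<infinity>" by (rule le_less_trans[OF order_trans[OF nsq_le[of 0 3] DN[of n]]]) auto
    then have "AE k in lborel. (ew k ^ 0 * Di T n k)\<^sup>2 \<noteq> \<infinity>" unfolding nsq_def by (intro nn_integral_PInf_AE) auto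
    then show "AE k in lborel. Di T n k \<noteq> \<infinity>" by eventually_elim (auto simp: power2_eq_square)
  qed
  \<comment> \<open>The exceptional null set of frequencies is the same for all times, because the
    majorants \<open>Di\<close> do not depend on time.\<close>
  ultimately have conv: "AE k in lborel. \<forall>t. 0 \<le> t \<longrightarrow> t \<le> T \<longrightarrow> convergent (\<lambda>n. Fi n t k)"
  proof eventually_elim
    case (elim k)
    show ?case
    proof (intro allI impI)
      fix t assume t: "0 \<le> t" "t \<le> T"
      have le: "cmod (Fi (Suc n) t k - Fi n t k) \<le> enn2real (Di T n k)" for n
      proof (rule le_enn2real[OF FD[OF t]])
        show "Di T n k < \<infinity>" using elim(2)[rule_format, of n] by (simp only: top.not_eq_extremum infinity_ennreal_def)
      qed
      have "summable (\<lambda>n. Fi (Suc n) t k - Fi n t k)"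
      proof (rule summable_comparison_test[OF _ elim(1)])
        show "\<exists>N. \<forall>n\<ge>N. norm (Fi (Suc n) t k - Fi n t k) \<le> cmod (?d n k)"
          unfolding norm_of_real abs_of_nonneg[OF enn2real_nonneg] using le by blast
      qed
      then have "convergent (\<lambda>n. \<Sum>i<n. Fi (Suc i) t k - Fi i t k)" by (simp add: summable_iff_convergent del: Fi.simps)
      then have "convergent (\<lambda>n. Fi n t k - Fi 0 t k)" by (simp add: sum_lessThan_telescope[of "\<lambda>i. Fi i t k"] del: Fi.simps)
      from convergent_add[OF this convergent_const[of "Fi 0 t k"]] show "convergent (\<lambda>n. Fi n t k)" by (simp del: Fi.simps)
    qed
  qed
  \<comment> \<open>On the null set without convergence \<open>lim\<close> is arbitrary. Resetting
    to 0 whenever the majorant is exceeded keeps \<open>L\<close> measurable and dominated by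
    \<open>Gs\<close> at every point.\<close>
  define L where "L t k = (let z = lim (\<lambda>n. Fi n t k) in if ennreal (cmod z) \<le> Gs T k then z else 0)" for t k
  have Lm: "(\<lambda>(t, k). L t k) \<in> borel_measurable (borel \<Otimes>\<^sub>M borel)"
  proof -
    note [measurable] = measurable_Pair_compose_split[OF Fi_meas]
    show ?thesis unfolding L_def Let_def split_beta by measurable
  qed
  have Llim: "AE k in lborel. (\<lambda>n. Fi n t k) \<longlonglongrightarrow> L t k" if t: "0 \<le> t" "t \<le> T" for t
    using conv
  proof eventually_elim
    case (elim k)
    then have l: "(\<lambda>n. Fi n t k) \<longlonglongrightarrow> lim (\<lambda>n. Fi n t k)" using t by (simp add: convergent_LIMSEQ_iff)
    then have "(\<lambda>n. ennreal (cmod (Fi n t k))) \<longlonglongrightarrow> ennreal (cmod (lim (\<lambda>n. Fi n t k)))" by (intro tendsto_intros)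
    then have "ennreal (cmod (lim (\<lambda>n. Fi n t k))) \<le> Gs T k"
      by (rule LIMSEQ_le_const2) (use FG[OF t] in auto)
    then show ?case using l by (simp add: L_def)
  qed
  \<comment> \<open>One more application of \<open>Du\<close> repairs the exceptional set:
    \<open>Du\<close> uses \<open>L\<close> only under integrals, so \<open>F\<close> satisfies the
    equation, the bound and the symmetry at every frequency.\<close>
  define F where "F = Du L"
  have Fm: "(\<lambda>(t, k). F t k) \<in> borel_measurable (borel \<Otimes>\<^sub>M borel)" unfolding F_def by (rule Du_meas[OF Lm])
  have Flim: "(\<lambda>n. Fi (Suc n) t k) \<longlonglongrightarrow> F t k" if t: "0 \<le> t" "t \<le> T" for t k
    unfolding F_def Fi.simps by (rule Du_lim[OF Fi_meas Lm FG Gs_meas Llim fin t])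
  have FL: "AE k in lborel. F t k = L t k" if t: "0 \<le> t" "t \<le> T" for t
    using Llim[OF t] by eventually_elim (rule LIMSEQ_unique[OF Flim[OF t]], rule LIMSEQ_Suc)
  define G where "G k = a0 k + ennreal T * maj q (Gs T) (Gs T) k" for k
  note [measurable] = maj_measurable[OF q_meas Gs_meas Gs_meas]
  show ?thesis
  proof (rule that[OF T0 Fm])
    show "G \<in> borel_measurable borel" unfolding G_def by measurable
    show "nsq 3 G < \<infinity>" unfolding G_def by (rule le_less_trans[OF nsq_affine_le[OF Gs_meas nsq_Gs[OF T] T] nu4])
    show "G k < \<infinity>" for k using fin[of k] by (simp add: G_def ennreal_mult_less_top)
    fix t k assume t: "0 \<le> t" "t \<le> T"
    show "ennreal (cmod (F t k)) \<le> G k" unfolding F_def G_def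
      by (rule Du_le[OF _ t]) (auto simp: L_def Let_def)
    show "F t k = Du F t k"
      using Du_cong[OF Fm Lm FL t(2), of k] by (simp add: F_def)
    show "F t (- k) = cnj (F t k)"
      by (rule LIMSEQ_unique[OF Flim[OF t]]) (use tendsto_cnj[OF Flim[OF t, of k]] in \<open>simp only: Fi_herm\<close>)
  qed
qed

end

context picard
begin

text \<open>At each fixed frequency the mild equation is an ordinary differential equation. The
  quadratic term is continuous in time by domination through \<open>G\<close>, so the Duhamel
  integral is continuously differentiable there.\<close>

lemma mild_C1:
  assumes T: "T > 0" and Fm: "(\<lambda>(t, k). F t k) \<in> borel_measurable (borel \<Otimes>\<^sub>M borel)" and Gm: "G \<in> borel_measurable borel"
    and GN: "nsq 3 G < \<infinity>" and FG: "\<And>t k. 0 \<le> t \<Longrightarrow> t \<le> T \<Longrightarrow> ennreal (cmod (F t k)) \<le> G k"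
    and FD: "\<And>t k. 0 \<le> t \<Longrightarrow> t \<le> T \<Longrightarrow> F t k = Du F t k"
  shows "F 0 k = phi k" "continuous_on {0..T} (\<lambda>t. F t k)" "continuous_on {0..T} (\<lambda>t. Qf q (F t) (F t) k)"
    and "t \<in> {0..T} \<Longrightarrow> ((\<lambda>t. F t k) has_vector_derivative (\<i> * p k * F t k + Qf q (F t) (F t) k)) (at t within {0..T})"
proof -
  have fin: "maj q G G k < \<infinity>" for k by (rule maj_fin[OF Gm Gm GN GN])
  define h where "h k s = ex (- (p k * s)) * Qf q (F s) (F s) k" for k s
  have duh: "duh F t k s = indicator {0..t} s *\<^sub>R h k s" for t k s by (simp add: duh_def h_def indicator_def)
  have hi: "set_integrable lborel {0..t} (h k)" if "t \<le> T" for t k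
    using duh_integrable[OF Fm FG _ that fin, of k] T unfolding set_integrable_def duh[symmetric] by simp
  have int: "(LINT s|lborel. duh F t k s) = integral {0..t} (h k)" if "t \<le> T" for t k
    unfolding duh using set_borel_integral_eq_integral(2)[OF hi[OF that]] by (simp add: set_lebesgue_integral_def)
  have Feq: "F t k = ex (p k * t) * (phi k + integral {0..t} (h k))" if "t \<in> {0..T}" for t k
    using FD[of t k] that by (simp add: Du_def int)
  have cF: "continuous_on {0..T} (\<lambda>t. F t k)" for k
  proof -
    have "h k integrable_on {0..T}" using set_borel_integral_eq_integral(1)[OF hi] by simp
    then have "continuous_on {0..T} (\<lambda>t. ex (p k * t) * (phi k + integral {0..t} (h k)))"
      by (intro continuous_intros indefinite_integral_continuous_1)
    then show ?thesis by (rule continuous_on_eq) (use Feq in auto)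
  qed
  then show "continuous_on {0..T} (\<lambda>t. F t k)" .
  have cQ: "continuous_on {0..T} (\<lambda>t. Qf q (F t) (F t) k)" for k
    unfolding continuous_on_sequentially o_def
  proof (intro allI ballI impI)
    fix X :: "nat \<Rightarrow> real" and a assume a: "a \<in> {0..T}" and X: "(\<forall>n. X n \<in> {0..T}) \<and> X \<longlonglongrightarrow> a"
    show "(\<lambda>n. Qf q (F (X n)) (F (X n)) k) \<longlonglongrightarrow> Qf q (F a) (F a) k"
    proof (rule Qf_lim[OF curry_meas[OF Fm] curry_meas[OF Fm] _ Gm _ fin])
      show "ennreal (cmod (F (X n) k)) \<le> G k" for n k using X by (intro FG) auto
      show "AE k in lborel. (\<lambda>n. F (X n) k) \<longlonglongrightarrow> F a k"
        using cF a X unfolding continuous_on_sequentially o_def by (intro AE_I2) blast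
    qed
  qed
  then show "continuous_on {0..T} (\<lambda>t. Qf q (F t) (F t) k)" .
  show "F 0 k = phi k" using Feq[of 0 k] T by simp
  show "((\<lambda>t. F t k) has_vector_derivative (\<i> * p k * F t k + Qf q (F t) (F t) k)) (at t within {0..T})" if t: "t \<in> {0..T}"
  proof -
    have ch: "continuous_on {0..T} (h k)" unfolding h_def by (intro continuous_intros cQ)
    have 1: "((\<lambda>t. phi k + integral {0..t} (h k)) has_vector_derivative h k t) (at t within {0..T})"
      using has_vector_derivative_add[OF has_vector_derivative_const integral_has_vector_derivative[OF ch t]] by simp
    have 2: "((\<lambda>t. ex (p k * t)) has_vector_derivative ex (p k * t) * (\<i> * p k)) (at t within {0..T})"
    proof -
      have "((\<lambda>z. exp (\<i> * (of_real (p k) * z))) has_field_derivative ex (p k * t) * (\<i> * p k)) (at (complex_of_real t))"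
        by (auto intro!: derivative_eq_intros)
      from has_vector_derivative_real_field[OF this] show ?thesis by (simp add: has_vector_derivative_at_within)
    qed
    have ee: "ex (p k * t) * h k t = Qf q (F t) (F t) k"
      unfolding h_def mult.assoc[symmetric] exp_add[symmetric] by simp
    have "((\<lambda>t. ex (p k * t) * (phi k + integral {0..t} (h k))) has_vector_derivative (ex (p k * t) * h k t + ex (p k * t) * (\<i> * p k) * (phi k + integral {0..t} (h k)))) (at t within {0..T})"
      by (rule has_vector_derivative_mult[OF 2 1])
    moreover have "ex (p k * t) * h k t + ex (p k * t) * (\<i> * p k) * (phi k + integral {0..t} (h k)) = \<i> * p k * F t k + Qf q (F t) (F t) k"
      unfolding ee Feq[OF t] by (simp add: mult_ac)
    ultimately show ?thesis
      by (auto intro: has_vector_derivative_transform[OF t] Feq)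
  qed
qed

end

section \<open>Return from the frequency to the space variable\<close>

lemma borel_prod_lborel: "borel_measurable (lborel \<Otimes>\<^sub>M lborel) = borel_measurable (borel \<Otimes>\<^sub>M borel)"
  by (rule measurable_cong_sets) (auto intro!: sets_pair_measure_cong)

lemma L2_norm_FT:
  assumes "FT (\<lambda>x. complex_of_real (h x)) H" shows "L2_norm h = sqrt (enn2real (sqn H))"
proof -
  have "sqn H = ennreal (LINT x|lborel. (h x)\<^sup>2)"
    using FT_isometry[OF assms] sqn_eq_integral[OF FT_L2C(1)[OF assms]] by simp
  moreover have "(LINT x|lborel. (h x)\<^sup>2) \<ge> 0" by (intro integral_nonneg_AE) auto
  ultimately show ?thesis by (simp add: L2_norm_def)
qed

lemma cft_herm_real:
  assumes "\<And>k. F (- k) = cnj (F k)" shows "complex_of_real (Re (cft F x)) = cft F x"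
proof -
  have "cnj (cft F x) = cft (\<lambda>k. cnj (F k)) (- x)" using cft_cnj[of F "- x"] by simp
  also have "\<dots> = cft (\<lambda>k. F (- k)) (- x)" by (simp add: assms)
  also have "\<dots> = cft F x" by (simp add: cft_reflect)
  finally show ?thesis by (simp add: complex_eq_iff)
qed

text \<open>Integration by parts in time is done at each frequency, where the derivative is
  classical and the test function vanishes at both ends. The integrable majorants allow time and
  frequency integrals to be exchanged, so the result holds at every \<open>x\<close>.\<close>

lemma weak_time_fubini:
  assumes T: "T > 0" and \<eta>: "test_function {0<..<T} \<eta>"
    and Fm: "(\<lambda>(t, k). F t k) \<in> borel_measurable (borel \<Otimes>\<^sub>M borel)" and dFm: "(\<lambda>(t, k). dF t k) \<in> borel_measurable (borel \<Otimes>\<^sub>M borel)"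
    and Gi: "integrable lborel G" "integrable lborel dG"
    and FG: "\<And>t k. t \<in> {0..T} \<Longrightarrow> cmod (F t k) \<le> G k" and dFG: "\<And>t k. t \<in> {0..T} \<Longrightarrow> cmod (dF t k) \<le> dG k"
    and c: "\<And>k. continuous_on {0..T} (\<lambda>t. dF t k)" 
    and D: "\<And>t k. t \<in> {0..T} \<Longrightarrow> ((\<lambda>t. F t k) has_vector_derivative dF t k) (at t within {0..T})"
  shows "(LINT t:{0<..<T}|lborel. complex_of_real (deriv \<eta> t) * cft (F t) x) = - (LINT t:{0<..<T}|lborel. complex_of_real (\<eta> t) * cft (dF t) x)"
proof -
  note sm = test_function_smooth[OF \<eta>]
  obtain K where K: "K \<subseteq> {0<..<T}" "\<And>x. x \<notin> K \<Longrightarrow> \<eta> x = 0" using \<eta> by (auto simp: test_function_def)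
  have "0 \<notin> K" "T \<notin> K" using K(1) by auto
  then have \<eta>0: "\<eta> 0 = 0" "\<eta> T = 0" using K(2) by blast+
  let ?e = "\<lambda>k. exp (- \<i> * complex_of_real (x * k))" and ?I = "\<lambda>t. indicat_real {0<..<T} t"
  let ?s = "complex_of_real (1 / sqrt (2 * pi))"
  \<comment> \<open>Stated for general \<open>z\<close> and \<open>H\<close> since it is applied
    twice: to the derivative of the test function with \<open>F\<close>, and to the test function
    with \<open>dF\<close>.\<close>
  have swap: "(LINT t:{0<..<T}|lborel. complex_of_real (z t) * cft (H t) x) = ?s * (LINT k|lborel. ?e k * (LINT t:{0<..<T}|lborel. complex_of_real (z t) * H t k))"
    if z: "smooth z" and Hm: "(\<lambda>(t, k). H t k) \<in> borel_measurable (borel \<Otimes>\<^sub>M borel)" and HG: "\<And>t k. t \<in> {0..T} \<Longrightarrow> cmod (H t k) \<le> L k" and L: "integrable lborel L"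
    for z H and L :: "real \<Rightarrow> real"
  proof -
    have [measurable]: "z \<in> borel_measurable borel" by (intro borel_measurable_continuous_onI smooth_continuous z)
    note [measurable] = measurable_Pair_compose_split[OF Hm]
    have Lm [measurable]: "L \<in> borel_measurable borel" using L by auto
    have "compact (z ` {0..T})" by (intro compact_continuous_image smooth_continuous z) auto
    then obtain B where B: "B > 0" "\<forall>y\<in>z ` {0..T}. norm y \<le> B" using compact_imp_bounded bounded_pos by metis
    let ?f = "\<lambda>t k. ?I t *\<^sub>R (complex_of_real (z t) * (H t k * ?e k))"
    have "(\<integral>\<^sup>+t. \<integral>\<^sup>+k. ennreal (norm (?f t k)) \<partial>lborel \<partial>lborel) \<le> (\<integral>\<^sup>+t. ennreal B * indicator {0..T} t * (\<integral>\<^sup>+k. ennreal (L k) \<partial>lborel) \<partial>lborel)"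
    proof (rule nn_integral_mono)
      fix t
      show "(\<integral>\<^sup>+k. ennreal (norm (?f t k)) \<partial>lborel) \<le> ennreal B * indicator {0..T} t * (\<integral>\<^sup>+k. ennreal (L k) \<partial>lborel)"
      proof (cases "t \<in> {0<..<T}")
        case True
        then have t: "t \<in> {0..T}" by auto
        have "(\<integral>\<^sup>+k. ennreal (norm (?f t k)) \<partial>lborel) \<le> (\<integral>\<^sup>+k. ennreal B * ennreal (L k) \<partial>lborel)"
        proof (rule nn_integral_mono)
          fix k
          have "norm (?f t k) = \<bar>z t\<bar> * cmod (H t k)" using True by (simp add: norm_mult)
          also have "\<dots> \<le> B * L k" using B t HG[OF t, of k] by (intro mult_mono) auto
          finally have "ennreal (norm (?f t k)) \<le> ennreal (B * L k)" by (rule ennreal_leI)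
          also have "\<dots> = ennreal B * ennreal (L k)" using B by (simp add: ennreal_mult')
          finally show "ennreal (norm (?f t k)) \<le> ennreal B * ennreal (L k)" .
        qed
        also have "\<dots> = ennreal B * (\<integral>\<^sup>+k. ennreal (L k) \<partial>lborel)" by (rule nn_integral_cmult) measurable
        finally show ?thesis using t by simp
      qed simp
    qed
    also have "\<dots> = (\<integral>\<^sup>+t. ennreal B * indicator {0..T} t \<partial>lborel) * (\<integral>\<^sup>+k. ennreal (L k) \<partial>lborel)" by (rule nn_integral_multc) measurable
    also have "(\<integral>\<^sup>+t. ennreal B * indicator {0..T} t \<partial>lborel) = ennreal B * emeasure lborel {0..T}" by (rule nn_integral_cmult_indicator) simp
    also have "\<dots> * (\<integral>\<^sup>+k. ennreal (L k) \<partial>lborel) < \<infinity>"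
      using T L by (auto simp: ennreal_mult_less_top real_integrable_def top.not_eq_extremum)
    finally have fin: "(\<integral>\<^sup>+t. \<integral>\<^sup>+k. ennreal (norm (?f t k)) \<partial>lborel \<partial>lborel) < \<infinity>" .
    have "(LINT t:{0<..<T}|lborel. complex_of_real (z t) * cft (H t) x) = (LINT t|lborel. ?s * (LINT k|lborel. ?f t k))"
      unfolding set_lebesgue_integral_def cft_def
    proof (rule Bochner_Integration.integral_cong[OF refl])
      fix t
      have eq: "(LINT k|lborel. ?f t k) = ?I t *\<^sub>R (complex_of_real (z t) * (LINT k|lborel. H t k * ?e k))"
        by (simp only: integral_scaleR_right integral_mult_right_zero)
      show "?I t *\<^sub>R (complex_of_real (z t) * (?s * (LINT k|lborel. H t k * ?e k))) = ?s * (LINT k|lborel. ?f t k)"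
        unfolding eq by (simp only: mult_scaleR_right mult.left_commute)
    qed
    also have "\<dots> = ?s * (LINT t|lborel. LINT k|lborel. ?f t k)" by (rule integral_mult_right_zero)
    also have "(LINT t|lborel. LINT k|lborel. ?f t k) = (LINT k|lborel. LINT t|lborel. ?f t k)"
      by (rule lborel_Fubini[OF _ fin]) measurable
    also have "\<dots> = (LINT k|lborel. ?e k * (LINT t:{0<..<T}|lborel. complex_of_real (z t) * H t k))"
    proof (rule Bochner_Integration.integral_cong[OF refl])
      fix k
      have "?e k * (LINT t:{0<..<T}|lborel. complex_of_real (z t) * H t k) = (LINT t|lborel. ?e k * (?I t *\<^sub>R (complex_of_real (z t) * H t k)))"
        unfolding set_lebesgue_integral_def by (rule integral_mult_right_zero[symmetric])
      also have "\<dots> = (LINT t|lborel. ?f t k)" by (intro Bochner_Integration.integral_cong refl) (simp add: mult_ac)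
      finally show "(LINT t|lborel. ?f t k) = ?e k * (LINT t:{0<..<T}|lborel. complex_of_real (z t) * H t k)" ..
    qed
    finally show ?thesis .
  qed
  have parts: "(LINT t:{0<..<T}|lborel. complex_of_real (deriv \<eta> t) * F t k) = - (LINT t:{0<..<T}|lborel. complex_of_real (\<eta> t) * dF t k)" for k
  proof -
    have cF: "continuous_on {0..T} (\<lambda>t. F t k)"
      using D by (meson continuous_on_eq_continuous_within has_vector_derivative_continuous)
    have c1: "continuous_on {0..T} (\<lambda>t. complex_of_real (deriv \<eta> t) * F t k)" "continuous_on {0..T} (\<lambda>t. complex_of_real (\<eta> t) * dF t k)"
      by (intro continuous_intros smooth_continuous smooth_deriv sm c cF)+
    have sub: "{0<..<T} \<subseteq> {0..T}" by auto
    have i: "set_integrable lborel {0..T} (\<lambda>t. complex_of_real (deriv \<eta> t) * F t k)" "set_integrable lborel {0..T} (\<lambda>t. complex_of_real (\<eta> t) * dF t k)"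
      by (intro borel_integrable_atLeastAtMost' c1)+
    have "(LINT t|lborel. indicator {0..T} t *\<^sub>R (complex_of_real (\<eta> t) * dF t k + complex_of_real (deriv \<eta> t) * F t k)) = complex_of_real (\<eta> T) * F T k - complex_of_real (\<eta> 0) * F 0 k"
    proof (rule integral_FTC_Icc)
      fix t assume "0 \<le> t" "t \<le> T"
      then have t: "t \<in> {0..T}" by auto
      have "((\<lambda>x. complex_of_real (\<eta> x)) has_vector_derivative complex_of_real (deriv \<eta> t)) (at t within {0..T})"
        using smooth_DERIV[OF sm, of t]
        by (intro has_vector_derivative_of_real) (auto simp: has_real_derivative_iff_has_vector_derivative intro: has_vector_derivative_at_within)
      from has_vector_derivative_mult[OF this D[OF t]]
      show "((\<lambda>t. complex_of_real (\<eta> t) * F t k) has_vector_derivative (complex_of_real (\<eta> t) * dF t k + complex_of_real (deriv \<eta> t) * F t k)) (at t within {0..T})" .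
    qed (use T c1 in \<open>auto intro: continuous_on_add\<close>)
    then have "(LINT t:{0..T}|lborel. complex_of_real (\<eta> t) * dF t k + complex_of_real (deriv \<eta> t) * F t k) = 0"
      by (simp add: set_lebesgue_integral_def \<eta>0)
    then have "(LINT t:{0..T}|lborel. complex_of_real (\<eta> t) * dF t k) + (LINT t:{0..T}|lborel. complex_of_real (deriv \<eta> t) * F t k) = 0"
      using set_integral_add(2)[OF i(2,1)] by simp
    moreover have "(LINT t:{0..T}|lborel. f t) = (LINT t:{0<..<T}|lborel. f t)" if "set_integrable lborel {0..T} f" for f :: "real \<Rightarrow> complex"
      unfolding set_lebesgue_integral_def
    proof (rule integral_cong_AE)
      show "(\<lambda>x. indicat_real {0..T} x *\<^sub>R f x) \<in> borel_measurable lborel" using that by (auto simp: set_integrable_def)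
      show "(\<lambda>x. indicat_real {0<..<T} x *\<^sub>R f x) \<in> borel_measurable lborel" 
        using set_integrable_subset[OF that _ sub] by (simp add: set_integrable_def)
      show "AE x in lborel. indicat_real {0..T} x *\<^sub>R f x = indicat_real {0<..<T} x *\<^sub>R f x"
        using AE_lborel_singleton[of 0] AE_lborel_singleton[of T] by eventually_elim (auto simp: indicator_def)
    qed
    ultimately show ?thesis using i by (simp add: add_eq_0_iff)
  qed
  have s2: "(LINT t:{0<..<T}|lborel. complex_of_real (\<eta> t) * cft (dF t) x) = ?s * (LINT k|lborel. ?e k * (LINT t:{0<..<T}|lborel. complex_of_real (\<eta> t) * dF t k))"
    by (rule swap[OF sm dFm dFG Gi(2)])
  have "(LINT t:{0<..<T}|lborel. complex_of_real (deriv \<eta> t) * cft (F t) x) = ?s * (LINT k|lborel. ?e k * (LINT t:{0<..<T}|lborel. complex_of_real (deriv \<eta> t) * F t k))"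
    by (rule swap[OF smooth_deriv[OF sm] Fm FG Gi(1)])
  then show ?thesis unfolding s2 parts by simp
qed

section \<open>Existence\<close>

lemma symb_odd: "symb e a g (- k) = - symb e a g k"
  by (simp add: symb_def sgn_minus divide_simps)

text \<open>The linear part costs exactly one weight; it is the reason why the time derivative has
  two weights where the solution has three.\<close>

lemma symb_bound:
  assumes e: "e > 0" and a: "a > 0"
  shows "\<bar>symb e a g k\<bar> \<le> (1 + \<bar>g\<bar>) * (1 + 1 / a) / e * (1 + \<bar>k\<bar>)"
proof -
  have d: "2 + a * \<bar>k\<bar> > 0" using a by (intro add_pos_nonneg) auto
  have "\<bar>k - sgn k + g * (k * \<bar>k\<bar>)\<bar> \<le> \<bar>k\<bar> + 1 + \<bar>g\<bar> * \<bar>k\<bar>\<^sup>2"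
  proof -
    have "\<bar>k - sgn k\<bar> \<le> \<bar>k\<bar> + 1" by (auto simp: sgn_real_def)
    moreover have "\<bar>g * (k * \<bar>k\<bar>)\<bar> = \<bar>g\<bar> * \<bar>k\<bar>\<^sup>2" by (simp add: abs_mult power2_eq_square)
    ultimately show ?thesis using abs_triangle_ineq[of "k - sgn k" "g * (k * \<bar>k\<bar>)"] by linarith
  qed
  also have "\<dots> \<le> (1 + \<bar>g\<bar>) * (1 + \<bar>k\<bar>)\<^sup>2" by (simp add: power2_eq_square algebra_simps)
  finally have 1: "\<bar>k - sgn k + g * (k * \<bar>k\<bar>)\<bar> \<le> (1 + \<bar>g\<bar>) * (1 + \<bar>k\<bar>)\<^sup>2" .
  have 2: "1 + \<bar>k\<bar> \<le> (1 + 1 / a) * (2 + a * \<bar>k\<bar>)" using a by (simp add: field_simps)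
  have "(1 + \<bar>g\<bar>) * (1 + \<bar>k\<bar>)\<^sup>2 = (1 + \<bar>g\<bar>) * (1 + \<bar>k\<bar>) * (1 + \<bar>k\<bar>)" by (simp add: power2_eq_square)
  also have "\<dots> \<le> (1 + \<bar>g\<bar>) * (1 + \<bar>k\<bar>) * ((1 + 1 / a) * (2 + a * \<bar>k\<bar>))"
    using 2 by (intro mult_left_mono) auto
  also have "\<dots> = (1 + \<bar>g\<bar>) * (1 + 1 / a) / e * (1 + \<bar>k\<bar>) * (e * (2 + a * \<bar>k\<bar>))" using e by (simp add: mult_ac)
  finally have "\<bar>k - sgn k + g * (k * \<bar>k\<bar>)\<bar> \<le> (1 + \<bar>g\<bar>) * (1 + 1 / a) / e * (1 + \<bar>k\<bar>) * (e * (2 + a * \<bar>k\<bar>))" using 1 by linarith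
  moreover have "e * (2 + a * \<bar>k\<bar>) > 0" using e d by simp
  ultimately have "\<bar>k - sgn k + g * (k * \<bar>k\<bar>)\<bar> / (e * (2 + a * \<bar>k\<bar>)) \<le> (1 + \<bar>g\<bar>) * (1 + 1 / a) / e * (1 + \<bar>k\<bar>)"
    by (subst pos_divide_le_eq) auto
  then show ?thesis using e d by (simp add: symb_def abs_divide abs_mult)
qed

lemma kq_herm: "kq a g (- k) (- m) = cnj (kq a g k m)"
proof -
  have "- sgn (- k) * \<bar>- k - (- m)\<bar> * \<bar>- m\<bar> + (sgn (- k) - sgn (- m)) * (\<bar>- m\<bar> - g * \<bar>- m\<bar> ^ 3)
      = - (- sgn k * \<bar>k - m\<bar> * \<bar>m\<bar> + (sgn k - sgn m) * (\<bar>m\<bar> - g * \<bar>m\<bar> ^ 3))"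
    by (simp add: sgn_minus abs_minus_commute[of m k] left_diff_distrib)
  then show ?thesis unfolding kq_def by (simp only: mult_minus_right of_real_minus complex_cnj_mult complex_cnj_i complex_cnj_complex_of_real abs_minus_cancel) simp
qed

lemma wt_dominated:
  assumes "wt s G \<in> L2C" "H \<in> borel_measurable borel" "\<And>k. cmod (H k) \<le> cmod (G k)"
  shows "wt s H \<in> L2C"
  by (rule L2C_bound[OF assms(1)]) (use assms in \<open>auto simp: cmod_wt intro!: mult_left_mono\<close>)

lemma wt_lower:
  assumes "wt r F \<in> L2C" "F \<in> borel_measurable borel" "s \<le> r" shows "wt s F \<in> L2C"
  unfolding wt_def
proof (rule wt_L2C_mult[OF assms(1,2)])
  show "cmod (complex_of_real ((1 + \<bar>k\<bar>) ^ s)) \<le> 1 * (1 + \<bar>k\<bar>) ^ r" for k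
    using assms(3) by (auto simp: norm_power intro: power_increasing)
qed measurable

lemma wt_integrable:
  assumes "wt (Suc s) F \<in> L2C" "F \<in> borel_measurable borel" shows "integrable lborel F"
proof -
  have "integrable lborel (\<lambda>k. 1 * F k)"
    by (rule wt_integrable_mult[OF assms, of _ 1]) (auto simp: one_le_power)
  then show ?thesis by simp
qed

lemma wt_0: "wt 0 F = F" by (rule ext) (simp add: wt_def)

lemma picard_kq:
  assumes "e > 0" "a > 0" and "phi \<in> borel_measurable borel" "wt 3 phi \<in> L2C" "\<And>k. phi (- k) = cnj (phi k)"
  shows "picard (kq a g) (symb e a g) phi (Kq a g)"
proof
  show "nsq 3 (\<lambda>k. ennreal (cmod (phi k))) < \<infinity>" using L2C_finite[OF assms(4)] by (simp add: sqn_wt_eq)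
  fix A D :: "real \<Rightarrow> ennreal" assume m: "A \<in> borel_measurable borel" "D \<in> borel_measurable borel"
  show "nsq 3 (maj (kq a g) A D) \<le> Kq a g * nsq 3 A * nsq 3 D" by (rule maj_bound1[OF assms(2) m])
  fix k assume "nsq 3 A < \<infinity>" "nsq 3 D < \<infinity>"
  then show "maj (kq a g) A D k < \<infinity>" by (rule maj_finite[OF assms(2) m])
qed (use assms Kq_finite in \<open>auto simp: symb_odd kq_herm intro!: kq_measurable symb_measurable\<close>)

text \<open>The solution is the inverse transform of the mild solution, written as an integral. The
  majorants \<open>Gr\<close> and \<open>dG\<close> of the solution and of its time derivative are
  independent of time, and they give the Sobolev bound, continuity in L2 and the exchange of
  integrals.\<close>

lemma existence:
  assumes e: "\<epsilon> > 0" and a: "\<alpha> > 0" and f0: "f\<^sub>0 \<in> sobolev 3"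
  shows "\<exists>T>0. \<exists>f \<in> Linf_sobolev T 3. is_solution \<epsilon> \<alpha> \<beta> f\<^sub>0 T f"
proof -
  define g where "g = \<alpha> - \<beta>"
  define H where "H = fourier f\<^sub>0"
  have f0L: "f\<^sub>0 \<in> L2" using f0 by (simp add: sobolev_def)
  have FH: "FT (\<lambda>x. complex_of_real (f\<^sub>0 x)) H" unfolding H_def by (rule fourier_FT[OF f0L])
  note [measurable] = FT_measurable(2)[OF FH]
  have H3: "wt 3 H \<in> L2C" using sobolev_iff[OF FH, of 3] f0 by simp
  \<comment> \<open>The chosen transform of the datum is hermitian only almost everywhere, whereas
    the locale asks for it at every frequency; averaging with the reflected conjugate repairs a null
    set.\<close>
  define phi where "phi k = (H k + cnj (H (- k))) / 2" for k
  have pm [measurable]: "phi \<in> borel_measurable borel" unfolding phi_def by measurable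
  have phiH: "AE k in lborel. phi k = H k"
    using FT_hermitian[OF FH] by eventually_elim (simp add: phi_def)
  have phi_herm: "phi (- k) = cnj (phi k)" for k by (simp add: phi_def add.commute)
  have phi3: "wt 3 phi \<in> L2C"
    by (rule L2C_cong_AE[OF H3]) (use phiH in \<open>auto elim!: eventually_mono simp: wt_def\<close>)
  define q where "q = kq \<alpha> g"
  define p where "p = symb \<epsilon> \<alpha> g"
  interpret picard q p phi "Kq \<alpha> g" unfolding q_def p_def by (rule picard_kq[OF e a pm phi3 phi_herm])
  obtain T F G where T: "T > 0" and Fm: "(\<lambda>(t, k). F t k) \<in> borel_measurable (borel \<Otimes>\<^sub>M borel)" and Gm: "G \<in> borel_measurable borel"
    and GN: "nsq 3 G < \<infinity>" and Gfin: "\<And>k. G k < \<infinity>" and FG0: "\<And>t k. 0 \<le> t \<Longrightarrow> t \<le> T \<Longrightarrow> ennreal (cmod (F t k)) \<le> G k"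
    and FD: "\<And>t k. 0 \<le> t \<Longrightarrow> t \<le> T \<Longrightarrow> F t k = Du F t k" and Fh: "\<And>t k. 0 \<le> t \<Longrightarrow> t \<le> T \<Longrightarrow> F t (- k) = cnj (F t k)"
    by (rule picard_solution) blast
  note C1 = mild_C1[OF T Fm Gm GN FG0 FD]
  define M where "M = maj q G G"
  have Mm: "M \<in> borel_measurable borel" unfolding M_def by (rule maj_measurable[OF q_meas Gm Gm])
  have Mfin: "M k < \<infinity>" for k unfolding M_def by (rule maj_fin[OF Gm Gm GN GN])
  note [measurable] = Gm Mm
  define Gr where "Gr k = enn2real (G k)" for k
  \<comment> \<open>Majorant of the time derivative: the linear part and the quadratic part of the
    equation are bounded separately.\<close>
  define dG where "dG k = \<bar>p k\<bar> * Gr k + enn2real (M k)" for k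
  have [measurable]: "Gr \<in> borel_measurable borel" "dG \<in> borel_measurable borel" unfolding Gr_def dG_def by measurable
  have Gr0: "Gr k \<ge> 0" "dG k \<ge> 0" for k by (auto simp: Gr_def dG_def)
  have eG: "ennreal (Gr k) = G k" "ennreal (enn2real (M k)) = M k" for k using Gfin[of k] Mfin[of k] by (auto simp: Gr_def)
  let ?Gc = "\<lambda>k. complex_of_real (Gr k)" and ?Mc = "\<lambda>k. complex_of_real (enn2real (M k))" and ?dGc = "\<lambda>k. complex_of_real (dG k)"
  have G3: "wt 3 ?Gc \<in> L2C"
    by (rule L2C_I) (use GN Gr0 in \<open>auto simp: sqn_wt_eq eG\<close>)
  have "nsq 3 M < \<infinity>"
    unfolding M_def by (rule le_less_trans[OF bound[OF Gm Gm]]) (use GN K_fin in \<open>auto simp: ennreal_mult_less_top\<close>)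
  then have M3: "wt 3 ?Mc \<in> L2C"
    by (intro L2C_I) (auto simp: sqn_wt_eq eG)
  \<comment> \<open>Two weights remain after the loss in \<open>p\<close>. They make the majorant
    square integrable and integrable, and they place the time derivative in
    \<open>sobolev 1\<close>.\<close>
  have dG2: "wt 2 ?dGc \<in> L2C"
  proof -
    have "(\<lambda>k. complex_of_real ((1 + \<bar>k\<bar>) ^ 2 * \<bar>p k\<bar>) * ?Gc k) \<in> L2C"
    proof (rule wt_L2C_mult[OF G3])
      show "cmod (complex_of_real ((1 + \<bar>k\<bar>) ^ 2 * \<bar>p k\<bar>)) \<le> ((1 + \<bar>g\<bar>) * (1 + 1 / \<alpha>) / \<epsilon>) * (1 + \<bar>k\<bar>) ^ 3" for k
      proof -
        have "(1 + \<bar>k\<bar>) ^ 2 * \<bar>p k\<bar> \<le> (1 + \<bar>k\<bar>) ^ 2 * ((1 + \<bar>g\<bar>) * (1 + 1 / \<alpha>) / \<epsilon> * (1 + \<bar>k\<bar>))"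
          unfolding p_def by (intro mult_left_mono symb_bound e a) auto
        also have "\<dots> = ((1 + \<bar>g\<bar>) * (1 + 1 / \<alpha>) / \<epsilon>) * (1 + \<bar>k\<bar>) ^ 3" by (simp add: power2_eq_square power3_eq_cube mult_ac)
        finally show ?thesis by (simp only: norm_of_real) (simp add: abs_mult)
      qed
    qed measurable
    from L2C_add[OF this wt_lower[OF M3, of 2]]
    have "(\<lambda>k. complex_of_real ((1 + \<bar>k\<bar>) ^ 2 * \<bar>p k\<bar>) * ?Gc k + wt 2 ?Mc k) \<in> L2C" by simp
    then show ?thesis by (rule L2C_cong_AE) (auto simp: wt_def dG_def algebra_simps)
  qed
  have Gi: "integrable lborel Gr" "integrable lborel dG"
    using wt_integrable[of 2 ?Gc] wt_integrable[of 1 ?dGc] G3 dG2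
    by (simp_all add: numeral_3_eq_3 numeral_2_eq_2 complex_of_real_integrable_eq)
  define dF where "dF t k = \<i> * p k * F t k + Qf q (F t) (F t) k" for t k
  have dFm: "(\<lambda>(t, k). dF t k) \<in> borel_measurable (borel \<Otimes>\<^sub>M borel)"
  proof -
    note [measurable] = measurable_Pair_compose_split[OF Fm] measurable_Pair_compose_split[OF Qf_meas[OF Fm]]
    show ?thesis unfolding dF_def split_beta by measurable
  qed
  note Ftm [measurable] = curry_meas[OF Fm] and dFtm [measurable] = curry_meas[OF dFm]
  have FG: "cmod (F t k) \<le> Gr k" if "t \<in> {0..T}" for t k
    unfolding Gr_def using that by (intro le_enn2real FG0 Gfin) auto
  have dFG: "cmod (dF t k) \<le> dG k" if t: "t \<in> {0..T}" for t k
  proof -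
    have "cmod (Qf q (F t) (F t) k) \<le> enn2real (M k)"
      unfolding M_def using t by (intro le_enn2real[OF Qf_le_maj] FG0 maj_fin[OF Gm Gm GN GN]) auto
    moreover have "cmod (\<i> * p k * F t k) \<le> \<bar>p k\<bar> * Gr k" using FG[OF t, of k] by (simp add: norm_mult mult_left_mono)
    ultimately show ?thesis unfolding dF_def dG_def by (intro norm_triangle_le add_mono) auto
  qed
  have dFh: "dF t (- k) = cnj (dF t k)" if t: "t \<in> {0..T}" for t k
    using Fh[of t] Qf_herm[of "F t" k] t by (simp add: dF_def p_odd)
  have F3: "wt 3 (F t) \<in> L2C" if "t \<in> {0..T}" for t
    by (rule wt_dominated[OF G3]) (use FG[OF that] Gr0 in auto)
  have dF2: "wt 2 (dF t) \<in> L2C" if "t \<in> {0..T}" for t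
    by (rule wt_dominated[OF dG2]) (use dFG[OF that] Gr0 in auto)
  \<comment> \<open>The inverse transform is the integral at the reflected point, an explicit
    formula that is jointly measurable in time and space; the real part changes no value, by
    hermitian symmetry.\<close>
  define f where "f t x = Re (cft (F t) (- x))" for t x
  define f' where "f' t x = Re (cft (dF t) (- x))" for t x
  have FTf: "FT (\<lambda>x. complex_of_real (f t x)) (F t)" if t: "t \<in> {0..T}" for t
  proof -
    have "F t \<in> L2C" using wt_lower[OF F3[OF t], of 0] by (simp add: wt_0)
    moreover have "integrable lborel (F t)" using wt_integrable[of 2 "F t"] F3[OF t] by (simp add: numeral_3_eq_3 numeral_2_eq_2)
    ultimately show ?thesis unfolding f_def using Fh t by (intro FT_real FT_inverse_L1) auto
  qed
  have FTf': "FT (\<lambda>x. complex_of_real (f' t x)) (dF t)" if t: "t \<in> {0..T}" for t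
  proof -
    have "dF t \<in> L2C" using wt_lower[OF dF2[OF t], of 0] by (simp add: wt_0)
    moreover have "integrable lborel (dF t)" using wt_integrable[of 1 "dF t"] dF2[OF t] by (simp add: numeral_2_eq_2)
    ultimately show ?thesis unfolding f'_def using dFh[OF t] by (intro FT_real FT_inverse_L1) auto
  qed
  have meas: "(\<lambda>(t, x). Re (cft (A t) (- x))) \<in> borel_measurable (borel \<Otimes>\<^sub>M borel)"
    if A: "(\<lambda>(t, k). A t k) \<in> borel_measurable (borel \<Otimes>\<^sub>M borel)" for A :: "real \<Rightarrow> real \<Rightarrow> complex"
  proof -
    note [measurable] = measurable_Pair_compose_split[OF A]
    show ?thesis unfolding cft_def split_beta by measurable
  qed
  have strip: "strip_measurable T (\<lambda>t x. Re (cft (A t) (- x)))"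
    if A: "(\<lambda>(t, k). A t k) \<in> borel_measurable (borel \<Otimes>\<^sub>M borel)" for A :: "real \<Rightarrow> real \<Rightarrow> complex"
  proof -
    note [measurable] = meas[OF A]
    show ?thesis unfolding strip_measurable_def set_borel_measurable_def borel_prod_lborel by measurable
  qed
  have fLinf: "f \<in> Linf_sobolev T 3"
    unfolding Linf_sobolev_def
  proof (intro CollectI conjI exI)
    show "strip_measurable T f" unfolding f_def[abs_def] by (rule strip[OF Fm])
    show "AE t in lborel. t \<in> {0<..<T} \<longrightarrow> f t \<in> sobolev 3 \<and> sobolev_norm 3 (f t) \<le> sqrt (enn2real (2 * nsq 3 G))"
    proof (intro AE_I2 impI conjI)
      fix t assume "t \<in> {0<..<T}"
      then have t: "t \<in> {0..T}" by auto
      show "f t \<in> sobolev 3" using sobolev_iff[OF FTf[OF t], of 3] F3[OF t] by simp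
      have "ennreal ((sobolev_norm 3 (f t))\<^sup>2) \<le> 2 * sqn (wt 3 (F t))" using sobolev_norm_bounds(1)[OF FTf[OF t], of 3] F3[OF t] by simp
      also have "\<dots> \<le> 2 * nsq 3 G" unfolding sqn_wt_eq using t by (intro mult_left_mono nsq_mono FG0) auto
      finally have "(sobolev_norm 3 (f t))\<^sup>2 \<le> enn2real (2 * nsq 3 G)" using GN by (intro le_enn2real) (auto simp: ennreal_mult_less_top)
      then show "sobolev_norm 3 (f t) \<le> sqrt (enn2real (2 * nsq 3 G))" by (rule real_le_rsqrt)
    qed
  qed
  have cont: "continuous_L2 T f"
    unfolding continuous_L2_def
  proof (intro ballI conjI)
    fix t assume t: "t \<in> {0..T}"
    show "f t \<in> L2" by (rule FT_fourier(1)[OF FTf[OF t]])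
    show "((\<lambda>s. L2_norm (\<lambda>x. f s x - f t x)) \<longlongrightarrow> 0) (at t within {0..T})"
      unfolding tendsto_at_iff_sequentially o_def
    proof (intro allI impI)
      fix X assume X: "\<forall>n. X n \<in> {0..T} - {t}" "X \<longlonglongrightarrow> t"
      then have Xn: "X n \<in> {0..T}" for n by auto
      have eq: "L2_norm (\<lambda>x. f (X n) x - f t x) = sqrt (enn2real (sqn (\<lambda>k. F (X n) k - F t k)))" for n
        using L2_norm_FT[of "\<lambda>x. f (X n) x - f t x"] FT_diff[OF FTf[OF Xn[of n]] FTf[OF t]] by simp
      have "(\<lambda>n. sqn (\<lambda>k. F (X n) k - F t k)) \<longlonglongrightarrow> 0"
      proof (rule sqn_dominated)
        show "(\<lambda>k. 2 * ?Gc k) \<in> L2C" using wt_lower[OF G3, of 0] by (intro L2C_cmult) (simp add: wt_0)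
        show "AE k in lborel. (\<lambda>n. F (X n) k - F t k) \<longlonglongrightarrow> 0"
        proof (intro AE_I2 LIM_zero)
          fix k
          show "(\<lambda>n. F (X n) k) \<longlonglongrightarrow> F t k"
            using C1(2)[of k] t Xn X(2) unfolding continuous_on_sequentially o_def by blast
        qed
        show "AE k in lborel. cmod (F (X n) k - F t k) \<le> cmod (2 * ?Gc k)" for n
        proof (intro AE_I2)
          fix k
          have "cmod (F (X n) k - F t k) \<le> Gr k + Gr k" by (rule norm_triangle_le_diff[OF add_mono[OF FG[OF Xn] FG[OF t]]])
          then show "cmod (F (X n) k - F t k) \<le> cmod (2 * ?Gc k)" using Gr0(1)[of k] by (simp add: norm_mult)
        qed
      qed measurable
      then have "(\<lambda>n. enn2real (sqn (\<lambda>k. F (X n) k - F t k))) \<longlonglongrightarrow> 0"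
        by (intro tendsto_enn2real) auto
      from tendsto_real_sqrt[OF this]
      show "(\<lambda>n. L2_norm (\<lambda>x. f (X n) x - f t x)) \<longlonglongrightarrow> 0" unfolding eq by simp
    qed
  qed
  have init: "AE x in lborel. f 0 x = f\<^sub>0 x"
  proof -
    have "AE k in lborel. F 0 k = H k" using phiH C1(1) by simp
    then have "AE x in lborel. complex_of_real (f 0 x) = complex_of_real (f\<^sub>0 x)"
      using FT_unique_iff[OF FTf FH, of 0] T by simp
    then show ?thesis by simp
  qed
  have weak: "is_weak_time_deriv T f f'"
    unfolding is_weak_time_deriv_def
  proof (intro conjI allI impI)
    show st: "strip_measurable T f'" unfolding f'_def[abs_def] by (rule strip[OF dFm])
    show "AE t in lborel. t \<in> {0<..<T} \<longrightarrow> f' t \<in> L2" by (intro AE_I2 impI FT_fourier(1)[OF FTf']) auto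
    show "set_integrable lborel {0<..<T} (\<lambda>t. L2_norm (f' t))"
      unfolding set_integrable_def
    proof (rule Bochner_Integration.integrable_bound)
      show "integrable lborel (\<lambda>t. sqrt (enn2real (sqn ?dGc)) * indicator {0<..<T} t)"
        using T by (intro integrable_mult_right integrable_real_indicator) auto
      have "(\<lambda>(t, x). f' t x) \<in> borel_measurable (borel \<Otimes>\<^sub>M borel)" unfolding f'_def by (rule meas[OF dFm])
      note [measurable] = measurable_Pair_compose_split[OF this]
      show "(\<lambda>t. indicat_real {0<..<T} t *\<^sub>R L2_norm (f' t)) \<in> borel_measurable lborel" unfolding L2_norm_def by measurable
      show "AE t in lborel. norm (indicat_real {0<..<T} t *\<^sub>R L2_norm (f' t)) \<le> norm (sqrt (enn2real (sqn ?dGc)) * indicator {0<..<T} t)"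
      proof (intro AE_I2)
        fix t
        show "norm (indicat_real {0<..<T} t *\<^sub>R L2_norm (f' t)) \<le> norm (sqrt (enn2real (sqn ?dGc)) * indicator {0<..<T} t)"
        proof (cases "t \<in> {0<..<T}")
          case True
          then have t: "t \<in> {0..T}" by auto
          have "sqn (dF t) \<le> sqn ?dGc" using dFG[OF t] Gr0 by (intro sqn_mono_AE AE_I2) auto
          moreover have "sqn ?dGc < \<infinity>" using wt_lower[OF dG2, of 0] by (intro L2C_finite) (simp add: wt_0)
          ultimately have "L2_norm (f' t) \<le> sqrt (enn2real (sqn ?dGc))" unfolding L2_norm_FT[OF FTf'[OF t]] by (simp add: enn2real_mono)
          moreover have "L2_norm (f' t) \<ge> 0" unfolding L2_norm_FT[OF FTf'[OF t]] by simp
          ultimately show ?thesis using True by simp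
        qed simp
      qed
    qed
    fix \<eta> assume \<eta>: "test_function {0<..<T} \<eta>"
    show "AE x in lborel. (LINT t:{0<..<T}|lborel. deriv \<eta> t * f t x) = - (LINT t:{0<..<T}|lborel. \<eta> t * f' t x)"
    proof (intro AE_I2)
      fix x
      have cdF: "continuous_on {0..T} (\<lambda>t. dF t k)" for k unfolding dF_def by (intro continuous_intros C1(2,3))
      have "(LINT t:{0<..<T}|lborel. complex_of_real (deriv \<eta> t) * cft (F t) (- x)) = - (LINT t:{0<..<T}|lborel. complex_of_real (\<eta> t) * cft (dF t) (- x))"
        by (rule weak_time_fubini[OF T \<eta> Fm dFm Gi FG dFG cdF C1(4)[folded dF_def]])
      moreover have "(LINT t:{0<..<T}|lborel. complex_of_real (z t) * cft (A t) (- x)) = complex_of_real (LINT t:{0<..<T}|lborel. z t * Re (cft (A t) (- x)))"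
        if "\<And>t k. t \<in> {0..T} \<Longrightarrow> A t (- k) = cnj (A t k)" for z A
      proof -
        have "indicat_real {0<..<T} t *\<^sub>R (complex_of_real (z t) * cft (A t) (- x)) = complex_of_real (indicat_real {0<..<T} t *\<^sub>R (z t * Re (cft (A t) (- x))))" for t
          using cft_herm_real[of "A t" "- x"] that[of t] by (cases "t \<in> {0<..<T}") auto
        then show ?thesis unfolding set_lebesgue_integral_def by (simp only: integral_complex_of_real)
      qed
      ultimately have "complex_of_real (LINT t:{0<..<T}|lborel. deriv \<eta> t * f t x) = - complex_of_real (LINT t:{0<..<T}|lborel. \<eta> t * f' t x)"
        unfolding f_def f'_def using Fh dFh by simp
      then show "(LINT t:{0<..<T}|lborel. deriv \<eta> t * f t x) = - (LINT t:{0<..<T}|lborel. \<eta> t * f' t x)"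
        by (simp only: of_real_minus[symmetric] of_real_eq_iff)
    qed
  qed
  have eqn: "f' t \<in> sobolev 1 \<and> (AE x in lborel. 2 * f' t x + \<alpha> * Lambda (f' t) x = wave_rhs \<epsilon> \<alpha> \<beta> (f t) x)" if t: "t \<in> {0..T}" for t
  proof
    have w1: "wt 1 (dF t) \<in> L2C" by (rule wt_lower[OF dF2[OF t]]) auto
    show "f' t \<in> sobolev 1" using sobolev_iff[OF FTf'[OF t], of 1] w1 by simp
    have L: "FT (\<lambda>x. complex_of_real (Lambda (f' t) x)) (\<lambda>k. complex_of_real (\<bar>k\<bar> ^ 1) * dF t k)"
      by (rule FT_Lambda_pow[OF FTf'[OF t] w1]) auto
    have 1: "FT (\<lambda>x. complex_of_real (2 * f' t x + \<alpha> * Lambda (f' t) x)) (\<lambda>k. 2 * dF t k + complex_of_real \<alpha> * (complex_of_real (\<bar>k\<bar> ^ 1) * dF t k))"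
      using FT_add[OF FT_cmult[OF FTf'[OF t], of 2] FT_cmult[OF L, of "of_real \<alpha>"]] by simp
    have "(\<lambda>k. complex_of_real (2 + \<alpha> * \<bar>k\<bar>) * (\<i> * p k * F t k + Qf q (F t) (F t) k)) = (\<lambda>k. 2 * dF t k + complex_of_real \<alpha> * (complex_of_real (\<bar>k\<bar> ^ 1) * dF t k))"
      by (auto simp: dF_def algebra_simps)
    then have 2: "FT (\<lambda>x. complex_of_real (wave_rhs \<epsilon> \<alpha> \<beta> (f t) x)) (\<lambda>k. 2 * dF t k + complex_of_real \<alpha> * (complex_of_real (\<bar>k\<bar> ^ 1) * dF t k))"
      using FT_wave_rhs[OF FTf[OF t] F3[OF t] e a, of \<beta>] unfolding g_def[symmetric] p_def[symmetric] q_def[symmetric] by simp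
    from FT_inj[OF 1 2] show "AE x in lborel. 2 * f' t x + \<alpha> * Lambda (f' t) x = wave_rhs \<epsilon> \<alpha> \<beta> (f t) x"
      by (simp only: of_real_eq_iff)
  qed
  have "is_solution \<epsilon> \<alpha> \<beta> f\<^sub>0 T f"
    unfolding is_solution_def using cont init weak eqn by (auto intro!: exI[of _ f'])
  with fLinf T show ?thesis by blast
qed

section \<open>Weak time derivatives tested against functions of space\<close>

abbreviation cr :: "(real \<Rightarrow> real) \<Rightarrow> real \<Rightarrow> complex" where "cr f \<equiv> \<lambda>x. complex_of_real (f x)"

lemma sqn_L2_norm: "f \<in> L2 \<Longrightarrow> sqn (cr f) = ennreal ((L2_norm f)\<^sup>2)"
proof -
  assume f: "f \<in> L2"
  have "(LINT x|lborel. (f x)\<^sup>2) \<ge> 0" by (intro integral_nonneg_AE) auto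
  then show ?thesis using sqn_eq_integral[of "cr f"] f by (simp add: L2_iff_L2C L2_norm_def)
qed

lemma L2_norm_nonneg: "L2_norm f \<ge> 0"
  by (auto simp: L2_norm_def intro!: integral_nonneg_AE)

lemma L2_diff: "f \<in> L2 \<Longrightarrow> g \<in> L2 \<Longrightarrow> (\<lambda>x. f x - g x) \<in> L2"
  using L2C_diff[of "cr f" "cr g"] by (simp add: L2_iff_L2C)

lemma L2_measurable: "f \<in> L2 \<Longrightarrow> f \<in> borel_measurable borel" by (simp add: L2_def)

lemma L2_integrable_mult: "f \<in> L2 \<Longrightarrow> g \<in> L2 \<Longrightarrow> integrable lborel (\<lambda>x. f x * g x)"
  using L2C_integrable_mult[of "cr f" "cr g"] complex_of_real_integrable_eq[of lborel "\<lambda>x. f x * g x"] by (simp add: L2_iff_L2C)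

lemma ennreal_sq_le: "(x::ennreal)\<^sup>2 \<le> (ennreal c)\<^sup>2 \<Longrightarrow> 0 \<le> c \<Longrightarrow> x \<le> ennreal c"
  by (cases x) (auto simp: ennreal_power power2_eq_square ennreal_top_mult top_unique ennreal_mult_eq_top_iff intro!: ennreal_leI intro: power2_le_imp_le simp flip: ennreal_mult)

lemma L2_nn_Cauchy_Schwarz:
  assumes f: "f \<in> L2" and g: "g \<in> L2"
  shows "(\<integral>\<^sup>+x. ennreal \<bar>f x * g x\<bar> \<partial>lborel) \<le> ennreal (L2_norm f * L2_norm g)"
proof -
  have "(\<integral>\<^sup>+x. ennreal (cmod (cr f x) * cmod (cr g x)) \<partial>lborel)\<^sup>2 \<le> sqn (cr f) * sqn (cr g)"
    using f g by (intro nn_Cauchy_Schwarz_L2C) (auto simp: L2_iff_L2C)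
  also have "\<dots> = (ennreal (L2_norm f * L2_norm g))\<^sup>2"
    using f g L2_norm_nonneg by (simp add: sqn_L2_norm ennreal_power power_mult_distrib flip: ennreal_mult)
  finally have "(\<integral>\<^sup>+x. ennreal \<bar>f x * g x\<bar> \<partial>lborel)\<^sup>2 \<le> (ennreal (L2_norm f * L2_norm g))\<^sup>2"
    by (simp add: abs_mult)
  then show ?thesis using L2_norm_nonneg by (intro ennreal_sq_le) auto
qed

lemma L2_Cauchy_Schwarz:
  assumes f: "f \<in> L2" and g: "g \<in> L2"
  shows "\<bar>LINT x|lborel. f x * g x\<bar> \<le> L2_norm f * L2_norm g"
proof -
  have "ennreal (norm (LINT x|lborel. f x * g x)) \<le> (\<integral>\<^sup>+x. ennreal (norm (f x * g x)) \<partial>lborel)"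
    by (rule integral_norm_bound_ennreal[OF L2_integrable_mult[OF f g]])
  also have "\<dots> \<le> ennreal (L2_norm f * L2_norm g)" using L2_nn_Cauchy_Schwarz[OF f g] by simp
  finally show ?thesis using L2_norm_nonneg by (simp add: ennreal_le_iff)
qed

lemma continuous_L2_sequentially:
  assumes f: "continuous_L2 T f" and t: "t \<in> {0..T}" and X: "\<And>n. X n \<in> {0..T}" "X \<longlonglongrightarrow> t"
  shows "(\<lambda>n. sqn (\<lambda>x. cr (f (X n)) x - cr (f t) x)) \<longlonglongrightarrow> 0"
proof -
  let ?N = "\<lambda>s. L2_norm (\<lambda>x. f s x - f t x)"
  have fL: "f s \<in> L2" if "s \<in> {0..T}" for s using f that by (simp add: continuous_L2_def)
  have "(?N \<longlongrightarrow> ?N t) (at t within {0..T})" using f t by (simp add: continuous_L2_def L2_norm_def)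
  then have "continuous (at t within {0..T}) ?N" by (simp add: continuous_within)
  then have "(\<lambda>n. ?N (X n)) \<longlonglongrightarrow> ?N t" using X unfolding continuous_within_sequentially o_def by blast
  then have "(\<lambda>n. (?N (X n))\<^sup>2) \<longlonglongrightarrow> 0" using tendsto_power[of "\<lambda>n. ?N (X n)" 0 sequentially 2] by (simp add: L2_norm_def)
  then have "(\<lambda>n. ennreal ((?N (X n))\<^sup>2)) \<longlonglongrightarrow> ennreal 0" by (rule tendsto_ennrealI)
  moreover have "ennreal ((?N (X n))\<^sup>2) = sqn (\<lambda>x. cr (f (X n)) x - cr (f t) x)" for n
    using sqn_L2_norm[OF L2_diff[OF fL[OF X(1)[of n]] fL[OF t]]] by simp
  ultimately show ?thesis by simp
qed

lemma continuous_L2_pairing: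
  assumes f: "continuous_L2 T f" and g: "continuous_L2 T g"
  shows "continuous_on {0..T} (\<lambda>t. LINT x|lborel. f t x * g t x)"
  unfolding continuous_on_sequentially o_def
proof (intro allI ballI impI)
  fix X :: "nat \<Rightarrow> real" and t assume t: "t \<in> {0..T}" and X: "(\<forall>n. X n \<in> {0..T}) \<and> X \<longlonglongrightarrow> t"
  have L: "cr (f s) \<in> L2C" "cr (g s) \<in> L2C" if "s \<in> {0..T}" for s
    using f g that by (auto simp: continuous_L2_def L2_iff_L2C)
  have "(\<lambda>n. LINT x|lborel. cr (f (X n)) x * cr (g (X n)) x) \<longlonglongrightarrow> (LINT x|lborel. cr (f t) x * cr (g t) x)"
    by (rule L2C_tendsto_integral) (use X t L in \<open>auto intro!: continuous_L2_sequentially f g\<close>)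
  then show "(\<lambda>n. LINT x|lborel. f (X n) x * g (X n) x) \<longlonglongrightarrow> (LINT x|lborel. f t x * g t x)"
    by (simp only: of_real_mult[symmetric] integral_complex_of_real tendsto_of_real_iff)
qed

lemma continuous_L2_const: "\<psi> \<in> L2 \<Longrightarrow> continuous_L2 T (\<lambda>_. \<psi>)"
  by (auto simp: continuous_L2_def L2_norm_def)

lemma continuous_L2_diff:
  assumes f: "continuous_L2 T f" and g: "continuous_L2 T g"
  shows "continuous_L2 T (\<lambda>t x. f t x - g t x)"
  unfolding continuous_L2_def
proof (intro ballI conjI)
  fix t assume t: "t \<in> {0..T}"
  have L: "f s \<in> L2" "g s \<in> L2" if "s \<in> {0..T}" for s
    using f g that by (auto simp: continuous_L2_def)
  show "(\<lambda>x. f t x - g t x) \<in> L2" by (intro L2_diff L t)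
  show "((\<lambda>s. L2_norm (\<lambda>x. f s x - g s x - (f t x - g t x))) \<longlongrightarrow> 0) (at t within {0..T})"
    unfolding tendsto_at_iff_sequentially o_def
  proof (intro allI impI)
    fix X assume X: "\<forall>n. X n \<in> {0..T} - {t}" "X \<longlonglongrightarrow> t"
    then have Xn: "X n \<in> {0..T}" for n by auto
    let ?D = "\<lambda>n x. f (X n) x - g (X n) x - (f t x - g t x)"
    note [measurable] = L2_measurable[OF L(1)[OF Xn]] L2_measurable[OF L(2)[OF Xn]] L2_measurable[OF L(1)[OF t]] L2_measurable[OF L(2)[OF t]]
    have lim: "(\<lambda>n. 2 * sqn (\<lambda>x. cr (f (X n)) x - cr (f t) x) + 2 * sqn (\<lambda>x. cr (g (X n)) x - cr (g t) x)) \<longlonglongrightarrow> 0"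
      using tendsto_add[OF tendsto_mult_ennreal_0(2)[OF continuous_L2_sequentially[OF f t Xn X(2)], of 2] tendsto_mult_ennreal_0(2)[OF continuous_L2_sequentially[OF g t Xn X(2)], of 2]]
      by (simp only: add_0_left) simp
    have "sqn (cr (?D n)) \<le> 2 * sqn (\<lambda>x. cr (f (X n)) x - cr (f t) x) + 2 * sqn (\<lambda>x. cr (g (X n)) x - cr (g t) x)" for n
    proof -
      have "sqn (cr (?D n)) = sqn (\<lambda>x. (cr (f (X n)) x - cr (f t) x) + (cr (g t) x - cr (g (X n)) x))"
        by (rule arg_cong[where f=sqn]) (auto simp: algebra_simps)
      also have "\<dots> \<le> 2 * sqn (\<lambda>x. cr (f (X n)) x - cr (f t) x) + 2 * sqn (\<lambda>x. cr (g t) x - cr (g (X n)) x)"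
        by (rule sqn_add_le) measurable
      also have "sqn (\<lambda>x. cr (g t) x - cr (g (X n)) x) = sqn (\<lambda>x. cr (g (X n)) x - cr (g t) x)"
        by (rule sqn_diff_commute)
      finally show ?thesis .
    qed
    from tendsto_ennreal_0_le[OF this lim] have "(\<lambda>n. sqn (cr (?D n))) \<longlonglongrightarrow> 0" .
    then have "(\<lambda>n. enn2real (sqn (cr (?D n)))) \<longlonglongrightarrow> 0" by (intro tendsto_enn2real) auto
    from tendsto_real_sqrt[OF this] have "(\<lambda>n. sqrt (enn2real (sqn (cr (?D n))))) \<longlonglongrightarrow> 0" by simp
    moreover have "sqrt (enn2real (sqn (cr (?D n)))) = L2_norm (?D n)" for n
      using sqn_L2_norm[OF L2_diff[OF L2_diff[OF L[OF Xn[of n]]] L2_diff[OF L[OF t]]]] L2_norm_nonneg[of "?D n"] by simp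
    ultimately show "(\<lambda>n. L2_norm (?D n)) \<longlonglongrightarrow> 0" by simp
  qed
qed

text \<open>A function with values in L2 at almost every time, measurable on the strip only, is
  replaced by a jointly Borel function on the plane which lies in L2 at every time and vanishes off
  the strip. This spares exceptional times in the Fubini arguments that follow.\<close>

lemma strip_normalise:
  assumes st: "strip_measurable T h" and L: "AE t in lborel. t \<in> {0<..<T} \<longrightarrow> h t \<in> L2"
  obtains v where "(\<lambda>(t, x). v t x) \<in> borel_measurable (borel \<Otimes>\<^sub>M borel)" "\<And>t. v t \<in> L2" "\<And>t x. t \<notin> {0<..<T} \<Longrightarrow> v t x = 0"
    "AE t in lborel. t \<in> {0<..<T} \<longrightarrow> v t = h t"
proof -
  define k where "k t x = indicat_real {0<..<T} t * h t x" for t x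
  have km: "(\<lambda>(t, x). k t x) \<in> borel_measurable (borel \<Otimes>\<^sub>M borel)"
  proof -
    have "(\<lambda>z. indicat_real ({0<..<T} \<times> UNIV) z *\<^sub>R (case z of (t, x) \<Rightarrow> h t x)) = (\<lambda>(t, x). k t x)"
      by (auto simp: k_def indicator_def)
    then show ?thesis using st by (simp add: strip_measurable_def set_borel_measurable_def borel_prod_lborel)
  qed
  note [measurable] = measurable_Pair_compose_split[OF km]
  \<comment> \<open>Times with infinite squared integral form a measurable set, so cutting them off
    preserves joint measurability.\<close>
  define v where "v t x = (if (\<integral>\<^sup>+y. ennreal ((k t y)\<^sup>2) \<partial>lborel) < \<infinity> then k t x else 0)" for t x
  show ?thesis
  proof (rule that[of v])
    show "(\<lambda>(t, x). v t x) \<in> borel_measurable (borel \<Otimes>\<^sub>M borel)" unfolding v_def split_beta by measurable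
    show "v t \<in> L2" for t
    proof (cases "(\<integral>\<^sup>+y. ennreal ((k t y)\<^sup>2) \<partial>lborel) < \<infinity>")
      case True
      then have "v t = k t" by (auto simp: v_def)
      moreover have "k t \<in> L2"
        unfolding L2_def using True by (auto simp: integrable_iff_bounded)
      ultimately show ?thesis by simp
    next
      case False
      then have "v t = (\<lambda>_. 0)" by (auto simp: v_def)
      then show ?thesis by (simp add: L2_def)
    qed
    show "v t x = 0" if "t \<notin> {0<..<T}" for t x using that by (simp add: v_def k_def)
    show "AE t in lborel. t \<in> {0<..<T} \<longrightarrow> v t = h t"
      using L
    proof eventually_elim
      case (elim t)
      show ?case
      proof
        assume t: "t \<in> {0<..<T}"
        then have k: "k t = h t" by (auto simp: k_def)
        have "integrable lborel (\<lambda>x. (h t x)\<^sup>2)" using elim t by (simp add: L2_def)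
        then have "(\<integral>\<^sup>+y. ennreal ((k t y)\<^sup>2) \<partial>lborel) < \<infinity>" unfolding k by (simp add: integrable_iff_bounded)
        then show "v t = h t" by (auto simp: v_def k[symmetric])
      qed
    qed
  qed
qed

text \<open>The definition of the weak time derivative speaks of time integrals at almost every
  \<open>x\<close>; this exchange converts them into time integrals of scalar pairings with
  \<open>\<psi>\<close>.\<close>

lemma pairing_Fubini:
  fixes v :: "real \<Rightarrow> real \<Rightarrow> real"
  assumes vm: "(\<lambda>(t, x). v t x) \<in> borel_measurable (borel \<Otimes>\<^sub>M borel)" and vL: "\<And>t. v t \<in> L2" and vi: "integrable lborel (\<lambda>t. L2_norm (v t))"
    and \<psi>: "\<psi> \<in> L2" and z: "z \<in> borel_measurable borel" "\<And>t. \<bar>z t\<bar> \<le> B"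
  shows "(LINT t|lborel. z t * (LINT x|lborel. v t x * \<psi> x)) = (LINT x|lborel. \<psi> x * (LINT t|lborel. z t * v t x))"
proof -
  note [measurable] = measurable_Pair_compose_split[OF vm] L2_measurable[OF \<psi>] z(1)
  have nm [measurable]: "(\<lambda>t. L2_norm (v t)) \<in> borel_measurable borel" unfolding L2_norm_def by measurable
  have "(\<integral>\<^sup>+t. \<integral>\<^sup>+x. ennreal (norm (z t * (v t x * \<psi> x))) \<partial>lborel \<partial>lborel) \<le> (\<integral>\<^sup>+t. ennreal \<bar>B\<bar> * ennreal (L2_norm \<psi>) * ennreal (L2_norm (v t)) \<partial>lborel)"
  proof (rule nn_integral_mono)
    fix t
    have "(\<integral>\<^sup>+x. ennreal (norm (z t * (v t x * \<psi> x))) \<partial>lborel) \<le> (\<integral>\<^sup>+x. ennreal \<bar>B\<bar> * ennreal \<bar>v t x * \<psi> x\<bar> \<partial>lborel)"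
    proof (rule nn_integral_mono)
      fix x
      have "norm (z t * (v t x * \<psi> x)) \<le> \<bar>B\<bar> * \<bar>v t x * \<psi> x\<bar>"
        using order_trans[OF z(2)[of t] abs_ge_self] by (simp add: abs_mult mult_right_mono)
      from ennreal_leI[OF this] show "ennreal (norm (z t * (v t x * \<psi> x))) \<le> ennreal \<bar>B\<bar> * ennreal \<bar>v t x * \<psi> x\<bar>" by (simp add: ennreal_mult)
    qed
    also have "\<dots> = ennreal \<bar>B\<bar> * (\<integral>\<^sup>+x. ennreal \<bar>v t x * \<psi> x\<bar> \<partial>lborel)" by (rule nn_integral_cmult) measurable
    also have "\<dots> \<le> ennreal \<bar>B\<bar> * ennreal (L2_norm (v t) * L2_norm \<psi>)" by (intro mult_left_mono L2_nn_Cauchy_Schwarz vL \<psi>) auto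
    finally show "(\<integral>\<^sup>+x. ennreal (norm (z t * (v t x * \<psi> x))) \<partial>lborel) \<le> ennreal \<bar>B\<bar> * ennreal (L2_norm \<psi>) * ennreal (L2_norm (v t))"
      using L2_norm_nonneg by (simp add: ennreal_mult mult_ac)
  qed
  also have "\<dots> = ennreal \<bar>B\<bar> * ennreal (L2_norm \<psi>) * (\<integral>\<^sup>+t. ennreal (L2_norm (v t)) \<partial>lborel)" by (rule nn_integral_cmult) measurable
  also have "\<dots> < \<infinity>" using vi L2_norm_nonneg by (auto simp: ennreal_mult_less_top integrable_iff_bounded)
  finally have fin: "(\<integral>\<^sup>+t. \<integral>\<^sup>+x. ennreal (norm (z t * (v t x * \<psi> x))) \<partial>lborel \<partial>lborel) < \<infinity>" .
  have "(LINT t|lborel. z t * (LINT x|lborel. v t x * \<psi> x)) = (LINT t|lborel. LINT x|lborel. z t * (v t x * \<psi> x))" by simp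
  also have "\<dots> = (LINT x|lborel. LINT t|lborel. z t * (v t x * \<psi> x))" by (rule lborel_Fubini[OF _ fin]) measurable
  also have "\<dots> = (LINT x|lborel. \<psi> x * (LINT t|lborel. z t * v t x))"
  proof (intro Bochner_Integration.integral_cong refl)
    fix x
    have "\<psi> x * (LINT t|lborel. z t * v t x) = (LINT t|lborel. \<psi> x * (z t * v t x))" by simp
    also have "\<dots> = (LINT t|lborel. z t * (v t x * \<psi> x))" by (intro Bochner_Integration.integral_cong refl) (simp add: mult_ac)
    finally show "(LINT t|lborel. z t * (v t x * \<psi> x)) = \<psi> x * (LINT t|lborel. z t * v t x)" ..
  qed
  finally show ?thesis .
qed

lemma set_integral_Icc_Ioo:
  fixes f :: "real \<Rightarrow> 'b::{banach, second_countable_topology}"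
  assumes f: "set_integrable lborel {a..b} f"
  shows "(LINT x:{a..b}|lborel. f x) = (LINT x:{a<..<b}|lborel. f x)"
  unfolding set_lebesgue_integral_def
proof (rule integral_cong_AE)
  have "{a<..<b} \<subseteq> {a..b}" by auto
  show "(\<lambda>x. indicat_real {a..b} x *\<^sub>R f x) \<in> borel_measurable lborel" using f by (auto simp: set_integrable_def)
  show "(\<lambda>x. indicat_real {a<..<b} x *\<^sub>R f x) \<in> borel_measurable lborel"
    using set_integrable_subset[OF f _ \<open>{a<..<b} \<subseteq> {a..b}\<close>] by (simp add: set_integrable_def)
  show "AE x in lborel. indicat_real {a..b} x *\<^sub>R f x = indicat_real {a<..<b} x *\<^sub>R f x"
    using AE_lborel_singleton[of a] AE_lborel_singleton[of b] by eventually_elim (auto simp: indicator_def)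
qed

lemma strip_section_integral:
  assumes st: "strip_measurable T h" and vm: "(\<lambda>(t, x). v t x) \<in> borel_measurable (borel \<Otimes>\<^sub>M borel)"
    and v0: "\<And>t x. t \<notin> {0<..<T} \<Longrightarrow> v t x = 0" and vae: "AE t in lborel. t \<in> {0<..<T} \<longrightarrow> v t = h t"
    and z: "z \<in> borel_measurable borel"
  shows "(LINT t:{0<..<T}|lborel. z t * h t x) = (LINT t|lborel. z t * v t x)"
  unfolding set_lebesgue_integral_def
proof (rule integral_cong_AE)
  have "(\<lambda>u. indicat_real ({0<..<T} \<times> UNIV) u *\<^sub>R (case u of (t, x) \<Rightarrow> h t x)) = (\<lambda>(t, x). indicat_real {0<..<T} t * h t x)"
    by (auto simp: indicator_def)
  then have "(\<lambda>(t, x). indicat_real {0<..<T} t * h t x) \<in> borel_measurable (borel \<Otimes>\<^sub>M borel)"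
    using st by (simp add: strip_measurable_def set_borel_measurable_def borel_prod_lborel)
  note [measurable] = measurable_Pair_compose_split[OF this measurable_ident_sets[OF refl] borel_measurable_const] z measurable_Pair_compose_split[OF vm]
  have "(\<lambda>t. z t * (indicat_real {0<..<T} t * h t x)) \<in> borel_measurable lborel" by measurable
  then show "(\<lambda>t. indicat_real {0<..<T} t *\<^sub>R (z t * h t x)) \<in> borel_measurable lborel" by (simp add: mult.left_commute)
  show "(\<lambda>t. z t * v t x) \<in> borel_measurable lborel" by measurable
  show "AE t in lborel. indicat_real {0<..<T} t *\<^sub>R (z t * h t x) = z t * v t x"
    using vae
  proof eventually_elim
    case (elim t)
    then show ?case using v0[of t x] by (cases "t \<in> {0<..<T}") auto
  qed
qed

lemma L2_norm_integrable_AE: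
  assumes i: "set_integrable lborel {0<..<T} (\<lambda>t. L2_norm (h t))" and vm: "(\<lambda>(t, x). v t x) \<in> borel_measurable (borel \<Otimes>\<^sub>M borel)"
    and v0: "\<And>t x. t \<notin> {0<..<T} \<Longrightarrow> v t x = 0" and vae: "AE t in lborel. t \<in> {0<..<T} \<longrightarrow> v t = h t"
  shows "integrable lborel (\<lambda>t. L2_norm (v t))"
proof -
  note [measurable] = measurable_Pair_compose_split[OF vm]
  have i': "integrable lborel (\<lambda>t. indicat_real {0<..<T} t *\<^sub>R L2_norm (h t))" using i by (simp add: set_integrable_def)
  show ?thesis
  proof (rule integrable_cong_AE_imp[OF i'])
    show "(\<lambda>t. L2_norm (v t)) \<in> borel_measurable lborel" unfolding L2_norm_def by measurable
    show "AE t in lborel. indicat_real {0<..<T} t *\<^sub>R L2_norm (h t) = L2_norm (v t)"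
      using vae
    proof eventually_elim
      case (elim t)
      then show ?case using v0[of t] by (cases "t \<in> {0<..<T}") (auto simp: L2_norm_def)
    qed
  qed
qed

text \<open>With \<open>\<psi>\<close> fixed in time, the weak derivative of an L2-valued function
  becomes the weak derivative of the continuous scalar function pairing \<open>f t\<close> with
  \<open>\<psi>\<close>, and \<open>weak_FTC\<close> integrates it up to the endpoints.\<close>

lemma weak_deriv_pairing:
  assumes T: "T > 0" and c: "continuous_L2 T f" and st: "strip_measurable T f" and M: "AE t in lborel. t \<in> {0<..<T} \<longrightarrow> L2_norm (f t) \<le> M"
    and wd: "is_weak_time_deriv T f f'"
    and vm: "(\<lambda>(t, x). v t x) \<in> borel_measurable (borel \<Otimes>\<^sub>M borel)" and vL: "\<And>t. v t \<in> L2"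
    and v0: "\<And>t x. t \<notin> {0<..<T} \<Longrightarrow> v t x = 0" and vae: "AE t in lborel. t \<in> {0<..<T} \<longrightarrow> v t = f' t"
    and \<psi>: "\<psi> \<in> L2" and t: "0 < t" "t \<le> T"
  shows "(LINT x|lborel. f t x * \<psi> x) = (LINT x|lborel. f 0 x * \<psi> x) + (LINT s:{0<..<t}|lborel. LINT x|lborel. v s x * \<psi> x)"
proof -
  have fL: "f s \<in> L2" if "s \<in> {0..T}" for s using c that by (simp add: continuous_L2_def)
  obtain u where um: "(\<lambda>(t, x). u t x) \<in> borel_measurable (borel \<Otimes>\<^sub>M borel)" and uL: "\<And>t. u t \<in> L2"
    and u0: "\<And>t x. t \<notin> {0<..<T} \<Longrightarrow> u t x = 0" and uae: "AE t in lborel. t \<in> {0<..<T} \<longrightarrow> u t = f t"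
    using strip_normalise[OF st] fL by (auto simp: AE_I2)
  note [measurable] = measurable_Pair_compose_split[OF um] measurable_Pair_compose_split[OF vm] L2_measurable[OF \<psi>]
  have vi: "integrable lborel (\<lambda>t. L2_norm (v t))"
    using wd by (intro L2_norm_integrable_AE[OF _ vm v0 vae]) (simp add: is_weak_time_deriv_def)
  have ui: "integrable lborel (\<lambda>t. L2_norm (u t))"
  proof (rule Bochner_Integration.integrable_bound)
    show "integrable lborel (\<lambda>t. \<bar>M\<bar> * indicat_real {0<..<T} t)" using T by (intro integrable_mult_right integrable_real_indicator) auto
    show "(\<lambda>t. L2_norm (u t)) \<in> borel_measurable lborel" unfolding L2_norm_def by measurable
    show "AE t in lborel. norm (L2_norm (u t)) \<le> norm (\<bar>M\<bar> * indicat_real {0<..<T} t)"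
      using uae M
    proof eventually_elim
      case (elim t)
      then show ?case using u0[of t] L2_norm_nonneg[of "u t"] by (cases "t \<in> {0<..<T}") (auto simp: L2_norm_def)
    qed
  qed
  let ?a = "\<lambda>t. LINT x|lborel. f t x * \<psi> x" and ?b = "\<lambda>s. LINT x|lborel. v s x * \<psi> x"
  have ca: "continuous_on {0..T} ?a" by (rule continuous_L2_pairing[OF c continuous_L2_const[OF \<psi>]])
  have bi: "set_integrable lborel {0<..<T} ?b"
    unfolding set_integrable_def
  proof (rule Bochner_Integration.integrable_bound)
    show "integrable lborel (\<lambda>s. L2_norm (v s) * L2_norm \<psi>)" using vi by simp
    show "(\<lambda>s. indicat_real {0<..<T} s *\<^sub>R ?b s) \<in> borel_measurable lborel" by measurable
    show "AE s in lborel. norm (indicat_real {0<..<T} s *\<^sub>R ?b s) \<le> norm (L2_norm (v s) * L2_norm \<psi>)"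
    proof (intro AE_I2)
      fix s
      have "\<bar>?b s\<bar> \<le> L2_norm (v s) * L2_norm \<psi>" by (rule L2_Cauchy_Schwarz[OF vL \<psi>])
      then show "norm (indicat_real {0<..<T} s *\<^sub>R ?b s) \<le> norm (L2_norm (v s) * L2_norm \<psi>)"
        using L2_norm_nonneg by (auto simp: indicator_def abs_mult)
    qed
  qed
  show ?thesis
  proof (rule weak_FTC[OF t ca bi])
    fix \<eta> assume \<eta>: "test_function {0<..<T} \<eta>"
    have \<eta>U: "test_function UNIV \<eta>" by (rule test_function_mono[OF \<eta>]) simp
    obtain B1 where B1: "\<And>x. \<bar>\<eta> x\<bar> \<le> B1" using Cc_bounded[OF test_function_Cc(1)[OF \<eta>U]] by auto
    obtain B2 where B2: "\<And>x. \<bar>deriv \<eta> x\<bar> \<le> B2" using Cc_bounded[OF test_function_Cc(2)[OF \<eta>U]] by auto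
    note sm = test_function_smooth[OF \<eta>]
    have m [measurable]: "\<eta> \<in> borel_measurable borel" "deriv \<eta> \<in> borel_measurable borel"
      by (intro borel_measurable_continuous_onI smooth_continuous smooth_deriv sm)+
    have "(LINT t:{0<..<T}|lborel. deriv \<eta> t * ?a t) = (LINT t|lborel. deriv \<eta> t * (LINT x|lborel. u t x * \<psi> x))"
      unfolding set_lebesgue_integral_def
    proof (rule integral_cong_AE)
      have "(\<lambda>t. indicat_real {0<..<T} t *\<^sub>R ?a t) \<in> borel_measurable borel"
        by (rule borel_measurable_continuous_on_indicator) (auto intro: continuous_on_subset[OF ca])
      then have "(\<lambda>t. deriv \<eta> t * (indicat_real {0<..<T} t *\<^sub>R ?a t)) \<in> borel_measurable lborel" by measurable
      then show "(\<lambda>t. indicat_real {0<..<T} t *\<^sub>R (deriv \<eta> t * ?a t)) \<in> borel_measurable lborel" by (simp add: mult.left_commute)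
      show "(\<lambda>t. deriv \<eta> t * (LINT x|lborel. u t x * \<psi> x)) \<in> borel_measurable lborel" by measurable
      show "AE t in lborel. indicat_real {0<..<T} t *\<^sub>R (deriv \<eta> t * ?a t) = deriv \<eta> t * (LINT x|lborel. u t x * \<psi> x)"
        using uae
      proof eventually_elim
        case (elim t)
        then show ?case using u0[of t] by (cases "t \<in> {0<..<T}") auto
      qed
    qed
    also have "\<dots> = (LINT x|lborel. \<psi> x * (LINT t|lborel. deriv \<eta> t * u t x))"
      by (rule pairing_Fubini[OF um uL ui \<psi> m(2) B2])
    also have "\<dots> = (LINT x|lborel. \<psi> x * - (LINT t|lborel. \<eta> t * v t x))"
    proof (rule integral_cong_AE)
      have "AE x in lborel. (LINT t:{0<..<T}|lborel. deriv \<eta> t * f t x) = - (LINT t:{0<..<T}|lborel. \<eta> t * f' t x)"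
        using wd \<eta> by (simp add: is_weak_time_deriv_def)
      moreover have "(LINT t:{0<..<T}|lborel. deriv \<eta> t * f t x) = (LINT t|lborel. deriv \<eta> t * u t x)" for x
        by (rule strip_section_integral[OF st um u0 uae m(2)])
      moreover have "(LINT t:{0<..<T}|lborel. \<eta> t * f' t x) = (LINT t|lborel. \<eta> t * v t x)" for x
        using wd by (intro strip_section_integral[OF _ vm v0 vae m(1)]) (simp_all add: is_weak_time_deriv_def)
      ultimately have "AE x in lborel. (LINT t|lborel. deriv \<eta> t * u t x) = - (LINT t|lborel. \<eta> t * v t x)"
        by simp
      then show "AE x in lborel. \<psi> x * (LINT t|lborel. deriv \<eta> t * u t x) = \<psi> x * - (LINT t|lborel. \<eta> t * v t x)"
        by eventually_elim simp
      show "(\<lambda>x. \<psi> x * (LINT t|lborel. deriv \<eta> t * u t x)) \<in> borel_measurable lborel" by measurable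
      show "(\<lambda>x. \<psi> x * - (LINT t|lborel. \<eta> t * v t x)) \<in> borel_measurable lborel" by measurable
    qed
    also have "\<dots> = - (LINT x|lborel. \<psi> x * (LINT t|lborel. \<eta> t * v t x))" by simp
    also have "(LINT x|lborel. \<psi> x * (LINT t|lborel. \<eta> t * v t x)) = (LINT t|lborel. \<eta> t * ?b t)"
      by (rule pairing_Fubini[OF vm vL vi \<psi> m(1) B1, symmetric])
    also have "\<dots> = (LINT t:{0<..<T}|lborel. \<eta> t * ?b t)"
      unfolding set_lebesgue_integral_def
    proof (intro Bochner_Integration.integral_cong refl)
      fix s
      show "\<eta> s * ?b s = indicat_real {0<..<T} s *\<^sub>R (\<eta> s * ?b s)"
        using v0[of s] by (cases "s \<in> {0<..<T}") auto
    qed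
    finally show "(LINT t:{0<..<T}|lborel. deriv \<eta> t * ?a t) = - (LINT t:{0<..<T}|lborel. \<eta> t * ?b t)" .
  qed
qed

lemma energy_identity:
  fixes V w :: "real \<Rightarrow> real \<Rightarrow> real"
  assumes Vm: "(\<lambda>(t, x). V t x) \<in> borel_measurable (borel \<Otimes>\<^sub>M borel)" and VL: "\<And>t. V t \<in> L2" and Vi: "integrable lborel (\<lambda>t. L2_norm (V t))"
    and wL: "\<And>t. t \<in> {0..T} \<Longrightarrow> w t \<in> L2"
    and pair: "\<And>t \<psi>. 0 < t \<Longrightarrow> t \<le> T \<Longrightarrow> \<psi> \<in> L2 \<Longrightarrow> (LINT x|lborel. w t x * \<psi> x) = (LINT s:{0<..<t}|lborel. LINT x|lborel. V s x * \<psi> x)"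
    and t: "0 < t" "t \<le> T"
  shows "set_integrable lborel {0<..<t} (\<lambda>s. LINT x|lborel. V s x * w s x)"
    and "(LINT x|lborel. w t x * w t x) = 2 * (LINT s:{0<..<t}|lborel. LINT x|lborel. V s x * w s x)"
proof -
  note [measurable] = measurable_Pair_compose_split[OF Vm]
  define kap where "kap s r = (LINT x|lborel. V s x * V r x)" for s r
  have kap_sym: "kap s r = kap r s" for s r by (simp add: kap_def mult.commute)
  have kap_le: "\<bar>kap s r\<bar> \<le> L2_norm (V s) * L2_norm (V r)" for s r unfolding kap_def by (rule L2_Cauchy_Schwarz[OF VL VL])
  have [measurable]: "(\<lambda>(s, r). kap s r) \<in> borel_measurable (borel \<Otimes>\<^sub>M borel)" unfolding kap_def split_beta by measurable
  let ?I = "indicat_real {0<..<t}"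
  define J where "J s r = ?I s * ?I r * kap s r" for s r
  define J1 where "J1 s r = (if r < s then J s r else 0)" for s r
  define J2 where "J2 s r = (if s < r then J s r else 0)" for s r
  have Jm: "(\<lambda>(s, r). J s r) \<in> borel_measurable (lborel \<Otimes>\<^sub>M lborel)" unfolding J_def borel_prod_lborel by measurable
  note [measurable] = Jm[unfolded borel_prod_lborel]
  have J1m: "(\<lambda>(s, r). J1 s r) \<in> borel_measurable (lborel \<Otimes>\<^sub>M lborel)" unfolding J1_def borel_prod_lborel by measurable
  have J2m: "(\<lambda>(s, r). J2 s r) \<in> borel_measurable (lborel \<Otimes>\<^sub>M lborel)" unfolding J2_def borel_prod_lborel by measurable
  have Jle: "\<bar>J s r\<bar> \<le> L2_norm (V s) * L2_norm (V r)" "\<bar>J1 s r\<bar> \<le> L2_norm (V s) * L2_norm (V r)" "\<bar>J2 s r\<bar> \<le> L2_norm (V s) * L2_norm (V r)" for s r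
    using kap_le[of s r] L2_norm_nonneg[of "V s"] L2_norm_nonneg[of "V r"] by (auto simp: J_def J1_def J2_def indicator_def)
  have fin: "(\<integral>\<^sup>+s. \<integral>\<^sup>+r. ennreal (norm (H s r)) \<partial>lborel \<partial>lborel) < \<infinity>" if H: "\<And>s r. \<bar>H s r\<bar> \<le> L2_norm (V s) * L2_norm (V r)" for H :: "real \<Rightarrow> real \<Rightarrow> real"
  proof -
    have nm [measurable]: "(\<lambda>s. L2_norm (V s)) \<in> borel_measurable borel" unfolding L2_norm_def by measurable
    have "(\<integral>\<^sup>+s. \<integral>\<^sup>+r. ennreal (norm (H s r)) \<partial>lborel \<partial>lborel) \<le> (\<integral>\<^sup>+s. \<integral>\<^sup>+r. ennreal (L2_norm (V s)) * ennreal (L2_norm (V r)) \<partial>lborel \<partial>lborel)"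
      using H L2_norm_nonneg by (intro nn_integral_mono) (auto simp: ennreal_mult[symmetric] intro!: ennreal_leI)
    also have "\<dots> = (\<integral>\<^sup>+s. ennreal (L2_norm (V s)) * (\<integral>\<^sup>+r. ennreal (L2_norm (V r)) \<partial>lborel) \<partial>lborel)"
      by (intro nn_integral_cong nn_integral_cmult) measurable
    also have "\<dots> = (\<integral>\<^sup>+s. ennreal (L2_norm (V s)) \<partial>lborel) * (\<integral>\<^sup>+r. ennreal (L2_norm (V r)) \<partial>lborel)"
      by (rule nn_integral_multc) measurable
    also have "\<dots> < \<infinity>" using Vi L2_norm_nonneg by (auto simp: ennreal_mult_less_top integrable_iff_bounded)
    finally show ?thesis .
  qed
  note Ji = lborel_prod_integrableI[OF Jm fin[OF Jle(1)]] lborel_prod_integrableI[OF J1m fin[OF Jle(2)]] lborel_prod_integrableI[OF J2m fin[OF Jle(3)]]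
  \<comment> \<open>Over r < s the integral of \<open>kap\<close> is \<open>pair\<close> at time
    \<open>s\<close> with test function \<open>V s\<close>, which is the pairing of
    \<open>V s\<close> with \<open>w s\<close>.\<close>
  have inner: "?I s * (LINT x|lborel. V s x * w s x) = (LINT r|lborel. J1 s r)" for s
  proof (cases "s \<in> {0<..<t}")
    case True
    then have s: "0 < s" "s \<le> T" using t by auto
    have "(LINT x|lborel. V s x * w s x) = (LINT x|lborel. w s x * V s x)" by (simp add: mult.commute)
    also have "\<dots> = (LINT r:{0<..<s}|lborel. kap r s)" unfolding kap_def by (rule pair[OF s VL])
    also have "\<dots> = (LINT r|lborel. J1 s r)"
      unfolding set_lebesgue_integral_def using True t
      by (intro Bochner_Integration.integral_cong refl) (auto simp: J1_def J_def indicator_def kap_sym)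
    finally show ?thesis using True by simp
  next
    case False
    then have "J1 s r = 0" for r unfolding J1_def J_def indicator_def by auto
    then show ?thesis using False by simp
  qed
  show si: "set_integrable lborel {0<..<t} (\<lambda>s. LINT x|lborel. V s x * w s x)"
    using lborel_pair.integrable_fst[OF Ji(2)] by (simp add: set_integrable_def inner)
  have "(LINT x|lborel. w t x * w t x) = (LINT s:{0<..<t}|lborel. LINT x|lborel. V s x * w t x)"
    using t by (intro pair wL) auto
  also have "\<dots> = (LINT s|lborel. LINT r|lborel. J s r)"
    unfolding set_lebesgue_integral_def
  proof (intro Bochner_Integration.integral_cong refl)
    fix s
    have "(LINT x|lborel. V s x * w t x) = (LINT x|lborel. w t x * V s x)" by (simp add: mult.commute)
    also have "\<dots> = (LINT r:{0<..<t}|lborel. kap r s)" unfolding kap_def by (rule pair[OF t VL])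
    finally have "?I s *\<^sub>R (LINT x|lborel. V s x * w t x) = ?I s * (LINT r|lborel. ?I r * kap r s)"
      by (simp add: set_lebesgue_integral_def)
    also have "\<dots> = (LINT r|lborel. ?I s * (?I r * kap r s))" by simp
    also have "\<dots> = (LINT r|lborel. J s r)"
      by (intro Bochner_Integration.integral_cong refl) (simp add: J_def kap_sym[of s] mult.assoc)
    finally show "?I s *\<^sub>R (LINT x|lborel. V s x * w t x) = (LINT r|lborel. J s r)" .
  qed
  also have "\<dots> = (LINT s|lborel. (LINT r|lborel. J1 s r) + (LINT r|lborel. J2 s r))"
  proof (rule integral_cong_AE)
    show "(\<lambda>s. LINT r|lborel. J s r) \<in> borel_measurable lborel" using lborel_pair.integrable_fst[OF Ji(1)] by auto
    show "(\<lambda>s. (LINT r|lborel. J1 s r) + (LINT r|lborel. J2 s r)) \<in> borel_measurable lborel"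
      using lborel_pair.integrable_fst[OF Ji(2)] lborel_pair.integrable_fst[OF Ji(3)] by auto
    show "AE s in lborel. (LINT r|lborel. J s r) = (LINT r|lborel. J1 s r) + (LINT r|lborel. J2 s r)"
      using lborel_pair.AE_integrable_fst[OF Ji(1)] lborel_pair.AE_integrable_fst[OF Ji(2)] lborel_pair.AE_integrable_fst[OF Ji(3)]
    proof eventually_elim
      case (elim s)
      have "(LINT r|lborel. J s r) = (LINT r|lborel. J1 s r + J2 s r)"
      proof (rule integral_cong_AE)
        \<comment> \<open>The two triangles miss only the diagonal r = s, a null set for each
          \<open>s\<close>.\<close>
        show "AE r in lborel. J s r = J1 s r + J2 s r"
          using AE_lborel_singleton[of s] by eventually_elim (auto simp: J1_def J2_def)
      qed (use elim in auto)
      also have "\<dots> = (LINT r|lborel. J1 s r) + (LINT r|lborel. J2 s r)" using elim(2,3) by (rule Bochner_Integration.integral_add)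
      finally show ?case .
    qed
  qed
  also have "\<dots> = (LINT s|lborel. LINT r|lborel. J1 s r) + (LINT s|lborel. LINT r|lborel. J2 s r)"
    by (rule Bochner_Integration.integral_add[OF lborel_pair.integrable_fst[OF Ji(2)] lborel_pair.integrable_fst[OF Ji(3)]])
  also have "(LINT s|lborel. LINT r|lborel. J2 s r) = (LINT r|lborel. LINT s|lborel. J2 s r)"
    by (rule lborel_Fubini[OF J2m fin[OF Jle(3)]])
  also have "\<dots> = (LINT s|lborel. LINT r|lborel. J1 s r)"
  proof -
    have "J2 s r = J1 r s" for s r by (simp add: J1_def J2_def J_def kap_sym[of s r])
    then show ?thesis by simp
  qed
  finally show "(LINT x|lborel. w t x * w t x) = 2 * (LINT s:{0<..<t}|lborel. LINT x|lborel. V s x * w s x)"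
    by (simp add: set_lebesgue_integral_def inner)
qed

text \<open>Let m be the maximum of y(s) exp(-2cs), attained at t0. Inserting y(s) <= m exp(2cs)
  into the integral inequality at t0 yields half of m exp(2 c t0), so m <= m/2 and m vanishes; the
  factor 2 in the exponent produces this half.\<close>

lemma gronwall_zero:
  fixes y :: "real \<Rightarrow> real"
  assumes T: "T > 0" and c: "c > 0" and cont: "continuous_on {0..T} y" and y0: "y 0 = 0" and pos: "\<And>t. t \<in> {0..T} \<Longrightarrow> 0 \<le> y t"
    and le: "\<And>t. 0 < t \<Longrightarrow> t \<le> T \<Longrightarrow> y t \<le> c * (LINT s:{0<..<t}|lborel. y s)" and t: "t \<in> {0..T}"
  shows "y t = 0"
proof -
  let ?h = "\<lambda>t. y t * exp (- (2 * c * t))"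
  have "continuous_on {0..T} ?h" by (intro continuous_intros cont)
  then obtain t0 where t0: "t0 \<in> {0..T}" "\<And>s. s \<in> {0..T} \<Longrightarrow> ?h s \<le> ?h t0"
    using continuous_attains_sup[of "{0..T}" ?h] T by auto
  define m where "m = y t0 * exp (- (2 * c * t0))"
  have ym: "y s \<le> m * exp (2 * c * s)" if "s \<in> {0..T}" for s
    using mult_right_mono[OF t0(2)[OF that], of "exp (2 * c * s)"] by (simp add: m_def mult.assoc flip: exp_add)
  have m0: "m \<ge> 0" using pos[OF t0(1)] by (simp add: m_def)
  have "m \<le> 0"
  proof (cases "t0 = 0")
    case True then show ?thesis by (simp add: m_def y0)
  next
    case False
    then have p: "0 < t0" "t0 \<le> T" using t0(1) by auto
    have ci: "set_integrable lborel {0..t0} y" using p by (intro borel_integrable_atLeastAtMost' continuous_on_subset[OF cont]) auto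
    have ei: "set_integrable lborel {0..t0} (\<lambda>s. m * exp (2 * c * s))" by (intro borel_integrable_atLeastAtMost' continuous_intros)
    have "y t0 \<le> c * (LINT s:{0<..<t0}|lborel. y s)" by (rule le[OF p])
    also have "(LINT s:{0<..<t0}|lborel. y s) = (LINT s:{0..t0}|lborel. y s)" by (rule set_integral_Icc_Ioo[OF ci, symmetric])
    also have "c * \<dots> \<le> c * (LINT s:{0..t0}|lborel. m * exp (2 * c * s))"
      using c p ym by (intro mult_left_mono set_integral_mono[OF ci ei]) auto
    also have "(LINT s:{0..t0}|lborel. m * exp (2 * c * s)) = m * exp (2 * c * t0) / (2 * c) - m * exp (2 * c * 0) / (2 * c)"
      unfolding set_lebesgue_integral_def
    proof (rule integral_FTC_Icc)
      show "((\<lambda>s. m * exp (2 * c * s) / (2 * c)) has_vector_derivative m * exp (2 * c * s)) (at s within {0..t0})" for s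
        unfolding has_real_derivative_iff_has_vector_derivative[symmetric]
        using c by (auto intro!: derivative_eq_intros)
    qed (use p in \<open>auto intro!: continuous_intros\<close>)
    also have "c * \<dots> \<le> m * exp (2 * c * t0) / 2" using c m0 by (simp add: field_simps)
    finally have "y t0 * exp (- (2 * c * t0)) \<le> m * exp (2 * c * t0) / 2 * exp (- (2 * c * t0))" by (rule mult_right_mono) simp
    moreover have "m * exp (2 * c * t0) / 2 * exp (- (2 * c * t0)) = m / 2" by (simp add: exp_minus)
    ultimately show ?thesis by (simp only: m_def[symmetric])
  qed
  then have "y t \<le> 0" using ym[OF t] m0 by simp
  then show ?thesis using pos[OF t] by simp
qed

section \<open>Uniqueness\<close>

text \<open>The factor 2 + \<open>\<alpha>\<close>|k| never vanishes, so the equation can be solved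
  for the transform of the time derivative. This holds for an arbitrary solution, whence equality
  almost everywhere only.\<close>

lemma time_derivative_transform:
  assumes e: "\<epsilon> > 0" and a: "\<alpha> > 0" and U: "FT (cr u) U" and U3: "wt 3 U \<in> L2C"
    and d: "d \<in> sobolev 1" and eq: "AE x in lborel. 2 * d x + \<alpha> * Lambda d x = wave_rhs \<epsilon> \<alpha> \<beta> u x"
  shows "AE k in lborel. fourier d k = \<i> * symb \<epsilon> \<alpha> (\<alpha> - \<beta>) k * U k + Qf (kq \<alpha> (\<alpha> - \<beta>)) U U k"
proof -
  have dL: "d \<in> L2" using d by (simp add: sobolev_def)
  note D = fourier_FT[OF dL]
  have w1: "wt 1 (fourier d) \<in> L2C" using sobolev_iff[OF D, of 1] d by simp
  have L: "FT (cr (Lambda d)) (\<lambda>k. complex_of_real (\<bar>k\<bar> ^ 1) * fourier d k)"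
    by (rule FT_Lambda_pow[OF D w1]) auto
  have 1: "FT (cr (\<lambda>x. 2 * d x + \<alpha> * Lambda d x)) (\<lambda>k. 2 * fourier d k + complex_of_real \<alpha> * (complex_of_real (\<bar>k\<bar> ^ 1) * fourier d k))"
    using FT_add[OF FT_cmult[OF D, of 2] FT_cmult[OF L, of "of_real \<alpha>"]] by simp
  have "AE x in lborel. cr (\<lambda>x. 2 * d x + \<alpha> * Lambda d x) x = cr (wave_rhs \<epsilon> \<alpha> \<beta> u) x"
    using eq by eventually_elim simp
  from iffD1[OF FT_unique_iff[OF 1 FT_wave_rhs[OF U U3 e a, of \<beta>]] this]
  show ?thesis
  proof eventually_elim
    case (elim k)
    have "2 + \<alpha> * \<bar>k\<bar> > 0" using a by (intro add_pos_nonneg) auto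
    then have nz: "complex_of_real (2 + \<alpha> * \<bar>k\<bar>) \<noteq> 0" unfolding of_real_eq_0_iff by linarith
    have "complex_of_real (2 + \<alpha> * \<bar>k\<bar>) * fourier d k = 2 * fourier d k + complex_of_real \<alpha> * (complex_of_real (\<bar>k\<bar> ^ 1) * fourier d k)"
      by (simp add: algebra_simps)
    then show ?case using elim nz by (simp only: mult_cancel_left) simp
  qed
qed

text \<open>The number 64 = 4^3 compares \<open>nsq 3\<close> with the squared Sobolev norm, and 256
  is 2 * 64 + 2 * 64 for the sum of two solutions; the factor 4 comes from the two terms of the
  difference of the quadratic expressions. The root returns from squares to norms.\<close>

definition stab :: "real \<Rightarrow> real \<Rightarrow> real \<Rightarrow> real" where
  "stab a g M = sqrt (enn2real (4 * Kq a g * ennreal (256 * M\<^sup>2)))"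

lemma stab_nonneg: "stab a g M \<ge> 0" by (simp add: stab_def)

text \<open>The dispersive part of the equation is skew-adjoint and drops out.\<close>

lemma difference_estimate:
  assumes e: "\<epsilon> > 0" and a: "\<alpha> > 0"
    and u: "u1 \<in> sobolev 3" "u2 \<in> sobolev 3" and M: "sobolev_norm 3 u1 \<le> M" "sobolev_norm 3 u2 \<le> M"
    and d: "d1 \<in> sobolev 1" "d2 \<in> sobolev 1"
    and eq: "AE x in lborel. 2 * d1 x + \<alpha> * Lambda d1 x = wave_rhs \<epsilon> \<alpha> \<beta> u1 x" "AE x in lborel. 2 * d2 x + \<alpha> * Lambda d2 x = wave_rhs \<epsilon> \<alpha> \<beta> u2 x"
  shows "(LINT x|lborel. (d1 x - d2 x) * (u1 x - u2 x)) \<le> stab \<alpha> (\<alpha> - \<beta>) M * (LINT x|lborel. (u1 x - u2 x) * (u1 x - u2 x))"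
proof -
  define g where "g = \<alpha> - \<beta>"
  let ?q = "kq \<alpha> g" and ?p = "symb \<epsilon> \<alpha> g"
  have uL: "u1 \<in> L2" "u2 \<in> L2" and dL: "d1 \<in> L2" "d2 \<in> L2" using u d by (auto simp: sobolev_def)
  define U1 where "U1 = fourier u1"
  define U2 where "U2 = fourier u2"
  have F1: "FT (cr u1) U1" and F2: "FT (cr u2) U2" unfolding U1_def U2_def using uL by (auto intro: fourier_FT)
  have w1: "wt 3 U1 \<in> L2C" using sobolev_iff[OF F1, of 3] u by simp
  have w2: "wt 3 U2 \<in> L2C" using sobolev_iff[OF F2, of 3] u by simp
  have m: "U1 \<in> borel_measurable borel" "U2 \<in> borel_measurable borel" using F1 F2 FT_measurable by auto
  note [measurable] = m
  define W where "W k = U1 k - U2 k" for k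
  define D where "D k = fourier d1 k - fourier d2 k" for k
  have FW: "FT (cr (\<lambda>x. u1 x - u2 x)) W" unfolding W_def using FT_diff[OF F1 F2] by simp
  have FDD: "FT (cr (\<lambda>x. d1 x - d2 x)) D" unfolding D_def using FT_diff[OF fourier_FT[OF dL(1)] fourier_FT[OF dL(2)]] by simp
  have WL: "W \<in> L2C" by (rule FT_L2C(2)[OF FW])
  note [measurable] = FT_measurable(2)[OF FW]
  define R where "R k = Qf ?q U1 U1 k - Qf ?q U2 U2 k" for k
  have DR: "AE k in lborel. D k = \<i> * ?p k * W k + R k"
    using time_derivative_transform[OF e a F1 w1 d(1) eq(1)] time_derivative_transform[OF e a F2 w2 d(2) eq(2)]
    unfolding g_def[symmetric] by eventually_elim (simp add: D_def W_def R_def algebra_simps)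
  \<comment> \<open>\<open>Qf_diff_le\<close> asks for one function dominating both transforms;
    their sum does, and its norm splits by \<open>nsq_add_le\<close>.\<close>
  define A where "A k = ennreal (cmod (U1 k)) + ennreal (cmod (U2 k))" for k
  define B where "B k = ennreal (cmod (W k))" for k
  have [measurable]: "A \<in> borel_measurable borel" "B \<in> borel_measurable borel" unfolding A_def B_def by measurable
  have Am: "A \<in> borel_measurable borel" and Bm: "B \<in> borel_measurable borel" by measurable
  have n1: "nsq 3 (\<lambda>k. ennreal (cmod (U1 k))) \<le> ennreal (64 * M\<^sup>2)"
  proof -
    have "sqn (wt 3 U1) \<le> ennreal (64 * (sobolev_norm 3 u1)\<^sup>2)" using sobolev_norm_bounds(2)[OF F1 _ w1] by simp
    also have "\<dots> \<le> ennreal (64 * M\<^sup>2)" using M by (intro ennreal_leI mult_left_mono power_mono) (auto simp: sobolev_norm_def intro!: integral_nonneg_AE)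
    finally show ?thesis by (simp add: sqn_wt_eq)
  qed
  have n2: "nsq 3 (\<lambda>k. ennreal (cmod (U2 k))) \<le> ennreal (64 * M\<^sup>2)"
  proof -
    have "sqn (wt 3 U2) \<le> ennreal (64 * (sobolev_norm 3 u2)\<^sup>2)" using sobolev_norm_bounds(2)[OF F2 _ w2] by simp
    also have "\<dots> \<le> ennreal (64 * M\<^sup>2)" using M by (intro ennreal_leI mult_left_mono power_mono) (auto simp: sobolev_norm_def intro!: integral_nonneg_AE)
    finally show ?thesis by (simp add: sqn_wt_eq)
  qed
  have nA: "nsq 3 A \<le> ennreal (256 * M\<^sup>2)"
  proof -
    have "nsq 3 A \<le> 2 * nsq 3 (\<lambda>k. ennreal (cmod (U1 k))) + 2 * nsq 3 (\<lambda>k. ennreal (cmod (U2 k)))"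
      unfolding A_def by (rule nsq_add_le) measurable
    also have "\<dots> \<le> 2 * ennreal (64 * M\<^sup>2) + 2 * ennreal (64 * M\<^sup>2)" using n1 n2 by (intro add_mono mult_left_mono) auto
    also have "\<dots> = ennreal (256 * M\<^sup>2)" by (simp add: ennreal_mult[symmetric] flip: ennreal_plus ennreal_numeral)
    finally show ?thesis .
  qed
  then have Afin: "nsq 3 A < \<infinity>" by (rule le_less_trans) simp
  have Rle: "ennreal (cmod (R k)) \<le> maj ?q B A k + maj ?q A B k" for k
    unfolding R_def
  proof (rule Qf_diff_le[OF kq_measurable m _ _ maj_finite[OF a Am Am Afin Afin] _ Am Bm])
    show "ennreal (cmod (U1 k)) \<le> A k" "ennreal (cmod (U2 k)) \<le> A k" for k by (simp_all add: A_def)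
    show "ennreal (cmod (U1 k - U2 k)) \<le> B k" for k by (simp add: B_def W_def)
  qed
  have nB: "nsq 0 B = sqn W" using sqn_wt_eq[of 0 W] unfolding wt_0 B_def[abs_def] by (rule sym)
  define l where "l = 4 * Kq \<alpha> g * ennreal (256 * M\<^sup>2)"
  have lfin: "l < \<infinity>" using Kq_finite[of \<alpha> g] by (simp add: l_def ennreal_mult_less_top)
  note [measurable] = maj_measurable[OF kq_measurable Bm Am, of \<alpha> g] maj_measurable[OF kq_measurable Am Bm, of \<alpha> g]
  have Rn: "sqn R \<le> l * sqn W"
  proof -
    have "sqn R = nsq 0 (\<lambda>k. ennreal (cmod (R k)))" using sqn_wt_eq[of 0 R] by (simp add: wt_0)
    also have "\<dots> \<le> nsq 0 (\<lambda>k. maj ?q B A k + maj ?q A B k)" by (intro nsq_mono Rle)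
    also have "\<dots> \<le> 2 * nsq 0 (maj ?q B A) + 2 * nsq 0 (maj ?q A B)" by (rule nsq_add_le) measurable
    \<comment> \<open>The difference \<open>B\<close> enters without weight, once on each side of
      the convolution: hence both asymmetric bounds.\<close>
    also have "\<dots> \<le> 2 * (Kq \<alpha> g * nsq 0 B * nsq 3 A) + 2 * (Kq \<alpha> g * nsq 3 A * nsq 0 B)"
      by (intro add_mono mult_left_mono maj_bound2 maj_bound3 a Am Bm) auto
    also have "\<dots> = 4 * Kq \<alpha> g * nsq 3 A * nsq 0 B"
    proof -
      have "2 * x + 2 * x = 4 * x" for x :: ennreal by (simp flip: distrib_right)
      from this[of "Kq \<alpha> g * nsq 3 A * nsq 0 B"] show ?thesis by (simp add: mult_ac)
    qed
    also have "\<dots> \<le> l * sqn W" unfolding l_def nB by (intro mult_right_mono mult_left_mono nA) auto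
    finally show ?thesis .
  qed
  have Rm [measurable]: "R \<in> borel_measurable borel"
  proof -
    note [measurable] = measurable_Pair_compose_split[OF kq_measurable]
    show ?thesis unfolding R_def Qf_def by measurable
  qed
  have RL: "R \<in> L2C" using Rn lfin L2C_finite[OF WL] by (intro L2C_I) (auto elim!: le_less_trans simp: ennreal_mult_less_top)
  let ?I = "LINT k|lborel. R k * cnj (W k)"
  have "complex_of_real (LINT x|lborel. (d1 x - d2 x) * (u1 x - u2 x)) = (LINT k|lborel. D k * cnj (W k))"
    using FT_Parseval[OF FDD FW] by (simp flip: of_real_mult of_real_diff)
  then have "(LINT x|lborel. (d1 x - d2 x) * (u1 x - u2 x)) = Re (LINT k|lborel. D k * cnj (W k))" by (metis Re_complex_of_real)
  also have "\<dots> = (LINT k|lborel. Re (D k * cnj (W k)))"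
    by (rule integral_Re[symmetric, OF L2C_integrable_mult[OF FT_L2C(2)[OF FDD] L2C_cnj[OF WL]]])
  also have "\<dots> = (LINT k|lborel. Re (R k * cnj (W k)))"
  proof (rule integral_cong_AE)
    show "AE k in lborel. Re (D k * cnj (W k)) = Re (R k * cnj (W k))"
      using DR by eventually_elim (simp add: algebra_simps)
  qed (use FT_measurable(2)[OF FDD] in measurable)
  also have "\<dots> = Re ?I" by (rule integral_Re[OF L2C_integrable_mult[OF RL L2C_cnj[OF WL]]])
  also have "\<dots> \<le> cmod ?I" by (rule complex_Re_le_cmod)
  also have "cmod ?I \<le> stab \<alpha> g M * enn2real (sqn W)"
  proof -
    have "ennreal ((cmod ?I)\<^sup>2) \<le> sqn R * sqn (\<lambda>k. cnj (W k))" by (rule L2C_Cauchy_Schwarz[OF RL L2C_cnj[OF WL]])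
    also have "sqn (\<lambda>k. cnj (W k)) = sqn W" by (simp add: sqn_def)
    also have "sqn R * sqn W \<le> l * sqn W * sqn W" by (intro mult_right_mono Rn) auto
    finally have "(cmod ?I)\<^sup>2 \<le> enn2real (l * sqn W * sqn W)"
      using lfin L2C_finite[OF WL] by (intro le_enn2real) (auto simp: ennreal_mult_less_top)
    also have "\<dots> = enn2real l * (enn2real (sqn W))\<^sup>2" by (simp add: enn2real_mult power2_eq_square mult.assoc)
    also have "\<dots> = (sqrt (enn2real l) * enn2real (sqn W))\<^sup>2" by (simp add: power_mult_distrib)
    finally show ?thesis unfolding stab_def l_def[symmetric] by (rule power2_le_imp_le) simp
  qed
  also have "enn2real (sqn W) = (LINT x|lborel. (u1 x - u2 x) * (u1 x - u2 x))"
  proof -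
    have "complex_of_real (enn2real (sqn W)) = (LINT x|lborel. cr (\<lambda>x. u1 x - u2 x) x * cnj (cr (\<lambda>x. u1 x - u2 x) x))"
      unfolding FT_isometry[OF FW] by (rule sqn_eq_integral_cnj[OF FT_L2C(1)[OF FW]])
    then have "complex_of_real (enn2real (sqn W)) = complex_of_real (LINT x|lborel. (u1 x - u2 x) * (u1 x - u2 x))"
      by (simp only: complex_cnj_complex_of_real of_real_mult[symmetric] integral_complex_of_real)
    then show ?thesis by (simp only: of_real_eq_iff)
  qed
  finally show ?thesis unfolding g_def .
qed

text \<open>The Sobolev bounds on both solutions supply a constant \<open>M\<close> valid at almost
  every time, which is all that the energy estimate uses; continuity in L2 provides the initial
  value and makes the squared distance \<open>y\<close> continuous, so that Gronwall's inequality
  gives the conclusion at every time.\<close>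

lemma uniqueness:
  assumes e: "\<epsilon> > 0" and a: "\<alpha> > 0" and T: "T > 0"
    and f: "f \<in> Linf_sobolev T 3" "is_solution \<epsilon> \<alpha> \<beta> f\<^sub>0 T f" and g: "g \<in> Linf_sobolev T 3" "is_solution \<epsilon> \<alpha> \<beta> f\<^sub>0 T g"
    and t: "t \<in> {0..T}"
  shows "AE x in lborel. g t x = f t x"
proof -
  obtain M1 where M1: "AE t in lborel. t \<in> {0<..<T} \<longrightarrow> f t \<in> sobolev 3 \<and> sobolev_norm 3 (f t) \<le> M1" using f(1) by (auto simp: Linf_sobolev_def)
  obtain M2 where M2: "AE t in lborel. t \<in> {0<..<T} \<longrightarrow> g t \<in> sobolev 3 \<and> sobolev_norm 3 (g t) \<le> M2" using g(1) by (auto simp: Linf_sobolev_def)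
  define M where "M = max M1 M2"
  have stf: "strip_measurable T f" "strip_measurable T g" using f(1) g(1) by (auto simp: Linf_sobolev_def)
  have cf: "continuous_L2 T f" "continuous_L2 T g" and init: "AE x in lborel. f 0 x = f\<^sub>0 x" "AE x in lborel. g 0 x = f\<^sub>0 x"
    using f(2) g(2) by (auto simp: is_solution_def)
  obtain f' where f': "is_weak_time_deriv T f f'" "AE t in lborel. t \<in> {0<..<T} \<longrightarrow> f' t \<in> sobolev 1 \<and>
      (AE x in lborel. 2 * f' t x + \<alpha> * Lambda (f' t) x = wave_rhs \<epsilon> \<alpha> \<beta> (f t) x)" using f(2) by (auto simp: is_solution_def)
  obtain g' where g': "is_weak_time_deriv T g g'" "AE t in lborel. t \<in> {0<..<T} \<longrightarrow> g' t \<in> sobolev 1 \<and>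
      (AE x in lborel. 2 * g' t x + \<alpha> * Lambda (g' t) x = wave_rhs \<epsilon> \<alpha> \<beta> (g t) x)" using g(2) by (auto simp: is_solution_def)
  \<comment> \<open>The factor 8 is the square root of 64, the comparison constant of the weights of
    order 3.\<close>
  have nb: "L2_norm h \<le> 8 * \<bar>N\<bar>" if "h \<in> sobolev 3" "sobolev_norm 3 h \<le> N" for h N
  proof -
    have hL: "h \<in> L2" using that by (simp add: sobolev_def)
    note H = fourier_FT[OF hL]
    have w: "wt 3 (fourier h) \<in> L2C" using sobolev_iff[OF H, of 3] that by simp
    have "ennreal ((L2_norm h)\<^sup>2) = nsq 0 (\<lambda>k. ennreal (cmod (fourier h k)))"
      using sqn_L2_norm[OF hL] FT_isometry[OF H] sqn_wt_eq[of 0 "fourier h"] by (simp add: wt_0)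
    also have "\<dots> \<le> sqn (wt 3 (fourier h))" unfolding sqn_wt_eq by (rule nsq_le) simp
    also have "\<dots> \<le> ennreal (64 * (sobolev_norm 3 h)\<^sup>2)" using sobolev_norm_bounds(2)[OF H _ w] by simp
    finally have "(L2_norm h)\<^sup>2 \<le> 64 * (sobolev_norm 3 h)\<^sup>2" by (simp add: ennreal_le_iff)
    also have "\<dots> = (8 * sobolev_norm 3 h)\<^sup>2" by (simp add: power_mult_distrib)
    finally have "L2_norm h \<le> 8 * sobolev_norm 3 h"
      by (rule power2_le_imp_le) (auto simp: sobolev_norm_def intro!: integral_nonneg_AE)
    then show ?thesis using that(2) by linarith
  qed
  have L2f: "AE t in lborel. t \<in> {0<..<T} \<longrightarrow> L2_norm (f t) \<le> 8 * \<bar>M1\<bar>" using M1 by eventually_elim (use nb in auto)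
  have L2g: "AE t in lborel. t \<in> {0<..<T} \<longrightarrow> L2_norm (g t) \<le> 8 * \<bar>M2\<bar>" using M2 by eventually_elim (use nb in auto)
  obtain v1 where v1: "(\<lambda>(t, x). v1 t x) \<in> borel_measurable (borel \<Otimes>\<^sub>M borel)" "\<And>t. v1 t \<in> L2" "\<And>t x. t \<notin> {0<..<T} \<Longrightarrow> v1 t x = 0"
    "AE t in lborel. t \<in> {0<..<T} \<longrightarrow> v1 t = f' t"
    using strip_normalise[of T f'] f'(1) by (auto simp: is_weak_time_deriv_def)
  obtain v2 where v2: "(\<lambda>(t, x). v2 t x) \<in> borel_measurable (borel \<Otimes>\<^sub>M borel)" "\<And>t. v2 t \<in> L2" "\<And>t x. t \<notin> {0<..<T} \<Longrightarrow> v2 t x = 0"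
    "AE t in lborel. t \<in> {0<..<T} \<longrightarrow> v2 t = g' t"
    using strip_normalise[of T g'] g'(1) by (auto simp: is_weak_time_deriv_def)
  have vi: "integrable lborel (\<lambda>t. L2_norm (v1 t))" "integrable lborel (\<lambda>t. L2_norm (v2 t))"
    using f'(1) g'(1) v1 v2 by (auto simp: is_weak_time_deriv_def intro: L2_norm_integrable_AE)
  note vm [measurable] = measurable_Pair_compose_split[OF v1(1)] measurable_Pair_compose_split[OF v2(1)]
  define V where "V t x = v1 t x - v2 t x" for t x
  define w where "w t x = f t x - g t x" for t x
  have Vm: "(\<lambda>(t, x). V t x) \<in> borel_measurable (borel \<Otimes>\<^sub>M borel)" unfolding V_def split_beta by measurable
  have VL: "V t \<in> L2" for t unfolding V_def by (intro L2_diff v1 v2)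
  have cw: "continuous_L2 T w" unfolding w_def by (rule continuous_L2_diff[OF cf])
  then have wL: "t \<in> {0..T} \<Longrightarrow> w t \<in> L2" for t by (simp add: continuous_L2_def)
  have fgL: "t \<in> {0..T} \<Longrightarrow> f t \<in> L2" "t \<in> {0..T} \<Longrightarrow> g t \<in> L2" for t using cf by (auto simp: continuous_L2_def)
  have Vi: "integrable lborel (\<lambda>t. L2_norm (V t))"
  proof (rule Bochner_Integration.integrable_bound)
    show "integrable lborel (\<lambda>t. 2 * (L2_norm (v1 t) + L2_norm (v2 t)))" using vi by simp
    note [measurable] = measurable_Pair_compose_split[OF Vm]
    show "(\<lambda>t. L2_norm (V t)) \<in> borel_measurable lborel" unfolding L2_norm_def by measurable
    show "AE t in lborel. norm (L2_norm (V t)) \<le> norm (2 * (L2_norm (v1 t) + L2_norm (v2 t)))"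
    proof (intro AE_I2)
      fix t
      let ?a = "L2_norm (v1 t)" and ?b = "L2_norm (v2 t)"
      have n: "0 \<le> ?a" "0 \<le> ?b" by (rule L2_norm_nonneg)+
      have "sqn (cr (V t)) \<le> 2 * sqn (cr (v1 t)) + 2 * sqn (\<lambda>x. - cr (v2 t) x)"
        using sqn_add_le[of "cr (v1 t)" "\<lambda>x. - cr (v2 t) x"] L2_measurable[OF v1(2)] L2_measurable[OF v2(2)] by (simp add: V_def)
      also have "sqn (\<lambda>x. - cr (v2 t) x) = sqn (cr (v2 t))" by (simp add: sqn_def)
      finally have "ennreal ((L2_norm (V t))\<^sup>2) \<le> ennreal (2 * ?a\<^sup>2 + 2 * ?b\<^sup>2)"
        unfolding sqn_L2_norm[OF VL] sqn_L2_norm[OF v1(2)] sqn_L2_norm[OF v2(2)] by (simp add: ennreal_mult)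
      then have "(L2_norm (V t))\<^sup>2 \<le> 2 * ?a\<^sup>2 + 2 * ?b\<^sup>2" by (subst (asm) ennreal_le_iff) auto
      also have "\<dots> \<le> (2 * (?a + ?b))\<^sup>2" using n by (simp add: power2_eq_square algebra_simps)
      finally have "L2_norm (V t) \<le> 2 * (?a + ?b)" by (rule power2_le_imp_le) (use n in simp)
      then show "norm (L2_norm (V t)) \<le> norm (2 * (?a + ?b))" using n L2_norm_nonneg[of "V t"] by simp
    qed
  qed
  have pair: "(LINT x|lborel. w t x * \<psi> x) = (LINT s:{0<..<t}|lborel. LINT x|lborel. V s x * \<psi> x)"
    if t: "0 < t" "t \<le> T" and \<psi>: "\<psi> \<in> L2" for t \<psi>
  proof -
    have tT: "t \<in> {0..T}" "0 \<in> {0..T}" using t by auto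
    let ?b1 = "\<lambda>s. LINT x|lborel. v1 s x * \<psi> x" and ?b2 = "\<lambda>s. LINT x|lborel. v2 s x * \<psi> x"
    have p1: "(LINT x|lborel. f t x * \<psi> x) = (LINT x|lborel. f 0 x * \<psi> x) + (LINT s:{0<..<t}|lborel. ?b1 s)"
      by (rule weak_deriv_pairing[OF T cf(1) stf(1) L2f f'(1) v1 \<psi> t])
    have p2: "(LINT x|lborel. g t x * \<psi> x) = (LINT x|lborel. g 0 x * \<psi> x) + (LINT s:{0<..<t}|lborel. ?b2 s)"
      by (rule weak_deriv_pairing[OF T cf(2) stf(2) L2g g'(1) v2 \<psi> t])
    note [measurable] = L2_measurable[OF \<psi>] L2_measurable[OF fgL(1)[OF tT(2)]] L2_measurable[OF fgL(2)[OF tT(2)]]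
    have i0: "(LINT x|lborel. f 0 x * \<psi> x) = (LINT x|lborel. g 0 x * \<psi> x)"
    proof (rule integral_cong_AE)
      show "AE x in lborel. f 0 x * \<psi> x = g 0 x * \<psi> x" using init by eventually_elim simp
    qed measurable
    have bi: "set_integrable lborel {0<..<t} (\<lambda>s. LINT x|lborel. v s x * \<psi> x)"
      if vm: "(\<lambda>(t, x). v t x) \<in> borel_measurable (borel \<Otimes>\<^sub>M borel)" and vL: "\<And>t. v t \<in> L2" and vi: "integrable lborel (\<lambda>t. L2_norm (v t))" for v :: "real \<Rightarrow> real \<Rightarrow> real"
      unfolding set_integrable_def
    proof (rule Bochner_Integration.integrable_bound)
      note [measurable] = measurable_Pair_compose_split[OF vm]
      show "integrable lborel (\<lambda>s. L2_norm (v s) * L2_norm \<psi>)" using vi by simp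
      show "(\<lambda>s. indicat_real {0<..<t} s *\<^sub>R (LINT x|lborel. v s x * \<psi> x)) \<in> borel_measurable lborel" by measurable
      show "AE s in lborel. norm (indicat_real {0<..<t} s *\<^sub>R (LINT x|lborel. v s x * \<psi> x)) \<le> norm (L2_norm (v s) * L2_norm \<psi>)"
      proof (intro AE_I2)
        fix s
        have "\<bar>LINT x|lborel. v s x * \<psi> x\<bar> \<le> L2_norm (v s) * L2_norm \<psi>" by (rule L2_Cauchy_Schwarz[OF vL \<psi>])
        then show "norm (indicat_real {0<..<t} s *\<^sub>R (LINT x|lborel. v s x * \<psi> x)) \<le> norm (L2_norm (v s) * L2_norm \<psi>)"
          using L2_norm_nonneg by (auto simp: indicator_def abs_mult)
      qed
    qed
    have "(LINT x|lborel. w t x * \<psi> x) = (LINT x|lborel. f t x * \<psi> x) - (LINT x|lborel. g t x * \<psi> x)"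
      unfolding w_def left_diff_distrib by (intro Bochner_Integration.integral_diff L2_integrable_mult fgL tT \<psi>)
    also have "\<dots> = (LINT s:{0<..<t}|lborel. ?b1 s) - (LINT s:{0<..<t}|lborel. ?b2 s)" using p1 p2 i0 by simp
    also have "\<dots> = (LINT s:{0<..<t}|lborel. ?b1 s - ?b2 s)"
      by (rule set_integral_diff(2)[OF bi[OF v1(1,2) vi(1)] bi[OF v2(1,2) vi(2)], symmetric])
    also have "(\<lambda>s. ?b1 s - ?b2 s) = (\<lambda>s. LINT x|lborel. V s x * \<psi> x)"
      unfolding V_def left_diff_distrib
      by (intro ext Bochner_Integration.integral_diff[symmetric] L2_integrable_mult v1 v2 \<psi>)
    finally show ?thesis .
  qed
  define y where "y t = (LINT x|lborel. w t x * w t x)" for t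
  define C where "C = stab \<alpha> (\<alpha> - \<beta>) M"
  have ypos: "y t \<ge> 0" for t unfolding y_def by (intro integral_nonneg_AE) auto
  have cy: "continuous_on {0..T} y" unfolding y_def by (rule continuous_L2_pairing[OF cw cw])
  have est: "AE s in lborel. s \<in> {0<..<T} \<longrightarrow> (LINT x|lborel. V s x * w s x) \<le> C * y s"
    using M1 M2 f'(2) g'(2) v1(4) v2(4)
  proof eventually_elim
    case (elim s)
    show ?case
    proof
      assume s: "s \<in> {0<..<T}"
      have n: "sobolev_norm 3 (f s) \<le> M" "sobolev_norm 3 (g s) \<le> M" using elim(1,2) s by (auto simp: M_def)
      have "V s x = f' s x - g' s x" for x using elim(5,6) s by (simp add: V_def)
      then show "(LINT x|lborel. V s x * w s x) \<le> C * y s"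
        using difference_estimate[OF e a _ _ n, of "f' s" "g' s" \<beta>] elim(1-4) s by (simp add: w_def y_def C_def)
    qed
  qed
  have "y t = 0" if t: "t \<in> {0..T}" for t
  proof (rule gronwall_zero[OF T _ cy _ ypos _ t, of "2 * C + 1"])
    \<comment> \<open>The energy identity and the estimate give the constant 2 C, which may be 0;
      adding 1 makes it positive, as Gronwall's inequality requires, and costs nothing since
      \<open>y\<close> is nonnegative.\<close>
    show "2 * C + 1 > 0" using stab_nonneg[of \<alpha> "\<alpha> - \<beta>" M] by (simp add: C_def)
    show "y 0 = 0"
    proof -
      have 0: "0 \<in> {0..T}" using T by simp
      note [measurable] = L2_measurable[OF wL[OF 0]]
      have "(LINT x|lborel. w 0 x * w 0 x) = (LINT (x::real)|lborel. 0)"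
      proof (rule integral_cong_AE)
        show "AE x in lborel. w 0 x * w 0 x = 0" using init by eventually_elim (simp add: w_def)
      qed measurable
      then show ?thesis by (simp add: y_def)
    qed
    fix t assume t: "0 < t" "t \<le> T"
    have yi: "set_integrable lborel {0<..<t} y"
    proof (rule set_integrable_subset)
      show "set_integrable lborel {0..T} y" by (rule borel_integrable_atLeastAtMost'[OF cy])
    qed (use t in auto)
    define c where "c = C + 1/2"
    note E = energy_identity[OF Vm VL Vi wL pair t]
    have "y t = 2 * (LINT s:{0<..<t}|lborel. LINT x|lborel. V s x * w s x)" unfolding y_def by (rule E(2))
    also have "\<dots> \<le> 2 * (LINT s:{0<..<t}|lborel. c * y s)"
    proof (intro mult_left_mono)
      show "(LINT s:{0<..<t}|lborel. LINT x|lborel. V s x * w s x) \<le> (LINT s:{0<..<t}|lborel. c * y s)"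
        unfolding set_lebesgue_integral_def
      proof (rule integral_mono_AE)
        show "integrable lborel (\<lambda>s. indicat_real {0<..<t} s *\<^sub>R (LINT x|lborel. V s x * w s x))" using E(1) unfolding set_integrable_def .
        show "integrable lborel (\<lambda>s. indicat_real {0<..<t} s *\<^sub>R (c * y s))"
          using set_integrable_mult_right[of c, OF yi] unfolding set_integrable_def .
        show "AE s in lborel. indicat_real {0<..<t} s *\<^sub>R (LINT x|lborel. V s x * w s x) \<le> indicat_real {0<..<t} s *\<^sub>R (c * y s)"
          using est
        proof eventually_elim
          case (elim s)
          show ?case
          proof (cases "s \<in> {0<..<t}")
            case True
            then have "s \<in> {0<..<T}" using t by auto
            with elim have "(LINT x|lborel. V s x * w s x) \<le> C * y s" by blast
            also have "\<dots> \<le> c * y s" using ypos[of s] by (intro mult_right_mono) (auto simp: c_def)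
            finally show ?thesis using True by simp
          qed simp
        qed
      qed
    qed simp
    also have "\<dots> = (2 * C + 1) * (LINT s:{0<..<t}|lborel. y s)" by (simp add: c_def mult.assoc[symmetric])
    finally show "y t \<le> (2 * C + 1) * (LINT s:{0<..<t}|lborel. y s)" .
  qed
  from this[OF t] have "(LINT x|lborel. w t x * w t x) = 0" by (simp add: y_def)
  then have "AE x in lborel. w t x * w t x = 0"
    by (subst (asm) integral_nonneg_eq_0_iff_AE[OF L2_integrable_mult[OF wL[OF t] wL[OF t]]]) auto
  then show ?thesis by eventually_elim (simp add: w_def)
qed

theorem theorem3:
  fixes \<epsilon> \<alpha>\<^sub>o \<beta> :: real and f\<^sub>0 :: "real \<Rightarrow> real"
  assumes "\<epsilon> > 0" and "\<alpha>\<^sub>o > 0" and "\<beta> \<ge> 0"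
    and "f\<^sub>0 \<in> sobolev 3"
  shows "\<exists>T>0.
    (\<exists>f \<in> Linf_sobolev T 3. is_solution \<epsilon> \<alpha>\<^sub>o \<beta> f\<^sub>0 T f \<and>
       (\<forall>g \<in> Linf_sobolev T 3. is_solution \<epsilon> \<alpha>\<^sub>o \<beta> f\<^sub>0 T g \<longrightarrow>
          (\<forall>t\<in>{0..T}. AE x in lborel. g t x = f t x)))"
proof -
  obtain T f where "T > 0" "f \<in> Linf_sobolev T 3" "is_solution \<epsilon> \<alpha>\<^sub>o \<beta> f\<^sub>0 T f"
    using existence[OF assms(1,2,4), of \<beta>] by blast
  \<comment> \<open>Uniqueness holds on every interval [0, T], in particular on the one supplied by
    existence.\<close>
  with uniqueness[OF assms(1,2)] show ?thesis by blast
qed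

end
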